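(* Let $k,m\ge1$. For partitions $\lambda$ and $\mu$ contained in $[k]\times[m]$, we have $$V_\lambda\wedge V_\mu=\bigoplus_{\nu\in\mathrm{LR}_{k,m}(\lambda,\mu)}V_\nu.$$
   Context: $\mathbb R^k\otimes\mathbb R^m$ has the standard Euclidean inner product and the tensor action of $\mathrm O(k)\times\mathrm O(m)$, inducing an action on $\Lambda^d(\mathbb R^k\otimes\mathbb R^m)$. A partition (Young diagram) $\lambda\subseteq[k]\times[m]$ (at most $k$ parts, all at most $m$) is identified with its set of boxes $(i,j)$, $j\le\lambda_i$; $|\lambda|$ is the number of boxes. Put $v_\lambda=\bigwedge_{(i,j)\in\lambda}e_i\otimes f_j\in\Lambda^{|\lambda|}(\mathbb R^k\otimes\mathbb R^m)$, with $(e_i)$, $(f_j)$ the standard bases (defined up to sign). The Schubert span $V_\lambda$ is the linear span of the Schubert zonoid associated with the real Schubert variety $\Omega_\lambda\subseteq G(k,m)$; equivalently (and this may be taken as the definition), $V_\lambda$ is the real linear span of the $\mathrm O(k)\times\mathrm O(m)$-orbit of $v_\lambda$. Further, $V_\lambda\wedge V_\mu:=\mathrm{span}\{u\wedge v\mid u\in V_\lambda,\ v\in V_\mu\}\subseteq\Lambda^{|\lambda|+|\mu|}(\mathbb R^k\otimes\mathbb R^m)$. Let $\mathscr S_\lambda(\mathbb C^k)$ denote the simple polynomial $\mathrm{GL}(\mathbb C^k)$-module of highest weight $\lambda$ (Schur–Weyl module). The Littlewood–Richardson coefficients $c^\nu_{\lambda\mu}$ are the multiplicities in $\mathscr S_\lambda(\mathbb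 C^k)\otimes\mathscr S_\mu(\mathbb C^k)\simeq\bigoplus_\nu c^\nu_{\lambda\mu}\,\mathscr S_\nu(\mathbb C^k)$, and $\mathrm{LR}_{k,m}(\lambda,\mu):=\{\nu\subseteq[k]\times[m]\mid c^\nu_{\lambda\mu}>0\}$. *)

theory Defs
  imports
    "HOL-Analysis.Finite_Function_Topology"
    "Jordan_Normal_Form.VS_Connect"
begin

section \<open>Partitions\<close>

text \<open>A partition with at most \<open>k\<close> parts is a weakly decreasing list of length exactly \<open>k\<close>,
  padded with zeros. Rows and columns are numbered from \<open>0\<close>, so the box written \<open>(i, j)\<close> in the
  one-based convention is \<open>(i - 1, j - 1)\<close> here.\<close>

definition partitions :: "nat \<Rightarrow> nat list set" where
  "partitions k = {lam. length lam = k \<and> sorted_wrt (\<ge>) lam}"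

definition box_partitions :: "nat \<Rightarrow> nat \<Rightarrow> nat list set" where
  "box_partitions k m = {lam \<in> partitions k. \<forall>x\<in>set lam. x \<le> m}"

definition diagram :: "nat list \<Rightarrow> (nat \<times> nat) set" where
  "diagram lam = {(i, j). i < length lam \<and> j < lam ! i}"


section \<open>The exterior algebra of \<open>\<real>\<^sup>k \<otimes> \<real>\<^sup>m\<close>\<close>

text \<open>The exterior algebra is represented in coordinates. The key \<open>A\<close>, a finite set of boxes
  \<open>a\<^sub>1 < \<dots> < a\<^sub>d\<close> in lexicographic order, stands for the basis element
  \<open>e\<^sub>A = e\<^bsub>a\<^sub>1\<^esub> \<and> \<dots> \<and> e\<^bsub>a\<^sub>d\<^esub>\<close>, where \<open>e\<^bsub>(i, j)\<^esub>\<close> is the vector \<open>e\<^sub>i \<otimes> f\<^sub>j\<close>.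
  The degree \<open>d\<close> part for \<open>\<real>\<^sup>k \<otimes> \<real>\<^sup>m\<close> is spanned by the \<open>e\<^sub>A\<close> with
  \<open>A \<subseteq> {..<k} \<times> {..<m}\<close> and \<open>card A = d\<close>; one type serves all \<open>k\<close>, \<open>m\<close> and \<open>d\<close>.\<close>

type_synonym ext = "(nat \<times> nat) set \<Rightarrow>\<^sub>0 real"

definition lex_less :: "nat \<times> nat \<Rightarrow> nat \<times> nat \<Rightarrow> bool" where
  "lex_less a b \<longleftrightarrow> fst a < fst b \<or> fst a = fst b \<and> snd a < snd b"

text \<open>For disjoint \<open>A\<close> and \<open>B\<close> this is the sign with \<open>e\<^sub>A \<and> e\<^sub>B = \<plusminus> e\<^bsub>A \<union> B\<^esub>\<close>: the sign of the
  permutation that sorts the concatenation of \<open>A\<close> and \<open>B\<close>.\<close>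

definition wedge_sign :: "(nat \<times> nat) set \<Rightarrow> (nat \<times> nat) set \<Rightarrow> real" where
  "wedge_sign A B = (- 1) ^ card {(a, b). a \<in> A \<and> b \<in> B \<and> lex_less b a}"

definition wedge :: "ext \<Rightarrow> ext \<Rightarrow> ext" where
  "wedge u v = (\<Sum>A\<in>Poly_Mapping.keys u. \<Sum>B\<in>Poly_Mapping.keys v.
     if A \<inter> B = {}
     then Poly_Mapping.single (A \<union> B)
            (wedge_sign A B * Poly_Mapping.lookup u A * Poly_Mapping.lookup v B)
     else 0)"

text \<open>The simple tensor \<open>x \<otimes> y\<close>, as an element of degree one.\<close>

definition tensor_vec :: "real vec \<Rightarrow> real vec \<Rightarrow> ext" where
  "tensor_vec x y =
     (\<Sum>i<dim_vec x. \<Sum>j<dim_vec y. Poly_Mapping.single {(i, j)} (x $ i * y $ j))"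

text \<open>\<open>\<And>\<^bsub>p \<in> A\<^esub> x\<^sub>p\<close>, the factors being taken in lexicographic order of \<open>p\<close>, which is the order
  in which \<^const>\<open>List.product\<close> lists the boxes.\<close>

definition wedge_over :: "nat \<Rightarrow> nat \<Rightarrow> (nat \<times> nat) set \<Rightarrow> (nat \<times> nat \<Rightarrow> ext) \<Rightarrow> ext" where
  "wedge_over k m A x =
     foldr (\<lambda>p. wedge (x p)) (filter (\<lambda>p. p \<in> A) (List.product [0..<k] [0..<m]))
       (Poly_Mapping.single {} 1)"

definition wedge_space :: "ext set \<Rightarrow> ext set \<Rightarrow> ext set" where
  "wedge_space U W = Real_Vector_Spaces.span {wedge u w | u w. u \<in> U \<and> w \<in> W}"


section \<open>Schubert spans\<close>

definition orthogonal_group :: "nat \<Rightarrow> real mat set" where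
  "orthogonal_group n = {g \<in> carrier_mat n n. g * g\<^sup>T = 1\<^sub>m n}"

text \<open>The action of \<open>(g, h)\<close> induced on the exterior algebra of \<open>\<real>\<^sup>k \<otimes> \<real>\<^sup>m\<close>: the linear extension
  of \<open>e\<^sub>A \<mapsto> \<And>\<^bsub>(i, j) \<in> A\<^esub> g e\<^sub>i \<otimes> h f\<^sub>j\<close>.\<close>

definition ext_action :: "nat \<Rightarrow> nat \<Rightarrow> real mat \<Rightarrow> real mat \<Rightarrow> ext \<Rightarrow> ext" where
  "ext_action k m g h u = (\<Sum>A\<in>Poly_Mapping.keys u. Poly_Mapping.lookup u A *\<^sub>R
     wedge_over k m A (\<lambda>(i, j). tensor_vec (g *\<^sub>v unit_vec k i) (h *\<^sub>v unit_vec m j)))"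

definition schubert_vector :: "nat \<Rightarrow> nat \<Rightarrow> nat list \<Rightarrow> ext" where
  "schubert_vector k m lam =
     wedge_over k m (diagram lam) (\<lambda>(i, j). tensor_vec (unit_vec k i) (unit_vec m j))"

definition schubert_span :: "nat \<Rightarrow> nat \<Rightarrow> nat list \<Rightarrow> ext set" where
  "schubert_span k m lam = Real_Vector_Spaces.span
     {ext_action k m g h (schubert_vector k m lam) | g h.
        g \<in> orthogonal_group k \<and> h \<in> orthogonal_group m}"


section \<open>Polynomial representations of the general linear group\<close>

definition GL :: "nat \<Rightarrow> complex mat monoid" where
  "GL k = units_of (ring_mat TYPE(complex) k ())"

text \<open>A finite-dimensional module is given in coordinates by its dimension \<open>n\<close> and by matrices
  acting on \<open>\<complex>\<^sup>n\<close>. Only the values of the matrix map on \<open>GL k\<close> are meaningful.\<close>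

type_synonym module_data = "nat \<times> (complex mat \<Rightarrow> complex mat)"

inductive_set polynomial_functions :: "nat \<Rightarrow> (complex mat \<Rightarrow> complex) set" for k :: nat where
  const: "(\<lambda>_. c) \<in> polynomial_functions k"
| entry: "i < k \<Longrightarrow> j < k \<Longrightarrow> (\<lambda>g. g $$ (i, j)) \<in> polynomial_functions k"
| add: "p \<in> polynomial_functions k \<Longrightarrow> q \<in> polynomial_functions k
    \<Longrightarrow> (\<lambda>g. p g + q g) \<in> polynomial_functions k"
| mult: "p \<in> polynomial_functions k \<Longrightarrow> q \<in> polynomial_functions k
    \<Longrightarrow> (\<lambda>g. p g * q g) \<in> polynomial_functions k"

definition polynomial_module :: "nat \<Rightarrow> module_data \<Rightarrow> bool" where
  "polynomial_module k M \<longleftrightarrow> (case M of (n, \<rho>) \<Rightarrow>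
     \<rho> \<in> hom (GL k) (GL n) \<and>
     (\<forall>i<n. \<forall>j<n. \<exists>p\<in>polynomial_functions k. \<forall>g\<in>carrier (GL k). \<rho> g $$ (i, j) = p g))"

definition simple_module :: "nat \<Rightarrow> module_data \<Rightarrow> bool" where
  "simple_module k M \<longleftrightarrow> (case M of (n, \<rho>) \<Rightarrow>
     0 < n \<and>
     (\<forall>W. VectorSpace.subspace class_ring W (module_vec TYPE(complex) n) \<and>
          (\<forall>g\<in>carrier (GL k). \<forall>w\<in>W. \<rho> g *\<^sub>v w \<in> W)
        \<longrightarrow> W = {0\<^sub>v n} \<or> W = carrier_vec n))"

text \<open>There is a nonzero vector of weight \<open>lam\<close> for the diagonal torus that is fixed by the
  upper unitriangular matrices.\<close>

definition has_highest_weight :: "nat \<Rightarrow> nat list \<Rightarrow> module_data \<Rightarrow> bool" where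
  "has_highest_weight k lam M \<longleftrightarrow> (case M of (n, \<rho>) \<Rightarrow>
     \<exists>v\<in>carrier_vec n. v \<noteq> 0\<^sub>v n \<and>
       (\<forall>t\<in>carrier (GL k). diagonal_mat t
          \<longrightarrow> \<rho> t *\<^sub>v v = (\<Prod>i<k. t $$ (i, i) ^ (lam ! i)) \<cdot>\<^sub>v v) \<and>
       (\<forall>u\<in>carrier (GL k). upper_triangular u \<and> (\<forall>i<k. u $$ (i, i) = 1)
          \<longrightarrow> \<rho> u *\<^sub>v v = v))"

text \<open>\<open>S\<^sub>\<lambda>(\<complex>\<^sup>k)\<close>; it is unique up to isomorphism.\<close>

definition schur_module :: "nat \<Rightarrow> nat list \<Rightarrow> module_data" where
  "schur_module k lam =
     (SOME M. polynomial_module k M \<and> simple_module k M \<and> has_highest_weight k lam M)"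

definition module_iso :: "nat \<Rightarrow> module_data \<Rightarrow> module_data \<Rightarrow> bool" where
  "module_iso k M N \<longleftrightarrow> fst M = fst N \<and>
     (\<exists>T\<in>carrier (GL (fst M)). \<forall>g\<in>carrier (GL k). T * snd M g = snd N g * T)"

definition kronecker :: "complex mat \<Rightarrow> complex mat \<Rightarrow> complex mat" where
  "kronecker A B = mat (dim_row A * dim_row B) (dim_col A * dim_col B)
     (\<lambda>(i, j). A $$ (i div dim_row B, j div dim_col B) * B $$ (i mod dim_row B, j mod dim_col B))"

definition module_tensor :: "module_data \<Rightarrow> module_data \<Rightarrow> module_data" where
  "module_tensor M N = (fst M * fst N, \<lambda>g. kronecker (snd M g) (snd N g))"

definition module_sum :: "module_data list \<Rightarrow> module_data" where
  "module_sum Ms = (sum_list (map fst Ms), \<lambda>g. diag_block_mat (map (\<lambda>M. snd M g) Ms))"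

text \<open>A decomposition of the tensor product into Schur modules is recorded by a list \<open>nus\<close> of
  partitions with repetitions, in which each partition occurs as often as its multiplicity.
  The partitions in \<open>nus\<close> have at most \<open>k\<close> parts, but the size of the parts is not bounded.\<close>

definition littlewood_richardson :: "nat \<Rightarrow> nat list \<Rightarrow> nat list \<Rightarrow> nat list \<Rightarrow> nat" where
  "littlewood_richardson k lam mu nu = (THE c. \<exists>nus. set nus \<subseteq> partitions k \<and>
     module_iso k (module_tensor (schur_module k lam) (schur_module k mu))
       (module_sum (map (schur_module k) nus)) \<and>
     c = count_list nus nu)"

definition LR :: "nat \<Rightarrow> nat \<Rightarrow> nat list \<Rightarrow> nat list \<Rightarrow> nat list set" where
  "LR k m lam mu = {nu \<in> box_partitions k m. littlewood_richardson k lam mu nu > 0}"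


section \<open>Internal direct sums\<close>

definition internal_direct_sum :: "'i set \<Rightarrow> ('i \<Rightarrow> 'v::real_vector set) \<Rightarrow> 'v set \<Rightarrow> bool" where
  "internal_direct_sum I W U \<longleftrightarrow>
     finite I \<and>
     (\<forall>i\<in>I. Real_Vector_Spaces.subspace (W i)) \<and>
     U = {\<Sum>i\<in>I. w i | w. \<forall>i\<in>I. w i \<in> W i} \<and>
     (\<forall>w. (\<forall>i\<in>I. w i \<in> W i) \<and> (\<Sum>i\<in>I. w i) = 0 \<longrightarrow> (\<forall>i\<in>I. w i = 0))"

end

theory Submission
  imports Defs "HOL-Library.Product_Lexorder"
begin

text \<open>Call \<open>\<nu>\<close> admissible when some \<open>g\<^sub>1 v\<^sub>\<lambda> \<and> g\<^sub>2 v\<^sub>\<mu>\<close> with invertible \<open>g\<^sub>1, g\<^sub>2\<close> has a nonzero coefficient at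
  \<open>v\<^sub>\<nu>\<close>.

  Upper triangular pairs of matrices preserve the line of \<open>v\<^sub>\<lambda>\<close>, so by QR decomposition the orthogonal
  orbit of \<open>v\<^sub>\<lambda>\<close> spans a space that is stable under all pairs of matrices. Coefficients at diagrams are
  extracted from a stable subspace with diagonal matrices, and a quadratic Casimir type operator
  shows that a stable subspace is generated by the diagrams that it contains. Hence the exterior
  algebra is the orthogonal sum of the \<open>V\<^sub>\<nu>\<close>, and \<open>V\<^sub>\<lambda> \<and> V\<^sub>\<mu>\<close> is the sum of those with \<open>\<nu>\<close> admissible.

  It remains to see that \<open>\<nu>\<close> is admissible iff \<open>c\<^sup>\<nu>\<^sub>\<lambda>\<^sub>\<mu> > 0\<close>. Admissibility is a statement on polynomials in
  matrix entries, so it does not change over \<open>\<complex>\<close>. There the exterior algebra contains a copy of the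
  \<open>GL\<^sub>k\<close>-module \<open>S\<^sub>\<lambda>\<close> generated by \<open>v\<^sub>\<lambda>\<close>. Composing the wedge product with column operations and with the
  coefficient at \<open>v\<^sub>\<nu>\<close> gives covectors of weight \<open>\<nu>\<close> on \<open>S\<^sub>\<lambda> \<otimes> S\<^sub>\<mu>\<close>, and such a covector can only be
  nonzero if \<open>S\<^sub>\<nu>\<close> is a constituent. Conversely, a highest weight vector of weight \<open>\<nu>\<close> in
  \<open>S\<^sub>\<lambda> \<otimes> S\<^sub>\<mu>\<close> is realised as a form on \<open>2 m\<close> columns, which column operations move to \<open>v\<^sub>\<nu>\<close>.\<close>

subsection \<open>The exterior algebra in coordinates\<close>

text \<open>Behind the argument is skew Howe duality: under both linear groups the exterior algebra
  is a multiplicity free sum of simple modules generated by the vectors \<open>v_\<nu>\<close>. None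
  of this is presupposed. The substitute is a rigidity of margins: a diagram is the only set of
  boxes with its row and column sums, so a stable subspace contains \<open>v_\<nu>\<close> as soon
  as one of its elements has a nonzero coefficient there, and questions on subspaces become
  questions on single coefficients. Since \<open>schur_module\<close> is a choice and
  \<open>littlewood_richardson\<close> a definite description, existence of the simple modules,
  complete reducibility and uniqueness of multiplicities all have to be established. No integration
  over the unitary group occurs: on the exterior algebra the action of the conjugate transpose of
  \<open>g\<close> is adjoint to that of \<open>g\<close>, and this passes to submodules and tensor
  products. Comparisons of modules rest on one tool, the density of the matrices with an LDU
  factorisation, where the pairing of a highest weight vector with a covector is known.\<close>

definition bas :: "'i set \<Rightarrow> 'i set \<Rightarrow> 'a::zero_neq_one" where
  "bas A = (\<lambda>B. if B = A then 1 else 0)"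

text \<open>A form is the function of its coefficients. \<open>lm x u\<close> is \<open>x \<and> u\<close> for a vector \<open>x\<close>, \<open>eps\<close> is its
  sign, and \<open>G p\<close> is the image of the basis vector \<open>p\<close> under the linear map \<open>G\<close>, which \<open>act X G\<close>
  extends to forms.\<close>

definition eps :: "'i::linorder \<Rightarrow> 'i set \<Rightarrow> 'a::field_char_0" where
  "eps p C = (- 1) ^ card {q\<in>C. q < p}"

definition forms :: "'i set \<Rightarrow> ('i set \<Rightarrow> 'a::zero) set" where
  "forms X = {u. \<forall>A. u A \<noteq> 0 \<longrightarrow> A \<subseteq> X}"

definition lm :: "('i::linorder \<Rightarrow> 'a::field_char_0) \<Rightarrow> ('i set \<Rightarrow> 'a) \<Rightarrow> 'i set \<Rightarrow> 'a" where
  "lm x u = (\<lambda>C. \<Sum>p\<in>C. eps p C * x p * u (C - {p}))"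

definition wsgn :: "'i::linorder set \<Rightarrow> 'i set \<Rightarrow> 'a::field_char_0" where
  "wsgn A B = (- 1) ^ card {(a, b). a \<in> A \<and> b \<in> B \<and> b < a}"

definition wed :: "('i::linorder set \<Rightarrow> 'a::field_char_0) \<Rightarrow> ('i set \<Rightarrow> 'a) \<Rightarrow> 'i set \<Rightarrow> 'a" where
  "wed u v = (\<lambda>C. \<Sum>A\<in>Pow C. wsgn A (C - A) * u A * v (C - A))"

definition img :: "('i::linorder \<Rightarrow> 'i \<Rightarrow> 'a::field_char_0) \<Rightarrow> 'i set \<Rightarrow> 'i set \<Rightarrow> 'a" where
  "img G A = foldr (\<lambda>p. lm (G p)) (sorted_list_of_set A) (bas {})"

definition act :: "'i::linorder set \<Rightarrow> ('i \<Rightarrow> 'i \<Rightarrow> 'a::field_char_0) \<Rightarrow> ('i set \<Rightarrow> 'a) \<Rightarrow> 'i set \<Rightarrow> 'a" where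
  "act X G u = (\<lambda>B. \<Sum>A\<in>Pow X. u A * img G A B)"

section \<open>Signs and left multiplication by a vector\<close>

lemma eps_sq [simp]: "eps p C * eps p C = 1"
  by (simp add: eps_def flip: power_add)

lemma eps_sq' [simp]: "eps p C * (eps p C * x) = x"
  by (simp flip: mult.assoc)

lemma eps_nz [simp]: "eps p C \<noteq> 0"
  by (simp add: eps_def)

lemma eps_del:
  assumes "finite C" "p \<in> C"
  shows "eps q (C - {p}) = (if p < q then - eps q C else eps q C)"
proof (cases "p < q")
  case True
  have "{r\<in>C. r < q} = insert p {r\<in>C - {p}. r < q}" using assms True by auto
  then have "card {r\<in>C. r < q} = Suc (card {r\<in>C - {p}. r < q})" using assms(1) by simp
  then show ?thesis using True by (simp add: eps_def)
next
  case False
  then have "{r\<in>C - {p}. r < q} = {r\<in>C. r < q}" by auto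
  then show ?thesis using False by (simp add: eps_def)
qed

lemma eps_self [simp]: "eps p (C - {p}) = eps p C" "eps p (insert p C) = eps p C"
proof -
  have "{q \<in> C - {p}. q < p} = {q \<in> C. q < p}" "{q \<in> insert p C. q < p} = {q \<in> C. q < p}" by auto
  then show "eps p (C - {p}) = eps p C" "eps p (insert p C) = eps p C" by (simp_all add: eps_def)
qed

lemma eps_ins:
  assumes "finite C" "p \<notin> C"
  shows "eps q (insert p C) = (if p < q then - eps q C else eps q C)"
  using eps_del[of "insert p C" p q, where 'b='b] assms by (auto split: if_splits)

lemma eps_min: "(\<And>q. q \<in> C \<Longrightarrow> p \<le> q) \<Longrightarrow> eps p C = 1"
proof -
  assume "\<And>q. q \<in> C \<Longrightarrow> p \<le> q"
  then have "{q \<in> C. q < p} = {}" by (auto simp: not_less)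
  then show ?thesis by (simp only: eps_def card.empty power_0)
qed

lemma eps_empty [simp]: "eps p {} = 1"
  by (simp add: eps_def)

lemma sum_pick:
  fixes f :: "'b \<Rightarrow> 'c::field"
  assumes "finite S"
  shows "(\<Sum>a\<in>S. (if a = b then 1 else 0) * f a) = (if b \<in> S then f b else 0)"
    "(\<Sum>a\<in>S. f a * (if a = b then 1 else 0)) = (if b \<in> S then f b else 0)"
    "(\<Sum>a\<in>S. (if b = a then 1 else 0) * f a) = (if b \<in> S then f b else 0)"
    "(\<Sum>a\<in>S. f a * (if b = a then 1 else 0)) = (if b \<in> S then f b else 0)"
proof -
  have "(if a = b then 1 else 0) * f a = (if a = b then f a else 0)"
    "f a * (if a = b then 1 else 0) = (if a = b then f a else 0)"
    "(if b = a then 1 else 0) * f a = (if a = b then f a else 0)"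
    "f a * (if b = a then 1 else 0) = (if a = b then f a else 0)" for a by auto
  then show "(\<Sum>a\<in>S. (if a = b then 1 else 0) * f a) = (if b \<in> S then f b else 0)"
    "(\<Sum>a\<in>S. f a * (if a = b then 1 else 0)) = (if b \<in> S then f b else 0)"
    "(\<Sum>a\<in>S. (if b = a then 1 else 0) * f a) = (if b \<in> S then f b else 0)"
    "(\<Sum>a\<in>S. f a * (if b = a then 1 else 0)) = (if b \<in> S then f b else 0)"
    using assms by (simp_all add: sum.delta)
qed

lemma lm_inf: "infinite C \<Longrightarrow> lm x u C = 0"
  by (simp add: lm_def)

lemma lm_add: "lm x (\<lambda>A. u A + v A) = (\<lambda>A. lm x u A + lm x v A)"
  by (simp add: lm_def sum.distrib algebra_simps)

lemma lm_scale: "lm x (\<lambda>A. c * u A) = (\<lambda>A. c * lm x u A)"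
  by (simp add: lm_def sum_distrib_left algebra_simps)

lemma lm_zero: "lm x (\<lambda>A. 0) = (\<lambda>A. 0)"
  by (simp add: lm_def)

lemma lm_sum: "lm x (\<lambda>A. \<Sum>i\<in>I. f i A) = (\<lambda>A. \<Sum>i\<in>I. lm x (f i) A)"
  by (rule ext) (simp add: lm_def sum_distrib_left sum.swap[of _ I] mult.assoc)

lemma lm_addl: "lm (\<lambda>q. x q + y q) u = (\<lambda>A. lm x u A + lm y u A)"
  by (simp add: lm_def sum.distrib algebra_simps)

lemma lm_scalel: "lm (\<lambda>q. c * x q) u = (\<lambda>A. c * lm x u A)"
  by (simp add: lm_def sum_distrib_left algebra_simps)

lemma lm_suml: "lm (\<lambda>q. \<Sum>i\<in>I. f i q) u = (\<lambda>A. \<Sum>i\<in>I. lm (f i) u A)"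
  by (rule ext) (simp add: lm_def sum_distrib_left sum_distrib_right sum.swap[of _ I] mult.assoc)

lemma lm_zerol: "lm (\<lambda>q. 0) u = (\<lambda>A. 0)"
  by (simp add: lm_def)

text \<open>Exactly one of \<open>p < q\<close> and \<open>q < p\<close> holds for distinct boxes,
  so exactly one of the two signs changes when the order of removal is reversed. On infinite sets
  both sides are zero by the convention for infinite sums.\<close>

lemma lm_anti: "lm x (lm y u) = (\<lambda>C. - lm y (lm x u) C)"
proof
  fix C
  show "lm x (lm y u) C = - lm y (lm x u) C"
  proof (cases "finite C")
    case True
    have e: "lm x (lm y u) C = (\<Sum>p\<in>C. \<Sum>q\<in>C. if q = p then 0 else
        eps p C * eps q (C - {p}) * x p * y q * u (C - {p} - {q}))" for x y
    proof -
      have "lm x (lm y u) C = (\<Sum>p\<in>C. \<Sum>q\<in>C - {p}. eps p C * eps q (C - {p}) * x p * y q * u (C - {p} - {q}))"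
        by (simp add: lm_def sum_distrib_left algebra_simps)
      also have "\<dots> = (\<Sum>p\<in>C. \<Sum>q\<in>C. if q = p then 0 else
        eps p C * eps q (C - {p}) * x p * y q * u (C - {p} - {q}))"
        using True by (intro sum.cong refl sum.mono_neutral_cong_left) auto
      finally show ?thesis .
    qed
    have "lm y (lm x u) C = (\<Sum>q\<in>C. \<Sum>p\<in>C. if q = p then 0 else
        eps q C * eps p (C - {q}) * x p * y q * u (C - {p} - {q}))"
      unfolding e by (intro sum.cong refl) (auto simp: Diff_insert2[symmetric] insert_commute mult_ac
          Diff_insert[symmetric])
    also have "\<dots> = (\<Sum>p\<in>C. \<Sum>q\<in>C. if q = p then 0 else
        eps q C * eps p (C - {q}) * x p * y q * u (C - {p} - {q}))"
      by (rule sum.swap)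
    also have "\<dots> = - lm x (lm y u) C"
      unfolding e sum_negf[symmetric] using True
      by (intro sum.cong refl) (auto simp: eps_del)
    finally show ?thesis by simp
  qed (simp add: lm_inf)
qed

lemma lm_lm: "lm x (lm x u) = (\<lambda>C. 0)"
proof
  fix C
  have "lm x (lm x u) C = - lm x (lm x u) C" using lm_anti[of x x u] by metis
  then show "lm x (lm x u) C = 0" by simp
qed

section \<open>Images of monomials under a linear map\<close>

lemma sorted_list_min:
  assumes "finite A" "\<And>q. q \<in> A \<Longrightarrow> p < q"
  shows "sorted_list_of_set (insert p A) = p # sorted_list_of_set A"
proof -
  have "p \<notin> A" using assms(2) by blast
  have "insort p (sorted_list_of_set A) = p # sorted_list_of_set A"
    using assms by (intro insort_is_Cons) (auto intro: less_imp_le)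
  then show ?thesis using assms(1) \<open>p \<notin> A\<close> by (simp add: sorted_list_of_set_insert)
qed

lemma img_empty [simp]: "img G {} = bas {}"
  by (simp add: img_def)

lemma img_min:
  assumes "finite A" "\<And>q. q \<in> A \<Longrightarrow> p < q"
  shows "img G (insert p A) = lm (G p) (img G A)"
  by (simp add: img_def sorted_list_min[OF assms])

lemma finite_min_split:
  fixes A :: "'i::linorder set"
  assumes "finite A" "A \<noteq> {}"
  obtains b A' where "A = insert b A'" "finite A'" "\<And>q. q \<in> A' \<Longrightarrow> b < q" "b \<notin> A'"
proof -
  obtain m where m: "m \<in> A" "\<And>b. b \<in> A \<Longrightarrow> b \<le> m \<Longrightarrow> m = b"
    using finite_has_minimal[OF assms] by metis
  show ?thesis
  proof (rule that[of m "A - {m}"])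
    show "m < q" if "q \<in> A - {m}" for q using m that by (metis DiffE insertI1 not_le)
  qed (use m assms in auto)
qed

text \<open>\<open>img\<close> multiplies its factors in increasing order; \<open>eps p A\<close>
  counts the factors that \<open>G p\<close> has to pass to reach its place. The induction peels off
  the least box and uses \<open>lm_anti\<close> once when \<open>p\<close> is not the new
  minimum.\<close>

lemma img_insert:
  assumes "finite A" "p \<notin> A"
  shows "img G (insert p A) = (\<lambda>B. eps p A * lm (G p) (img G A) B)"
  using assms
proof (induction "card A" arbitrary: A)
  case 0
  then have "A = {}" by simp
  then show ?case using img_min[of "{}" p G] by (simp add: eps_min)
next
  case (Suc n)
  then have "A \<noteq> {}" by auto
  from finite_min_split[OF Suc(3) this] obtain b A' where A: "A = insert b A'" "finite A'"
    "\<And>q. q \<in> A' \<Longrightarrow> b < q" "b \<notin> A'" by metis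
  show ?case
  proof (cases "p < b")
    case True
    then have lt: "q \<in> A \<Longrightarrow> p < q" for q using A(1,3) by (auto intro: less_trans)
    then have "eps p A = (1::'b)" by (auto intro!: eps_min less_imp_le)
    then show ?thesis using img_min[OF Suc(3) lt] by simp
  next
    case False
    then have bp: "b < p" using Suc(4) A(1) by auto
    have pA: "p \<notin> A'" using Suc(4) A(1) by auto
    have "img G (insert p A) = img G (insert b (insert p A'))" using A(1) by (simp add: insert_commute)
    also have "\<dots> = lm (G b) (img G (insert p A'))"
      by (rule img_min) (use A bp in auto)
    also have "img G (insert p A') = (\<lambda>B. eps p A' * lm (G p) (img G A') B)"
      by (rule Suc(1)) (use Suc(2) A pA in auto)
    also have "lm (G b) \<dots> = (\<lambda>B. - eps p A' * lm (G p) (lm (G b) (img G A')) B)"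
      by (subst lm_scale, subst lm_anti) simp
    also have "lm (G b) (img G A') = img G A" using A by (simp add: img_min)
    also have "- eps p A' = eps p A" using A bp by (simp add: eps_ins)
    finally show ?thesis .
  qed
qed

lemma img_remove:
  assumes "finite A" "p \<in> A"
  shows "img G A = (\<lambda>B. eps p A * lm (G p) (img G (A - {p})) B)"
  using img_insert[of "A - {p}" p G] assms by (simp add: insert_absorb)

lemma lm_img: "finite A \<Longrightarrow> lm (G p) (img G A) = (\<lambda>B. if p \<in> A then 0 else eps p A * img G (insert p A) B)"
proof (cases "p \<in> A")
  case True
  assume "finite A"
  then show ?thesis using True by (subst img_remove[of A p]) (simp_all add: lm_scale lm_lm)
qed (simp add: img_insert)

definition dl :: "'i \<Rightarrow> 'i \<Rightarrow> 'a::zero_neq_one" where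
  "dl p = (\<lambda>q. if q = p then 1 else 0)"

lemma lm_dl: "lm (dl p) u C = (if p \<in> C \<and> finite C then eps p C * u (C - {p}) else 0)"
  by (cases "finite C") (auto simp: lm_def dl_def if_distrib if_distribR sum.delta' cong: if_cong)

lemma lm_dl_bas: "finite A \<Longrightarrow> lm (dl p) (bas A) = (\<lambda>B. if p \<in> A then 0 else eps p A * bas (insert p A) B)"
proof
  fix B assume "finite A"
  have "C - {p} = A \<longleftrightarrow> C = insert p A" if "p \<notin> A" "p \<in> C" for C using that by auto
  then show "lm (dl p) (bas A) B = (if p \<in> A then 0 else eps p A * bas (insert p A) B)"
    using \<open>finite A\<close> by (auto simp: lm_dl bas_def)
qed

text \<open>Adding boxes below all earlier ones matches the sorted list in \<open>img\<close>, so no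
  sign arises in an induction step.\<close>

lemma finite_min_induct [consumes 1, case_names empty insert]:
  assumes "finite A" "P {}"
    "\<And>p A. finite A \<Longrightarrow> (\<And>q. q \<in> A \<Longrightarrow> p < q) \<Longrightarrow> p \<notin> A \<Longrightarrow> P A \<Longrightarrow> P (insert p A)"
  shows "P (A::'i::linorder set)"
  using assms(1)
proof (induction "card A" arbitrary: A)
  case 0
  then show ?case using assms(2) by simp
next
  case (Suc n)
  then have "A \<noteq> {}" by auto
  from finite_min_split[OF Suc(3) this] obtain b A' where A: "A = insert b A'" "finite A'"
    "\<And>q. q \<in> A' \<Longrightarrow> b < q" "b \<notin> A'" by metis
  show ?case unfolding A(1) by (rule assms(3)) (use A Suc in auto)
qed

lemma img_dl: "finite A \<Longrightarrow> img dl A = (bas A :: 'i::linorder set \<Rightarrow> 'a::field_char_0)"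
proof (induction rule: finite_min_induct)
  case (insert p A)
  then have "eps p A = (1::'a)" by (auto intro!: eps_min less_imp_le)
  then show ?case using insert by (simp add: img_min lm_dl_bas)
qed simp

lemma formsI: "(\<And>A. u A \<noteq> 0 \<Longrightarrow> A \<subseteq> X) \<Longrightarrow> u \<in> forms X"
  by (simp add: forms_def)

lemma formsD: "u \<in> forms X \<Longrightarrow> \<not> A \<subseteq> X \<Longrightarrow> u A = 0"
  by (auto simp: forms_def)

lemma bas_forms: "A \<subseteq> X \<Longrightarrow> bas A \<in> forms X"
  by (auto simp: forms_def bas_def)

lemma lm_forms:
  assumes "\<And>q. x q \<noteq> 0 \<Longrightarrow> q \<in> X" "u \<in> forms X"
  shows "lm x u \<in> forms X"
proof (rule formsI)
  fix A assume "lm x u A \<noteq> 0"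
  then obtain p where "p \<in> A" "x p \<noteq> 0" "u (A - {p}) \<noteq> 0"
    unfolding lm_def by (metis (no_types, lifting) mult_eq_0_iff sum.not_neutral_contains_not_neutral)
  then show "A \<subseteq> X" using assms unfolding forms_def by blast
qed

lemma img_forms:
  assumes "finite A" "\<And>p q. p \<in> A \<Longrightarrow> G p q \<noteq> 0 \<Longrightarrow> q \<in> X"
  shows "img G A \<in> forms X"
  using assms
proof (induction rule: finite_min_induct)
  case (insert p A)
  then have "img G A \<in> forms X" "\<And>q. G p q \<noteq> 0 \<Longrightarrow> q \<in> X" by auto
  then show ?case using insert by (simp add: img_min lm_forms)
qed (simp add: bas_forms)

lemma act_bas: "finite X \<Longrightarrow> A \<subseteq> X \<Longrightarrow> act X G (bas A) = img G A"
  by (rule ext) (simp add: act_def bas_def sum_pick)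

lemma act_add: "act X G (\<lambda>A. u A + v A) = (\<lambda>A. act X G u A + act X G v A)"
  by (simp add: act_def sum.distrib algebra_simps)

lemma act_scale: "act X G (\<lambda>A. c * u A) = (\<lambda>A. c * act X G u A)"
  by (simp add: act_def sum_distrib_left algebra_simps)

lemma act_zero: "act X G (\<lambda>A. 0) = (\<lambda>A. 0)"
  by (simp add: act_def)

lemma act_sum: "act X G (\<lambda>A. \<Sum>i\<in>I. f i A) = (\<lambda>A. \<Sum>i\<in>I. act X G (f i) A)"
  by (rule ext) (simp add: act_def sum_distrib_right sum.swap[of _ I] mult.assoc)

lemma act_forms:
  assumes "finite X" "\<And>p q. p \<in> X \<Longrightarrow> G p q \<noteq> 0 \<Longrightarrow> q \<in> Y"
  shows "act X G u \<in> forms Y"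
proof (rule formsI)
  fix B assume "act X G u B \<noteq> 0"
  then obtain A where "A \<subseteq> X" "img G A B \<noteq> 0"
    unfolding act_def by (metis (no_types, lifting) mult_eq_0_iff sum.not_neutral_contains_not_neutral PowD)
  moreover have "img G A \<in> forms Y" using assms \<open>A \<subseteq> X\<close> by (intro img_forms) (auto intro: finite_subset)
  ultimately show "B \<subseteq> Y" by (auto simp: forms_def)
qed

lemma forms_expand: "finite X \<Longrightarrow> (u :: 'i set \<Rightarrow> 'a::field) \<in> forms X \<Longrightarrow> u = (\<lambda>B. \<Sum>A\<in>Pow X. u A * bas A B)"
  by (rule ext) (auto simp: bas_def sum_pick formsD)

text \<open>Both sides are linear in \<open>x\<close> and in \<open>u\<close>, which reduces the
  claim to \<open>lm_img\<close> for monomials.\<close>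

lemma act_lm:
  assumes "finite X" "\<And>q. x q \<noteq> 0 \<Longrightarrow> q \<in> X" "u \<in> forms X"
  shows "act X G (lm x u) = lm (\<lambda>q. \<Sum>p\<in>X. x p * G p q) (act X G u)"
proof -
  have x: "x = (\<lambda>q. \<Sum>p\<in>X. x p * dl p q)"
    using assms(1,2) by (intro ext) (auto simp: dl_def sum_pick)
  have 1: "act X G (lm (dl p) (bas A)) = lm (G p) (img G A)" if "p \<in> X" "A \<subseteq> X" for p A
  proof -
    have "finite A" using assms(1) that by (auto intro: finite_subset)
    then show ?thesis using that assms(1)
      by (cases "p \<in> A") (simp_all add: lm_dl_bas lm_img act_zero act_scale act_bas)
  qed
  have "act X G (lm x u) = act X G (lm (\<lambda>q. \<Sum>p\<in>X. x p * dl p q) (\<lambda>B. \<Sum>A\<in>Pow X. u A * bas A B))"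
    using x forms_expand[OF assms(1,3)] by simp
  also have "\<dots> = (\<lambda>B. \<Sum>p\<in>X. x p * (\<Sum>A\<in>Pow X. u A * act X G (lm (dl p) (bas A)) B))"
    by (simp add: lm_suml lm_scalel lm_sum lm_scale act_sum act_scale)
  also have "\<dots> = (\<lambda>B. \<Sum>p\<in>X. x p * (\<Sum>A\<in>Pow X. u A * lm (G p) (img G A) B))"
    by (intro ext sum.cong refl arg_cong[of _ _ "(*) (x _)"]) (simp add: 1)
  also have "\<dots> = lm (\<lambda>q. \<Sum>p\<in>X. x p * G p q) (\<lambda>B. \<Sum>A\<in>Pow X. u A * img G A B)"
    by (simp add: lm_suml lm_scalel lm_sum lm_scale)
  finally show ?thesis by (simp add: act_def)
qed

lemma img_cong: "finite A \<Longrightarrow> (\<And>p. p \<in> A \<Longrightarrow> G p = H p) \<Longrightarrow> img G A = img H A"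
  by (induction rule: finite_min_induct) (simp_all add: img_min)

lemma act_cong: "finite X \<Longrightarrow> (\<And>p. p \<in> X \<Longrightarrow> G p = H p) \<Longrightarrow> act X G u = act X H u"
  unfolding act_def
proof (intro ext sum.cong refl)
  fix B A assume "finite X" "\<And>p. p \<in> X \<Longrightarrow> G p = H p" "A \<in> Pow X"
  then have "img G A = img H A" by (intro img_cong) (auto intro: finite_subset)
  then show "u A * img G A B = u A * img H A B" by simp
qed

lemma act_img:
  assumes "finite X" "A \<subseteq> X" "\<And>p q. p \<in> X \<Longrightarrow> H p q \<noteq> 0 \<Longrightarrow> q \<in> X"
  shows "act X G (img H A) = img (\<lambda>p q. \<Sum>r\<in>X. H p r * G r q) A"
proof -
  have "finite A" using assms by (auto intro: finite_subset)
  then show ?thesis using assms(2)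
  proof (induction rule: finite_min_induct)
    case empty
    then show ?case by (simp add: act_bas assms(1))
  next
    case (insert p A)
    have "img H A \<in> forms X" by (rule img_forms) (use insert assms in auto)
    moreover have "\<And>q. H p q \<noteq> 0 \<Longrightarrow> q \<in> X" using insert assms by auto
    ultimately show ?case using insert assms(1) by (simp add: img_min act_lm)
  qed
qed

text \<open>Functoriality, which in terms of minors is the Cauchy-Binet formula.\<close>

lemma act_act:
  assumes "finite X" "\<And>p q. p \<in> X \<Longrightarrow> H p q \<noteq> 0 \<Longrightarrow> q \<in> X"
  shows "act X G (act X H u) = act X (\<lambda>p q. \<Sum>r\<in>X. H p r * G r q) u"
proof -
  have "act X G (act X H u) = (\<lambda>B. \<Sum>A\<in>Pow X. u A * act X G (img H A) B)"
    by (subst (2) act_def) (simp add: act_sum act_scale)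
  also have "\<dots> = act X (\<lambda>p q. \<Sum>r\<in>X. H p r * G r q) u"
    unfolding act_def[of X "\<lambda>p q. \<Sum>r\<in>X. H p r * G r q"] using assms
    by (intro ext sum.cong refl) (simp add: act_img)
  finally show ?thesis .
qed

lemma act_dl: "finite X \<Longrightarrow> u \<in> forms X \<Longrightarrow> act X dl u = u"
proof -
  assume "finite X" "u \<in> forms X"
  have "act X dl u = (\<lambda>B. \<Sum>A\<in>Pow X. u A * bas A B)"
    unfolding act_def using \<open>finite X\<close> by (intro ext sum.cong refl) (auto simp: img_dl finite_subset)
  then show ?thesis using forms_expand[OF \<open>finite X\<close> \<open>u \<in> forms X\<close>] by simp
qed

section \<open>The wedge product and its compatibility with linear maps\<close>

lemma wsgn_ins:
  assumes "finite A" "finite B" "p \<notin> A"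
  shows "wsgn (insert p A) B = eps p B * wsgn A B"
proof -
  have fin: "finite {(a, b). a \<in> A \<and> b \<in> B \<and> b < a}"
    by (rule finite_subset[of _ "A \<times> B"]) (use assms in auto)
  have "{(a, b). a \<in> insert p A \<and> b \<in> B \<and> b < a} = Pair p ` {q\<in>B. q < p} \<union> {(a, b). a \<in> A \<and> b \<in> B \<and> b < a}"
    by auto
  moreover have "card (Pair p ` {q\<in>B. q < p} \<union> {(a, b). a \<in> A \<and> b \<in> B \<and> b < a}) =
      card (Pair p ` {q\<in>B. q < p}) + card {(a, b). a \<in> A \<and> b \<in> B \<and> b < a}"
    using assms fin by (intro card_Un_disjoint) auto
  ultimately have "card {(a, b). a \<in> insert p A \<and> b \<in> B \<and> b < a} = card {q\<in>B. q < p} + card {(a, b). a \<in> A \<and> b \<in> B \<and> b < a}"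
    by (simp add: card_image inj_on_def)
  then show ?thesis by (simp add: wsgn_def eps_def power_add)
qed

lemma eps_Un:
  assumes "finite A" "finite B" "A \<inter> B = {}"
  shows "eps p (A \<union> B) = eps p A * eps p B"
proof -
  have "{q \<in> A \<union> B. q < p} = {q\<in>A. q < p} \<union> {q\<in>B. q < p}" by auto
  then have "card {q \<in> A \<union> B. q < p} = card {q\<in>A. q < p} + card {q\<in>B. q < p}"
    using assms by (subst card_Un_disjoint[symmetric]) auto
  then show ?thesis by (simp add: eps_def power_add)
qed

text \<open>A subset \<open>A\<close> of \<open>C\<close> with a marked box \<open>p\<close> is the
  same as \<open>p\<close> with a subset of the remaining boxes. The sign \<open>eps p C\<close>
  splits into \<open>eps p A\<close> and \<open>eps p (C - A)\<close>, and the second is what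
  distinguishes \<open>wsgn\<close> of \<open>A\<close> from that of \<open>A - {p}\<close>.\<close>

lemma wed_lm: "wed (lm x u) v = lm x (wed u v)"
proof
  fix C
  show "wed (lm x u) v C = lm x (wed u v) C"
  proof (cases "finite C")
    case True
    have "wed (lm x u) v C = (\<Sum>A\<in>Pow C. \<Sum>p\<in>A. wsgn A (C - A) * eps p A * x p * u (A - {p}) * v (C - A))"
      by (simp add: wed_def lm_def sum_distrib_left sum_distrib_right mult_ac)
    also have "\<dots> = (\<Sum>(A, p)\<in>(SIGMA A:Pow C. A). wsgn A (C - A) * eps p A * x p * u (A - {p}) * v (C - A))"
      using True by (intro sum.Sigma) (auto intro: finite_subset)
    also have "\<dots> = (\<Sum>(p, A)\<in>(SIGMA p:C. Pow (C - {p})). eps p C * x p * (wsgn A (C - {p} - A) * u A * v (C - {p} - A)))"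
    proof (rule sum.reindex_bij_witness[of _ "\<lambda>(p, A). (insert p A, p)" "\<lambda>(A, p). (p, A - {p})"], goal_cases)
      case (1 a) then show ?case by auto
    next
      case (2 a) then show ?case by auto
    next
      case (3 a) then show ?case by auto
    next
      case (4 a) then show ?case by auto
    next
      case (5 a)
      obtain A p where a: "a = (A, p)" "A \<subseteq> C" "p \<in> A" using 5 by auto
      have fin: "finite A" "finite (C - A)" using True a by (auto intro: finite_subset)
      have s: "wsgn A (C - A) = eps p (C - A) * (wsgn (A - {p}) (C - A)::'b)"
        using wsgn_ins[of "A - {p}" "C - A" p, where 'b='b] fin a by (simp add: insert_absorb)
      have e: "eps p C = eps p A * (eps p (C - A)::'b)"
        using eps_Un[of A "C - A" p, where 'b='b] fin a(2) by (simp add: Un_absorb1)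
      have d: "C - {p} - (A - {p}) = C - A" using a by auto
      show ?case unfolding a by (simp add: s e d)
    qed
    also have "\<dots> = (\<Sum>p\<in>C. \<Sum>A\<in>Pow (C - {p}). eps p C * x p * (wsgn A (C - {p} - A) * u A * v (C - {p} - A)))"
      using True by (intro sum.Sigma[symmetric]) auto
    also have "\<dots> = lm x (wed u v) C"
      by (simp add: wed_def lm_def sum_distrib_left mult_ac)
    finally show ?thesis .
  qed (simp add: lm_inf wed_def)
qed

lemma wed_add: "wed (\<lambda>A. u A + u' A) v = (\<lambda>A. wed u v A + wed u' v A)"
  and wed_scale: "wed (\<lambda>A. c * u A) v = (\<lambda>A. c * wed u v A)"
  and wed_addr: "wed w (\<lambda>A. u A + u' A) = (\<lambda>A. wed w u A + wed w u' A)"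
  and wed_scaler: "wed w (\<lambda>A. c * u A) = (\<lambda>A. c * wed w u A)"
  by (simp_all add: wed_def sum.distrib sum_distrib_left algebra_simps)

lemma wed_sum: "wed (\<lambda>A. \<Sum>i\<in>I. f i A) v = (\<lambda>A. \<Sum>i\<in>I. wed (f i) v A)"
  and wed_sumr: "wed v (\<lambda>A. \<Sum>i\<in>I. f i A) = (\<lambda>A. \<Sum>i\<in>I. wed v (f i) A)"
  by (rule ext, simp add: wed_def sum_distrib_left sum_distrib_right sum.swap[of _ I] mult.assoc)+

lemma wed_one: "finite X \<Longrightarrow> v \<in> forms X \<Longrightarrow> wed (bas {}) v = v"
proof
  fix C assume X: "finite X" "v \<in> forms X"
  show "wed (bas {}) v C = v C"
  proof (cases "finite C")
    case True
    have "wed (bas {}) v C = (\<Sum>A\<in>Pow C. if A = {} then wsgn {} C * v C else 0)"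
      unfolding wed_def by (intro sum.cong refl) (auto simp: bas_def)
    also have "\<dots> = wsgn {} C * v C"
      using True by (subst sum.delta) auto
    finally show ?thesis by (simp add: wsgn_def)
  next
    case False
    then have "\<not> C \<subseteq> X" using X finite_subset by blast
    then show ?thesis using False X(2) by (auto simp: wed_def forms_def)
  qed
qed

lemma wed_forms: "u \<in> forms X \<Longrightarrow> v \<in> forms X \<Longrightarrow> wed u v \<in> forms X"
proof (rule formsI)
  fix C assume f: "u \<in> forms X" "v \<in> forms X" "wed u v C \<noteq> 0"
  then obtain A where "A \<in> Pow C" "wsgn A (C - A) * u A * v (C - A) \<noteq> 0"
    unfolding wed_def by (metis (no_types, lifting) sum.not_neutral_contains_not_neutral)
  then have "A \<subseteq> X" "C - A \<subseteq> X" using f by (auto simp: forms_def)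
  then show "C \<subseteq> X" by auto
qed

text \<open>Left multiplications by vectors generate everything: \<open>wed_lm\<close> and
  \<open>act_lm\<close> carry the claim from one monomial to the next larger one, and linearity does
  the rest.\<close>

lemma act_wed:
  assumes "finite X" "\<And>p q. p \<in> X \<Longrightarrow> G p q \<noteq> 0 \<Longrightarrow> q \<in> X" "u \<in> forms X" "v \<in> forms X"
  shows "act X G (wed u v) = wed (act X G u) (act X G v)"
proof -
  have 1: "act X G (wed (bas A) v) = wed (img G A) (act X G v)" if "A \<subseteq> X" for A
  proof -
    have "finite A" using assms that by (auto intro: finite_subset)
    then show ?thesis using that
    proof (induction rule: finite_min_induct)
      case empty
      have "act X G v \<in> forms X" using assms by (intro act_forms)
      then show ?case using assms by (simp add: wed_one)
    next
      case (insert p A)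
      then have e: "eps p A = (1::'b)" by (auto intro!: eps_min less_imp_le)
      have b: "bas (insert p A) = lm (dl p) (bas A :: 'a set \<Rightarrow> 'b)" using insert e by (simp add: lm_dl_bas)
      have "act X G (wed (bas (insert p A)) v) = act X G (lm (dl p) (wed (bas A) v))"
        by (simp add: b wed_lm)
      also have "\<dots> = lm (\<lambda>q. \<Sum>r\<in>X. dl p r * G r q) (act X G (wed (bas A) v))"
        using assms insert by (intro act_lm wed_forms bas_forms) (auto simp: dl_def split: if_splits)
      also have "(\<lambda>q. \<Sum>r\<in>X. dl p r * G r q) = G p"
        using insert assms(1) by (simp add: dl_def sum_pick)
      finally show ?case using insert by (simp add: img_min wed_lm)
    qed
  qed
  have "act X G (wed u v) = act X G (wed (\<lambda>B. \<Sum>A\<in>Pow X. u A * bas A B) v)"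
    using forms_expand[OF assms(1,3)] by simp
  also have "\<dots> = (\<lambda>B. \<Sum>A\<in>Pow X. u A * act X G (wed (bas A) v) B)"
    by (simp add: wed_sum wed_scale act_sum act_scale)
  also have "\<dots> = (\<lambda>B. \<Sum>A\<in>Pow X. u A * wed (img G A) (act X G v) B)"
    by (intro ext sum.cong refl) (simp add: 1)
  also have "\<dots> = wed (act X G u) (act X G v)"
    by (simp add: act_def[of X G u] wed_sum wed_scale)
  finally show ?thesis .
qed

section \<open>Supports, transposes and triangular maps\<close>

lemma lm_nz:
  assumes "lm x u B \<noteq> 0"
  obtains q where "q \<in> B" "finite B" "x q \<noteq> 0" "u (B - {q}) \<noteq> 0"
proof -
  have "finite B" using assms lm_inf by blast
  moreover obtain q where "q \<in> B" "eps q B * x q * u (B - {q}) \<noteq> 0"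
    using assms unfolding lm_def by (metis (no_types, lifting) sum.not_neutral_contains_not_neutral)
  ultimately show ?thesis using that by auto
qed

lemma img_nz_card: "finite A \<Longrightarrow> img G A B \<noteq> 0 \<Longrightarrow> finite B \<and> card B = card A"
proof (induction arbitrary: B rule: finite_min_induct)
  case (insert p A)
  then have "lm (G p) (img G A) B \<noteq> 0" by (simp add: img_min)
  then obtain q where "q \<in> B" "finite B" "img G A (B - {q}) \<noteq> 0" by (rule lm_nz)
  then show ?case using insert by (metis card.insert card.remove finite_Diff)
qed (auto simp: bas_def split: if_splits)

text \<open>\<open>f\<close> is a colouring that the linear map respects. It will be the row index
  for column operations and the column index for row operations.\<close>

lemma img_nz_fibre:
  assumes "finite A" "\<And>p q. G p q \<noteq> 0 \<Longrightarrow> f q = f p" "img G A B \<noteq> 0"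
  shows "card {p\<in>B. f p = c} = card {p\<in>A. f p = c}"
  using assms(1,3)
proof (induction arbitrary: B rule: finite_min_induct)
  case (insert p A)
  then have "lm (G p) (img G A) B \<noteq> 0" by (simp add: img_min)
  then obtain q where q: "q \<in> B" "finite B" "G p q \<noteq> 0" "img G A (B - {q}) \<noteq> 0" by (rule lm_nz)
  have "{p\<in>B. f p = c} = (if f q = c then insert q {p\<in>B - {q}. f p = c} else {p\<in>B - {q}. f p = c})"
    using q(1) by auto
  then have "card {p\<in>B. f p = c} = card {p\<in>B - {q}. f p = c} + (if f q = c then 1 else 0)"
    using q(2) by (auto simp: card_insert_if)
  moreover have "{r\<in>insert p A. f r = c} = (if f p = c then insert p {r\<in>A. f r = c} else {r\<in>A. f r = c})"
    by auto
  then have "card {r\<in>insert p A. f r = c} = card {r\<in>A. f r = c} + (if f p = c then 1 else 0)"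
    using insert by (auto simp: card_insert_if)
  moreover have "f q = f p" using assms(2) q(3) .
  ultimately show ?case using insert.IH[OF q(4)] by simp
qed (auto simp: bas_def split: if_splits)

lemma img_cong_on:
  assumes "finite A" "\<And>p q. p \<in> A \<Longrightarrow> q \<in> B \<Longrightarrow> G p q = H p q"
  shows "img G A B = img H A B"
  using assms
proof (induction arbitrary: B rule: finite_min_induct)
  case (insert p A)
  have "img G A (B - {q}) = img H A (B - {q})" for q by (rule insert.IH) (use insert in auto)
  then show ?case using insert by (simp add: img_min lm_def)
qed simp

text \<open>\<open>img G A B\<close> is the minor of \<open>G\<close> on \<open>A\<close> and
  \<open>B\<close>, so this is invariance of determinants under transposition. Expanding along one
  row is not symmetric; summing over all rows in \<open>A\<close> gives the symmetric double sum
  \<open>S\<close>, at the price of dividing by \<open>card A\<close>, which characteristic zero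
  permits.\<close>

lemma img_transpose:
  assumes "finite A" "finite B"
  shows "img G A B = img (\<lambda>p q. G q p) B A"
  using assms
proof (induction "card A" arbitrary: A B)
  case 0
  then have "A = {}" by simp
  moreover have "img (\<lambda>p q. G q p) B {} = bas {} B"
  proof (cases "B = {}")
    case False
    then have "img (\<lambda>p q. G q p) B {} = 0" using img_nz_card[OF 0(3), of "\<lambda>p q. G q p" "{}"] 0 by auto
    then show ?thesis using False by (simp add: bas_def)
  qed (simp add: bas_def)
  ultimately show ?case by simp
next
  case (Suc n)
  show ?case
  proof (cases "card A = card B")
    case False
    then have "img G A B = 0" "img (\<lambda>p q. G q p) B A = 0"
      using img_nz_card[of A G B] img_nz_card[of B "\<lambda>p q. G q p" A] Suc.prems by auto
    then show ?thesis by simp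
  next
    case True
    define S where "S = (\<Sum>p\<in>A. \<Sum>q\<in>B. eps p A * eps q B * G p q * img G (A - {p}) (B - {q}))"
    have "of_nat (card A) * img G A B = (\<Sum>p\<in>A. img G A B)" by simp
    also have "\<dots> = (\<Sum>p\<in>A. eps p A * lm (G p) (img G (A - {p})) B)"
      using Suc by (intro sum.cong refl) (subst img_remove, auto)
    also have "\<dots> = S" unfolding S_def lm_def by (simp add: sum_distrib_left mult_ac)
    finally have 1: "of_nat (card A) * img G A B = S" .
    have "of_nat (card B) * img (\<lambda>p q. G q p) B A = (\<Sum>q\<in>B. img (\<lambda>p q. G q p) B A)" by simp
    also have "\<dots> = (\<Sum>q\<in>B. eps q B * lm (\<lambda>p. G p q) (img (\<lambda>p q. G q p) (B - {q})) A)"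
      using Suc by (intro sum.cong refl) (subst img_remove, auto)
    also have "\<dots> = (\<Sum>q\<in>B. \<Sum>p\<in>A. eps p A * eps q B * G p q * img (\<lambda>p q. G q p) (B - {q}) (A - {p}))"
      unfolding lm_def by (simp add: sum_distrib_left mult_ac)
    also have "\<dots> = (\<Sum>p\<in>A. \<Sum>q\<in>B. eps p A * eps q B * G p q * img (\<lambda>p q. G q p) (B - {q}) (A - {p}))"
      by (rule sum.swap)
    also have "\<dots> = S" unfolding S_def
    proof (intro sum.cong refl)
      fix p q assume "p \<in> A" "q \<in> B"
      have "img G (A - {p}) (B - {q}) = img (\<lambda>p q. G q p) (B - {q}) (A - {p})"
        by (rule Suc(1)) (use Suc \<open>p \<in> A\<close> in auto)
      then show "eps p A * eps q B * G p q * img (\<lambda>p q. G q p) (B - {q}) (A - {p}) =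
         eps p A * eps q B * G p q * img G (A - {p}) (B - {q})" by simp
    qed
    finally have "of_nat (card A) * img G A B = of_nat (card A) * img (\<lambda>p q. G q p) B A"
      using 1 True by simp
    moreover have "of_nat (card A) \<noteq> (0::'b)" using Suc by (metis nat.distinct(1) of_nat_eq_0_iff)
    ultimately show ?thesis by simp
  qed
qed

text \<open>Bilinear without conjugation, also over the complex numbers. It serves to read off
  coefficients and to transpose the action, and only over the reals as an inner product.\<close>

definition ip :: "'i set \<Rightarrow> ('i set \<Rightarrow> 'a::field_char_0) \<Rightarrow> ('i set \<Rightarrow> 'a) \<Rightarrow> 'a" where
  "ip X u v = (\<Sum>A\<in>Pow X. u A * v A)"

lemma ip_sym: "ip X u v = ip X v u"
  by (simp add: ip_def mult.commute)

lemma ip_bas: "finite X \<Longrightarrow> A \<subseteq> X \<Longrightarrow> ip X u (bas A) = u A"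
  by (simp add: ip_def bas_def sum_pick)

lemma act_adj:
  assumes "finite X" "\<And>p q. p \<in> X \<Longrightarrow> q \<in> X \<Longrightarrow> H q p = G p q"
  shows "ip X (act X G u) v = ip X u (act X H v)"
proof -
  have "img G A B = img H B A" if "A \<subseteq> X" "B \<subseteq> X" for A B
  proof -
    have f: "finite A" "finite B" using assms that by (auto intro: finite_subset)
    have "img H B A = img (\<lambda>p q. G q p) B A" by (rule img_cong_on) (use f that assms in auto)
    then show ?thesis using img_transpose[OF f] by simp
  qed
  then have "ip X (act X G u) v = (\<Sum>B\<in>Pow X. \<Sum>A\<in>Pow X. u A * img H B A * v B)"
    unfolding ip_def act_def by (simp add: sum_distrib_right)
  also have "\<dots> = (\<Sum>A\<in>Pow X. \<Sum>B\<in>Pow X. u A * img H B A * v B)" by (rule sum.swap)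
  also have "\<dots> = ip X u (act X H v)"
    unfolding ip_def act_def by (simp add: sum_distrib_left mult_ac)
  finally show ?thesis .
qed

lemma img_tri:
  assumes "finite A" "\<And>p q. p \<in> A \<Longrightarrow> G p q \<noteq> 0 \<Longrightarrow> q \<in> A \<and> q \<le> p"
  shows "img G A = (\<lambda>B. (\<Prod>p\<in>A. G p p) * bas A B)"
  using assms
proof (induction rule: finite_linorder_max_induct)
  case (insert p A)
  have pA: "p \<notin> A" using insert by auto
  have "q \<in> A \<and> q \<le> r" if "r \<in> A" "G r q \<noteq> 0" for r q
    using insert.prems[of r q] insert.hyps(2) that by (auto simp: not_less[symmetric])
  then have "img G A = (\<lambda>B. (\<Prod>p\<in>A. G p p) * bas A B)" by (rule insert.IH)
  then have 1: "img G (insert p A) = (\<lambda>B. eps p A * ((\<Prod>p\<in>A. G p p) * lm (G p) (bas A) B))"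
    using insert pA by (simp add: img_insert lm_scale)
  \<comment> \<open>All coordinates of \<open>G p\<close> other than \<open>p\<close> itself lie in
    \<open>A\<close> and would repeat a factor.\<close>
  have "lm (G p) (bas A) B = lm (\<lambda>q. G p p * dl p q) (bas A) B" for B
  proof -
    have "eps q B * G p q * bas A (B - {q}) = eps q B * (G p p * dl p q) * bas A (B - {q})" if "q \<in> B" for q
    proof (cases "q = p")
      case False
      have "G p q \<noteq> 0 \<Longrightarrow> q \<in> A" using insert.prems[of p q] False by auto
      then show ?thesis using False by (cases "q \<in> A") (auto simp: dl_def bas_def)
    qed (simp add: dl_def)
    then show ?thesis unfolding lm_def by (intro sum.cong) auto
  qed
  then have "lm (G p) (bas A) = (\<lambda>B. G p p * (eps p A * bas (insert p A) B))"
    using insert(1) pA by (intro ext) (simp add: lm_scalel lm_dl_bas)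
  then show ?case using 1 insert pA by (simp add: mult_ac)
qed simp

lemma act_diag:
  assumes "finite X" "u \<in> forms X" "\<And>p. p \<in> X \<Longrightarrow> G p = (\<lambda>q. c p * dl p q)"
  shows "act X G u = (\<lambda>B. (\<Prod>p\<in>B. c p) * u B)"
proof -
  have "img G A = (\<lambda>B. (\<Prod>p\<in>A. c p) * bas A B)" if "A \<subseteq> X" for A
  proof -
    have "img G A = (\<lambda>B. (\<Prod>p\<in>A. G p p) * bas A B)"
      using assms that by (intro img_tri) (auto simp: dl_def intro: finite_subset split: if_splits)
    also have "(\<Prod>p\<in>A. G p p) = (\<Prod>p\<in>A. c p)"
      using assms that by (intro prod.cong) (auto simp: dl_def)
    finally show ?thesis .
  qed
  then have "act X G u = (\<lambda>B. \<Sum>A\<in>Pow X. (u A * (\<Prod>p\<in>A. c p)) * bas A B)"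
    unfolding act_def by (intro ext sum.cong refl) auto
  also have "\<dots> = (\<lambda>B. (\<Prod>p\<in>B. c p) * u B)"
    using assms(1,2) by (intro ext) (auto simp: bas_def sum_pick formsD)
  finally show ?thesis .
qed

section \<open>Linear classes of functions and homogeneous components\<close>

definition linc :: "('b \<Rightarrow> 'a::field_char_0) set \<Rightarrow> bool" where
  "linc T \<longleftrightarrow> (\<lambda>_. 0) \<in> T \<and> (\<forall>u\<in>T. \<forall>v\<in>T. (\<lambda>A. u A + v A) \<in> T) \<and> (\<forall>c. \<forall>u\<in>T. (\<lambda>A. c * u A) \<in> T)"

lemma linc_zero: "linc T \<Longrightarrow> (\<lambda>_. 0) \<in> T"
  and linc_add: "linc T \<Longrightarrow> u \<in> T \<Longrightarrow> v \<in> T \<Longrightarrow> (\<lambda>A. u A + v A) \<in> T"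
  and linc_scale: "linc T \<Longrightarrow> u \<in> T \<Longrightarrow> (\<lambda>A. c * u A) \<in> T"
  by (auto simp: linc_def)

lemma linc_sum:
  assumes "linc T" "\<And>i. i \<in> I \<Longrightarrow> f i \<in> T"
  shows "(\<lambda>A. \<Sum>i\<in>I. f i A) \<in> T"
proof (cases "finite I")
  case True
  then show ?thesis using assms(2)
    by (induction I rule: finite_induct) (auto intro: linc_zero linc_add assms(1))
qed (auto intro: linc_zero assms(1))

lemma linc_diff: "linc T \<Longrightarrow> u \<in> T \<Longrightarrow> v \<in> T \<Longrightarrow> (\<lambda>A. u A - v A) \<in> T"
  using linc_add[of T u "\<lambda>A. (-1) * v A"] linc_scale[of T v "-1"] by simp

text \<open>Substituting \<open>2 * s\<close> and subtracting \<open>2 ^ Suc e\<close> times the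
  original cancels the top power and multiplies the lower components by the nonzero numbers
  \<open>2 ^ r - 2 ^ Suc e\<close>. This replaces the inversion of a Vandermonde matrix.\<close>

lemma linc_poly:
  assumes "linc T" "\<And>s. (\<lambda>A. \<Sum>r\<le>d. s ^ r * w r A) \<in> T" "r \<le> d"
  shows "w r \<in> T"
  using assms(2,3)
proof (induction d arbitrary: w r)
  case 0
  then show ?case using 0(1)[of 1] by simp
next
  case (Suc e)
  let ?c = "\<lambda>r. (2::'b) ^ r - 2 ^ Suc e"
  have c: "?c r \<noteq> 0" if "r \<le> e" for r
  proof -
    have "(2::nat) ^ r < 2 ^ Suc e" using that by (intro power_strict_increasing) auto
    then have "of_nat (2 ^ r) \<noteq> (of_nat (2 ^ Suc e) :: 'b)" by (metis nat_neq_iff of_nat_eq_iff)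
    then show ?thesis by simp
  qed
  have "(\<lambda>A. \<Sum>r\<le>e. s ^ r * (?c r * w r A)) \<in> T" for s
  proof -
    have "(\<lambda>A. (\<Sum>r\<le>Suc e. (2 * s) ^ r * w r A) - 2 ^ Suc e * (\<Sum>r\<le>Suc e. s ^ r * w r A)) \<in> T"
      by (intro linc_diff linc_scale assms(1) Suc.prems(1))
    also have "(\<lambda>A. (\<Sum>r\<le>Suc e. (2 * s) ^ r * w r A) - 2 ^ Suc e * (\<Sum>r\<le>Suc e. s ^ r * w r A)) =
      (\<lambda>A. \<Sum>r\<le>e. s ^ r * (?c r * w r A))"
      unfolding sum_distrib_left sum_subtractf[symmetric]
      by (intro ext) (simp add: power_mult_distrib algebra_simps)
    finally show ?thesis .
  qed
  then have "(\<lambda>A. ?c r * w r A) \<in> T" if "r \<le> e" for r using Suc.IH[of "\<lambda>r A. ?c r * w r A" r] that by simp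
  then have "(\<lambda>A. inverse (?c r) * (?c r * w r A)) \<in> T" if "r \<le> e" for r using that assms(1) linc_scale by blast
  moreover have "inverse (?c r) * (?c r * w r A) = w r A" if "r \<le> e" for r A
    using c[OF that] by (metis (no_types, lifting) mult.assoc left_inverse mult_1_left)
  ultimately have le: "w r \<in> T" if "r \<le> e" for r using that by (metis (no_types, lifting) ext)
  have "(\<lambda>A. (\<Sum>r\<le>Suc e. 1 ^ r * w r A) - (\<Sum>r\<le>e. w r A)) \<in> T"
    by (intro linc_diff linc_sum assms(1) Suc.prems(1)) (simp add: le)
  then have "w (Suc e) \<in> T" by simp
  then show ?case using le Suc.prems(2) by (cases "r = Suc e") auto
qed

section \<open>Pairs of matrices acting on a rectangular box\<close>

definition bx :: "nat \<Rightarrow> nat \<Rightarrow> (nat \<times> nat) set" where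
  "bx k m = {..<k} \<times> {..<m}"

lemma bx_fin [simp]: "finite (bx k m)"
  by (simp add: bx_def)

lemma bx_iff [simp]: "(i, j) \<in> bx k m \<longleftrightarrow> i < k \<and> j < m"
  by (auto simp: bx_def)

text \<open>Entry \<open>q\<close> of the tensor of column \<open>fst p\<close> of \<open>g\<close>
  with column \<open>snd p\<close> of \<open>h\<close>, hence the index order. Matrices are bare
  functions of two indices, so their size enters only through \<open>bx k m\<close>.\<close>

definition tens :: "nat \<Rightarrow> nat \<Rightarrow> (nat \<Rightarrow> nat \<Rightarrow> 'a) \<Rightarrow> (nat \<Rightarrow> nat \<Rightarrow> 'a) \<Rightarrow> nat \<times> nat \<Rightarrow> nat \<times> nat \<Rightarrow> 'a::field_char_0" where
  "tens k m g h = (\<lambda>p q. if q \<in> bx k m then g (fst q) (fst p) * h (snd q) (snd p) else 0)"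

definition idm :: "nat \<Rightarrow> nat \<Rightarrow> 'a::field_char_0" where
  "idm = (\<lambda>i j. if i = j then 1 else 0)"

definition mm :: "nat \<Rightarrow> (nat \<Rightarrow> nat \<Rightarrow> 'a) \<Rightarrow> (nat \<Rightarrow> nat \<Rightarrow> 'a) \<Rightarrow> nat \<Rightarrow> nat \<Rightarrow> 'a::field_char_0" where
  "mm k g g' = (\<lambda>i j. \<Sum>l<k. g i l * g' l j)"

definition ac :: "nat \<Rightarrow> nat \<Rightarrow> (nat \<Rightarrow> nat \<Rightarrow> 'a) \<Rightarrow> (nat \<Rightarrow> nat \<Rightarrow> 'a) \<Rightarrow> ((nat \<times> nat) set \<Rightarrow> 'a) \<Rightarrow> (nat \<times> nat) set \<Rightarrow> 'a::field_char_0" where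
  "ac k m g h = act (bx k m) (tens k m g h)"

lemma tens_supp: "tens k m g h p q \<noteq> 0 \<Longrightarrow> q \<in> bx k m"
  by (auto simp: tens_def split: if_splits)

lemma ac_forms [simp]: "ac k m g h u \<in> forms (bx k m)"
  unfolding ac_def by (rule act_forms) (auto dest: tens_supp)

lemma mm_idl: "i < k \<Longrightarrow> mm k idm g i j = g i j"
  by (simp add: mm_def idm_def sum_pick)

lemma mm_idr: "j < k \<Longrightarrow> mm k g idm i j = g i j"
  by (simp add: mm_def idm_def sum_pick)

lemma tens_cong:
  assumes "\<And>i i'. i < k \<Longrightarrow> i' < k \<Longrightarrow> g i i' = g' i i'" "\<And>i i'. i < m \<Longrightarrow> i' < m \<Longrightarrow> h i i' = h' i i'"
    "p \<in> bx k m"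
  shows "tens k m g h p = tens k m g' h' p"
  using assms by (auto simp: tens_def bx_def)

lemma ac_cong:
  assumes "\<And>i i'. i < k \<Longrightarrow> i' < k \<Longrightarrow> g i i' = g' i i'" "\<And>i i'. i < m \<Longrightarrow> i' < m \<Longrightarrow> h i i' = h' i i'"
  shows "ac k m g h u = ac k m g' h' u"
  unfolding ac_def using assms by (intro act_cong tens_cong) auto

lemma ac_ac: "ac k m g h (ac k m g' h' u) = ac k m (mm k g g') (mm m h h') u"
proof -
  have "(\<Sum>r\<in>bx k m. tens k m g' h' p r * tens k m g h r q) = tens k m (mm k g g') (mm m h h') p q" for p q
  proof (cases "q \<in> bx k m")
    case True
    have "(\<Sum>r\<in>bx k m. tens k m g' h' p r * tens k m g h r q) =
      (\<Sum>r\<in>bx k m. (g (fst q) (fst r) * g' (fst r) (fst p)) * (h (snd q) (snd r) * h' (snd r) (snd p)))"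
      using True by (intro sum.cong) (auto simp: tens_def)
    also have "\<dots> = tens k m (mm k g g') (mm m h h') p q"
      using True unfolding bx_def mm_def tens_def sum_product
      by (subst sum.cartesian_product) (simp add: case_prod_unfold)
    finally show ?thesis .
  qed (simp add: tens_def)
  then show ?thesis unfolding ac_def by (subst act_act) (auto dest: tens_supp)
qed

lemma ac_id: "u \<in> forms (bx k m) \<Longrightarrow> ac k m idm idm u = u"
proof -
  assume u: "u \<in> forms (bx k m)"
  have "tens k m idm idm p = dl p" if "p \<in> bx k m" for p
    using that by (cases p) (auto simp: tens_def idm_def dl_def fun_eq_iff)
  then have "ac k m idm idm u = act (bx k m) dl u" unfolding ac_def by (intro act_cong) auto
  then show ?thesis using u by (simp add: act_dl)
qed

text \<open>The two factorisations together say that row and column operations commute.\<close>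

lemma ac_split: "ac k m g h u = ac k m g idm (ac k m idm h u)" "ac k m g h u = ac k m idm h (ac k m g idm u)"
  unfolding ac_ac by (rule ac_cong; simp add: mm_idl mm_idr)+

lemma ac_wed: "u \<in> forms (bx k m) \<Longrightarrow> v \<in> forms (bx k m) \<Longrightarrow>
    ac k m g h (wed u v) = wed (ac k m g h u) (ac k m g h v)"
  unfolding ac_def by (rule act_wed) (auto dest: tens_supp)

lemma ac_adj: "ip (bx k m) (ac k m g h u) v = ip (bx k m) u (ac k m (\<lambda>i j. g j i) (\<lambda>i j. h j i) v)"
  unfolding ac_def by (rule act_adj) (auto simp: tens_def)

lemma ac_add: "ac k m g h (\<lambda>A. u A + v A) = (\<lambda>A. ac k m g h u A + ac k m g h v A)"
  and ac_scale: "ac k m g h (\<lambda>A. c * u A) = (\<lambda>A. c * ac k m g h u A)"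
  and ac_zero: "ac k m g h (\<lambda>A. 0) = (\<lambda>A. 0)"
  and ac_sum: "ac k m g h (\<lambda>A. \<Sum>i\<in>I. f i A) = (\<lambda>A. \<Sum>i\<in>I. ac k m g h (f i) A)"
  by (simp_all add: ac_def act_add act_scale act_zero act_sum)

text \<open>Singular matrices are included, so that diagonal families with a parameter
  \<open>s\<close> are available for every value of \<open>s\<close>.\<close>

definition stab :: "nat \<Rightarrow> nat \<Rightarrow> ((nat \<times> nat) set \<Rightarrow> 'a::field_char_0) set \<Rightarrow> bool" where
  "stab k m T \<longleftrightarrow> linc T \<and> T \<subseteq> forms (bx k m) \<and> (\<forall>g h. \<forall>u\<in>T. ac k m g h u \<in> T)"

definition rowc :: "(nat \<times> nat) set \<Rightarrow> nat \<Rightarrow> nat" where "rowc A i = card {p\<in>A. fst p = i}"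
definition colc :: "(nat \<times> nat) set \<Rightarrow> nat \<Rightarrow> nat" where "colc A j = card {p\<in>A. snd p = j}"

text \<open>With \<open>idm\<close> acting on the rows no box changes its row;
  \<open>ac_col_nz\<close> is the mirror image.\<close>

lemma ac_row_nz:
  assumes "A \<subseteq> bx k m" "ac k m idm h (bas A) B \<noteq> 0"
  shows "rowc B i = rowc A i"
  unfolding rowc_def
proof (rule img_nz_fibre)
  show "finite A" using assms(1) finite_subset bx_fin by blast
  show "img (tens k m idm h) A B \<noteq> 0" using assms by (simp add: ac_def act_bas)
qed (auto simp: tens_def idm_def split: if_splits)

lemma ac_col_nz:
  assumes "A \<subseteq> bx k m" "ac k m g idm (bas A) B \<noteq> 0"
  shows "colc B i = colc A i"
  unfolding colc_def
proof (rule img_nz_fibre)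
  show "finite A" using assms(1) finite_subset bx_fin by blast
  show "img (tens k m g idm) A B \<noteq> 0" using assms by (simp add: ac_def act_bas)
qed (auto simp: tens_def idm_def split: if_splits)

lemma ac_diag:
  assumes "u \<in> forms (bx k m)"
  shows "ac k m (\<lambda>i j. if i = j then c i else 0) (\<lambda>i j. if i = j then d i else 0) u
    = (\<lambda>B. (\<Prod>p\<in>B. c (fst p) * d (snd p)) * u B)"
  unfolding ac_def by (rule act_diag) (use assms in \<open>auto simp: tens_def dl_def fun_eq_iff prod_eq_iff\<close>)

lemma prod_if_power_forms:
  fixes u :: "'i set \<Rightarrow> 'a::field_char_0"
  assumes "finite X" "u \<in> forms X"
  shows "(\<Prod>p\<in>B. if P p then s else 1) * u B = s ^ card {p\<in>B. P p} * u B"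
proof (cases "u B = 0")
  case False
  then have "finite B" using assms by (metis finite_subset formsD)
  then have "(\<Prod>p\<in>B. if P p then s else 1) = s ^ card {p\<in>B. P p}"
    by (simp add: prod.If_cases Collect_conj_eq)
  then show ?thesis by simp
qed simp

text \<open>The scaling factor is a power of \<open>s\<close>, so the last hypothesis describes a
  polynomial curve inside \<open>T\<close> whose coefficients are the homogeneous components;
  \<open>linc_poly\<close> extracts them.\<close>

lemma weight_component:
  assumes "linc T" "u \<in> forms X" "finite X" "\<And>s. (\<lambda>B. s ^ card {p\<in>B. P p} * u B) \<in> T"
  shows "(\<lambda>B. if card {p\<in>B. P p} = n then u B else 0) \<in> T"
proof -
  let ?w = "\<lambda>r B. if card {p\<in>B. P p} = r then u B else 0"
  have le: "card {p\<in>B. P p} \<le> card X" if "u B \<noteq> 0" for B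
    using assms(2,3) that by (intro card_mono) (auto simp: forms_def)
  have "(\<lambda>B. s ^ card {p\<in>B. P p} * u B) = (\<lambda>B. \<Sum>r\<le>card X. s ^ r * ?w r B)" for s
  proof
    fix B
    have "(\<Sum>r\<le>card X. s ^ r * ?w r B) = (\<Sum>r\<le>card X. (s ^ r * u B) * (if card {p\<in>B. P p} = r then 1 else 0))"
      by (intro sum.cong) auto
    then show "s ^ card {p\<in>B. P p} * u B = (\<Sum>r\<le>card X. s ^ r * ?w r B)"
      using le[of B] by (cases "u B = 0") (simp_all add: sum_pick)
  qed
  then have *: "(\<lambda>B. \<Sum>r\<le>card X. s ^ r * ?w r B) \<in> T" for s using assms(4)[of s] by simp
  show ?thesis
  proof (cases "n \<le> card X")
    case True
    then show ?thesis using linc_poly[where T = T and d = "card X" and w = ?w and r = n] assms(1) * by blast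
  next
    case False
    then have "?w n = (\<lambda>B. 0)" using le by (auto simp: fun_eq_iff)
    then show ?thesis using assms(1) by (simp add: linc_zero)
  qed
qed

lemma stab_proj_row:
  assumes "stab k m T" "u \<in> T"
  shows "(\<lambda>B. if rowc B i = n then u B else 0) \<in> T"
  unfolding rowc_def
proof (rule weight_component[OF _ _ bx_fin])
  show u: "u \<in> forms (bx k m)" using assms by (auto simp: stab_def)
  fix s
  have "ac k m (\<lambda>a b. if a = b then (if a = i then s else 1) else 0) (\<lambda>a b. if a = b then 1 else 0) u \<in> T"
    using assms by (auto simp: stab_def)
  also have "ac k m (\<lambda>a b. if a = b then (if a = i then s else 1) else 0) (\<lambda>a b. if a = b then 1 else 0) u
    = (\<lambda>B. (\<Prod>p\<in>B. (if fst p = i then s else 1) * 1) * u B)"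
    using u by (rule ac_diag)
  also have "\<dots> = (\<lambda>B. s ^ card {p\<in>B. fst p = i} * u B)"
    by (simp only: mult_1_right prod_if_power_forms[OF bx_fin u])
  finally show "(\<lambda>B. s ^ card {p\<in>B. fst p = i} * u B) \<in> T" .
qed (use assms in \<open>auto simp: stab_def\<close>)

lemma stab_proj_col:
  assumes "stab k m T" "u \<in> T"
  shows "(\<lambda>B. if colc B i = n then u B else 0) \<in> T"
  unfolding colc_def
proof (rule weight_component[OF _ _ bx_fin])
  show u: "u \<in> forms (bx k m)" using assms by (auto simp: stab_def)
  fix s
  have "ac k m (\<lambda>a b. if a = b then 1 else 0) (\<lambda>a b. if a = b then (if a = i then s else 1) else 0) u \<in> T"
    using assms by (auto simp: stab_def)
  also have "ac k m (\<lambda>a b. if a = b then 1 else 0) (\<lambda>a b. if a = b then (if a = i then s else 1) else 0) u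
    = (\<lambda>B. (\<Prod>p\<in>B. 1 * (if snd p = i then s else 1)) * u B)"
    using u by (rule ac_diag)
  also have "\<dots> = (\<lambda>B. s ^ card {p\<in>B. snd p = i} * u B)"
    by (simp only: mult_1_left prod_if_power_forms[OF bx_fin u])
  finally show "(\<lambda>B. s ^ card {p\<in>B. snd p = i} * u B) \<in> T" .
qed (use assms in \<open>auto simp: stab_def\<close>)

lemma stab_proj_rows:
  assumes "stab k m T" "u \<in> T"
  shows "(\<lambda>B. if \<forall>i<n. rowc B i = a i then u B else 0) \<in> T"
proof (induction n)
  case (Suc n)
  have "(\<lambda>B. if rowc B n = a n then (if \<forall>i<n. rowc B i = a i then u B else 0) else 0) \<in> T"
    by (rule stab_proj_row[OF assms(1) Suc])
  also have "(\<lambda>B. if rowc B n = a n then (if \<forall>i<n. rowc B i = a i then u B else 0) else 0) = (\<lambda>B. if \<forall>i<Suc n. rowc B i = a i then u B else 0)"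
    by (auto simp: fun_eq_iff less_Suc_eq)
  finally show ?case .
qed (use assms in simp)

lemma stab_proj_cols:
  assumes "stab k m T" "u \<in> T"
  shows "(\<lambda>B. if \<forall>i<n. colc B i = a i then u B else 0) \<in> T"
proof (induction n)
  case (Suc n)
  have "(\<lambda>B. if colc B n = a n then (if \<forall>i<n. colc B i = a i then u B else 0) else 0) \<in> T"
    by (rule stab_proj_col[OF assms(1) Suc])
  also have "(\<lambda>B. if colc B n = a n then (if \<forall>i<n. colc B i = a i then u B else 0) else 0) = (\<lambda>B. if \<forall>i<Suc n. colc B i = a i then u B else 0)"
    by (auto simp: fun_eq_iff less_Suc_eq)
  finally show ?case .
qed (use assms in simp)

subsection \<open>Diagrams and stable subspaces\<close>

lemma diagram_bx: "lam \<in> box_partitions k m \<Longrightarrow> diagram lam \<subseteq> bx k m"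
  by (auto simp: box_partitions_def diagram_def bx_def partitions_def) (meson nth_mem order.strict_trans2)

lemma partitions_nth_le:
  "lam \<in> partitions k \<Longrightarrow> i \<le> j \<Longrightarrow> j < k \<Longrightarrow> lam ! j \<le> lam ! i"
  unfolding partitions_def by (cases "i = j") (auto simp: sorted_wrt_iff_nth_less)

lemma diagram_down:
  assumes "lam \<in> partitions k" "(i, j) \<in> diagram lam" "i' \<le> i" "j' \<le> j"
  shows "(i', j') \<in> diagram lam"
  using assms partitions_nth_le[OF assms(1,3)] by (auto simp: diagram_def partitions_def)

lemma box_partitions_partitions: "lam \<in> box_partitions k m \<Longrightarrow> lam \<in> partitions k"
  by (simp add: box_partitions_def)

lemma rowc_diagram: "lam \<in> partitions k \<Longrightarrow> i < k \<Longrightarrow> rowc (diagram lam) i = lam ! i"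
proof -
  assume "lam \<in> partitions k" "i < k"
  then have "{p\<in>diagram lam. fst p = i} = Pair i ` {..<lam ! i}"
    by (auto simp: diagram_def partitions_def)
  then show ?thesis by (simp add: rowc_def card_image inj_on_def)
qed

section \<open>Extremal margins of diagrams\<close>

definition colb :: "(nat \<times> nat) set \<Rightarrow> nat \<Rightarrow> nat \<Rightarrow> nat" where
  "colb A j r = card {p\<in>A. snd p = j \<and> fst p < r}"

lemma colb_Suc: "finite A \<Longrightarrow> colb A j (Suc r) = colb A j r + (if (r, j) \<in> A then 1 else 0)"
proof -
  assume "finite A"
  have "{p\<in>A. snd p = j \<and> fst p < Suc r} = (if (r, j) \<in> A then insert (r, j) {p\<in>A. snd p = j \<and> fst p < r}
     else {p\<in>A. snd p = j \<and> fst p < r})"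
    by (auto simp: less_Suc_eq)
  then show ?thesis using \<open>finite A\<close> by (simp add: colb_def)
qed

lemma colb_le: "finite A \<Longrightarrow> colb A j r \<le> r"
  by (induction r) (auto simp: colb_Suc, simp add: colb_def)

lemma colb_down:
  assumes "finite D" "\<And>i i'. (i, j) \<in> D \<Longrightarrow> i' \<le> i \<Longrightarrow> (i', j) \<in> D"
  shows "colb D j r = r \<or> colb D j r = colc D j"
proof (cases "\<exists>i\<ge>r. (i, j) \<in> D")
  case True
  then have "(i, j) \<in> D" if "i < r" for i using assms(2) that by (meson less_imp_le order.trans)
  then have "{p\<in>D. snd p = j \<and> fst p < r} = (\<lambda>i. (i, j)) ` {..<r}" by auto
  then show ?thesis by (simp add: colb_def card_image inj_on_def)
next
  case False
  then have "{p\<in>D. snd p = j \<and> fst p < r} = {p\<in>D. snd p = j}" by (auto simp: not_le[symmetric])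
  then show ?thesis by (simp add: colb_def colc_def)
qed

lemma cumul_cols:
  assumes "A \<subseteq> bx k m"
  shows "card {p\<in>A. fst p < r} = (\<Sum>j<m. colb A j r)"
proof -
  have f: "finite A" using assms finite_subset bx_fin by blast
  have "{p\<in>A. fst p < r} = (\<Union>j<m. {p\<in>A. snd p = j \<and> fst p < r})" using assms by auto
  also have "card \<dots> = (\<Sum>j<m. colb A j r)"
    unfolding colb_def by (rule card_UN_disjoint) (use f in auto)
  finally show ?thesis .
qed

lemma cumul_rows:
  assumes "A \<subseteq> bx k m"
  shows "card {p\<in>A. fst p < r} = (\<Sum>i<r. rowc A i)"
proof -
  have f: "finite A" using assms finite_subset bx_fin by blast
  have "{p\<in>A. fst p < r} = (\<Union>i<r. {p\<in>A. fst p = i})" by auto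
  also have "card \<dots> = (\<Sum>i<r. rowc A i)"
    unfolding rowc_def by (rule card_UN_disjoint) (use f in auto)
  finally show ?thesis .
qed

lemma rowc_out: "A \<subseteq> bx k m \<Longrightarrow> k \<le> i \<Longrightarrow> rowc A i = 0"
  by (auto simp: rowc_def bx_def card_eq_0_iff)

text \<open>A set of boxes with the column sums of a diagram has at most as many boxes in the first
  \<open>r\<close> rows, since a diagram fills its columns from the top.\<close>

lemma colb_le_diagram:
  assumes "A \<subseteq> bx k m" "lam \<in> box_partitions k m" "\<And>j. j < m \<Longrightarrow> colc A j = colc (diagram lam) j" "j < m"
  shows "colb A j r \<le> colb (diagram lam) j r"
proof -
  have fA: "finite A" using assms finite_subset bx_fin by blast
  have fD: "finite (diagram lam)" using diagram_bx[OF assms(2)] finite_subset bx_fin by blast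
  have "colb A j r \<le> colc A j"
    unfolding colb_def colc_def using fA by (intro card_mono) auto
  moreover have "colb (diagram lam) j r = r \<or> colb (diagram lam) j r = colc (diagram lam) j"
    using fD by (rule colb_down) (use diagram_down[OF box_partitions_partitions[OF assms(2)]] in blast)
  ultimately show ?thesis using colb_le[OF fA, of j r] assms(3,4) by auto
qed

lemma cumul_le_diagram:
  assumes "A \<subseteq> bx k m" "lam \<in> box_partitions k m" "\<And>j. j < m \<Longrightarrow> colc A j = colc (diagram lam) j"
  shows "(\<Sum>i<r. rowc A i) \<le> (\<Sum>i<r. rowc (diagram lam) i)"
proof -
  have "(\<Sum>j<m. colb A j r) \<le> (\<Sum>j<m. colb (diagram lam) j r)"
    by (rule sum_mono) (use colb_le_diagram[OF assms] in auto)
  then show ?thesis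
    by (simp only: cumul_rows[OF assms(1), symmetric] cumul_rows[OF diagram_bx[OF assms(2)], symmetric]
        cumul_cols[OF assms(1)] cumul_cols[OF diagram_bx[OF assms(2)]])
qed

text \<open>The equality case of \<open>colb_le_diagram\<close>: equal row sums make the sums of the
  column bounds equal, so every single bound is attained; comparing \<open>r\<close> with
  \<open>Suc r\<close> then decides the membership of each box.\<close>

lemma diagram_unique:
  assumes "A \<subseteq> bx k m" "lam \<in> box_partitions k m" "\<And>j. j < m \<Longrightarrow> colc A j = colc (diagram lam) j"
    "\<And>i. i < k \<Longrightarrow> rowc A i = rowc (diagram lam) i"
  shows "A = diagram lam"
proof -
  let ?D = "diagram lam"
  have D: "?D \<subseteq> bx k m" using diagram_bx[OF assms(2)] .
  have fA: "finite A" and fD: "finite ?D" using assms(1) D finite_subset bx_fin by blast+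
  have "rowc A i = rowc ?D i" for i
    using assms(4) rowc_out[OF assms(1)] rowc_out[OF D] by (cases "i < k") auto
  then have "card {p\<in>A. fst p < r} = card {p\<in>?D. fst p < r}" for r
    using cumul_rows[OF assms(1)] cumul_rows[OF D] by simp
  then have s: "(\<Sum>j<m. colb A j r) = (\<Sum>j<m. colb ?D j r)" for r
    using cumul_cols[OF assms(1)] cumul_cols[OF D] by simp
  have c: "colb A j r = colb ?D j r" if "j < m" for j r
  proof (rule ccontr)
    assume "colb A j r \<noteq> colb ?D j r"
    then have "colb A j r < colb ?D j r" using colb_le_diagram[OF assms(1-3) that] by (simp add: order.not_eq_order_implies_strict)
    note lt = this
    have "(\<Sum>j<m. colb A j r) < (\<Sum>j<m. colb ?D j r)"
      by (rule sum_strict_mono_ex1) (use lt that colb_le_diagram[OF assms(1-3)] in auto)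
    then show False using s by simp
  qed
  have "(r, j) \<in> A \<longleftrightarrow> (r, j) \<in> ?D" if "j < m" for r j
    using c[OF that, of r] c[OF that, of "Suc r"] fA fD by (simp add: colb_Suc split: if_splits)
  then have "p \<in> A \<longleftrightarrow> p \<in> ?D" if "p \<in> bx k m" for p using that by (cases p) auto
  then show ?thesis using assms(1) D by blast
qed

text \<open>\<open>A\<close> and \<open>B\<close> carry the margins crosswise, so
  \<open>cumul_le_diagram\<close> gives the dominance order between the two partitions in both
  directions.\<close>

lemma margins_unique:
  assumes "lam \<in> box_partitions k m" "mu \<in> box_partitions k m" "A \<subseteq> bx k m" "B \<subseteq> bx k m"
    "\<And>i. rowc A i = rowc (diagram mu) i" "\<And>j. colc A j = colc (diagram lam) j"
    "\<And>i. rowc B i = rowc (diagram lam) i" "\<And>j. colc B j = colc (diagram mu) j"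
  shows "lam = mu"
proof -
  have "(\<Sum>i<r. rowc (diagram mu) i) \<le> (\<Sum>i<r. rowc (diagram lam) i)" for r
    using cumul_le_diagram[OF assms(3,1), of r] assms(5,6) by simp
  moreover have "(\<Sum>i<r. rowc (diagram lam) i) \<le> (\<Sum>i<r. rowc (diagram mu) i)" for r
    using cumul_le_diagram[OF assms(4,2), of r] assms(7,8) by simp
  ultimately have e: "(\<Sum>i<r. rowc (diagram lam) i) = (\<Sum>i<r. rowc (diagram mu) i)" for r
    by (simp add: antisym)
  have "rowc (diagram lam) i = rowc (diagram mu) i" for i
    using e[of i] e[of "Suc i"] by simp
  then have "lam ! i = mu ! i" if "i < k" for i
    using rowc_diagram[of lam k i] rowc_diagram[of mu k i] assms(1,2) that by (simp add: box_partitions_def)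
  then show ?thesis using assms(1,2) by (auto simp: box_partitions_def partitions_def intro: nth_equalityI)
qed

text \<open>Moving \<open>g\<close> to the other side leaves a column operation on one factor and a
  row operation on the other, so a common monomial \<open>B\<close> has the row sums of
  \<open>lam\<close> and the column sums of \<open>mu\<close>. Moving \<open>h\<close> instead gives
  \<open>A\<close> with the roles exchanged, and \<open>margins_unique\<close> applies.\<close>

lemma ac_orth:
  assumes "lam \<in> box_partitions k m" "mu \<in> box_partitions k m" "lam \<noteq> mu"
  shows "ip (bx k m) (ac k m g h (bas (diagram lam))) (bas (diagram mu)) = 0"
proof (rule ccontr)
  assume nz: "ip (bx k m) (ac k m g h (bas (diagram lam))) (bas (diagram mu)) \<noteq> 0"
  let ?gt = "\<lambda>i j. g j i" and ?ht = "\<lambda>i j. h j i"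
  have idt: "(\<lambda>i j. idm j i) = (idm :: nat \<Rightarrow> nat \<Rightarrow> 'a)" by (auto simp: idm_def fun_eq_iff)
  have D: "diagram lam \<subseteq> bx k m" "diagram mu \<subseteq> bx k m" using assms diagram_bx by auto
  have "ip (bx k m) (ac k m idm h (bas (diagram lam))) (ac k m ?gt idm (bas (diagram mu))) \<noteq> 0"
    using nz by (subst (asm) ac_split(1)) (simp add: ac_adj idt)
  then obtain B where B: "B \<subseteq> bx k m" "ac k m idm h (bas (diagram lam)) B \<noteq> 0" "ac k m ?gt idm (bas (diagram mu)) B \<noteq> 0"
    unfolding ip_def by (metis (no_types, lifting) PowD mult_eq_0_iff sum.not_neutral_contains_not_neutral)
  have "ip (bx k m) (ac k m g idm (bas (diagram lam))) (ac k m idm ?ht (bas (diagram mu))) \<noteq> 0"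
    using nz by (subst (asm) ac_split(2)) (simp add: ac_adj idt)
  then obtain A where A: "A \<subseteq> bx k m" "ac k m g idm (bas (diagram lam)) A \<noteq> 0" "ac k m idm ?ht (bas (diagram mu)) A \<noteq> 0"
    unfolding ip_def by (metis (no_types, lifting) PowD mult_eq_0_iff sum.not_neutral_contains_not_neutral)
  have "lam = mu"
    by (rule margins_unique[OF assms(1,2) A(1) B(1)])
      (use ac_row_nz[OF D(2) A(3)] ac_col_nz[OF D(1) A(2)] ac_row_nz[OF D(1) B(2)] ac_col_nz[OF D(2) B(3)] in auto)
  then show False using assms by simp
qed

text \<open>Diagonal matrices project onto prescribed row and column sums, and by
  \<open>diagram_unique\<close> this weight space is spanned by the monomial of the diagram.\<close>

lemma stab_diagram_coeff:
  assumes "stab k m T" "u \<in> T" "nu \<in> box_partitions k m" "u (diagram nu) \<noteq> 0"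
  shows "bas (diagram nu) \<in> T"
proof -
  let ?D = "diagram nu"
  have f: "u \<in> forms (bx k m)" using assms by (auto simp: stab_def)
  have "(\<lambda>B. if \<forall>j<m. colc B j = colc ?D j then (if \<forall>i<k. rowc B i = rowc ?D i then u B else 0) else 0) \<in> T"
    using assms by (intro stab_proj_cols stab_proj_rows)
  also have "(\<lambda>B. if \<forall>j<m. colc B j = colc ?D j then (if \<forall>i<k. rowc B i = rowc ?D i then u B else 0) else 0)
    = (\<lambda>B. u ?D * bas ?D B)"
  proof
    fix B
    have "u B = 0" if "B \<noteq> ?D" "\<forall>j<m. colc B j = colc ?D j" "\<forall>i<k. rowc B i = rowc ?D i"
      using diagram_unique[OF _ assms(3), of B] that formsD[OF f, of B] by blast
    then show "(if \<forall>j<m. colc B j = colc ?D j then (if \<forall>i<k. rowc B i = rowc ?D i then u B else 0) else 0) = u ?D * bas ?D B"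
      by (auto simp: bas_def)
  qed
  finally have "(\<lambda>B. u ?D * bas ?D B) \<in> T" .
  moreover have "linc T" using assms(1) by (simp add: stab_def)
  ultimately have "(\<lambda>B. inverse (u ?D) * (u ?D * bas ?D B)) \<in> T" by (rule linc_scale[rotated])
  moreover have "(\<lambda>B. inverse (u ?D) * (u ?D * bas ?D B)) = bas ?D" using assms(4) by (simp add: bas_def fun_eq_iff)
  ultimately show ?thesis by simp
qed

section \<open>Creation and annihilation operators; a Casimir identity\<close>

definition an :: "'i::linorder \<Rightarrow> ('i set \<Rightarrow> 'a::field_char_0) \<Rightarrow> 'i set \<Rightarrow> 'a" where
  "an p u = (\<lambda>B. if p \<in> B then 0 else eps p B * u (insert p B))"

definition cr :: "'i::linorder \<Rightarrow> ('i set \<Rightarrow> 'a::field_char_0) \<Rightarrow> 'i set \<Rightarrow> 'a" where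
  "cr p = lm (dl p)"

lemma cr_app: "finite B \<Longrightarrow> cr p u B = (if p \<in> B then eps p B * u (B - {p}) else 0)"
  by (simp add: cr_def lm_dl)

lemma an_app: "an p u B = (if p \<in> B then 0 else eps p B * u (insert p B))"
  by (simp add: an_def)

lemma cr_cr: "cr p (cr q u) = (\<lambda>B. - cr q (cr p u) B)"
  unfolding cr_def by (rule lm_anti)

lemma an_an: "finite B \<Longrightarrow> an p (an q u) B = - an q (an p u) B"
  by (cases "p = q") (auto simp: an_app eps_ins insert_commute not_less)

lemma an_cr: "finite B \<Longrightarrow> p \<noteq> q \<Longrightarrow> an p (cr q u) B = - cr q (an p u) B"
proof -
  assume "finite B" "p \<noteq> q"
  moreover have "insert p B - {q} = insert p (B - {q})" using \<open>p \<noteq> q\<close> by auto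
  moreover have "\<not> q < p" if "p < q" using that by auto
  moreover have "q < p" if "\<not> p < q" using that \<open>p \<noteq> q\<close> by auto
  ultimately show ?thesis
    by (cases "p \<in> B"; cases "q \<in> B"; cases "p < q") (simp_all add: an_app cr_app eps_ins eps_del)
qed

lemma an_cr_same: "finite B \<Longrightarrow> an p (cr p u) B = (if p \<in> B then 0 else u B)"
  by (auto simp: an_app cr_app)

lemma cr_an_same: "finite B \<Longrightarrow> cr p (an p u) B = (if p \<in> B then u B else 0)"
  by (auto simp: an_app cr_app insert_absorb)

lemma cr_neg: "cr p (\<lambda>B. - u B) = (\<lambda>B. - cr p u B)"
  by (auto simp: an_def cr_def lm_def sum_negf fun_eq_iff)

lemma an_sum: "an p (\<lambda>B. \<Sum>i\<in>I. f i B) = (\<lambda>B. \<Sum>i\<in>I. an p (f i) B)"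
  and cr_sum: "cr p (\<lambda>B. \<Sum>i\<in>I. f i B) = (\<lambda>B. \<Sum>i\<in>I. cr p (f i) B)"
  by (auto simp: an_def cr_def lm_sum sum_distrib_left fun_eq_iff)

lemma an_scale: "an p (\<lambda>B. c * u B) = (\<lambda>B. c * an p u B)"
  and cr_scale: "cr p (\<lambda>B. c * u B) = (\<lambda>B. c * cr p u B)"
  by (auto simp: an_def cr_def lm_scale fun_eq_iff)

lemma cr_cong: "finite B \<Longrightarrow> (\<And>B. finite B \<Longrightarrow> u B = v B) \<Longrightarrow> cr p u B = cr p v B"
  by (auto simp: an_def cr_app)

text \<open>The derivation of the exterior algebra induced by the elementary matrix that sends row
  \<open>i'\<close> to row \<open>i\<close>; \<open>cmv\<close> is its analogue for columns.\<close>

definition rmv :: "nat \<Rightarrow> nat \<Rightarrow> nat \<Rightarrow> ((nat \<times> nat) set \<Rightarrow> 'a) \<Rightarrow> (nat \<times> nat) set \<Rightarrow> 'a::field_char_0" where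
  "rmv m i i' u = (\<lambda>B. \<Sum>j<m. cr (i, j) (an (i', j) u) B)"

definition cmv :: "nat \<Rightarrow> nat \<Rightarrow> nat \<Rightarrow> ((nat \<times> nat) set \<Rightarrow> 'a) \<Rightarrow> (nat \<times> nat) set \<Rightarrow> 'a::field_char_0" where
  "cmv k j j' u = (\<lambda>B. \<Sum>i<k. cr (i, j) (an (i, j') u) B)"

text \<open>Counts the boxes of \<open>B\<close> paired with an empty place above them in the same
  column or to their left in the same row.\<close>

definition viol :: "nat \<Rightarrow> nat \<Rightarrow> (nat \<times> nat) set \<Rightarrow> nat" where
  "viol k m B = (\<Sum>i<k. \<Sum>i'<k. \<Sum>j<m. if i < i' \<and> (i', j) \<in> B \<and> (i, j) \<notin> B then 1 else 0) +
     (\<Sum>j<m. \<Sum>j'<m. \<Sum>i<k. if j < j' \<and> (i, j') \<in> B \<and> (i, j) \<notin> B then 1 else 0)"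

text \<open>The mixed term of two moves: the corners \<open>(i, j')\<close> and
  \<open>(i', j)\<close> of a rectangle are replaced by the other two corners.\<close>

definition quad :: "((nat \<times> nat) set \<Rightarrow> 'a) \<Rightarrow> (nat \<times> nat) set \<Rightarrow> nat \<Rightarrow> nat \<Rightarrow> nat \<Rightarrow> nat \<Rightarrow> 'a::field_char_0" where
  "quad u B i i' j j' = cr (i', j') (cr (i, j) (an (i, j') (an (i', j) u))) B"

lemma quad_sym: "finite B \<Longrightarrow> quad u B i' i j' j = quad u B i i' j j'"
proof -
  assume B: "finite B"
  have "quad u B i' i j' j = cr (i, j) (cr (i', j') (\<lambda>B. - an (i, j') (an (i', j) u) B)) B"
    unfolding quad_def by (intro cr_cong B an_an)
  also have "\<dots> = quad u B i i' j j'"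
    unfolding quad_def by (subst cr_cr) (simp add: cr_neg)
  finally show ?thesis .
qed

lemma move_diag:
  assumes "finite B" "p \<noteq> q"
  shows "cr q (an p (cr p (an q u))) B = (if q \<in> B \<and> p \<notin> B then u B else 0)"
proof -
  have "cr q (an p (cr p (an q u))) B = cr q (\<lambda>B. if p \<in> B then 0 else an q u B) B"
    using assms(1) by (intro cr_cong) (auto simp: an_cr_same)
  also have "\<dots> = (if p \<in> B then 0 else cr q (an q u) B)"
    using assms by (simp add: cr_app)
  finally show ?thesis using assms by (simp add: cr_an_same)
qed

text \<open>The off-diagonal terms of the row and column parts cancel, which is why the operator is
  diagonal in the monomial basis.\<close>

lemma casimir_diagonal:
  assumes "finite B"
  shows "(\<Sum>i<k. \<Sum>i'<k. if i < i' then rmv m i' i (rmv m i i' u) B else 0) +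
     (\<Sum>j<m. \<Sum>j'<m. if j < j' then cmv k j' j (cmv k j j' u) B else 0) = of_nat (viol k m B) * u B"
proof -
  let ?Q = "quad u B"
  \<comment> \<open>For \<open>j \<noteq> j'\<close> one annihilator has to pass one creator, hence
    the minus sign in front of the mixed terms.\<close>
  have r: "rmv m i' i (rmv m i i' u) B = (\<Sum>j<m. if (i', j) \<in> B \<and> (i, j) \<notin> B then u B else 0) -
      (\<Sum>j<m. \<Sum>j'<m. if j \<noteq> j' then ?Q i i' j j' else 0)" if "i < i'" for i i'
  proof -
    have "rmv m i' i (rmv m i i' u) B = (\<Sum>j'<m. \<Sum>j<m. cr (i', j') (an (i, j') (cr (i, j) (an (i', j) u))) B)"
      by (simp add: rmv_def an_sum cr_sum)
    also have "\<dots> = (\<Sum>j<m. \<Sum>j'<m. cr (i', j') (an (i, j') (cr (i, j) (an (i', j) u))) B)"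
      by (rule sum.swap)
    also have "\<dots> = (\<Sum>j<m. \<Sum>j'<m. (if j' = j then (if (i', j) \<in> B \<and> (i, j) \<notin> B then u B else 0) else 0) -
        (if j \<noteq> j' then ?Q i i' j j' else 0))"
    proof (intro sum.cong refl)
      fix j j'
      show "cr (i', j') (an (i, j') (cr (i, j) (an (i', j) u))) B =
        (if j' = j then (if (i', j) \<in> B \<and> (i, j) \<notin> B then u B else 0) else 0) - (if j \<noteq> j' then ?Q i i' j j' else 0)"
      proof (cases "j = j'")
        case True
        then show ?thesis using move_diag[OF assms, of "(i, j)" "(i', j)" u] that by simp
      next
        case False
        have "cr (i', j') (an (i, j') (cr (i, j) (an (i', j) u))) B = cr (i', j') (\<lambda>B. - cr (i, j) (an (i, j') (an (i', j) u)) B) B"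
          using False by (intro cr_cong assms an_cr) auto
        then show ?thesis using False by (simp add: cr_neg quad_def)
      qed
    qed
    also have "\<dots> = (\<Sum>j<m. if (i', j) \<in> B \<and> (i, j) \<notin> B then u B else 0) - (\<Sum>j<m. \<Sum>j'<m. if j \<noteq> j' then ?Q i i' j j' else 0)"
      by (simp add: sum_subtractf)
    finally show ?thesis .
  qed
  \<comment> \<open>Here the two annihilators have to be exchanged as well in order to reach the
    same \<open>quad\<close>, and this second sign restores a plus.\<close>
  have c: "cmv k j' j (cmv k j j' u) B = (\<Sum>i<k. if (i, j') \<in> B \<and> (i, j) \<notin> B then u B else 0) +
      (\<Sum>i<k. \<Sum>i'<k. if i \<noteq> i' then ?Q i i' j j' else 0)" if "j < j'" for j j'
  proof -
    have "cmv k j' j (cmv k j j' u) B = (\<Sum>i'<k. \<Sum>i<k. cr (i', j') (an (i', j) (cr (i, j) (an (i, j') u))) B)"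
      by (simp add: cmv_def an_sum cr_sum)
    also have "\<dots> = (\<Sum>i<k. \<Sum>i'<k. cr (i', j') (an (i', j) (cr (i, j) (an (i, j') u))) B)"
      by (rule sum.swap)
    also have "\<dots> = (\<Sum>i<k. \<Sum>i'<k. (if i' = i then (if (i, j') \<in> B \<and> (i, j) \<notin> B then u B else 0) else 0) +
        (if i \<noteq> i' then ?Q i i' j j' else 0))"
    proof (intro sum.cong refl)
      fix i i'
      show "cr (i', j') (an (i', j) (cr (i, j) (an (i, j') u))) B =
        (if i' = i then (if (i, j') \<in> B \<and> (i, j) \<notin> B then u B else 0) else 0) + (if i \<noteq> i' then ?Q i i' j j' else 0)"
      proof (cases "i = i'")
        case True
        then show ?thesis using move_diag[OF assms, of "(i, j)" "(i, j')" u] that by simp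
      next
        case False
        have "cr (i', j') (an (i', j) (cr (i, j) (an (i, j') u))) B = cr (i', j') (\<lambda>B. - cr (i, j) (an (i', j) (an (i, j') u)) B) B"
          using False by (intro cr_cong assms an_cr) auto
        also have "\<dots> = - cr (i', j') (cr (i, j) (an (i', j) (an (i, j') u))) B" by (simp add: cr_neg)
        also have "cr (i', j') (cr (i, j) (an (i', j) (an (i, j') u))) B = cr (i', j') (cr (i, j) (\<lambda>B. - an (i, j') (an (i', j) u) B)) B"
          by (intro cr_cong assms an_an)
        finally show ?thesis using False by (simp add: cr_neg quad_def)
      qed
    qed
    also have "\<dots> = (\<Sum>i<k. if (i, j') \<in> B \<and> (i, j) \<notin> B then u B else 0) + (\<Sum>i<k. \<Sum>i'<k. if i \<noteq> i' then ?Q i i' j j' else 0)"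
      by (simp add: sum.distrib)
    finally show ?thesis .
  qed
  \<comment> \<open>The mixed terms are sorted by the orientation of the two index pairs. Reversing
    both orientations leaves \<open>quad\<close> unchanged, so \<open>S2\<close> and
    \<open>S3\<close> agree.\<close>
  define S1 where "S1 = (\<Sum>i<k. \<Sum>i'<k. \<Sum>j<m. \<Sum>j'<m. if i < i' \<and> j < j' then ?Q i i' j j' else 0)"
  define S2 where "S2 = (\<Sum>i<k. \<Sum>i'<k. \<Sum>j<m. \<Sum>j'<m. if i < i' \<and> j' < j then ?Q i i' j j' else 0)"
  define S3 where "S3 = (\<Sum>i<k. \<Sum>i'<k. \<Sum>j<m. \<Sum>j'<m. if i' < i \<and> j < j' then ?Q i i' j j' else 0)"
  have "S3 = (\<Sum>i'<k. \<Sum>i<k. \<Sum>j'<m. \<Sum>j<m. if i' < i \<and> j < j' then ?Q i i' j j' else 0)"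
    unfolding S3_def by (subst sum.swap) (intro sum.cong refl sum.swap)
  also have "\<dots> = S2"
    unfolding S2_def by (intro sum.cong refl) (simp add: quad_sym[OF assms])
  finally have S23: "S3 = S2" .
  have R: "(\<Sum>i<k. \<Sum>i'<k. if i < i' then (\<Sum>j<m. \<Sum>j'<m. if j \<noteq> j' then ?Q i i' j j' else 0) else 0) = S1 + S2"
    unfolding S1_def S2_def sum.distrib[symmetric]
  proof (intro sum.cong refl)
    fix i i' 
    show "(if i < i' then (\<Sum>j<m. \<Sum>j'<m. if j \<noteq> j' then ?Q i i' j j' else 0) else 0) =
      (\<Sum>j<m. \<Sum>j'<m. (if i < i' \<and> j < j' then ?Q i i' j j' else 0) + (if i < i' \<and> j' < j then ?Q i i' j j' else 0))"
    proof (cases "i < i'")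
      case True
      have "(if j \<noteq> j' then ?Q i i' j j' else 0) = (if i < i' \<and> j < j' then ?Q i i' j j' else 0) +
        (if i < i' \<and> j' < j then ?Q i i' j j' else 0)" for j j' using True by (auto simp: neq_iff)
      then show ?thesis using True by (simp only: if_True)
    qed simp
  qed
  have "(\<Sum>j<m. \<Sum>j'<m. if j < j' then (\<Sum>i<k. \<Sum>i'<k. if i \<noteq> i' then ?Q i i' j j' else 0) else 0)
     = (\<Sum>j<m. \<Sum>j'<m. \<Sum>i<k. \<Sum>i'<k. (if i < i' \<and> j < j' then ?Q i i' j j' else 0) + (if i' < i \<and> j < j' then ?Q i i' j j' else 0))"
  proof (intro sum.cong refl)
    fix j j'
    show "(if j < j' then (\<Sum>i<k. \<Sum>i'<k. if i \<noteq> i' then ?Q i i' j j' else 0) else 0) =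
      (\<Sum>i<k. \<Sum>i'<k. (if i < i' \<and> j < j' then ?Q i i' j j' else 0) + (if i' < i \<and> j < j' then ?Q i i' j j' else 0))"
    proof (cases "j < j'")
      case True
      have "(if i \<noteq> i' then ?Q i i' j j' else 0) = (if i < i' \<and> j < j' then ?Q i i' j j' else 0) +
        (if i' < i \<and> j < j' then ?Q i i' j j' else 0)" for i i' using True by (auto simp: neq_iff)
      then show ?thesis using True by (simp only: if_True)
    qed simp
  qed
  also have "\<dots> = (\<Sum>i<k. \<Sum>i'<k. \<Sum>j<m. \<Sum>j'<m. (if i < i' \<and> j < j' then ?Q i i' j j' else 0) + (if i' < i \<and> j < j' then ?Q i i' j j' else 0))"
  proof -
    have "(\<Sum>j<m. \<Sum>j'<m. \<Sum>i<k. \<Sum>i'<k. f i i' j j') = (\<Sum>i<k. \<Sum>i'<k. \<Sum>j<m. \<Sum>j'<m. f i i' j j')" for f :: "_ \<Rightarrow> _ \<Rightarrow> _ \<Rightarrow> _ \<Rightarrow> 'a"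
    proof -
      have "(\<Sum>j<m. \<Sum>j'<m. \<Sum>i<k. \<Sum>i'<k. f i i' j j') = (\<Sum>j<m. \<Sum>i<k. \<Sum>j'<m. \<Sum>i'<k. f i i' j j')"
        by (intro sum.cong refl sum.swap)
      also have "\<dots> = (\<Sum>i<k. \<Sum>j<m. \<Sum>i'<k. \<Sum>j'<m. f i i' j j')"
        by (subst sum.swap) (intro sum.cong refl sum.swap)
      also have "\<dots> = (\<Sum>i<k. \<Sum>i'<k. \<Sum>j<m. \<Sum>j'<m. f i i' j j')"
        by (intro sum.cong refl sum.swap)
      finally show ?thesis .
    qed
    then show ?thesis .
  qed
  also have "\<dots> = S1 + S3" unfolding S1_def S3_def by (simp add: sum.distrib)
  finally have C: "(\<Sum>j<m. \<Sum>j'<m. if j < j' then (\<Sum>i<k. \<Sum>i'<k. if i \<noteq> i' then ?Q i i' j j' else 0) else 0) = S1 + S3" .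
  have "(\<Sum>i<k. \<Sum>i'<k. if i < i' then rmv m i' i (rmv m i i' u) B else 0) =
     (\<Sum>i<k. \<Sum>i'<k. \<Sum>j<m. if i < i' \<and> (i', j) \<in> B \<and> (i, j) \<notin> B then u B else 0) - (S1 + S2)"
    unfolding R[symmetric] sum_subtractf[symmetric] by (intro sum.cong refl) (auto simp: r)
  moreover have "(\<Sum>j<m. \<Sum>j'<m. if j < j' then cmv k j' j (cmv k j j' u) B else 0) =
     (\<Sum>j<m. \<Sum>j'<m. \<Sum>i<k. if j < j' \<and> (i, j') \<in> B \<and> (i, j) \<notin> B then u B else 0) + (S1 + S3)"
    unfolding C[symmetric] sum.distrib[symmetric] by (intro sum.cong refl) (auto simp: c)
  moreover have "of_nat (viol k m B) * u B =
     (\<Sum>i<k. \<Sum>i'<k. \<Sum>j<m. if i < i' \<and> (i', j) \<in> B \<and> (i, j) \<notin> B then u B else 0) +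
     (\<Sum>j<m. \<Sum>j'<m. \<Sum>i<k. if j < j' \<and> (i, j') \<in> B \<and> (i, j) \<notin> B then u B else 0)"
    unfolding viol_def by (simp add: distrib_right sum_distrib_right if_distrib[of of_nat] if_distrib[of "\<lambda>x. x * u B"] cong: if_cong)
  ultimately show ?thesis using S23 by simp
qed

text \<open>Without violations the set is closed upwards and to the left, so every row is an initial
  segment and the row lengths decrease weakly.\<close>

lemma viol_0_diagram:
  assumes "A \<subseteq> bx k m" "viol k m A = 0"
  obtains nu where "nu \<in> box_partitions k m" "A = diagram nu"
proof -
  have fA: "finite A" using assms finite_subset bx_fin by blast
  have row: "(i, j) \<in> A" if "i < i'" "(i', j) \<in> A" for i i' j
  proof (rule ccontr)
    assume "(i, j) \<notin> A"
    have "i < k" "i' < k" "j < m" using that assms(1) by auto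
    have "(\<Sum>i<k. \<Sum>i'<k. \<Sum>j<m. if i < i' \<and> (i', j) \<in> A \<and> (i, j) \<notin> A then 1 else 0::nat) = 0"
      using assms(2) by (simp only: viol_def add_is_0)
    then show False using that \<open>(i, j) \<notin> A\<close> \<open>i < k\<close> \<open>i' < k\<close> \<open>j < m\<close> by (auto split: if_splits)
  qed
  have col: "(i, j) \<in> A" if "j < j'" "(i, j') \<in> A" for i j j'
  proof (rule ccontr)
    assume "(i, j) \<notin> A"
    have "i < k" "j' < m" "j < m" using that assms(1) by auto
    have "(\<Sum>j<m. \<Sum>j'<m. \<Sum>i<k. if j < j' \<and> (i, j') \<in> A \<and> (i, j) \<notin> A then 1 else 0::nat) = 0"
      using assms(2) by (simp only: viol_def add_is_0)
    then show False using that \<open>(i, j) \<notin> A\<close> \<open>i < k\<close> \<open>j' < m\<close> \<open>j < m\<close> by (auto split: if_splits)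
  qed
  let ?R = "\<lambda>i. {j. (i, j) \<in> A}"
  have R1: "?R i \<subseteq> {..<m}" for i using assms(1) by auto
  have R2: "finite (?R i)" for i using R1 by (rule finite_subset) simp
  note R = R1 R2
  have eq: "?R i = {..<card (?R i)}" for i
  proof (cases "?R i = {}")
    case False
    have "?R i = {..Max (?R i)}"
    proof (intro equalityI subsetI)
      fix j assume "j \<in> {..Max (?R i)}"
      moreover have "Max (?R i) \<in> ?R i" using False R by (intro Max_in)
      ultimately show "j \<in> ?R i" using col[of j "Max (?R i)" i] by (cases "j = Max (?R i)") auto
    qed (use R in auto)
    then show ?thesis by (metis card_atMost lessThan_Suc_atMost)
  qed simp
  let ?nu = "map (\<lambda>i. card (?R i)) [0..<k]"
  have "card (?R i') \<le> card (?R i)" if "i < i'" for i i'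
    using R row[OF that] by (intro card_mono) auto
  moreover have "card (?R i) \<le> m" for i using R card_mono[of "{..<m}" "?R i"] by simp
  ultimately have "?nu \<in> box_partitions k m"
    by (auto simp: box_partitions_def partitions_def sorted_wrt_iff_nth_less)
  moreover have "A = diagram ?nu"
  proof (intro equalityI subsetI)
    fix p assume p: "p \<in> A"
    obtain i j where ij: "p = (i, j)" by (cases p)
    have "j \<in> {..<card (?R i)}" using p ij eq[of i] by blast
    then show "p \<in> diagram ?nu" using p assms(1) ij by (auto simp: diagram_def)
  next
    fix p assume p: "p \<in> diagram ?nu"
    obtain i j where ij: "p = (i, j)" by (cases p)
    have "j \<in> {..<card (?R i)}" using p ij by (auto simp: diagram_def)
    then show "p \<in> A" using ij eq[of i] by blast
  qed
  ultimately show ?thesis by (rule that)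
qed

lemma move_nz:
  assumes "cr p (an p' (bas A)) B \<noteq> (0::'a::field_char_0)"
  obtains C where "B = insert p C" "A = insert p' C" "p \<notin> C" "p' \<notin> C" "finite C"
proof -
  have "finite B" using assms lm_inf unfolding cr_def by blast
  moreover have "p \<in> B" "an p' (bas A) (B - {p}) \<noteq> (0::'a)" using assms \<open>finite B\<close> by (auto simp: cr_app split: if_splits)
  then have "p' \<notin> B - {p}" "insert p' (B - {p}) = A" by (auto simp: an_app bas_def split: if_splits)
  ultimately show ?thesis using that[of "B - {p}"] \<open>p \<in> B\<close> by auto
qed

lemma cr_nz:
  assumes "cr p u B \<noteq> 0"
  shows "p \<in> B" "u (B - {p}) \<noteq> 0" "finite B"
proof -
  show "finite B" using assms lm_inf unfolding cr_def by blast
  then show "p \<in> B" "u (B - {p}) \<noteq> 0" using assms by (auto simp: cr_app split: if_splits)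
qed

lemma card_filter_insert: "finite C \<Longrightarrow> p \<notin> C \<Longrightarrow>
    card {q\<in>insert p C. Y q} = card {q\<in>C. Y q} + (if Y p then 1 else 0)"
proof -
  assume "finite C" "p \<notin> C"
  moreover have "{q\<in>insert p C. Y q} = (if Y p then insert p {q\<in>C. Y q} else {q\<in>C. Y q})" by auto
  ultimately show ?thesis by (simp add: card_insert_if)
qed

lemma card_filter_remove: "finite B \<Longrightarrow> p \<in> B \<Longrightarrow>
    card {q\<in>B. Y q} = card {q\<in>B - {p}. Y q} + (if Y p then 1 else 0)"
  using card_filter_insert[of "B - {p}" p Y] by (simp add: insert_absorb)

section \<open>Derivations as homogeneous parts of unipotent matrices\<close>

definition mvs :: "'i::linorder set \<Rightarrow> ('i \<Rightarrow> 'i) \<Rightarrow> ('i set \<Rightarrow> 'a::field_char_0) \<Rightarrow> 'i set \<Rightarrow> 'a" where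
  "mvs P \<sigma> u = (\<lambda>B. \<Sum>p\<in>P. cr (\<sigma> p) (an p u) B)"

lemma mvs_bas_deg:
  assumes "mvs P \<sigma> (bas A) B \<noteq> (0::'a::field_char_0)" "\<And>p. p \<in> P \<Longrightarrow> \<not> Y p \<and> Y (\<sigma> p)"
  shows "card {q\<in>B. Y q} = card {q\<in>A. Y q} + 1"
proof -
  obtain p where p: "p \<in> P" "cr (\<sigma> p) (an p (bas A)) B \<noteq> (0::'a)"
    using assms(1) unfolding mvs_def by (metis (no_types, lifting) sum.not_neutral_contains_not_neutral)
  from p(2) obtain C where "B = insert (\<sigma> p) C" "A = insert p C" "\<sigma> p \<notin> C" "p \<notin> C" "finite C"
    by (rule move_nz)
  then show ?thesis using assms(2)[OF p(1)] by (simp add: card_filter_insert del: insert_iff)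
qed

text \<open>\<open>mvs P \<sigma>\<close> is the infinitesimal action of the linear map sending \<open>p\<close> to \<open>\<sigma> p\<close> for \<open>p \<in> P\<close> and
  the other boxes to zero. It is recovered from the group as a homogeneous component.\<close>

lemma img_shift_remainder:
  fixes G :: "'i::linorder \<Rightarrow> 'i \<Rightarrow> 'b::field_char_0"
  assumes "finite A" "finite P" "\<And>p. p \<in> P \<Longrightarrow> \<not> Y p \<and> Y (\<sigma> p)"
    "\<And>p. p \<in> A \<Longrightarrow> G p = (\<lambda>q. dl p q + (if p \<in> P then dl (\<sigma> p) q else 0))"
    "img G A B - bas A B - mvs P \<sigma> (bas A) B \<noteq> 0"
  shows "card {q\<in>A. Y q} + 2 \<le> card {q\<in>B. Y q}"
  using assms(1,4,5)
proof (induction arbitrary: B rule: finite_min_induct)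
  case empty
  let ?bas = "bas :: 'i set \<Rightarrow> 'i set \<Rightarrow> 'b"
  have "an p (?bas {}) B = 0" for p B by (auto simp: an_app bas_def)
  then have "an p (?bas {}) = (\<lambda>B. 0)" for p by (rule ext)
  then have "mvs P \<sigma> (?bas {}) B = 0" by (simp add: mvs_def cr_def lm_zero)
  then show ?case using empty by simp
next
  case (insert p A)
  let ?bas = "bas :: 'i set \<Rightarrow> 'i set \<Rightarrow> 'b"
  \<comment> \<open>\<open>R\<close> collects the terms in which at least two boxes have moved into
    \<open>Y\<close>. On multiplication by one more factor the terms of order zero and one obey the
    Leibniz rule \<open>m\<close>, and everything else stays of order two or more.\<close>
  define R where "R = (\<lambda>B. img G A B - ?bas A B - mvs P \<sigma> (?bas A) B)"
  have IH: "card {q\<in>A. Y q} + 2 \<le> card {q\<in>B. Y q}" if "R B \<noteq> 0" for B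
    using insert.IH[of B] insert.prems(1) that by (simp add: R_def)
  have fB: "finite B"
  proof (rule ccontr)
    assume "infinite B"
    then have "img G (insert p A) B = 0" "?bas (insert p A) B = 0" "mvs P \<sigma> (?bas (insert p A)) B = 0"
      using insert.hyps by (auto simp: img_min lm_inf mvs_def cr_def bas_def)
    then show False using insert.prems(2) by simp
  qed
  have w: "img G A = (\<lambda>B. ?bas A B + (mvs P \<sigma> (?bas A) B + R B))" by (simp add: R_def)
  have e: "eps p A = (1::'b)" using insert.hyps by (auto intro!: eps_min less_imp_le)
  have b: "?bas (insert p A) = (cr p (?bas A) )"
    using insert.hyps e by (simp add: cr_def lm_dl_bas)
  have i: "img G (insert p A) B = cr p (img G A) B + (if p \<in> P then cr (\<sigma> p) (img G A) B else 0)"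
    using insert by (simp add: img_min lm_addl cr_def lm_zerol)
  have m: "mvs P \<sigma> (?bas (insert p A)) B = cr p (mvs P \<sigma> (?bas A)) B + (if p \<in> P then cr (\<sigma> p) (?bas A) B else 0)"
  proof -
    have t: "cr (\<sigma> q) (an q (cr p (?bas A))) B = cr p (cr (\<sigma> q) (an q (?bas A))) B + (if q = p then cr (\<sigma> p) (?bas A) B else 0)" for q
    proof (cases "q = p")
      case True
      have "an p (?bas A) = (\<lambda>B. 0)" using insert.hyps by (auto simp: an_app bas_def fun_eq_iff)
      moreover have "cr (\<sigma> p) (an p (cr p (?bas A))) B = cr (\<sigma> p) (?bas A) B"
        using insert.hyps fB by (intro cr_cong) (auto simp: an_cr_same bas_def)
      ultimately show ?thesis using True by (simp add: cr_def lm_zero)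
    next
      case False
      have "cr (\<sigma> q) (an q (cr p (?bas A))) B = cr (\<sigma> q) (\<lambda>B. - cr p (an q (?bas A)) B) B"
        using False fB by (intro cr_cong an_cr)
      also have "\<dots> = cr p (cr (\<sigma> q) (an q (?bas A))) B"
        by (simp add: cr_neg) (subst cr_cr, simp)
      finally show ?thesis using False by simp
    qed
    have "mvs P \<sigma> (?bas (insert p A)) B = (\<Sum>q\<in>P. cr p (cr (\<sigma> q) (an q (?bas A))) B + (if q = p then cr (\<sigma> p) (?bas A) B else 0))"
      unfolding b mvs_def by (intro sum.cong refl t)
    then show ?thesis using assms(2) by (simp add: sum.distrib mvs_def cr_sum)
  qed
  have cadd: "cr r (\<lambda>B. u B + v B) B = cr r u B + cr r v B" for r u v by (simp add: cr_def lm_add)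
  have "cr p R B + (if p \<in> P then cr (\<sigma> p) (\<lambda>B. mvs P \<sigma> (?bas A) B + R B) B else 0) \<noteq> 0"
  proof -
    have "img G (insert p A) B = ?bas (insert p A) B + mvs P \<sigma> (?bas (insert p A)) B +
        (cr p R B + (if p \<in> P then cr (\<sigma> p) (\<lambda>B. mvs P \<sigma> (?bas A) B + R B) B else 0))"
      unfolding i m unfolding w cadd b by simp
    then show ?thesis using insert.prems(2) by simp
  qed
  then consider "cr p R B \<noteq> 0" | "p \<in> P" "cr (\<sigma> p) (\<lambda>B. mvs P \<sigma> (?bas A) B + R B) B \<noteq> 0"
    by (cases "p \<in> P"; cases "cr p R B = 0") auto
  then show ?case
  proof cases
    case 1
    from cr_nz[OF 1] IH[of "B - {p}"] show ?thesis
      using card_filter_remove[of B p Y] card_filter_insert[of A p Y] insert.hyps by simp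
  next
    case 2
    note z = cr_nz[OF 2(2)]
    have Y: "\<not> Y p" "Y (\<sigma> p)" using assms(3)[OF 2(1)] by auto
    have "card {q\<in>A. Y q} + 1 \<le> card {q\<in>B - {\<sigma> p}. Y q}"
      using z(2) mvs_bas_deg[of P \<sigma> A "B - {\<sigma> p}" Y, where 'a = 'b] IH[of "B - {\<sigma> p}"] assms(3)
      by (cases "R (B - {\<sigma> p}) = 0") auto
    then show ?thesis
      using card_filter_remove[OF z(3,1), of Y] card_filter_insert[of A p Y] insert.hyps Y by simp
  qed
qed

text \<open>The number of boxes in \<open>Y\<close> is a grading. The matrix is the identity plus a
  map into \<open>Y\<close>, so the degree rises by zero on the monomial itself, by one on the
  derivation and by at least two on the remainder.\<close>

lemma shift_component:
  assumes "A \<subseteq> bx k m" "finite P" "\<And>p. p \<in> P \<Longrightarrow> \<not> Y p \<and> Y (\<sigma> p)"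
    "\<And>p. p \<in> bx k m \<Longrightarrow> tens k m g h p = (\<lambda>q. dl p q + (if p \<in> P then dl (\<sigma> p) q else 0))"
  shows "(\<lambda>B. if card {p\<in>B. Y p} = card {p\<in>A. Y p} + 1 then ac k m g h (bas A) B else 0) = mvs P \<sigma> (bas A)"
proof
  fix B
  have f: "finite A" using assms(1) finite_subset bx_fin by blast
  have i: "ac k m g h (bas A) = img (tens k m g h) A" using assms(1) by (simp add: ac_def act_bas)
  have m: "mvs P \<sigma> (bas A) B \<noteq> (0::'a) \<Longrightarrow> card {p\<in>B. Y p} = card {p\<in>A. Y p} + 1"
    by (erule mvs_bas_deg) (rule assms(3))
  have r: "img (tens k m g h) A B - bas A B - mvs P \<sigma> (bas A) B \<noteq> 0 \<Longrightarrow> card {p\<in>A. Y p} + 2 \<le> card {p\<in>B. Y p}"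
    using f assms by (intro img_shift_remainder) auto
  show "(if card {p\<in>B. Y p} = card {p\<in>A. Y p} + 1 then ac k m g h (bas A) B else 0) = mvs P \<sigma> (bas A) B"
  proof (cases "card {p\<in>B. Y p} = card {p\<in>A. Y p} + 1")
    case True
    then have "B \<noteq> A" by auto
    then show ?thesis using True r i by (auto simp: bas_def)
  qed (use m in auto)
qed

lemma rmv_mvs: "rmv m i i' u = mvs ({i'} \<times> {..<m}) (\<lambda>p. (i, snd p)) u"
proof -
  have "{i'} \<times> {..<m} = Pair i' ` {..<m}" by auto
  then show ?thesis by (simp add: rmv_def mvs_def sum.reindex inj_on_def)
qed

lemma cmv_mvs: "cmv k j j' u = mvs ({..<k} \<times> {j'}) (\<lambda>p. (fst p, j)) u"
proof -
  have "{..<k} \<times> {j'} = (\<lambda>i. (i, j')) ` {..<k}" by auto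
  then show ?thesis by (simp add: cmv_def mvs_def sum.reindex inj_on_def)
qed

lemma stab_rmv:
  assumes "stab k m T" "A \<subseteq> bx k m" "bas A \<in> T" "i < k" "i' < k" "i \<noteq> i'"
  shows "rmv m i i' (bas A) \<in> T"
proof -
  \<comment> \<open>The identity plus the elementary matrix in position \<open>(i, i')\<close>; its
    part of degree one in row \<open>i\<close> is \<open>rmv m i i'\<close>.\<close>
  let ?g = "\<lambda>a b. if a = b \<or> a = i \<and> b = i' then 1 else 0"
  have "ac k m ?g idm (bas A) \<in> T" using assms by (auto simp: stab_def)
  from stab_proj_row[OF assms(1) this, of i "rowc A i + 1"]
  show ?thesis unfolding rmv_mvs rowc_def
    by (subst (asm) shift_component)
      (use assms in \<open>auto simp: tens_def idm_def dl_def fun_eq_iff\<close>)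
qed

lemma stab_cmv:
  assumes "stab k m T" "A \<subseteq> bx k m" "bas A \<in> T" "j < m" "j' < m" "j \<noteq> j'"
  shows "cmv k j j' (bas A) \<in> T"
proof -
  let ?g = "\<lambda>a b. if a = b \<or> a = j \<and> b = j' then 1 else 0"
  have "ac k m idm ?g (bas A) \<in> T" using assms by (auto simp: stab_def)
  from stab_proj_col[OF assms(1) this, of j "colc A j + 1"]
  show ?thesis unfolding cmv_mvs colc_def
    by (subst (asm) shift_component)
      (use assms in \<open>auto simp: tens_def idm_def dl_def fun_eq_iff\<close>)
qed

lemma mvs_sum: "mvs P \<sigma> (\<lambda>B. \<Sum>i\<in>I. c i * f i B) = (\<lambda>B. \<Sum>i\<in>I. c i * mvs P \<sigma> (f i) B)"
  unfolding mvs_def an_sum cr_sum an_scale cr_scale by (rule ext) (simp add: sum_distrib_left sum.swap[of _ I])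

lemma mvs_bas_nz:
  assumes "mvs P \<sigma> (bas A) B \<noteq> (0::'a::field_char_0)"
  obtains p C where "p \<in> P" "B = insert (\<sigma> p) C" "A = insert p C" "\<sigma> p \<notin> C" "p \<notin> C" "finite C"
proof -
  obtain p where p: "p \<in> P" "cr (\<sigma> p) (an p (bas A)) B \<noteq> (0::'a)"
    using assms(1) unfolding mvs_def by (metis (no_types, lifting) sum.not_neutral_contains_not_neutral)
  from p(2) show ?thesis by (rule move_nz) (use p(1) that in blast)
qed

text \<open>Every monomial that is not a diagram is an eigenvector of \<open>casimir_diagonal\<close> with nonzero
  eigenvalue, hence obtained from monomials closer to the upper left corner.\<close>

lemma stab_generated:
  assumes T: "stab k m T" and D: "\<And>nu. nu \<in> box_partitions k m \<Longrightarrow> bas (diagram nu) \<in> T"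
    and A: "A \<subseteq> bx k m"
  shows "bas A \<in> T"
  using A
proof (induction "\<Sum>p\<in>A. fst p + snd p" arbitrary: A rule: less_induct)
  case less
  have lin: "linc T" and TX: "T \<subseteq> forms (bx k m)" using T by (auto simp: stab_def)
  show ?case
  proof (cases "viol k m A = 0")
    case True
    then show ?thesis using viol_0_diagram[OF less(2)] D by metis
  next
    case False
    \<comment> \<open>The first move strictly lowers the sum of the coordinates, so the induction
      hypothesis puts all monomials of its result into \<open>T\<close>. The move back only has to
      preserve \<open>T\<close>.\<close>
    have step: "mvs P' \<sigma>' (mvs P \<sigma> (bas A)) \<in> T"
      if P: "\<And>p. p \<in> P \<Longrightarrow> \<sigma> p \<in> bx k m \<and> fst (\<sigma> p) + snd (\<sigma> p) < fst p + snd p"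
        and st: "\<And>B. B \<subseteq> bx k m \<Longrightarrow> bas B \<in> T \<Longrightarrow> mvs P' \<sigma>' (bas B) \<in> T" for P P' \<sigma> \<sigma>'
    proof -
      let ?v = "mvs P \<sigma> (bas A) :: _ \<Rightarrow> 'a"
      have v: "B \<subseteq> bx k m \<and> (\<Sum>p\<in>B. fst p + snd p) < (\<Sum>p\<in>A. fst p + snd p)" if "?v B \<noteq> 0" for B
        using that
      proof (rule mvs_bas_nz)
        fix p C assume "p \<in> P" "B = insert (\<sigma> p) C" "A = insert p C" "\<sigma> p \<notin> C" "p \<notin> C" "finite C"
        then show ?thesis using P[of p] less(2) by auto
      qed
      then have "?v \<in> forms (bx k m)" by (auto intro: formsI)
      then have "?v = (\<lambda>B. \<Sum>C\<in>Pow (bx k m). ?v C * bas C B)" by (intro forms_expand bx_fin)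
      then have "mvs P' \<sigma>' ?v = mvs P' \<sigma>' (\<lambda>B. \<Sum>C\<in>Pow (bx k m). ?v C * bas C B)" by simp
      also have "\<dots> = (\<lambda>B. \<Sum>C\<in>Pow (bx k m). ?v C * mvs P' \<sigma>' (bas C) B)" by (rule mvs_sum)
      also have "\<dots> \<in> T"
      proof (rule linc_sum[OF lin])
        fix C assume "C \<in> Pow (bx k m)"
        show "(\<lambda>B. ?v C * mvs P' \<sigma>' (bas C) B) \<in> T"
        proof (cases "?v C = 0")
          case True
          then show ?thesis by (simp add: linc_zero lin)
        next
          case False
          then have "bas C \<in> T" using less(1)[of C] v by blast
          then show ?thesis using st \<open>C \<in> Pow (bx k m)\<close> by (intro linc_scale lin) auto
        qed
      qed
      finally show ?thesis .
    qed
    have r: "rmv m i' i (rmv m i i' (bas A)) \<in> T" if "i < i'" "i' < k" for i i'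
      unfolding rmv_mvs
      by (rule step) (use that stab_rmv[OF T, of _ i' i] in \<open>auto simp: rmv_mvs[symmetric]\<close>)
    have c: "cmv k j' j (cmv k j j' (bas A)) \<in> T" if "j < j'" "j' < m" for j j'
      unfolding cmv_mvs
      by (rule step) (use that stab_cmv[OF T, of _ j' j] in \<open>auto simp: cmv_mvs[symmetric]\<close>)
    let ?S = "\<lambda>B. (\<Sum>i<k. \<Sum>i'<k. if i < i' then rmv m i' i (rmv m i i' (bas A)) B else 0) +
       (\<Sum>j<m. \<Sum>j'<m. if j < j' then cmv k j' j (cmv k j j' (bas A)) B else 0) :: 'a"
    have "?S \<in> T"
    proof (intro linc_add linc_sum lin)
      fix i i' assume "i \<in> {..<k}" "i' \<in> {..<k}"
      then show "(\<lambda>B. if i < i' then rmv m i' i (rmv m i i' (bas A)) B else 0) \<in> T"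
        using r[of i i'] linc_zero[OF lin] by (cases "i < i'") auto
    next
      fix j j' assume "j \<in> {..<m}" "j' \<in> {..<m}"
      then show "(\<lambda>B. if j < j' then cmv k j' j (cmv k j j' (bas A)) B else 0) \<in> T"
        using c[of j j'] linc_zero[OF lin] by (cases "j < j'") auto
    qed
    moreover have "?S = (\<lambda>B. of_nat (viol k m A) * bas A B)"
    proof
      fix B
      have f: "finite A" using less(2) finite_subset bx_fin by blast
      show "?S B = of_nat (viol k m A) * bas A B"
      proof (cases "finite B")
        case True
        then show ?thesis unfolding casimir_diagonal[OF True] by (auto simp: bas_def)
      next
        case False
        then have "B \<noteq> A" using f by auto
        then show ?thesis using False by (simp add: rmv_def cmv_def cr_def lm_inf bas_def)
      qed
    qed
    ultimately have "(\<lambda>B. of_nat (viol k m A) * bas A B) \<in> T" by simp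
    from linc_scale[OF lin this, of "inverse (of_nat (viol k m A))"]
    show ?thesis using False by (simp add: mult.assoc[symmetric])
  qed
qed

lemma linc_forms: "linc (forms X)"
  unfolding linc_def forms_def by (auto, metis add.right_neutral subsetD)

lemma ip_add: "ip X (\<lambda>A. u A + v A) w = ip X u w + ip X v w"
  and ip_scale: "ip X (\<lambda>A. c * u A) w = c * ip X u w"
  and ip_zero: "ip X (\<lambda>A. 0) w = 0"
  by (simp_all add: ip_def distrib_right sum.distrib sum_distrib_left mult.assoc)

text \<open>The forms whose whole orbit is orthogonal to \<open>Z\<close> are a stable subspace. If
  it contained all diagrams it would be everything by \<open>stab_generated\<close>, and
  \<open>Z\<close> would vanish. The argument also covers the complex numbers, where
  \<open>ip\<close> is not definite.\<close>

lemma nondegenerate: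
  assumes "Z \<in> forms (bx k m)" "Z \<noteq> (\<lambda>_. 0)"
  obtains g h nu where "nu \<in> box_partitions k m" "ip (bx k m) (ac k m g h (bas (diagram nu))) Z \<noteq> 0"
proof (rule ccontr)
  note nd = that
  assume "\<not> thesis"
  then have z: "ip (bx k m) (ac k m g h (bas (diagram nu))) Z = 0" if "nu \<in> box_partitions k m" for g h nu
    using that \<open>\<not> thesis\<close> nd by blast
  let ?T = "{u \<in> forms (bx k m). \<forall>g h. ip (bx k m) (ac k m g h u) Z = 0}"
  have "linc ?T" unfolding linc_def
    by (auto simp: ac_add ac_scale ac_zero ip_add ip_scale ip_zero intro: linc_add[OF linc_forms] linc_scale[OF linc_forms]
        linc_zero[OF linc_forms])
  then have "stab k m ?T" unfolding stab_def by (auto simp: ac_ac)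
  moreover have "bas (diagram nu) \<in> ?T" if "nu \<in> box_partitions k m" for nu
    using z[OF that] diagram_bx[OF that] by (simp add: bas_forms)
  ultimately have "bas A \<in> ?T" if "A \<subseteq> bx k m" for A using that by (rule stab_generated)
  then have "ip (bx k m) (bas A) Z = 0" if "A \<subseteq> bx k m" for A
  proof -
    have "ip (bx k m) (ac k m idm idm (bas A)) Z = 0" using \<open>\<And>A. A \<subseteq> bx k m \<Longrightarrow> bas A \<in> ?T\<close>[OF that] by blast
    then show ?thesis using that by (simp add: ac_id bas_forms)
  qed
  then have "Z A = 0" if "A \<subseteq> bx k m" for A using that by (metis ip_bas ip_sym bx_fin)
  then have "Z = (\<lambda>_. 0)" using assms(1) by (metis formsD ext)
  then show False using assms(2) by simp
qed

subsection \<open>Schubert spans\<close>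

lemma householder_step:
  fixes A :: "real mat"
  assumes A: "A \<in> carrier_mat k k" and r: "r < k"
    and z: "\<And>i j. j < r \<Longrightarrow> j < i \<Longrightarrow> i < k \<Longrightarrow> A $$ (i, j) = 0"
  shows "\<exists>H\<in>orthogonal_group k. \<forall>i j. j < Suc r \<longrightarrow> j < i \<longrightarrow> i < k \<longrightarrow> (H * A) $$ (i, j) = 0"
proof (cases "\<forall>i. r < i \<longrightarrow> i < k \<longrightarrow> A $$ (i, r) = 0")
  case True
  have "1\<^sub>m k \<in> orthogonal_group k" by (simp add: orthogonal_group_def)
  moreover have "(1\<^sub>m k * A) $$ (i, j) = 0" if "j < Suc r" "j < i" "i < k" for i j
    using that z True A by (cases "j = r") auto
  ultimately show ?thesis by blast
next
  case False
  then obtain i0 where i0: "r < i0" "i0 < k" "A $$ (i0, r) \<noteq> 0" by blast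
  \<comment> \<open>\<open>x\<close> is column \<open>r\<close> from the diagonal on and
    \<open>n\<close> its length. The reflection along \<open>w\<close> takes \<open>x\<close> to
    \<open>n\<close> times a unit vector; since \<open>w\<close> vanishes in the rows above
    \<open>r\<close>, the columns cleared earlier stay cleared.\<close>
  define x where "x = (\<lambda>i. if r \<le> i then A $$ (i, r) else 0)"
  define N where "N = (\<Sum>i<k. x i * x i)"
  define n where "n = sqrt N"
  define w where "w = (\<lambda>i. x i - (if i = r then n else 0))"
  define W where "W = (\<Sum>i<k. w i * w i)"
  have N0: "N \<ge> 0" unfolding N_def by (intro sum_nonneg) simp
  then have nn: "n * n = N" by (simp add: n_def)
  \<comment> \<open>The nonzero entry at \<open>i0\<close> makes \<open>x r\<close> strictly smaller
    than \<open>n\<close>, so \<open>w\<close> is not zero and the division by \<open>W\<close> is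
    legitimate.\<close>
  have "(\<Sum>i\<in>{i0, r}. x i * x i) \<le> N" unfolding N_def using i0 r by (intro sum_mono2) auto
  then have "x i0 * x i0 + x r * x r \<le> N" using i0 by simp
  moreover have "x i0 * x i0 > 0" using i0 by (simp add: x_def flip: power2_eq_square)
  ultimately have "x r * x r < n * n" using nn by linarith
  then have "\<bar>x r\<bar> < n" using N0 by (metis abs_le_square_iff abs_of_nonneg n_def not_le power2_eq_square real_sqrt_ge_zero)
  then have n0: "n > 0" "x r < n" by auto
  have wx: "(\<Sum>i<k. w i * x i) = N - n * x r"
  proof -
    have "(\<Sum>i<k. w i * x i) = (\<Sum>i<k. x i * x i - (if i = r then n * x i else 0))"
      unfolding w_def by (intro sum.cong) (auto simp: algebra_simps)
    then show ?thesis using r by (simp add: sum_subtractf N_def)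
  qed
  have Wv: "W = 2 * (N - n * x r)"
  proof -
    have "W = (\<Sum>i<k. w i * x i - (if i = r then n * w i else 0))"
      unfolding W_def by (intro sum.cong) (auto simp: w_def algebra_simps)
    also have "\<dots> = N - n * x r - n * w r" using r wx by (simp add: sum_subtractf)
    finally show ?thesis using nn by (simp add: w_def algebra_simps)
  qed
  have W0: "W > 0"
  proof -
    have "n * x r < n * n" using n0 by simp
    then show ?thesis using Wv nn by simp
  qed
  define H where "H = mat k k (\<lambda>(i, j). (if i = j then 1 else 0) - 2 / W * (w i * w j))"
  have Hc: "H \<in> carrier_mat k k" by (simp add: H_def)
  have ap: "(H * B) $$ (i, j) = B $$ (i, j) - 2 / W * w i * (\<Sum>l<k. w l * B $$ (l, j))"
    if "B \<in> carrier_mat k k" "i < k" "j < k" for B i j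
  proof -
    have "(H * B) $$ (i, j) = (\<Sum>l<k. ((if i = l then 1 else 0) - 2 / W * (w i * w l)) * B $$ (l, j))"
      using that by (simp add: H_def scalar_prod_def lessThan_atLeast0)
    also have "\<dots> = (\<Sum>l<k. (if i = l then 1 else 0) * B $$ (l, j)) - (\<Sum>l<k. 2 / W * w i * (w l * B $$ (l, j)))"
      by (simp add: left_diff_distrib sum_subtractf mult.assoc)
    also have "\<dots> = B $$ (i, j) - 2 / W * w i * (\<Sum>l<k. w l * B $$ (l, j))"
      using that by (simp add: sum_pick sum_distrib_left)
    finally show ?thesis .
  qed
  have "H * H\<^sup>T = 1\<^sub>m k"
  proof (rule eq_matI)
    fix i j assume ij: "i < dim_row (1\<^sub>m k :: real mat)" "j < dim_col (1\<^sub>m k :: real mat)"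
    then have ij: "i < k" "j < k" by auto
    have s: "(\<Sum>l<k. w l * H\<^sup>T $$ (l, j)) = - w j"
    proof -
      have "(\<Sum>l<k. w l * H\<^sup>T $$ (l, j)) = (\<Sum>l<k. w l * (if j = l then 1 else 0) - 2 / W * w j * (w l * w l))"
        using ij by (intro sum.cong) (auto simp: H_def algebra_simps)
      also have "\<dots> = w j - 2 / W * w j * W" using ij by (simp add: sum_subtractf sum_pick W_def sum_distrib_left)
      finally show ?thesis using W0 by simp
    qed
    have "(H * H\<^sup>T) $$ (i, j) = H\<^sup>T $$ (i, j) - 2 / W * w i * (\<Sum>l<k. w l * H\<^sup>T $$ (l, j))"
      using ij Hc by (intro ap) auto
    also have "\<dots> = (1\<^sub>m k :: real mat) $$ (i, j)" unfolding s using ij by (simp add: H_def)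
    finally show "(H * H\<^sup>T) $$ (i, j) = (1\<^sub>m k :: real mat) $$ (i, j)" .
  qed (use Hc in auto)
  then have "H \<in> orthogonal_group k" using Hc by (simp add: orthogonal_group_def)
  moreover have "(H * A) $$ (i, j) = 0" if "j < Suc r" "j < i" "i < k" for i j
  proof (cases "j = r")
    case True
    have "(\<Sum>l<k. w l * A $$ (l, j)) = (\<Sum>l<k. w l * x l)"
      using True by (intro sum.cong) (auto simp: x_def w_def)
    also have "\<dots> = W / 2" using wx Wv by simp
    finally have s: "(\<Sum>l<k. w l * A $$ (l, j)) = W / 2" .
    have "(H * A) $$ (i, j) = A $$ (i, j) - w i" using ap[OF A that(3), of j] that W0 unfolding s by simp
    also have "\<dots> = 0" using True that by (simp add: w_def x_def)
    finally show ?thesis .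
  next
    case False
    then have "j < r" using that by simp
    have "(\<Sum>l<k. w l * A $$ (l, j)) = 0"
      using z[OF \<open>j < r\<close>] \<open>j < r\<close> by (intro sum.neutral) (auto simp: w_def x_def)
    then show ?thesis using ap[OF A that(3), of j] that z[OF \<open>j < r\<close> that(2,3)] by simp
  qed
  ultimately show ?thesis by blast
qed

lemma orthogonal_group_mult:
  assumes "p \<in> orthogonal_group k" "q \<in> orthogonal_group k"
  shows "p * q \<in> orthogonal_group k"
proof -
  have c: "p \<in> carrier_mat k k" "q \<in> carrier_mat k k" "p * p\<^sup>T = 1\<^sub>m k" "q * q\<^sup>T = 1\<^sub>m k"
    using assms by (auto simp: orthogonal_group_def)
  have "(p * q) * (p * q)\<^sup>T = p * q * (q\<^sup>T * p\<^sup>T)" using c by (simp add: transpose_mult)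
  also have "\<dots> = p * (q * (q\<^sup>T * p\<^sup>T))" using c by (intro assoc_mult_mat) auto
  also have "q * (q\<^sup>T * p\<^sup>T) = q * q\<^sup>T * p\<^sup>T" using c by (intro assoc_mult_mat[symmetric]) auto
  finally have "(p * q) * (p * q)\<^sup>T = 1\<^sub>m k" using c by simp
  then show ?thesis using c by (simp add: orthogonal_group_def)
qed

lemma orthogonal_triangularise:
  fixes A :: "real mat"
  assumes "A \<in> carrier_mat k k" "r \<le> k"
  shows "\<exists>q\<in>orthogonal_group k. \<forall>i j. j < r \<longrightarrow> j < i \<longrightarrow> i < k \<longrightarrow> (q * A) $$ (i, j) = 0"
  using assms(2)
proof (induction r)
  case 0
  have "1\<^sub>m k \<in> orthogonal_group k" by (simp add: orthogonal_group_def)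
  then show ?case by blast
next
  case (Suc r)
  then obtain q where q: "q \<in> orthogonal_group k" "\<And>i j. j < r \<Longrightarrow> j < i \<Longrightarrow> i < k \<Longrightarrow> (q * A) $$ (i, j) = 0" by auto
  have c: "q \<in> carrier_mat k k" using q by (simp add: orthogonal_group_def)
  obtain H where H: "H \<in> orthogonal_group k" "\<forall>i j. j < Suc r \<longrightarrow> j < i \<longrightarrow> i < k \<longrightarrow> (H * (q * A)) $$ (i, j) = 0"
    using householder_step[of "q * A" k r] q(2) c assms(1) Suc.prems by auto
  have "H * (q * A) = (H * q) * A" using H(1) c assms(1) by (intro assoc_mult_mat[symmetric]) (auto simp: orthogonal_group_def)
  then show ?case using H orthogonal_group_mult[OF H(1) q(1)] by metis
qed

definition mf :: "'a mat \<Rightarrow> nat \<Rightarrow> nat \<Rightarrow> 'a" where "mf A = (\<lambda>i j. A $$ (i, j))"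

lemma mf_mult: "A \<in> carrier_mat k k \<Longrightarrow> B \<in> carrier_mat k k \<Longrightarrow> i < k \<Longrightarrow> j < k \<Longrightarrow> mf (A * B) i j = mm k (mf A) (mf B) i j"
  by (simp add: mf_def mm_def scalar_prod_def lessThan_atLeast0)

text \<open>The triangular factor absorbs the singularity of \<open>g\<close>, which is an arbitrary
  matrix.\<close>

lemma qr_decomposition:
  fixes g :: "nat \<Rightarrow> nat \<Rightarrow> real"
  obtains q b where "q \<in> orthogonal_group k" "\<And>i j. j < i \<Longrightarrow> i < k \<Longrightarrow> b i j = 0"
    "\<And>i j. i < k \<Longrightarrow> j < k \<Longrightarrow> g i j = mm k (mf q) b i j"
proof -
  define A where "A = mat k k (\<lambda>(i, j). g i j)"
  have A: "A \<in> carrier_mat k k" by (simp add: A_def)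
  obtain q where q: "q \<in> orthogonal_group k" "\<forall>i j. j < k \<longrightarrow> j < i \<longrightarrow> i < k \<longrightarrow> (q * A) $$ (i, j) = 0"
    using orthogonal_triangularise[OF A order_refl] by auto
  have c: "q \<in> carrier_mat k k" "q * q\<^sup>T = 1\<^sub>m k" using q(1) by (auto simp: orthogonal_group_def)
  have l: "q\<^sup>T * q = 1\<^sub>m k" using c mat_mult_left_right_inverse[of q k "q\<^sup>T"] by auto
  show ?thesis
  proof (rule that)
    show "q\<^sup>T \<in> orthogonal_group k" using c l by (simp add: orthogonal_group_def)
    show "mf (q * A) i j = 0" if "j < i" "i < k" for i j using q(2) that by (simp add: mf_def)
    show "g i j = mm k (mf q\<^sup>T) (mf (q * A)) i j" if "i < k" "j < k" for i j
    proof -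
      have "q\<^sup>T * (q * A) = q\<^sup>T * q * A" using c A by (intro assoc_mult_mat[symmetric]) auto
      also have "\<dots> = A" using l A by simp
      finally have "mf A i j = mm k (mf q\<^sup>T) (mf (q * A)) i j" using that c A by (simp flip: mf_mult)
      then show ?thesis using that by (simp add: A_def mf_def)
    qed
  qed
qed

text \<open>A diagram is closed under moving up and to the left, so upper triangular matrices send
  each of its boxes to a combination of boxes of the diagram that are not larger in the
  lexicographic order, as \<open>img_tri\<close> requires.\<close>

lemma ac_upper_diagram:
  assumes "lam \<in> box_partitions k m" "\<And>i j. j < i \<Longrightarrow> i < k \<Longrightarrow> g i j = 0" "\<And>i j. j < i \<Longrightarrow> i < m \<Longrightarrow> h i j = 0"
  shows "ac k m g h (bas (diagram lam)) =
    (\<lambda>B. (\<Prod>p\<in>diagram lam. g (fst p) (fst p) * h (snd p) (snd p)) * bas (diagram lam) B)"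
proof -
  let ?D = "diagram lam"
  have D: "?D \<subseteq> bx k m" "finite ?D" using diagram_bx[OF assms(1)] finite_subset bx_fin by blast+
  have "ac k m g h (bas ?D) = img (tens k m g h) ?D" using D by (simp add: ac_def act_bas)
  also have "\<dots> = (\<lambda>B. (\<Prod>p\<in>?D. tens k m g h p p) * bas ?D B)"
  proof (rule img_tri[OF D(2)])
    fix p q assume p: "p \<in> ?D" and nz: "tens k m g h p q \<noteq> 0"
    then have q: "q \<in> bx k m" "g (fst q) (fst p) \<noteq> 0" "h (snd q) (snd p) \<noteq> 0" by (auto simp: tens_def split: if_splits)
    then have le: "fst q \<le> fst p" "snd q \<le> snd p"
      using assms(2)[of "fst p" "fst q"] assms(3)[of "snd p" "snd q"] by (auto simp: bx_def not_less[symmetric])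
    then have "q \<in> ?D" using diagram_down[OF box_partitions_partitions[OF assms(1)], of "fst p" "snd p" "fst q" "snd q"] p by simp
    moreover have "q \<le> p" using le by (cases p, cases q) auto
    ultimately show "q \<in> ?D \<and> q \<le> p" ..
  qed
  also have "(\<Prod>p\<in>?D. tens k m g h p p) = (\<Prod>p\<in>?D. g (fst p) (fst p) * h (snd p) (snd p))"
    using D(1) by (intro prod.cong) (auto simp: tens_def)
  finally show ?thesis .
qed

section \<open>From polynomial mappings to coefficient functions\<close>

abbreviation lkp :: "ext \<Rightarrow> (nat \<times> nat) set \<Rightarrow> real" where "lkp \<equiv> Poly_Mapping.lookup"

lemma lookup_scale: "lkp (c *\<^sub>R u) A = c * lkp u A"
proof -
  have "finite {A. c *\<^sub>R lkp u A \<noteq> 0}"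
    by (rule finite_subset[of _ "Poly_Mapping.keys u"]) (auto simp: in_keys_iff)
  then show ?thesis by (simp add: scaleR_poly_mapping_def Abs_poly_mapping_inverse)
qed

lemma lookup_single_if: "lkp (Poly_Mapping.single A c) B = (if A = B then c else 0)"
  by (simp add: lookup_single when_def)

lemma lookup_wedge:
  assumes "finite X" "lkp u \<in> forms X" "lkp v \<in> forms X"
  shows "lkp (wedge u v) = wed (lkp u) (lkp v)"
proof
  fix C
  have k: "Poly_Mapping.keys u \<subseteq> Pow X" "Poly_Mapping.keys v \<subseteq> Pow X"
    using assms(2,3) by (auto simp: forms_def in_keys_iff)
  \<comment> \<open>The order on pairs is the lexicographic one, so the two sign conventions
    coincide.\<close>
  have s: "wedge_sign A B = wsgn A B" for A B :: "(nat \<times> nat) set"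
    by (simp add: wedge_sign_def wsgn_def lex_less_def less_prod_def')
  let ?f = "\<lambda>A B. if A \<inter> B = {} \<and> A \<union> B = C then wsgn A B * lkp u A * lkp v B else 0"
  have "lkp (wedge u v) C = (\<Sum>A\<in>Poly_Mapping.keys u. \<Sum>B\<in>Poly_Mapping.keys v. ?f A B)"
    unfolding wedge_def lookup_sum by (intro sum.cong refl) (auto simp: lookup_single_if s)
  also have "\<dots> = (\<Sum>A\<in>Pow X. \<Sum>B\<in>Poly_Mapping.keys v. ?f A B)"
    using k assms(1) by (intro sum.mono_neutral_left) (auto simp: in_keys_iff intro!: sum.neutral)
  also have "\<dots> = (\<Sum>A\<in>Pow X. \<Sum>B\<in>Pow X. ?f A B)"
    using k assms(1) by (intro sum.cong refl sum.mono_neutral_left) (auto simp: in_keys_iff)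
  also have "\<dots> = (\<Sum>A\<in>Pow X. if A \<subseteq> C then wsgn A (C - A) * lkp u A * lkp v (C - A) else 0)"
  proof (intro sum.cong refl)
    fix A assume "A \<in> Pow X"
    have "?f A B = (if B = C - A then (if A \<subseteq> C then wsgn A (C - A) * lkp u A * lkp v (C - A) else 0) else 0)" for B
      by auto
    moreover have "lkp v (C - A) = 0" if "\<not> C - A \<subseteq> X" using assms(3) that by (rule formsD)
    ultimately show "(\<Sum>B\<in>Pow X. ?f A B) = (if A \<subseteq> C then wsgn A (C - A) * lkp u A * lkp v (C - A) else 0)"
      using assms(1) by (simp add: sum.delta)
  qed
  also have "\<dots> = wed (lkp u) (lkp v) C"
  proof (cases "finite C")
    case True
    have "wed (lkp u) (lkp v) C = (\<Sum>A\<in>Pow C \<inter> Pow X. wsgn A (C - A) * lkp u A * lkp v (C - A))"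
      unfolding wed_def using True formsD[OF assms(2)] by (intro sum.mono_neutral_right) auto
    also have "Pow C \<inter> Pow X = {A \<in> Pow X. A \<subseteq> C}" by auto
    finally show ?thesis using assms(1) by (simp only: sum.inter_filter finite_Pow_iff)
  next
    case False
    have "lkp v (C - A) = 0" if "A \<subseteq> X" for A
    proof (rule formsD[OF assms(3)])
      have "finite A" using that assms(1) finite_subset by blast
      then have "infinite (C - A)" using False by simp
      then show "\<not> C - A \<subseteq> X" using assms(1) finite_subset by blast
    qed
    then have "(\<Sum>A\<in>Pow X. if A \<subseteq> C then wsgn A (C - A) * lkp u A * lkp v (C - A) else 0) = 0"
      by (intro sum.neutral) auto
    then show ?thesis using False by (simp add: wed_def)
  qed
  finally show "lkp (wedge u v) C = wed (lkp u) (lkp v) C" .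
qed

lemma lm_one: "lm x (bas {}) C = (if \<exists>p. C = {p} then x (THE p. C = {p}) else 0)"
proof (cases "\<exists>p. C = {p}")
  case True
  then obtain p where "C = {p}" by blast
  then show ?thesis by (simp add: lm_def bas_def eps_min)
next
  case False
  then have "C - {p} \<noteq> {}" if "p \<in> C" for p using that by auto
  then show ?thesis using False by (auto simp: lm_def bas_def)
qed

lemma lookup_tensor_vec:
  assumes "dim_vec x = k" "dim_vec y = m"
  shows "lkp (tensor_vec x y) = lm (\<lambda>q. if q \<in> bx k m then x $ fst q * y $ snd q else 0) (bas {})"
proof
  fix C
  have e: "lkp (tensor_vec x y) C = (\<Sum>i<k. \<Sum>j<m. if {(i, j)} = C then x $ i * y $ j else 0)"
    unfolding tensor_vec_def lookup_sum assms lookup_single_if ..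
  show "lkp (tensor_vec x y) C = lm (\<lambda>q. if q \<in> bx k m then x $ fst q * y $ snd q else 0) (bas {}) C"
  proof (cases "\<exists>p. C = {p}")
    case True
    then obtain a b where C: "C = {(a, b)}" by auto
    have "lkp (tensor_vec x y) C = (\<Sum>i<k. if i = a then (\<Sum>j<m. if j = b then x $ i * y $ j else 0) else 0)"
      unfolding e unfolding C by (intro sum.cong refl) auto
    then show ?thesis by (auto simp: C lm_one)
  next
    case False
    then show ?thesis by (auto simp: e lm_one intro!: sum.neutral)
  qed
qed

lemma sorted_product:
  "sorted xs \<Longrightarrow> distinct xs \<Longrightarrow> sorted ys \<Longrightarrow> sorted (List.product xs ys :: ('a::linorder \<times> 'b::linorder) list)"
proof (induction xs)
  case (Cons x xs)
  have "sorted (map (Pair x) ys)" using Cons by (simp add: sorted_map)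
  moreover have "(x, y) \<le> (x', y')" if "x' \<in> set xs" for x' y y' using Cons that by (auto simp: less_le)
  ultimately show ?case using Cons by (auto simp: sorted_append)
qed simp

lemma filter_product:
  "filter (\<lambda>p. p \<in> A) (List.product [0..<k] [0..<m]) = sorted_list_of_set (A \<inter> bx k m)"
proof (rule sorted_distinct_set_unique)
  show "sorted (filter (\<lambda>p. p \<in> A) (List.product [0..<k] [0..<m]))"
    by (intro sorted_wrt_filter sorted_product) auto
  show "distinct (filter (\<lambda>p. p \<in> A) (List.product [0..<k] [0..<m]))"
    by (intro distinct_filter distinct_product) auto
qed (auto simp: bx_def)

text \<open>\<open>List.product\<close> lists the boxes lexicographically, so the product follows
  the sorted list in \<open>img\<close>. The accumulated form must stay inside the box for
  \<open>lookup_wedge\<close> to apply, hence the conjunction in the induction.\<close>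

lemma lookup_wedge_over:
  assumes "\<And>p. p \<in> bx k m \<Longrightarrow> lkp (x p) = lm (G p) (bas {})" "\<And>p q. G p q \<noteq> 0 \<Longrightarrow> q \<in> bx k m"
  shows "lkp (wedge_over k m A x) = img G (A \<inter> bx k m)"
proof -
  have "lkp (foldr (\<lambda>p. wedge (x p)) ps (Poly_Mapping.single {} 1)) = foldr (\<lambda>p. lm (G p)) ps (bas {}) \<and>
    foldr (\<lambda>p. lm (G p)) ps (bas {}) \<in> forms (bx k m)" if "set ps \<subseteq> bx k m" for ps
    using that
  proof (induction ps)
    case Nil
    then show ?case by (auto simp: bas_def lookup_single_if fun_eq_iff forms_def)
  next
    case (Cons p ps)
    let ?w = "foldr (\<lambda>p. lm (G p)) ps (bas {})"
    have f: "lm (G p) (bas {}) \<in> forms (bx k m)" using assms(2) by (intro lm_forms bas_forms) auto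
    have "lkp (wedge (x p) (foldr (\<lambda>p. wedge (x p)) ps (Poly_Mapping.single {} 1))) = wed (lm (G p) (bas {})) ?w"
      using Cons assms(1)[of p] f by (subst lookup_wedge[of "bx k m"]) auto
    also have "\<dots> = lm (G p) ?w" using Cons by (simp add: wed_lm wed_one[of "bx k m"])
    moreover have "lm (G p) ?w \<in> forms (bx k m)" by (rule lm_forms) (use Cons assms(2) in auto)
    ultimately show ?case by simp
  qed
  from this[of "sorted_list_of_set (A \<inter> bx k m)"] show ?thesis
    by (simp add: wedge_over_def filter_product img_def)
qed

lemma lookup_ext_action:
  assumes "g \<in> carrier_mat k k" "h \<in> carrier_mat m m" "lkp u \<in> forms (bx k m)"
  shows "lkp (ext_action k m g h u) = ac k m (mf g) (mf h) (lkp u)"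
proof
  fix B
  have k: "Poly_Mapping.keys u \<subseteq> Pow (bx k m)"
    using assms(3) by (auto simp: forms_def in_keys_iff)
  have w: "lkp (wedge_over k m A (\<lambda>(i, j). tensor_vec (g *\<^sub>v unit_vec k i) (h *\<^sub>v unit_vec m j))) = img (tens k m (mf g) (mf h)) (A \<inter> bx k m)" for A
  proof (rule lookup_wedge_over)
    fix p assume p: "p \<in> bx k m"
    obtain i j where ij: "p = (i, j)" "i < k" "j < m" using p by (cases p) auto
    have "lkp (tensor_vec (g *\<^sub>v unit_vec k i) (h *\<^sub>v unit_vec m j)) =
      lm (\<lambda>q. if q \<in> bx k m then (g *\<^sub>v unit_vec k i) $ fst q * (h *\<^sub>v unit_vec m j) $ snd q else 0) (bas {})"
      using assms by (intro lookup_tensor_vec) auto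
    also have "(\<lambda>q. if q \<in> bx k m then (g *\<^sub>v unit_vec k i) $ fst q * (h *\<^sub>v unit_vec m j) $ snd q else 0) = tens k m (mf g) (mf h) p"
      using assms ij by (auto simp: fun_eq_iff tens_def mf_def)
    finally show "lkp (case p of (i, j) \<Rightarrow> tensor_vec (g *\<^sub>v unit_vec k i) (h *\<^sub>v unit_vec m j)) = lm (tens k m (mf g) (mf h) p) (bas {})"
      using ij by simp
  qed (auto dest: tens_supp)
  have "lkp (ext_action k m g h u) B = (\<Sum>A\<in>Poly_Mapping.keys u. lkp u A * img (tens k m (mf g) (mf h)) (A \<inter> bx k m) B)"
    unfolding ext_action_def lookup_sum lookup_scale w ..
  also have "\<dots> = (\<Sum>A\<in>Poly_Mapping.keys u. lkp u A * img (tens k m (mf g) (mf h)) A B)"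
    using k by (intro sum.cong refl) (auto simp: Int_absorb2)
  also have "\<dots> = ac k m (mf g) (mf h) (lkp u) B"
    unfolding ac_def act_def using k by (intro sum.mono_neutral_left) (auto simp: in_keys_iff)
  finally show "lkp (ext_action k m g h u) B = ac k m (mf g) (mf h) (lkp u) B" .
qed

lemma lookup_schubert_vector:
  assumes "lam \<in> box_partitions k m"
  shows "lkp (schubert_vector k m lam) = bas (diagram lam)"
proof -
  have "lkp (schubert_vector k m lam) = img (tens k m idm idm) (diagram lam \<inter> bx k m)"
    unfolding schubert_vector_def
  proof (rule lookup_wedge_over)
    fix p assume p: "p \<in> bx k m"
    obtain i j where ij: "p = (i, j)" "i < k" "j < m" using p by (cases p) auto
    have "lkp (tensor_vec (unit_vec k i) (unit_vec m j)) =
      lm (\<lambda>q. if q \<in> bx k m then unit_vec k i $ fst q * unit_vec m j $ snd q else 0) (bas {})"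
      by (intro lookup_tensor_vec) auto
    also have "(\<lambda>q. if q \<in> bx k m then (unit_vec k i $ fst q :: real) * unit_vec m j $ snd q else 0) = tens k m idm idm p"
      using ij by (auto simp: fun_eq_iff tens_def idm_def)
    finally show "lkp (case p of (i, j) \<Rightarrow> tensor_vec (unit_vec k i) (unit_vec m j)) = lm (tens k m idm idm p) (bas {})"
      using ij by simp
  qed (auto dest: tens_supp)
  also have "\<dots> = ac k m idm idm (bas (diagram lam))"
    using diagram_bx[OF assms] by (simp add: ac_def act_bas Int_absorb2)
  finally show ?thesis using diagram_bx[OF assms] by (simp add: ac_id bas_forms)
qed

text \<open>The field is left open because nonvanishing is needed over the reals for the Schubert
  spans and over the complex numbers for the modules.\<close>

definition product_coeff :: "nat \<Rightarrow> nat \<Rightarrow> nat list \<Rightarrow> nat list \<Rightarrow> nat list \<Rightarrow> (nat \<Rightarrow> nat \<Rightarrow> 'a) \<Rightarrow> (nat \<Rightarrow> nat \<Rightarrow> 'a) \<Rightarrow>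
    (nat \<Rightarrow> nat \<Rightarrow> 'a) \<Rightarrow> (nat \<Rightarrow> nat \<Rightarrow> 'a) \<Rightarrow> 'a::field_char_0" where
  "product_coeff k m lam mu nu g h g' h' =
     wed (ac k m g h (bas (diagram lam))) (ac k m g' h' (bas (diagram mu))) (diagram nu)"

section \<open>Schubert spans as stable subspaces\<close>

lemma linc_image:
  assumes "Real_Vector_Spaces.subspace S"
  shows "linc (lkp ` S)"
  unfolding linc_def
proof (intro conjI ballI allI)
  have "lkp 0 = (\<lambda>_. 0)" by (simp add: fun_eq_iff)
  then show "(\<lambda>_. 0) \<in> lkp ` S" using subspace_0[OF assms] by (metis image_eqI)
next
  fix u v assume "u \<in> lkp ` S" "v \<in> lkp ` S"
  then obtain a b where "a \<in> S" "b \<in> S" "u = lkp a" "v = lkp b" by auto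
  then have "(\<lambda>A. u A + v A) = lkp (a + b)" "a + b \<in> S"
    using subspace_add[OF assms] by (auto simp: fun_eq_iff lookup_add)
  then show "(\<lambda>A. u A + v A) \<in> lkp ` S" by simp
next
  fix c u assume "u \<in> lkp ` S"
  then obtain a where "a \<in> S" "u = lkp a" by auto
  then have "(\<lambda>A. c * u A) = lkp (c *\<^sub>R a)" "c *\<^sub>R a \<in> S"
    using subspace_scale[OF assms] by (auto simp: fun_eq_iff lookup_scale)
  then show "(\<lambda>A. c * u A) \<in> lkp ` S" by simp
qed

lemma lookup_span:
  assumes "linc T" "\<And>x. x \<in> S \<Longrightarrow> lkp x \<in> T" "u \<in> Real_Vector_Spaces.span S"
  shows "lkp u \<in> T"
  using assms(3)
proof (induction rule: span_induct_alt)
  case base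
  have "lkp 0 = (\<lambda>_. 0)" by (simp add: fun_eq_iff)
  then show ?case using linc_zero[OF assms(1)] by simp
next
  case (step c x y)
  have "lkp (c *\<^sub>R x + y) = (\<lambda>A. c * lkp x A + lkp y A)" by (simp add: fun_eq_iff lookup_add lookup_scale)
  then show ?case using step assms(1,2) by (simp add: linc_add linc_scale)
qed

lemma schubert_span_orbit:
  assumes lam: "lam \<in> box_partitions k m"
  shows "ac k m g h (bas (diagram lam)) \<in> lkp ` schubert_span k m lam"
proof -
  have D: "bas (diagram lam) \<in> forms (bx k m)" using diagram_bx[OF lam] by (rule bas_forms)
  obtain q b where q: "q \<in> orthogonal_group k" "\<And>i j. j < i \<Longrightarrow> i < k \<Longrightarrow> b i j = 0"
    "\<And>i j. i < k \<Longrightarrow> j < k \<Longrightarrow> g i j = mm k (mf q) b i j" by (rule qr_decomposition[of k g]) (rule that)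
  obtain q' b' where q': "q' \<in> orthogonal_group m" "\<And>i j. j < i \<Longrightarrow> i < m \<Longrightarrow> b' i j = 0"
    "\<And>i j. i < m \<Longrightarrow> j < m \<Longrightarrow> h i j = mm m (mf q') b' i j" by (rule qr_decomposition[of m h]) (rule that)
  \<comment> \<open>The scalar by which the triangular factors act on the diagram. It may be zero,
    and the translate then is the zero form.\<close>
  define c where "c = (\<Prod>p\<in>diagram lam. b (fst p) (fst p) * b' (snd p) (snd p))"
  let ?e = "ext_action k m q q' (schubert_vector k m lam)"
  have l: "lkp ?e = ac k m (mf q) (mf q') (bas (diagram lam))"
    using q(1) q'(1) D by (subst lookup_ext_action) (auto simp: orthogonal_group_def lookup_schubert_vector[OF lam])
  have "?e \<in> schubert_span k m lam" unfolding schubert_span_def using q(1) q'(1) by (intro span_base) blast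
  then have "c *\<^sub>R ?e \<in> schubert_span k m lam" unfolding schubert_span_def by (rule span_scale)
  moreover have "ac k m g h (bas (diagram lam)) = ac k m (mm k (mf q) b) (mm m (mf q') b') (bas (diagram lam))"
    using q(3) q'(3) by (intro ac_cong)
  then have "ac k m g h (bas (diagram lam)) = ac k m (mf q) (mf q') (ac k m b b' (bas (diagram lam)))"
    by (simp add: ac_ac)
  then have "ac k m g h (bas (diagram lam)) = (\<lambda>A. c * ac k m (mf q) (mf q') (bas (diagram lam)) A)"
    using q(2) q'(2) by (simp add: ac_upper_diagram[OF lam] ac_scale c_def)
  then have "ac k m g h (bas (diagram lam)) = lkp (c *\<^sub>R ?e)"
    by (simp add: fun_eq_iff lookup_scale l)
  ultimately show ?thesis by simp
qed

text \<open>Reduces linear statements on the span to translates by arbitrary matrices, which compose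
  and transpose more freely than orthogonal ones.\<close>

lemma schubert_span_induct:
  assumes lam: "lam \<in> box_partitions k m" and T: "linc T" "\<And>g h. ac k m g h (bas (diagram lam)) \<in> T"
    and u: "u \<in> schubert_span k m lam"
  shows "lkp u \<in> T"
  using T(1) _ u[unfolded schubert_span_def]
proof (rule lookup_span)
  fix x assume "x \<in> {ext_action k m g h (schubert_vector k m lam) |g h. g \<in> orthogonal_group k \<and> h \<in> orthogonal_group m}"
  then obtain g h where "x = ext_action k m g h (schubert_vector k m lam)" "g \<in> orthogonal_group k" "h \<in> orthogonal_group m" by blast
  then have "lkp x = ac k m (mf g) (mf h) (bas (diagram lam))"
    by (simp add: lookup_ext_action orthogonal_group_def lookup_schubert_vector[OF lam] bas_forms[OF diagram_bx[OF lam]])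
  then show "lkp x \<in> T" using T(2) by simp
qed

lemma schubert_span_subspace: "Real_Vector_Spaces.subspace (schubert_span k m lam)"
  by (simp add: schubert_span_def)

lemma schubert_span_forms: "lam \<in> box_partitions k m \<Longrightarrow> u \<in> schubert_span k m lam \<Longrightarrow> lkp u \<in> forms (bx k m)"
  by (erule schubert_span_induct[OF _ linc_forms]) auto

lemma stab_schubert_span:
  assumes lam: "lam \<in> box_partitions k m"
  shows "stab k m (lkp ` schubert_span k m lam)"
proof -
  let ?S = "lkp ` schubert_span k m lam"
  have lin: "linc ?S" using schubert_span_subspace by (rule linc_image)
  have "ac k m g h (lkp u) \<in> ?S" if "u \<in> schubert_span k m lam" for g h u
  proof -
    have "lkp u \<in> {v. ac k m g h v \<in> ?S}"
      using lam _ _ that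
    proof (rule schubert_span_induct)
      show "linc {v. ac k m g h v \<in> ?S}"
        using lin by (auto simp: linc_def ac_add ac_scale ac_zero)
    qed (simp add: ac_ac schubert_span_orbit[OF lam])
    then show ?thesis by simp
  qed
  then show ?thesis using lin schubert_span_forms[OF lam] by (auto simp: stab_def)
qed

lemma schubert_span_diagram: "lam \<in> box_partitions k m \<Longrightarrow> bas (diagram lam) \<in> lkp ` schubert_span k m lam"
  using schubert_span_orbit[of lam k m idm idm] by (simp add: ac_id bas_forms diagram_bx)

lemma stab_wedge_space:
  assumes lam: "lam \<in> box_partitions k m" and mu: "mu \<in> box_partitions k m"
  shows "stab k m (lkp ` wedge_space (schubert_span k m lam) (schubert_span k m mu))" (is "stab k m (lkp ` ?T)")
proof -
  have lin: "linc (lkp ` ?T)" unfolding wedge_space_def by (intro linc_image) simp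
  have w: "lkp (wedge u v) = wed (lkp u) (lkp v)" if "u \<in> schubert_span k m lam" "v \<in> schubert_span k m mu" for u v
    using that schubert_span_forms lam mu by (intro lookup_wedge[of "bx k m"]) auto
  have f: "lkp u \<in> forms (bx k m)" if "u \<in> ?T" for u
    using linc_forms _ that[unfolded wedge_space_def]
    by (rule lookup_span) (use w schubert_span_forms lam mu in \<open>auto intro!: wed_forms\<close>)
  have s: "ac k m g h (lkp u) \<in> lkp ` ?T" if "u \<in> ?T" for u g h
  proof -
    have "lkp u \<in> {v. ac k m g h v \<in> lkp ` ?T}"
      using _ _ that[unfolded wedge_space_def]
    proof (rule lookup_span)
      show "linc {v. ac k m g h v \<in> lkp ` ?T}"
        using lin by (auto simp: linc_def ac_add ac_scale ac_zero)
      fix x assume "x \<in> {wedge u w |u w. u \<in> schubert_span k m lam \<and> w \<in> schubert_span k m mu}"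
      then obtain u v where uv: "x = wedge u v" "u \<in> schubert_span k m lam" "v \<in> schubert_span k m mu" by blast
      obtain u' where u': "u' \<in> schubert_span k m lam" "ac k m g h (lkp u) = lkp u'"
        using stab_schubert_span[OF lam] uv(2) unfolding stab_def by blast
      obtain v' where v': "v' \<in> schubert_span k m mu" "ac k m g h (lkp v) = lkp v'"
        using stab_schubert_span[OF mu] uv(3) unfolding stab_def by blast
      have "ac k m g h (lkp x) = lkp (wedge u' v')"
        using uv u' v' schubert_span_forms[OF lam] schubert_span_forms[OF mu] by (simp add: w ac_wed)
      moreover have "wedge u' v' \<in> ?T" unfolding wedge_space_def using u'(1) v'(1) by (intro span_base) blast
      ultimately show "lkp x \<in> {v. ac k m g h v \<in> lkp ` ?T}" by simp
    qed
    then show ?thesis by simp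
  qed
  show ?thesis unfolding stab_def using lin f s by auto
qed

lemma linc_coeff: "linc {v. v A = 0}" and linc_ip: "linc {v. ip X v w = 0}" "linc {v. ip X w v = 0}"
  by (auto simp: linc_def ip_def distrib_left distrib_right sum.distrib mult.left_commute mult.assoc sum_distrib_left[symmetric])

text \<open>If one coefficient is nonzero, \<open>stab_diagram_coeff\<close> cuts the monomial out
  of a product. If all vanish, the coefficient at the diagram is zero on all products by linearity
  in either factor, hence on their span.\<close>

lemma diagram_in_wedge_space:
  assumes lam: "lam \<in> box_partitions k m" and mu: "mu \<in> box_partitions k m" and nu: "nu \<in> box_partitions k m"
  shows "bas (diagram nu) \<in> lkp ` wedge_space (schubert_span k m lam) (schubert_span k m mu) \<longleftrightarrow>
    (\<exists>g h g' h'. product_coeff k m lam mu nu g h g' h' \<noteq> (0::real))" (is "?L \<longleftrightarrow> ?R")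
proof
  let ?T = "wedge_space (schubert_span k m lam) (schubert_span k m mu)"
  have w: "lkp (wedge u v) = wed (lkp u) (lkp v)" if "u \<in> schubert_span k m lam" "v \<in> schubert_span k m mu" for u v
    using that schubert_span_forms lam mu by (intro lookup_wedge[of "bx k m"]) auto
  {
    assume ?R
    then obtain g h g' h' where nz: "product_coeff k m lam mu nu g h g' h' \<noteq> (0::real)" by blast
    obtain u where u: "u \<in> schubert_span k m lam" "ac k m g h (bas (diagram lam)) = lkp u"
      using schubert_span_orbit[OF lam] by blast
    obtain v where v: "v \<in> schubert_span k m mu" "ac k m g' h' (bas (diagram mu)) = lkp v"
      using schubert_span_orbit[OF mu] by blast
    have "wedge u v \<in> ?T" unfolding wedge_space_def using u(1) v(1) by (intro span_base) blast
    then have "wed (lkp u) (lkp v) \<in> lkp ` ?T" using u v w by (metis image_eqI)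
    then show ?L using nz u v
      by (intro stab_diagram_coeff[OF stab_wedge_space[OF lam mu] _ nu]) (auto simp: product_coeff_def)
  }
  assume ?L
  show ?R
  proof (rule ccontr)
    assume "\<not> ?R"
    then have z: "wed (ac k m g h (bas (diagram lam))) (ac k m g' h' (bas (diagram mu))) (diagram nu) = (0::real)" for g h g' h'
      by (simp add: product_coeff_def)
    have z1: "wed (lkp u) (ac k m g' h' (bas (diagram mu))) (diagram nu) = 0" if "u \<in> schubert_span k m lam" for u g' h'
    proof -
      have "lkp u \<in> {v. wed v (ac k m g' h' (bas (diagram mu))) (diagram nu) = 0}"
        using lam _ _ that by (rule schubert_span_induct) (auto simp: z linc_def wed_add wed_scale, simp add: wed_def)
      then show ?thesis by simp
    qed
    have z2: "wed (lkp u) (lkp v) (diagram nu) = 0" if "u \<in> schubert_span k m lam" "v \<in> schubert_span k m mu" for u v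
    proof -
      have "lkp v \<in> {v. wed (lkp u) v (diagram nu) = 0}"
        using mu _ _ that(2) by (rule schubert_span_induct) (auto simp: z1[OF that(1)] linc_def wed_addr wed_scaler, simp add: wed_def)
      then show ?thesis by simp
    qed
    have "lkp u \<in> {v. v (diagram nu) = 0}" if "u \<in> ?T" for u
      using linc_coeff _ that[unfolded wedge_space_def] by (rule lookup_span) (auto simp: w z2)
    then have "bas (diagram nu) (diagram nu) = (0::real)" using \<open>?L\<close> by auto
    then show False by (simp add: bas_def)
  qed
qed

lemma schubert_span_orth:
  assumes lam: "lam \<in> box_partitions k m" and mu: "mu \<in> box_partitions k m" and ne: "lam \<noteq> mu"
    and u: "u \<in> schubert_span k m lam" and v: "v \<in> schubert_span k m mu"
  shows "ip (bx k m) (lkp u) (lkp v) = 0"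
proof -
  have "lkp v \<in> {w. ip (bx k m) (lkp u) w = 0}" using mu linc_ip(2) _ v
  proof (rule schubert_span_induct)
    fix g h
    have "lkp u \<in> {w. ip (bx k m) w (ac k m g h (bas (diagram mu))) = 0}" using lam linc_ip(1) _ u
    proof (rule schubert_span_induct)
      fix g' h'
      \<comment> \<open>Transposing the second pair of matrices onto the first factor leaves a
        single translate, which is the case of \<open>ac_orth\<close>.\<close>
      have "ip (bx k m) (ac k m g' h' (bas (diagram lam))) (ac k m g h (bas (diagram mu))) = (0::real)"
        by (subst ip_sym, subst ac_adj) (simp add: ac_ac ip_sym[of _ "bas _"] ac_orth[OF lam mu ne])
      then show "ac k m g' h' (bas (diagram lam)) \<in> {w. ip (bx k m) w (ac k m g h (bas (diagram mu))) = 0}" by simp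
    qed
    then show "ac k m g h (bas (diagram mu)) \<in> {w. ip (bx k m) (lkp u) w = 0}" by simp
  qed
  then show ?thesis by simp
qed

lemma ip_self: "lkp u \<in> forms X \<Longrightarrow> finite X \<Longrightarrow> ip X (lkp u) (lkp u) = 0 \<Longrightarrow> u = 0"
proof (rule poly_mapping_eqI)
  fix A assume a: "lkp u \<in> forms X" "finite X" "ip X (lkp u) (lkp u) = 0"
  then have "\<forall>A\<in>Pow X. lkp u A * lkp u A = 0" unfolding ip_def by (subst (asm) sum_nonneg_eq_0_iff) auto
  then show "lkp u A = lkp 0 A" using formsD[OF a(1)] by (cases "A \<subseteq> X") auto
qed

lemma finite_box_partitions: "finite (box_partitions k m)"
  by (rule finite_subset[OF _ finite_lists_length_eq[of "{..m}" k]]) (auto simp: box_partitions_def partitions_def)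

lemma lookup_sum': "lkp (\<Sum>i\<in>I. f i) = (\<lambda>A. \<Sum>i\<in>I. lkp (f i) A)"
  by (simp add: lookup_sum fun_eq_iff)

text \<open>The sums of elements of the spans form a stable subspace containing every diagram, so
  \<open>stab_generated\<close> leaves nothing outside.\<close>

lemma schubert_spans_generate:
  assumes "u \<in> forms (bx k m)"
  shows "\<exists>w. (\<forall>nu\<in>box_partitions k m. w nu \<in> schubert_span k m nu) \<and> u = lkp (\<Sum>nu\<in>box_partitions k m. w nu)"
proof -
  let ?B = "box_partitions k m"
  let ?T = "{u. \<exists>w. (\<forall>nu\<in>?B. w nu \<in> schubert_span k m nu) \<and> u = lkp (\<Sum>nu\<in>?B. w nu)}"
  have "linc ?T" unfolding linc_def
  proof (intro conjI ballI allI)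
    have "\<forall>nu\<in>?B. 0 \<in> schubert_span k m nu" by (simp add: schubert_span_def span_zero)
    moreover have "(\<lambda>_. 0) = lkp (\<Sum>nu\<in>?B. 0)" by (simp add: fun_eq_iff)
    ultimately show "(\<lambda>_. 0) \<in> ?T" by (intro CollectI exI[of _ "\<lambda>_. 0"] conjI)
  next
    fix u v assume "u \<in> ?T" "v \<in> ?T"
    then obtain w w' where "\<forall>nu\<in>?B. w nu \<in> schubert_span k m nu" "u = lkp (\<Sum>nu\<in>?B. w nu)"
      "\<forall>nu\<in>?B. w' nu \<in> schubert_span k m nu" "v = lkp (\<Sum>nu\<in>?B. w' nu)" by blast
    then have "\<forall>nu\<in>?B. w nu + w' nu \<in> schubert_span k m nu" "(\<lambda>A. u A + v A) = lkp (\<Sum>nu\<in>?B. w nu + w' nu)"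
      by (auto simp: schubert_span_def span_add sum.distrib lookup_add fun_eq_iff)
    then show "(\<lambda>A. u A + v A) \<in> ?T" by (intro CollectI exI[of _ "\<lambda>nu. w nu + w' nu"] conjI)
  next
    fix c u assume "u \<in> ?T"
    then obtain w where "\<forall>nu\<in>?B. w nu \<in> schubert_span k m nu" "u = lkp (\<Sum>nu\<in>?B. w nu)" by blast
    then have "\<forall>nu\<in>?B. c *\<^sub>R w nu \<in> schubert_span k m nu" "(\<lambda>A. c * u A) = lkp (\<Sum>nu\<in>?B. c *\<^sub>R w nu)"
      by (auto simp: schubert_span_def span_scale lookup_sum' lookup_scale sum_distrib_left fun_eq_iff)
    then show "(\<lambda>A. c * u A) \<in> ?T" by (intro CollectI exI[of _ "\<lambda>nu. c *\<^sub>R w nu"] conjI)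
  qed
  moreover have "?T \<subseteq> forms (bx k m)"
    by (auto simp: lookup_sum' intro!: linc_sum[OF linc_forms] schubert_span_forms)
  moreover have "ac k m g h u \<in> ?T" if "u \<in> ?T" for g h u
  proof -
    from CollectD[OF that] obtain w where w: "\<forall>nu\<in>?B. w nu \<in> schubert_span k m nu" "u = lkp (\<Sum>nu\<in>?B. w nu)"
      by (elim exE conjE)
    have "\<forall>nu\<in>?B. \<exists>x. x \<in> schubert_span k m nu \<and> ac k m g h (lkp (w nu)) = lkp x"
      using w(1) stab_schubert_span unfolding stab_def by blast
    then obtain w' where "\<forall>nu\<in>?B. w' nu \<in> schubert_span k m nu \<and> ac k m g h (lkp (w nu)) = lkp (w' nu)" by metis
    then have "\<forall>nu\<in>?B. w' nu \<in> schubert_span k m nu" "ac k m g h u = lkp (\<Sum>nu\<in>?B. w' nu)"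
      by (auto simp: w(2) lookup_sum' ac_sum)
    then show ?thesis by blast
  qed
  ultimately have st: "stab k m ?T" unfolding stab_def by blast
  have "bas (diagram nu) \<in> ?T" if nu: "nu \<in> ?B" for nu
  proof -
    obtain x where x: "x \<in> schubert_span k m nu" "bas (diagram nu) = lkp x" using schubert_span_diagram[OF nu] by blast
    let ?w = "\<lambda>kap. if kap = nu then x else 0"
    have "\<forall>kap\<in>?B. ?w kap \<in> schubert_span k m kap" using x by (auto simp: schubert_span_def span_zero)
    moreover have "(\<Sum>kap\<in>?B. ?w kap) = x" using nu finite_box_partitions by simp
    ultimately show ?thesis using x(2) by force
  qed
  then have b: "bas A \<in> ?T" if "A \<subseteq> bx k m" for A using stab_generated[OF st] that by blast
  have "(\<lambda>B. \<Sum>A\<in>Pow (bx k m). u A * bas A B) \<in> ?T"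
    using st b by (intro linc_sum linc_scale) (auto simp: stab_def)
  then show ?thesis using forms_expand[OF bx_fin assms] by simp
qed

text \<open>The index set is turned into the set of diagrams whose monomials lie in the product.
  Mutual orthogonality gives independence, and it isolates the components of an element, so that
  each nonzero component forces its diagram into the product.\<close>

theorem schubert_wedge_decomposition:
  assumes lam: "lam \<in> box_partitions k m" and mu: "mu \<in> box_partitions k m"
  shows "internal_direct_sum {nu \<in> box_partitions k m. \<exists>g h g' h'. product_coeff k m lam mu nu g h g' h' \<noteq> (0::real)}
    (schubert_span k m) (wedge_space (schubert_span k m lam) (schubert_span k m mu))"
proof -
  let ?T = "wedge_space (schubert_span k m lam) (schubert_span k m mu)" and ?B = "box_partitions k m"
  define I where "I = {nu \<in> ?B. bas (diagram nu) \<in> lkp ` ?T}"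
  have I: "{nu \<in> ?B. \<exists>g h g' h'. product_coeff k m lam mu nu g h g' h' \<noteq> (0::real)} = I"
    unfolding I_def using diagram_in_wedge_space[OF lam mu] by blast
  have IB: "I \<subseteq> ?B" "finite I" using finite_box_partitions by (auto simp: I_def)
  have st: "stab k m (lkp ` ?T)" by (rule stab_wedge_space[OF lam mu])
  have sub: "Real_Vector_Spaces.subspace ?T" by (simp add: wedge_space_def)
  have T1: "w \<in> ?T" if "nu \<in> I" "w \<in> schubert_span k m nu" for nu w
  proof -
    have "lkp w \<in> lkp ` ?T"
      using _ _ _ that(2) by (rule schubert_span_induct) (use that st in \<open>auto simp: I_def stab_def\<close>)
    then show ?thesis by (auto simp: lookup_inject)
  qed
  have "u \<in> {\<Sum>i\<in>I. w i |w. \<forall>i\<in>I. w i \<in> schubert_span k m i}" if u: "u \<in> ?T" for u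
  proof -
    have "lkp u \<in> forms (bx k m)" using st u by (auto simp: stab_def)
    then obtain w where w: "\<forall>nu\<in>?B. w nu \<in> schubert_span k m nu" "lkp u = lkp (\<Sum>nu\<in>?B. w nu)"
      using schubert_spans_generate by blast
    then have u_eq: "u = (\<Sum>nu\<in>?B. w nu)" by (simp add: lookup_inject)
    have "nu \<in> I" if nu: "nu \<in> ?B" "w nu \<noteq> 0" for nu
    proof -
      have wf: "lkp (w nu) \<in> forms (bx k m)" using w nu schubert_span_forms by blast
      \<comment> \<open>Otherwise the component would be orthogonal to its own Schubert span, in
        particular to itself, against positive definiteness over the reals.\<close>
      obtain g h where gh: "ip (bx k m) (ac k m g h (bas (diagram nu))) (lkp (w nu)) \<noteq> 0"
      proof (rule ccontr)
        assume "\<not> thesis"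
        then have "\<forall>g h. ip (bx k m) (ac k m g h (bas (diagram nu))) (lkp (w nu)) = 0" using that by blast
        then have "lkp (w nu) \<in> {v. ip (bx k m) v (lkp (w nu)) = 0}"
          using nu(1) linc_ip(1) w(1) by (intro schubert_span_induct[of nu k m]) auto
        then show False using ip_self[OF wf bx_fin] nu(2) by simp
      qed
      let ?v = "ac k m g h (bas (diagram nu))"
      have "ip (bx k m) ?v (lkp u) = (\<Sum>kap\<in>?B. ip (bx k m) ?v (lkp (w kap)))"
        unfolding w(2) lookup_sum' ip_def by (simp add: sum_distrib_left) (rule sum.swap)
      also have "\<dots> = (\<Sum>kap\<in>?B. if kap = nu then ip (bx k m) ?v (lkp (w nu)) else 0)"
      proof (intro sum.cong refl)
        fix kap assume kap: "kap \<in> ?B"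
        obtain x where x: "x \<in> schubert_span k m nu" "?v = lkp x" using schubert_span_orbit[OF nu(1)] by blast
        show "ip (bx k m) ?v (lkp (w kap)) = (if kap = nu then ip (bx k m) ?v (lkp (w nu)) else 0)"
          using schubert_span_orth[OF nu(1) kap _ x(1)] w(1) kap x(2) by auto
      qed
      also have "\<dots> \<noteq> 0" using gh nu(1) finite_box_partitions by simp
      \<comment> \<open>Transposing the pair onto \<open>u\<close> exhibits an element of the stable
        product space with a nonzero coefficient at \<open>nu\<close>.\<close>
      finally have "ip (bx k m) (bas (diagram nu)) (ac k m (\<lambda>i j. g j i) (\<lambda>i j. h j i) (lkp u)) \<noteq> 0"
        by (simp add: ac_adj)
      then have "ac k m (\<lambda>i j. g j i) (\<lambda>i j. h j i) (lkp u) (diagram nu) \<noteq> 0"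
        using diagram_bx[OF nu(1)] by (simp add: ip_sym[of _ "bas _"] ip_bas)
      moreover have "ac k m (\<lambda>i j. g j i) (\<lambda>i j. h j i) (lkp u) \<in> lkp ` ?T" using st u by (auto simp: stab_def)
      ultimately have "bas (diagram nu) \<in> lkp ` ?T" using stab_diagram_coeff[OF st _ nu(1)] by blast
      then show ?thesis using nu by (simp add: I_def)
    qed
    then have "u = (\<Sum>nu\<in>I. w nu)"
      unfolding u_eq using finite_box_partitions IB by (intro sum.mono_neutral_right) auto
    then show ?thesis using w(1) IB by blast
  qed
  moreover have "(\<Sum>i\<in>I. w i) \<in> ?T" if "\<forall>i\<in>I. w i \<in> schubert_span k m i" for w
    using that T1 by (intro subspace_sum[OF sub]) auto
  ultimately have U: "?T = {\<Sum>i\<in>I. w i |w. \<forall>i\<in>I. w i \<in> schubert_span k m i}" by auto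
  have indep: "w i = 0" if w: "\<forall>i\<in>I. w i \<in> schubert_span k m i" "(\<Sum>i\<in>I. w i) = 0" "i \<in> I" for w i
  proof -
    have "ip (bx k m) (lkp (w i)) (lkp (w i)) = (\<Sum>j\<in>I. if j = i then ip (bx k m) (lkp (w i)) (lkp (w i)) else 0)"
      using w(3) IB by simp
    also have "\<dots> = (\<Sum>j\<in>I. ip (bx k m) (lkp (w i)) (lkp (w j)))"
    proof (intro sum.cong refl)
      fix j assume "j \<in> I"
      then show "(if j = i then ip (bx k m) (lkp (w i)) (lkp (w i)) else 0) = ip (bx k m) (lkp (w i)) (lkp (w j))"
        using w IB schubert_span_orth[of i k m j "w i" "w j"] by (cases "j = i") auto
    qed
    also have "\<dots> = ip (bx k m) (lkp (w i)) (lkp (\<Sum>j\<in>I. w j))"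
      unfolding lookup_sum' ip_def by (simp add: sum_distrib_left) (rule sum.swap)
    also have "\<dots> = 0" using w(2) by (simp add: ip_def)
    finally show ?thesis using w IB by (intro ip_self[of _ "bx k m"] schubert_span_forms[of i]) auto
  qed
  show ?thesis unfolding I internal_direct_sum_def
    using IB(2) schubert_span_subspace U indep by blast
qed

subsection \<open>Highest weight vectors and covectors\<close>

definition wt :: "nat \<Rightarrow> nat list \<Rightarrow> complex mat \<Rightarrow> complex" where
  "wt k kap t = (\<Prod>i<k. t $$ (i, i) ^ (kap ! i))"

definition hwv :: "nat \<Rightarrow> module_data \<Rightarrow> nat list \<Rightarrow> complex vec \<Rightarrow> bool" where
  "hwv k M kap v \<longleftrightarrow> v \<in> carrier_vec (fst M) \<and>
     (\<forall>t\<in>carrier (GL k). diagonal_mat t \<longrightarrow> snd M t *\<^sub>v v = wt k kap t \<cdot>\<^sub>v v) \<and>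
     (\<forall>u\<in>carrier (GL k). upper_triangular u \<and> (\<forall>i<k. u $$ (i, i) = 1) \<longrightarrow> snd M u *\<^sub>v v = v)"

text \<open>A functional written as a vector. Invariance is under lower unitriangular matrices,
  opposite to \<open>hwv\<close>, so that functional and vector together control the values on
  products of a lower, a diagonal and an upper triangular matrix.\<close>

definition covv :: "nat \<Rightarrow> module_data \<Rightarrow> nat list \<Rightarrow> complex vec \<Rightarrow> bool" where
  "covv k M kap y \<longleftrightarrow> y \<in> carrier_vec (fst M) \<and>
     (\<forall>t\<in>carrier (GL k). diagonal_mat t \<longrightarrow> (\<forall>x\<in>carrier_vec (fst M). y \<bullet> (snd M t *\<^sub>v x) = wt k kap t * (y \<bullet> x))) \<and>
     (\<forall>l\<in>carrier (GL k). upper_triangular (l\<^sup>T) \<and> (\<forall>i<k. l $$ (i, i) = 1) \<longrightarrow>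
        (\<forall>x\<in>carrier_vec (fst M). y \<bullet> (snd M l *\<^sub>v x) = y \<bullet> x))"

lemma has_highest_weight_hwv: "has_highest_weight k kap M \<longleftrightarrow> (\<exists>v. v \<noteq> 0\<^sub>v (fst M) \<and> hwv k M kap v)"
  by (cases M) (auto simp: has_highest_weight_def hwv_def wt_def)

lemma GL_iff: "g \<in> carrier (GL k) \<longleftrightarrow> g \<in> carrier_mat k k \<and> (\<exists>h\<in>carrier_mat k k. h * g = 1\<^sub>m k \<and> g * h = 1\<^sub>m k)"
  by (auto simp: GL_def units_of_def Units_def ring_mat_def)

lemma GL_carrier: "g \<in> carrier (GL k) \<Longrightarrow> g \<in> carrier_mat k k"
  by (simp add: GL_iff)

lemma GL_mult [simp]: "g \<otimes>\<^bsub>GL k\<^esub> h = g * h" and GL_one [simp]: "\<one>\<^bsub>GL k\<^esub> = 1\<^sub>m k"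
  by (simp_all add: GL_def units_of_def ring_mat_def)

lemma GL_group: "group (GL k)"
  unfolding GL_def by (rule monoid.units_group) (rule ring.is_monoid[OF ring_mat])

lemma GL_det: "g \<in> carrier_mat k k \<Longrightarrow> det g \<noteq> 0 \<Longrightarrow> g \<in> carrier (GL k)"
  using det_non_zero_imp_unit[of g k "()"] by (simp add: GL_def units_of_def)

lemma GL_upper:
  assumes "g \<in> carrier_mat k k" "upper_triangular g" "\<And>i. i < k \<Longrightarrow> g $$ (i, i) \<noteq> 0"
  shows "g \<in> carrier (GL k)"
proof (rule GL_det[OF assms(1)])
  show "det g \<noteq> 0" using assms by (subst det_upper_triangular[OF assms(2,1)]) (auto simp: prod_list_zero_iff diag_mat_def)
qed

lemma GL_lower:
  assumes "g \<in> carrier_mat k k" "upper_triangular (g\<^sup>T)" "\<And>i. i < k \<Longrightarrow> g $$ (i, i) \<noteq> 0"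
  shows "g \<in> carrier (GL k)"
proof (rule GL_det[OF assms(1)])
  have "det (g\<^sup>T) \<noteq> 0" using assms
    by (subst det_upper_triangular[OF assms(2), of k]) (auto simp: prod_list_zero_iff diag_mat_def)
  then show "det g \<noteq> 0" using det_transpose[OF assms(1)] by simp
qed

lemma GL_mult_closed: "g \<in> carrier (GL k) \<Longrightarrow> h \<in> carrier (GL k) \<Longrightarrow> g * h \<in> carrier (GL k)"
  using monoid.m_closed[OF group.is_monoid[OF GL_group], of g k h] by simp

lemma GL_one_closed: "1\<^sub>m k \<in> carrier (GL k)"
  using monoid.one_closed[OF group.is_monoid[OF GL_group], of k] by simp

lemma GL_transpose: "g \<in> carrier (GL k) \<Longrightarrow> g\<^sup>T \<in> carrier (GL k)"
proof -
  assume "g \<in> carrier (GL k)"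
  then obtain h where h: "g \<in> carrier_mat k k" "h \<in> carrier_mat k k" "h * g = 1\<^sub>m k" "g * h = 1\<^sub>m k" by (auto simp: GL_iff)
  have "g\<^sup>T * h\<^sup>T = 1\<^sub>m k" "h\<^sup>T * g\<^sup>T = 1\<^sub>m k"
    by (metis h transpose_mult transpose_one)+
  then show ?thesis using h by (auto simp: GL_iff intro!: bexI[of _ "h\<^sup>T"])
qed

lemma mv_index: "A \<in> carrier_mat r n \<Longrightarrow> x \<in> carrier_vec n \<Longrightarrow> i < r \<Longrightarrow> (A *\<^sub>v x) $ i = (\<Sum>j<n. A $$ (i, j) * x $ j)"
  by (auto simp: scalar_prod_def lessThan_atLeast0 intro!: sum.cong)

lemma mm_index: "A \<in> carrier_mat r n \<Longrightarrow> B \<in> carrier_mat n q \<Longrightarrow> i < r \<Longrightarrow> j < q \<Longrightarrow>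
    (A * B) $$ (i, j) = (\<Sum>l<n. A $$ (i, l) * B $$ (l, j))"
  by (auto simp: scalar_prod_def lessThan_atLeast0 intro!: sum.cong)

lemma sp_sum: "x \<in> carrier_vec n \<Longrightarrow> y \<bullet> x = (\<Sum>j<n. y $ j * x $ j)"
  by (auto simp: scalar_prod_def lessThan_atLeast0)

section \<open>Zariski density of the big cell\<close>

lemma poly_cofinite_eq:
  fixes p q :: "complex poly"
  assumes "finite F" "\<And>s. s \<notin> F \<Longrightarrow> poly p s = poly q s"
  shows "p = q"
proof (rule ccontr)
  assume "p \<noteq> q"
  then have "finite {s. poly (p - q) s = 0}" by (intro poly_roots_finite) simp
  moreover have "- F \<subseteq> {s. poly (p - q) s = 0}" using assms(2) by auto
  ultimately have "finite (- F)" by (rule rev_finite_subset)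
  then show False using assms(1) by (metis finite_compl infinite_UNIV_char_0)
qed

lemma polyfun_curve:
  assumes "p \<in> polynomial_functions k" "\<And>i j. i < k \<Longrightarrow> j < k \<Longrightarrow> \<exists>q. \<forall>s. c s $$ (i, j) = poly q s"
  shows "\<exists>q. \<forall>s. p (c s) = poly q s"
  using assms(1)
proof induction
  case (const c)
  show ?case by (rule exI[of _ "[:c:]"]) simp
next
  case (add p q)
  then obtain a b where "\<forall>s. p (c s) = poly a s" "\<forall>s. q (c s) = poly b s" by blast
  then show ?case by (intro exI[of _ "a + b"]) simp
next
  case (mult p q)
  then obtain a b where "\<forall>s. p (c s) = poly a s" "\<forall>s. q (c s) = poly b s" by blast
  then show ?case by (intro exI[of _ "a * b"]) simp
qed (use assms(2) in auto)

text \<open>Along a line the function is a polynomial in \<open>s\<close>; if it vanishes for almost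
  all \<open>s\<close>, it vanishes at \<open>s = 0\<close>.\<close>

lemma polyfun_affine_zero:
  assumes "p \<in> polynomial_functions k" "l \<in> carrier_mat k k" "A \<in> carrier_mat k k" "E \<in> carrier_mat k k"
    "finite F" "\<And>s. s \<notin> F \<Longrightarrow> p (l * (A + s \<cdot>\<^sub>m E)) = 0"
  shows "p (l * A) = 0"
proof -
  have e: "l * (A + s \<cdot>\<^sub>m E) = l * A + s \<cdot>\<^sub>m (l * E)" for s
    using assms by (simp add: mult_add_distrib_mat[of l k k] mult_smult_distrib)
  have "\<exists>q. \<forall>s. p (l * (A + s \<cdot>\<^sub>m E)) = poly q s"
  proof (rule polyfun_curve[OF assms(1)])
    fix i j assume "i < k" "j < k"
    then show "\<exists>q. \<forall>s. (l * (A + s \<cdot>\<^sub>m E)) $$ (i, j) = poly q s"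
      unfolding e using assms by (intro exI[of _ "[:(l * A) $$ (i, j), (l * E) $$ (i, j):]"]) (auto simp: algebra_simps)
  qed
  then obtain q where q: "\<forall>s. p (l * (A + s \<cdot>\<^sub>m E)) = poly q s" by blast
  have "q = 0" using assms(5) by (rule poly_cofinite_eq) (use q assms(6) in auto)
  then have "p (l * (A + 0 \<cdot>\<^sub>m E)) = 0" using q by simp
  moreover have "A + 0 \<cdot>\<^sub>m E = A" using assms by (intro eq_matI) auto
  ultimately show ?thesis by simp
qed

text \<open>Gaussian elimination can only fail when a pivot vanishes, and a vanishing pivot is
  perturbed away along a line; so the big cell is Zariski dense.\<close>

lemma big_cell_dense:
  assumes p: "p \<in> polynomial_functions k"
    and z: "\<And>l d u. l \<in> carrier_mat k k \<Longrightarrow> upper_triangular (l\<^sup>T) \<Longrightarrow> (\<forall>i<k. l $$ (i, i) = 1) \<Longrightarrow>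
      d \<in> carrier_mat k k \<Longrightarrow> diagonal_mat d \<Longrightarrow> (\<forall>i<k. d $$ (i, i) \<noteq> 0) \<Longrightarrow>
      u \<in> carrier_mat k k \<Longrightarrow> upper_triangular u \<Longrightarrow> (\<forall>i<k. u $$ (i, i) = 1) \<Longrightarrow> p (l * d * u) = 0"
    and g: "g \<in> carrier_mat k k"
  shows "p g = 0"
proof -
  \<comment> \<open>An invertible upper triangular matrix is a diagonal matrix times a unitriangular
    one.\<close>
  have A1: "p (l * A) = 0" if l: "l \<in> carrier_mat k k" "upper_triangular (l\<^sup>T)" "\<forall>i<k. l $$ (i, i) = 1"
    and A: "A \<in> carrier_mat k k" "upper_triangular A" "\<forall>i<k. A $$ (i, i) \<noteq> 0" for l A
  proof -
    define d where "d = mat k k (\<lambda>(i, j). if i = j then A $$ (i, i) else 0)"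
    define u where "u = mat k k (\<lambda>(i, j). A $$ (i, j) / A $$ (i, i))"
    have c: "d \<in> carrier_mat k k" "u \<in> carrier_mat k k" by (auto simp: d_def u_def)
    have "d * u = A"
    proof (rule eq_matI)
      fix i j assume "i < dim_row A" "j < dim_col A"
      then have ij: "i < k" "j < k" using A by auto
      have "(d * u) $$ (i, j) = (\<Sum>l<k. d $$ (i, l) * u $$ (l, j))" by (rule mm_index[OF c ij])
      also have "\<dots> = (\<Sum>l<k. (if i = l then 1 else 0) * (A $$ (i, i) * (A $$ (l, j) / A $$ (l, l))))"
        using ij by (intro sum.cong) (auto simp: d_def u_def)
      finally have e: "(d * u) $$ (i, j) = (\<Sum>l<k. (if i = l then 1 else 0) * (A $$ (i, i) * (A $$ (l, j) / A $$ (l, l))))" .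
      show "(d * u) $$ (i, j) = A $$ (i, j)" unfolding e using ij A(3) by (subst sum_pick) simp_all
    qed (use A c in auto)
    moreover have "l * d * u = l * (d * u)" using l c by (intro assoc_mult_mat) auto
    moreover have "p (l * d * u) = 0"
      by (rule z) (use l A c in \<open>auto simp: d_def u_def diagonal_mat_def upper_triangular_def\<close>)
    ultimately show ?thesis by simp
  qed
  \<comment> \<open>Zero diagonal entries disappear on adding a multiple of the identity, for all
    but finitely many multiples.\<close>
  have A2: "p (l * A) = 0" if l: "l \<in> carrier_mat k k" "upper_triangular (l\<^sup>T)" "\<forall>i<k. l $$ (i, i) = 1"
    and A: "A \<in> carrier_mat k k" "upper_triangular A" for l A
  proof (rule polyfun_affine_zero[OF p l(1) A(1) one_carrier_mat])
    show "finite ((\<lambda>i. - A $$ (i, i)) ` {..<k})" by simp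
    fix s assume s: "s \<notin> (\<lambda>i. - A $$ (i, i)) ` {..<k}"
    show "p (l * (A + s \<cdot>\<^sub>m 1\<^sub>m k)) = 0"
    proof (rule A1[OF l])
      show "\<forall>i<k. (A + s \<cdot>\<^sub>m 1\<^sub>m k) $$ (i, i) \<noteq> 0"
      proof (intro allI impI)
        fix i assume i: "i < k"
        then have "s \<noteq> - A $$ (i, i)" using s by blast
        then show "(A + s \<cdot>\<^sub>m 1\<^sub>m k) $$ (i, i) \<noteq> 0" using A i by (simp add: add_eq_0_iff)
      qed
    qed (use A in \<open>auto simp: upper_triangular_def\<close>)
  qed
  \<comment> \<open>\<open>r\<close> counts the last columns that are not yet cleared below the
    diagonal. Clearing one of them moves a lower unitriangular factor into \<open>l\<close>.\<close>
  have A3: "p (l * A) = 0" if l: "l \<in> carrier_mat k k" "upper_triangular (l\<^sup>T)" "\<forall>i<k. l $$ (i, i) = 1"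
    and A: "A \<in> carrier_mat k k" "\<And>i j. j + r < k \<Longrightarrow> j < i \<Longrightarrow> i < k \<Longrightarrow> A $$ (i, j) = 0" for l A r
    using that
  proof (induction r arbitrary: l A)
    case 0
    then show ?case by (intro A2) (auto simp: upper_triangular_def)
  next
    case (Suc r)
    show ?case
    proof (cases "Suc r \<le> k")
      case False
      then show ?thesis using Suc.IH[OF Suc.prems(1-4)] by auto
    next
      case True
      define c where "c = k - Suc r"
      have ck: "c < k" "c + r < k" using True by (auto simp: c_def)
      \<comment> \<open>Only the pivot of column \<open>c\<close>, the first column not yet cleared,
        is perturbed.\<close>
      define E where "E = mat k k (\<lambda>(i, j). if i = c \<and> j = c then 1 else 0 :: complex)"
      have E: "E \<in> carrier_mat k k" by (simp add: E_def)
      note A = Suc.prems(4)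
      have z': "A $$ (i, j) = 0" if "j < c" "j < i" "i < k" for i j
        using Suc.prems(5)[of j i] that by (auto simp: c_def)
      show ?thesis
      proof (rule polyfun_affine_zero[OF p Suc.prems(1) A E])
        show "finite {- A $$ (c, c)}" by simp
        fix s assume "s \<notin> {- A $$ (c, c)}"
        then have pv: "A $$ (c, c) + s \<noteq> 0" by (auto simp: add_eq_0_iff2)
        define As where "As = A + s \<cdot>\<^sub>m E"
        have As: "As \<in> carrier_mat k k" using A E by (simp add: As_def)
        have Ase: "As $$ (i, j) = A $$ (i, j) + (if i = c \<and> j = c then s else 0)" if "i < k" "j < k" for i j
          using that A by (simp add: As_def E_def)
        \<comment> \<open>The multipliers of the elimination in column \<open>c\<close>:
          \<open>y\<close> is lower unitriangular, \<open>B\<close> has the column cleared, and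
          \<open>y * B = As\<close>.\<close>
        define f where "f = (\<lambda>i. if c < i then As $$ (i, c) / As $$ (c, c) else 0)"
        define y where "y = mat k k (\<lambda>(i, j). (if i = j then 1 else 0) + (if j = c then f i else 0))"
        define B where "B = mat k k (\<lambda>(i, j). As $$ (i, j) - f i * As $$ (c, j))"
        have cy: "y \<in> carrier_mat k k" "B \<in> carrier_mat k k" by (auto simp: y_def B_def)
        have f0: "f c = 0" "i \<le> c \<Longrightarrow> f i = 0" for i by (auto simp: f_def)
        have "y * B = As"
        proof (rule eq_matI)
          fix i j assume "i < dim_row As" "j < dim_col As"
          then have ij: "i < k" "j < k" using As by auto
          have "(y * B) $$ (i, j) = (\<Sum>l<k. y $$ (i, l) * B $$ (l, j))" by (rule mm_index[OF cy ij])
          also have "\<dots> = (\<Sum>l<k. (if i = l then 1 else 0) * B $$ (l, j) + (if l = c then 1 else 0) * (f i * B $$ (l, j)))"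
            using ij by (intro sum.cong) (auto simp: y_def algebra_simps)
          also have "\<dots> = B $$ (i, j) + f i * B $$ (c, j)" using ij ck by (simp add: sum.distrib sum_pick)
          also have "\<dots> = As $$ (i, j)" using ij ck f0 by (simp add: B_def)
          finally show "(y * B) $$ (i, j) = As $$ (i, j)" .
        qed (use As cy in auto)
        then have e: "l * As = (l * y) * B" using Suc.prems(1) cy by simp
        have ly: "(l * y) $$ (i, j) = l $$ (i, j) + (if j = c then (\<Sum>a<k. l $$ (i, a) * f a) else 0)" if "i < k" "j < k" for i j
        proof -
          have "(l * y) $$ (i, j) = (\<Sum>a<k. l $$ (i, a) * y $$ (a, j))" by (rule mm_index[OF Suc.prems(1) cy(1) that])
          also have "\<dots> = (\<Sum>a<k. l $$ (i, a) * (if a = j then 1 else 0) + (if j = c then l $$ (i, a) * f a else 0))"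
            using that by (intro sum.cong) (auto simp: y_def algebra_simps)
          finally show ?thesis using that by (simp add: sum.distrib sum_pick)
        qed
        have l0: "l $$ (i, a) = 0" if "i < a" "a < k" for i a
          using Suc.prems(2) Suc.prems(1) that by (auto simp: upper_triangular_def)
        have s0: "(\<Sum>a<k. l $$ (i, a) * f a) = 0" if "i \<le> c" "i < k" for i
        proof (rule sum.neutral, safe)
          fix a assume "a < k"
          then show "l $$ (i, a) * f a = 0" using l0[of i a] f0(2)[of a] that by (cases "a \<le> c") auto
        qed
        show "p (l * (A + s \<cdot>\<^sub>m E)) = 0" unfolding As_def[symmetric] e
        proof (rule Suc.IH)
          show "l * y \<in> carrier_mat k k" "B \<in> carrier_mat k k" using Suc.prems(1) cy by auto
          show "upper_triangular ((l * y)\<^sup>T)"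
            unfolding upper_triangular_def
          proof (intro allI impI)
            fix i j assume "i < dim_row (l * y)\<^sup>T" "j < i"
            then have ij: "i < k" "j < k" "j < i" using Suc.prems(1) cy by auto
            then have "(l * y) $$ (j, i) = 0" using l0 s0 by (simp only: ly) auto
            then show "(l * y)\<^sup>T $$ (i, j) = 0" using ij Suc.prems(1) cy by simp
          qed
          show "\<forall>i<k. (l * y) $$ (i, i) = 1" 
          proof (intro allI impI)
            fix i assume "i < k"
            then show "(l * y) $$ (i, i) = 1" using Suc.prems(3) s0[of i] by (cases "i = c") (simp_all only: ly, auto)
          qed
          fix i j assume ij: "j + r < k" "j < i" "i < k"
          then have "j \<le> c" by (auto simp: c_def)
          then show "B $$ (i, j) = 0"
          proof (cases "j = c")
            case True
            have "As $$ (c, c) \<noteq> 0" using pv ck by (simp add: Ase)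
            then show ?thesis using True ij by (simp add: B_def f_def)
          next
            case False
            then have "j < c" using \<open>j \<le> c\<close> by simp
            then show ?thesis using ij ck z'[of j i] z'[of j c] by (simp add: B_def Ase)
          qed
        qed
      qed
    qed
  qed
  have "p (1\<^sub>m k * g) = 0" by (rule A3[where r = k]) (use g in \<open>auto simp: upper_triangular_def\<close>)
  then show ?thesis using g by simp
qed

section \<open>Polynomial modules and their matrix coefficients\<close>

lemma subspaceI:
  assumes "W \<subseteq> carrier_vec n" "0\<^sub>v n \<in> W" "\<And>v w. v \<in> W \<Longrightarrow> w \<in> W \<Longrightarrow> v + w \<in> W"
    "\<And>c v. v \<in> W \<Longrightarrow> c \<cdot>\<^sub>v v \<in> W"
  shows "VectorSpace.subspace class_ring W (module_vec TYPE(complex) n)"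
  unfolding subspace_def submodule_def using assms
  by (auto simp: vec_vs vec_module module_vec_simps)

lemma simple_moduleD:
  assumes "simple_module k M" "W \<subseteq> carrier_vec (fst M)" "0\<^sub>v (fst M) \<in> W"
    "\<And>v w. v \<in> W \<Longrightarrow> w \<in> W \<Longrightarrow> v + w \<in> W" "\<And>c v. v \<in> W \<Longrightarrow> c \<cdot>\<^sub>v v \<in> W"
    "\<And>g v. g \<in> carrier (GL k) \<Longrightarrow> v \<in> W \<Longrightarrow> snd M g *\<^sub>v v \<in> W"
  shows "W = {0\<^sub>v (fst M)} \<or> W = carrier_vec (fst M)"
  using assms(1) subspaceI[OF assms(2-5)] assms(6) unfolding simple_module_def by (cases M) auto

lemma pm_carrier: "polynomial_module k M \<Longrightarrow> g \<in> carrier (GL k) \<Longrightarrow> snd M g \<in> carrier_mat (fst M) (fst M)"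
  by (cases M) (auto simp: polynomial_module_def hom_def GL_iff)

lemma pm_mult: "polynomial_module k M \<Longrightarrow> g \<in> carrier (GL k) \<Longrightarrow> h \<in> carrier (GL k) \<Longrightarrow> snd M (g * h) = snd M g * snd M h"
  by (cases M) (auto simp: polynomial_module_def hom_def)

lemma pm_one: "polynomial_module k M \<Longrightarrow> snd M (1\<^sub>m k) = 1\<^sub>m (fst M)"
proof -
  assume "polynomial_module k M"
  then have "snd M \<in> hom (GL k) (GL (fst M))" by (cases M) (simp add: polynomial_module_def)
  from hom_one[OF this GL_group GL_group] show ?thesis by simp
qed

lemma pm_entry: "polynomial_module k M \<Longrightarrow> i < fst M \<Longrightarrow> j < fst M \<Longrightarrow>
    \<exists>p\<in>polynomial_functions k. \<forall>g\<in>carrier (GL k). snd M g $$ (i, j) = p g"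
  by (cases M) (auto simp: polynomial_module_def)

lemma pm_vec: "polynomial_module k M \<Longrightarrow> g \<in> carrier (GL k) \<Longrightarrow> x \<in> carrier_vec (fst M) \<Longrightarrow> snd M g *\<^sub>v x \<in> carrier_vec (fst M)"
  using pm_carrier mult_mat_vec_carrier by blast

lemma pm_mult_vec: "polynomial_module k M \<Longrightarrow> g \<in> carrier (GL k) \<Longrightarrow> h \<in> carrier (GL k) \<Longrightarrow> x \<in> carrier_vec (fst M) \<Longrightarrow>
    snd M (g * h) *\<^sub>v x = snd M g *\<^sub>v (snd M h *\<^sub>v x)"
  using pm_carrier[of k M g] pm_carrier[of k M h] by (simp add: pm_mult)

lemma polyfun_sum: "finite I \<Longrightarrow> (\<And>i. i \<in> I \<Longrightarrow> f i \<in> polynomial_functions k) \<Longrightarrow> (\<lambda>g. \<Sum>i\<in>I. f i g) \<in> polynomial_functions k"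
  by (induction I rule: finite_induct) (auto intro: polynomial_functions.intros)

lemma pm_coeff:
  assumes "polynomial_module k M" "x \<in> carrier_vec (fst M)"
  shows "\<exists>p\<in>polynomial_functions k. \<forall>g\<in>carrier (GL k). y \<bullet> (snd M g *\<^sub>v x) = p g"
proof -
  let ?n = "fst M"
  obtain p where p: "\<And>i j. i < ?n \<Longrightarrow> j < ?n \<Longrightarrow> p i j \<in> polynomial_functions k \<and> (\<forall>g\<in>carrier (GL k). snd M g $$ (i, j) = p i j g)"
    using pm_entry[OF assms(1)] by metis
  let ?p = "\<lambda>g. \<Sum>i<?n. y $ i * (\<Sum>j<?n. p i j g * x $ j)"
  have "?p \<in> polynomial_functions k"
  proof (rule polyfun_sum[OF finite_lessThan])
    fix i assume "i \<in> {..<?n}"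
    then have "(\<lambda>g. \<Sum>j<?n. p i j g * x $ j) \<in> polynomial_functions k"
      by (intro polyfun_sum[OF finite_lessThan] polynomial_functions.mult[OF _ polynomial_functions.const]) (use p in auto)
    then show "(\<lambda>g. y $ i * (\<Sum>j<?n. p i j g * x $ j)) \<in> polynomial_functions k"
      by (rule polynomial_functions.mult[OF polynomial_functions.const])
  qed
  moreover have "y \<bullet> (snd M g *\<^sub>v x) = ?p g" if g: "g \<in> carrier (GL k)" for g
  proof -
    have "y \<bullet> (snd M g *\<^sub>v x) = (\<Sum>i<?n. y $ i * (snd M g *\<^sub>v x) $ i)"
      using pm_vec[OF assms(1) g assms(2)] by (rule sp_sum)
    also have "\<dots> = ?p g"
    proof (intro sum.cong refl arg_cong[of _ _ "(*) _"])
      fix i assume i: "i \<in> {..<?n}"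
      have "(snd M g *\<^sub>v x) $ i = (\<Sum>j<?n. snd M g $$ (i, j) * x $ j)"
        using i by (intro mv_index[OF pm_carrier[OF assms(1) g] assms(2)]) simp
      also have "\<dots> = (\<Sum>j<?n. p i j g * x $ j)" using p g i by (intro sum.cong) auto
      finally show "(snd M g *\<^sub>v x) $ i = (\<Sum>j<?n. p i j g * x $ j)" .
    qed
    finally show ?thesis .
  qed
  ultimately show ?thesis by (intro bexI[of _ ?p] ballI)
qed

lemma GL_diagonal: "diagonal_mat d \<Longrightarrow> d \<in> carrier_mat k k \<Longrightarrow> (\<forall>i<k. d $$ (i, i) \<noteq> 0) \<Longrightarrow> d \<in> carrier (GL k)"
  by (rule GL_upper) (auto simp: diagonal_mat_def upper_triangular_def)

text \<open>The upper factor fixes \<open>v\<close>, the lower one is invisible to \<open>y\<close>,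
  and the diagonal one acts by the weight of \<open>v\<close>.\<close>

lemma pairing_big_cell:
  assumes M: "polynomial_module k M" and v: "hwv k M kap v" and y: "covv k M kap' y"
    and l: "l \<in> carrier_mat k k" "upper_triangular (l\<^sup>T)" "\<forall>i<k. l $$ (i, i) = 1"
    and d: "d \<in> carrier_mat k k" "diagonal_mat d" "\<forall>i<k. d $$ (i, i) \<noteq> 0"
    and u: "u \<in> carrier_mat k k" "upper_triangular u" "\<forall>i<k. u $$ (i, i) = 1"
  shows "l * d * u \<in> carrier (GL k)" "y \<bullet> (snd M (l * d * u) *\<^sub>v v) = wt k kap d * (y \<bullet> v)"
proof -
  have G: "l \<in> carrier (GL k)" "d \<in> carrier (GL k)" "u \<in> carrier (GL k)"
    using GL_lower[OF l(1,2)] GL_upper[OF u(1,2)] GL_diagonal[OF d(2,1,3)] l(3) u(3) by auto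
  then show "l * d * u \<in> carrier (GL k)" by (intro GL_mult_closed)
  have vc: "v \<in> carrier_vec (fst M)" "y \<in> carrier_vec (fst M)" using v y by (auto simp: hwv_def covv_def)
  have "snd M (l * d * u) *\<^sub>v v = snd M (l * d) *\<^sub>v v"
    using G v u vc by (simp add: pm_mult_vec[OF M GL_mult_closed] hwv_def)
  also have "\<dots> = snd M l *\<^sub>v (snd M d *\<^sub>v v)" using G vc by (simp add: pm_mult_vec[OF M])
  finally have e: "snd M (l * d * u) *\<^sub>v v = snd M l *\<^sub>v (snd M d *\<^sub>v v)" .
  have "y \<bullet> (snd M l *\<^sub>v (snd M d *\<^sub>v v)) = y \<bullet> (snd M d *\<^sub>v v)"
    using y l G pm_vec[OF M G(2) vc(1)] by (auto simp: covv_def)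
  also have "\<dots> = wt k kap d * (y \<bullet> v)" using v d G vc by (auto simp: hwv_def)
  finally show "y \<bullet> (snd M (l * d * u) *\<^sub>v v) = wt k kap d * (y \<bullet> v)" unfolding e .
qed

text \<open>The matrix coefficient is a polynomial function that vanishes on the big cell by
  \<open>pairing_big_cell\<close>, so \<open>big_cell_dense\<close> applies.\<close>

lemma pairing_zero:
  assumes M: "polynomial_module k M" and v: "hwv k M kap v" and y: "covv k M kap' y" and z: "y \<bullet> v = 0"
    and g: "g \<in> carrier (GL k)"
  shows "y \<bullet> (snd M g *\<^sub>v v) = 0"
proof -
  have vc: "v \<in> carrier_vec (fst M)" using v by (simp add: hwv_def)
  obtain p where p: "p \<in> polynomial_functions k" "\<forall>g\<in>carrier (GL k). y \<bullet> (snd M g *\<^sub>v v) = p g"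
    using pm_coeff[OF M vc] by blast
  have "p g = 0"
  proof (rule big_cell_dense[OF p(1) _ GL_carrier[OF g]])
    fix l d u :: "complex mat"
    assume "l \<in> carrier_mat k k" "upper_triangular (l\<^sup>T)" "\<forall>i<k. l $$ (i, i) = 1"
      "d \<in> carrier_mat k k" "diagonal_mat d" "\<forall>i<k. d $$ (i, i) \<noteq> 0"
      "u \<in> carrier_mat k k" "upper_triangular u" "\<forall>i<k. u $$ (i, i) = 1"
    from pairing_big_cell[OF M v y this] show "p (l * d * u) = 0" using p(2) z by simp
  qed
  then show ?thesis using p(2) g by simp
qed

section \<open>One parameter groups and existence of highest weight vectors\<close>

lemma pow_coeffs:
  fixes a b :: "nat \<Rightarrow> complex"
  assumes "finite F" "\<And>s. s \<notin> F \<Longrightarrow> (\<Sum>d\<le>D. s ^ d * a d) = (\<Sum>d\<le>D. s ^ d * b d)" "d \<le> D"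
  shows "a d = b d"
proof -
  have "(\<Sum>d\<le>D. monom (a d) d) = (\<Sum>d\<le>D. monom (b d) d)"
    using assms(1) by (rule poly_cofinite_eq) (use assms(2) in \<open>simp add: poly_sum poly_monom mult.commute\<close>)
  then have "coeff (\<Sum>d\<le>D. monom (a d) d) d = coeff (\<Sum>d\<le>D. monom (b d) d) d" by simp
  then show ?thesis using assms(3) by (simp add: coeff_sum)
qed

text \<open>\<open>Ms d\<close> collects the coefficients of \<open>s ^ d\<close> in all matrix
  entries. The set \<open>S\<close> of parameters is kept open because the curve may leave the group
  at some of them.\<close>

lemma curve_expand:
  assumes M: "polynomial_module k M" and S: "\<And>s. s \<in> S \<Longrightarrow> c s \<in> carrier (GL k)"
    and c: "\<And>i j. i < k \<Longrightarrow> j < k \<Longrightarrow> \<exists>q. \<forall>s. c s $$ (i, j) = poly q s"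
  shows "\<exists>D Ms. (\<forall>d. Ms d \<in> carrier_mat (fst M) (fst M)) \<and>
     (\<forall>x\<in>carrier_vec (fst M). \<forall>s\<in>S. \<forall>i<fst M. (snd M (c s) *\<^sub>v x) $ i = (\<Sum>d\<le>D. s ^ d * (Ms d *\<^sub>v x) $ i))"
proof -
  let ?n = "fst M"
  have "\<exists>q. \<forall>s\<in>S. snd M (c s) $$ (i, j) = poly q s" if ij: "i < ?n" "j < ?n" for i j
  proof -
    obtain p where p: "p \<in> polynomial_functions k" "\<forall>g\<in>carrier (GL k). snd M g $$ (i, j) = p g"
      using pm_entry[OF M ij] by blast
    obtain q where "\<forall>s. p (c s) = poly q s" using polyfun_curve[OF p(1)] c by blast
    then show ?thesis using p(2) S by auto
  qed
  then obtain q where q: "\<And>i j. i < ?n \<Longrightarrow> j < ?n \<Longrightarrow> \<forall>s\<in>S. snd M (c s) $$ (i, j) = poly (q i j) s" by metis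
  define D where "D = (\<Sum>i<?n. \<Sum>j<?n. degree (q i j))"
  define Ms where "Ms = (\<lambda>d. mat ?n ?n (\<lambda>(i, j). coeff (q i j) d))"
  have deg: "degree (q i j) \<le> D" if "i < ?n" "j < ?n" for i j
  proof -
    have "degree (q i j) \<le> (\<Sum>j<?n. degree (q i j))" using that by (intro member_le_sum) auto
    also have "\<dots> \<le> D" unfolding D_def using that by (intro member_le_sum) auto
    finally show ?thesis .
  qed
  have Mc: "Ms d \<in> carrier_mat ?n ?n" for d by (simp add: Ms_def)
  have "(snd M (c s) *\<^sub>v x) $ i = (\<Sum>d\<le>D. s ^ d * (Ms d *\<^sub>v x) $ i)"
    if x: "x \<in> carrier_vec ?n" and s: "s \<in> S" and i: "i < ?n" for x s i
  proof -
    have "(snd M (c s) *\<^sub>v x) $ i = (\<Sum>j<?n. snd M (c s) $$ (i, j) * x $ j)"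
      by (rule mv_index[OF pm_carrier[OF M S[OF s]] x i])
    also have "\<dots> = (\<Sum>j<?n. \<Sum>d\<le>D. s ^ d * (coeff (q i j) d * x $ j))"
    proof (intro sum.cong refl)
      fix j assume j: "j \<in> {..<?n}"
      have "poly (q i j) s = (\<Sum>d\<le>D. coeff (q i j) d * s ^ d)"
        unfolding poly_altdef using deg[of i j] i j by (intro sum.mono_neutral_left) (auto simp: coeff_eq_0)
      then show "snd M (c s) $$ (i, j) * x $ j = (\<Sum>d\<le>D. s ^ d * (coeff (q i j) d * x $ j))"
        using q[of i j] i j s by (simp add: sum_distrib_left sum_distrib_right mult_ac)
    qed
    also have "\<dots> = (\<Sum>d\<le>D. s ^ d * (\<Sum>j<?n. coeff (q i j) d * x $ j))"
      by (subst sum.swap) (simp add: sum_distrib_left)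
    also have "\<dots> = (\<Sum>d\<le>D. s ^ d * (Ms d *\<^sub>v x) $ i)"
    proof (intro sum.cong refl arg_cong[of _ _ "(*) _"])
      fix d
      have "(Ms d *\<^sub>v x) $ i = (\<Sum>j<?n. Ms d $$ (i, j) * x $ j)" by (rule mv_index[OF Mc x i])
      also have "\<dots> = (\<Sum>j<?n. coeff (q i j) d * x $ j)" using i by (intro sum.cong) (auto simp: Ms_def)
      finally show "(\<Sum>j<?n. coeff (q i j) d * x $ j) = (Ms d *\<^sub>v x) $ i" by simp
    qed
    finally show ?thesis .
  qed
  then show ?thesis using Mc by blast
qed

lemma mv_sum:
  fixes C :: "complex mat"
  assumes "C \<in> carrier_mat r n" "\<And>d. w d \<in> carrier_vec n" "y \<in> carrier_vec n"
    "\<And>i. i < n \<Longrightarrow> y $ i = (\<Sum>d\<le>(D::nat). a d * w d $ i)" "i < r"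
  shows "(C *\<^sub>v y) $ i = (\<Sum>d\<le>D. a d * (C *\<^sub>v w d) $ i)"
proof -
  have "(C *\<^sub>v y) $ i = (\<Sum>j<n. \<Sum>d\<le>D. a d * (C $$ (i, j) * w d $ j))"
    unfolding mv_index[OF assms(1,3,5)] using assms(4)
    by (intro sum.cong refl) (simp add: sum_distrib_left mult.left_commute)
  also have "\<dots> = (\<Sum>d\<le>D. a d * (C *\<^sub>v w d) $ i)"
    by (subst sum.swap) (simp add: sum_distrib_left mv_index[OF assms(1,2,5)] del: index_mult_mat_vec)
  finally show ?thesis .
qed

text \<open>The matrices \<open>Ms d\<close> extract the components of a vector in the weight spaces
  of the one parameter group \<open>c\<close>. The last clause says that a linear condition valid
  along the orbit of \<open>x\<close> holds for each weight component of \<open>x\<close>; it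
  carries stability and commutation properties over to the components.\<close>

definition torus_weights :: "module_data \<Rightarrow> (complex \<Rightarrow> complex mat) \<Rightarrow> nat \<Rightarrow> (nat \<Rightarrow> complex mat) \<Rightarrow> bool" where
  "torus_weights M c D Ms \<longleftrightarrow> (\<forall>d. Ms d \<in> carrier_mat (fst M) (fst M)) \<and>
     (\<forall>x\<in>carrier_vec (fst M). \<forall>s. s \<noteq> 0 \<longrightarrow> (\<forall>i<fst M. (snd M (c s) *\<^sub>v x) $ i = (\<Sum>d\<le>D. s ^ d * (Ms d *\<^sub>v x) $ i))) \<and>
     (\<forall>x\<in>carrier_vec (fst M). \<forall>i<fst M. x $ i = (\<Sum>d\<le>D. (Ms d *\<^sub>v x) $ i)) \<and>
     (\<forall>x\<in>carrier_vec (fst M). \<forall>d\<le>D. \<forall>s. s \<noteq> 0 \<longrightarrow> snd M (c s) *\<^sub>v (Ms d *\<^sub>v x) = s ^ d \<cdot>\<^sub>v (Ms d *\<^sub>v x)) \<and>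
     (\<forall>x\<in>carrier_vec (fst M). \<forall>r. \<forall>C\<in>carrier_mat r (fst M). (\<forall>s. s \<noteq> 0 \<longrightarrow> C *\<^sub>v (snd M (c s) *\<^sub>v x) = 0\<^sub>v r) \<longrightarrow>
        (\<forall>d\<le>D. C *\<^sub>v (Ms d *\<^sub>v x) = 0\<^sub>v r))"

text \<open>The eigenvector property comes from expanding \<open>c s * c s' = c (s * s')\<close> in
  powers of \<open>s'\<close>, the transport of linear conditions from comparing coefficients in
  \<open>s\<close>, and the sum of the components from \<open>s = 1\<close>.\<close>

lemma torus_expand:
  assumes M: "polynomial_module k M" and G: "\<And>s. s \<noteq> 0 \<Longrightarrow> c s \<in> carrier (GL k)"
    and c: "\<And>i j. i < k \<Longrightarrow> j < k \<Longrightarrow> \<exists>q. \<forall>s. c s $$ (i, j) = poly q s"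
    and mul: "\<And>s s'. s \<noteq> 0 \<Longrightarrow> s' \<noteq> 0 \<Longrightarrow> c s * c s' = c (s * s')" and one: "c 1 = 1\<^sub>m k"
  shows "\<exists>D Ms. torus_weights M c D Ms"
proof -
  let ?n = "fst M"
  have "\<exists>D Ms. (\<forall>d. Ms d \<in> carrier_mat ?n ?n) \<and>
     (\<forall>x\<in>carrier_vec ?n. \<forall>s\<in>- {0}. \<forall>i<?n. (snd M (c s) *\<^sub>v x) $ i = (\<Sum>d\<le>D. s ^ d * (Ms d *\<^sub>v x) $ i))"
    by (rule curve_expand[OF M _ c]) (use G in auto)
  then obtain D Ms where *: "\<forall>d. Ms d \<in> carrier_mat ?n ?n"
     "\<forall>x\<in>carrier_vec ?n. \<forall>s\<in>- {0}. \<forall>i<?n. (snd M (c s) *\<^sub>v x) $ i = (\<Sum>d\<le>D. s ^ d * (Ms d *\<^sub>v x) $ i)"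
    by (elim exE conjE)
  have Mc: "\<And>d. Ms d \<in> carrier_mat ?n ?n" using *(1) by simp
  have e: "\<And>x s i. x \<in> carrier_vec ?n \<Longrightarrow> s \<noteq> 0 \<Longrightarrow> i < ?n \<Longrightarrow> (snd M (c s) *\<^sub>v x) $ i = (\<Sum>d\<le>D. s ^ d * (Ms d *\<^sub>v x) $ i)"
    using *(2) by simp
  have Mx: "Ms d *\<^sub>v x \<in> carrier_vec ?n" if "x \<in> carrier_vec ?n" for d x using Mc that by (rule mult_mat_vec_carrier)
  have C: "C *\<^sub>v (Ms d *\<^sub>v x) = 0\<^sub>v r" if x: "x \<in> carrier_vec ?n" and C: "C \<in> carrier_mat r ?n"
    and z: "\<And>s. s \<noteq> 0 \<Longrightarrow> C *\<^sub>v (snd M (c s) *\<^sub>v x) = 0\<^sub>v r" and d: "d \<le> D" for x C r d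
  proof (rule eq_vecI)
    fix i assume "i < dim_vec (0\<^sub>v r :: complex vec)"
    then have i: "i < r" by simp
    have "(C *\<^sub>v (Ms d *\<^sub>v x)) $ i = 0"
    proof (rule pow_coeffs[where F = "{0}" and D = D and b = "\<lambda>_. 0", OF _ _ d])
      fix s :: complex assume "s \<notin> {0}"
      then have s: "s \<noteq> 0" by simp
      have "(\<Sum>d\<le>D. s ^ d * (C *\<^sub>v (Ms d *\<^sub>v x)) $ i) = (C *\<^sub>v (snd M (c s) *\<^sub>v x)) $ i"
        using e[OF x s] by (intro mv_sum[OF C Mx[OF x] pm_vec[OF M G[OF s] x] _ i, symmetric])
      then show "(\<Sum>d\<le>D. s ^ d * (C *\<^sub>v (Ms d *\<^sub>v x)) $ i) = (\<Sum>d\<le>D. s ^ d * 0)" using z[OF s] i by simp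
    qed simp
    then show "(C *\<^sub>v (Ms d *\<^sub>v x)) $ i = 0\<^sub>v r $ i" using i by simp
  qed (use C in auto)
  have one': "x $ i = (\<Sum>d\<le>D. (Ms d *\<^sub>v x) $ i)" if "x \<in> carrier_vec ?n" "i < ?n" for x i
    using e[OF that(1), of 1 i] that pm_one[OF M] by (simp add: one)
  have eig: "snd M (c s) *\<^sub>v (Ms d *\<^sub>v x) = s ^ d \<cdot>\<^sub>v (Ms d *\<^sub>v x)" if x: "x \<in> carrier_vec ?n" and d: "d \<le> D" and s: "s \<noteq> 0" for x d s
  proof (rule eq_vecI)
    fix i assume "i < dim_vec (s ^ d \<cdot>\<^sub>v (Ms d *\<^sub>v x))"
    then have i: "i < ?n" using Mc[of d] by auto
    have "(snd M (c s) *\<^sub>v (Ms d *\<^sub>v x)) $ i = s ^ d * (Ms d *\<^sub>v x) $ i"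
    proof (rule pow_coeffs[where F = "{0}" and D = D and b = "\<lambda>d. s ^ d * (Ms d *\<^sub>v x) $ i", OF _ _ d])
      fix s' :: complex assume "s' \<notin> {0}"
      then have s': "s' \<noteq> 0" by simp
      have "(\<Sum>d\<le>D. s' ^ d * (snd M (c s) *\<^sub>v (Ms d *\<^sub>v x)) $ i) = (snd M (c s) *\<^sub>v (snd M (c s') *\<^sub>v x)) $ i"
        using e[OF x s'] by (intro mv_sum[OF pm_carrier[OF M G[OF s]] Mx[OF x] pm_vec[OF M G[OF s'] x] _ i, symmetric])
      also have "\<dots> = (snd M (c (s * s')) *\<^sub>v x) $ i"
        using pm_mult_vec[OF M G[OF s] G[OF s'] x] mul[OF s s'] by simp
      also have "\<dots> = (\<Sum>d\<le>D. (s * s') ^ d * (Ms d *\<^sub>v x) $ i)" using e[OF x _ i, of "s * s'"] s s' by simp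
      finally show "(\<Sum>d\<le>D. s' ^ d * (snd M (c s) *\<^sub>v (Ms d *\<^sub>v x)) $ i) = (\<Sum>d\<le>D. s' ^ d * (s ^ d * (Ms d *\<^sub>v x) $ i))"
        by (simp add: power_mult_distrib mult_ac)
    qed simp
    then show "(snd M (c s) *\<^sub>v (Ms d *\<^sub>v x)) $ i = (s ^ d \<cdot>\<^sub>v (Ms d *\<^sub>v x)) $ i" using i Mc[of d] by simp
  qed (use pm_carrier[OF M G[OF s]] Mc[of d] in auto)
  show ?thesis unfolding torus_weights_def
  proof (intro exI[of _ D] exI[of _ Ms] conjI allI ballI impI, goal_cases)
    case 1 show ?case by (rule Mc)
  next
    case 2 then show ?case by (intro e)
  next
    case 3 then show ?case by (intro one')
  next
    case 4 then show ?case by (intro eig)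
  next
    case 5 then show ?case by (intro C) auto
  qed
qed

lemma torus_weights_nonzero:
  assumes "torus_weights M c D Ms" "x \<in> carrier_vec (fst M)" "x \<noteq> 0\<^sub>v (fst M)"
  shows "\<exists>d\<le>D. Ms d *\<^sub>v x \<noteq> 0\<^sub>v (fst M)"
proof (rule ccontr)
  assume "\<not> ?thesis"
  moreover have "\<forall>i<fst M. x $ i = (\<Sum>d\<le>D. (Ms d *\<^sub>v x) $ i)"
    using assms(1,2) unfolding torus_weights_def by blast
  ultimately have "x $ i = 0" if "i < fst M" for i using that by simp
  then show False using assms by (auto simp: vec_eq_iff)
qed

lemma diag_mat_mult:
  "mat k k (\<lambda>(i, j). if i = j then a i else 0) * mat k k (\<lambda>(i, j). if i = j then b i else 0) =
   mat k k (\<lambda>(i, j). if i = j then a i * b i else (0::complex))"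
  (is "?a * ?b = ?c")
proof (rule eq_matI)
  fix i j assume "i < dim_row (mat k k (\<lambda>(i, j). if i = j then a i * b i else (0::complex)))"
    "j < dim_col (mat k k (\<lambda>(i, j). if i = j then a i * b i else (0::complex)))"
  then have ij: "i < k" "j < k" by auto
  show "(mat k k (\<lambda>(i, j). if i = j then a i else 0) * mat k k (\<lambda>(i, j). if i = j then b i else 0)) $$ (i, j) =
    mat k k (\<lambda>(i, j). if i = j then a i * b i else 0) $$ (i, j)"
  proof -
    have "(?a * ?b) $$ (i, j) = (\<Sum>l<k. ?a $$ (i, l) * ?b $$ (l, j))"
      by (rule mm_index) (use ij in auto)
    also have "\<dots> = (\<Sum>l<k. (if i = l then 1 else 0) * (a i * (if l = j then b l else 0)))"
      using ij by (intro sum.cong) auto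
    also have "\<dots> = a i * (if i = j then b i else 0)" using ij by (subst sum_pick) auto
    finally show ?thesis using ij by simp
  qed
qed auto

abbreviation dmat :: "nat \<Rightarrow> (nat \<Rightarrow> complex) \<Rightarrow> complex mat" where
  "dmat k a \<equiv> mat k k (\<lambda>(i, j). if i = j then a i else 0)"

lemma dmat_GL: "(\<And>i. i < k \<Longrightarrow> a i \<noteq> 0) \<Longrightarrow> dmat k a \<in> carrier (GL k)"
  by (rule GL_diagonal) (auto simp: diagonal_mat_def)

lemma shift_coeffs:
  fixes a b :: "nat \<Rightarrow> complex"
  assumes "finite F" "\<And>s. s \<notin> F \<Longrightarrow> (\<Sum>e\<le>D. s ^ e * a e) = s ^ d * (\<Sum>e\<le>D'. s ^ e * b e)"
  shows "e \<le> D \<Longrightarrow> e < d \<Longrightarrow> a e = 0" "d \<le> D \<Longrightarrow> a d = b 0"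
proof -
  have eq: "(\<Sum>e\<le>D. monom (a e) e) = monom 1 d * (\<Sum>e\<le>D'. monom (b e) e)"
    using assms(1) by (rule poly_cofinite_eq) (use assms(2) in \<open>simp add: poly_sum poly_monom mult.commute\<close>)
  have l: "coeff (\<Sum>e\<le>D. monom (a e) e) e = a e" if "e \<le> D" for e using that by (simp add: coeff_sum)
  have r: "coeff (\<Sum>e\<le>D'. monom (b e) e) 0 = b 0" by (simp add: coeff_sum)
  show "a e = 0" if "e \<le> D" "e < d" using l[OF that(1)] that by (simp add: eq coeff_monom_mult)
  show "a d = b 0" if "d \<le> D" using l[OF that] r by (simp add: eq coeff_monom_mult)
qed

lemma GL_diag_nz:
  assumes "t \<in> carrier (GL k)" "diagonal_mat t" "i < k"
  shows "t $$ (i, i) \<noteq> 0"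
proof -
  obtain h where h: "t \<in> carrier_mat k k" "h \<in> carrier_mat k k" "t * h = 1\<^sub>m k" using assms(1) by (auto simp: GL_iff)
  have "(t * h) $$ (i, i) = (\<Sum>l<k. t $$ (i, l) * h $$ (l, i))" using assms(3) by (intro mm_index[OF h(1,2)])
  also have "\<dots> = (\<Sum>l<k. if l = i then t $$ (i, i) * h $$ (i, i) else 0)"
    using assms h by (intro sum.cong) (auto simp: diagonal_mat_def)
  finally show ?thesis using h(3) assms(3) by auto
qed

lemma minus_scalar_apply:
  fixes B :: "complex mat"
  assumes "B \<in> carrier_mat n n" "y \<in> carrier_vec n"
  shows "(B - c \<cdot>\<^sub>m 1\<^sub>m n) *\<^sub>v y = 0\<^sub>v n \<longleftrightarrow> B *\<^sub>v y = c \<cdot>\<^sub>v y"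
proof -
  have s: "(c \<cdot>\<^sub>m 1\<^sub>m n) *\<^sub>v y = c \<cdot>\<^sub>v y"
    using assms(2) by (intro eq_vecI) auto
  have "(B - c \<cdot>\<^sub>m 1\<^sub>m n) *\<^sub>v y = B *\<^sub>v y - c \<cdot>\<^sub>v y"
    using assms s by (subst minus_mult_distrib_mat_vec[of _ n n]) auto
  moreover have "(B *\<^sub>v y - c \<cdot>\<^sub>v y = 0\<^sub>v n) = (B *\<^sub>v y = c \<cdot>\<^sub>v y)"
    using assms by (auto simp: vec_eq_iff)
  ultimately show ?thesis by simp
qed

text \<open>\<open>A\<close> encodes a submodule as a kernel, so that the vector is found inside a
  prescribed submodule. In place of raising operators, a component of highest degree under the group
  \<open>tau\<close> is taken: conjugation by \<open>tau s\<close> contracts upper unitriangular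
  matrices to the identity as \<open>s\<close> tends to \<open>0\<close>, which makes this component
  invariant. It is then refined to a weight vector, one torus coordinate at a time.\<close>

lemma exists_highest_weight_vector:
  assumes M: "polynomial_module k M" and A: "A \<in> carrier_mat r (fst M)"
    and st: "\<And>x g. x \<in> carrier_vec (fst M) \<Longrightarrow> A *\<^sub>v x = 0\<^sub>v r \<Longrightarrow> g \<in> carrier (GL k) \<Longrightarrow> A *\<^sub>v (snd M g *\<^sub>v x) = 0\<^sub>v r"
    and x0: "x0 \<in> carrier_vec (fst M)" "A *\<^sub>v x0 = 0\<^sub>v r" "x0 \<noteq> 0\<^sub>v (fst M)"
  shows "\<exists>kap v. length kap = k \<and> v \<noteq> 0\<^sub>v (fst M) \<and> A *\<^sub>v v = 0\<^sub>v r \<and> hwv k M kap v"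
proof -
  let ?n = "fst M"
  \<comment> \<open>Strictly decreasing exponents, so that conjugation scales every entry above the
    diagonal by a positive power of \<open>s\<close>.\<close>
  define tau where "tau = (\<lambda>s. dmat k (\<lambda>i. s ^ (k - 1 - i)))"
  have tG: "tau s \<in> carrier (GL k)" if "s \<noteq> 0" for s unfolding tau_def using that by (intro dmat_GL) simp
  have "\<exists>D Ms. torus_weights M tau D Ms"
  proof (rule torus_expand[OF M tG])
    show "\<exists>q. \<forall>s. tau s $$ (i, j) = poly q s" if "i < k" "j < k" for i j
      using that by (intro exI[of _ "if i = j then monom 1 (k - 1 - i) else 0"]) (auto simp: tau_def poly_monom)
    show "tau s * tau s' = tau (s * s')" for s s' unfolding tau_def diag_mat_mult by (intro eq_matI) (auto simp: power_mult_distrib)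
    show "tau 1 = 1\<^sub>m k" unfolding tau_def by (intro eq_matI) auto
  qed auto
  then obtain D Ms where W: "torus_weights M tau D Ms" by blast
  have Mc: "\<forall>d. Ms d \<in> carrier_mat ?n ?n"
    and ex: "\<forall>x\<in>carrier_vec ?n. \<forall>s. s \<noteq> 0 \<longrightarrow> (\<forall>i<?n. (snd M (tau s) *\<^sub>v x) $ i = (\<Sum>d\<le>D. s ^ d * (Ms d *\<^sub>v x) $ i))"
    and one: "\<forall>x\<in>carrier_vec ?n. \<forall>i<?n. x $ i = (\<Sum>d\<le>D. (Ms d *\<^sub>v x) $ i)"
    and eig: "\<forall>x\<in>carrier_vec ?n. \<forall>d\<le>D. \<forall>s. s \<noteq> 0 \<longrightarrow> snd M (tau s) *\<^sub>v (Ms d *\<^sub>v x) = s ^ d \<cdot>\<^sub>v (Ms d *\<^sub>v x)"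
    and lin: "\<forall>x\<in>carrier_vec ?n. \<forall>r. \<forall>C\<in>carrier_mat r ?n. (\<forall>s. s \<noteq> 0 \<longrightarrow> C *\<^sub>v (snd M (tau s) *\<^sub>v x) = 0\<^sub>v r) \<longrightarrow>
        (\<forall>d\<le>D. C *\<^sub>v (Ms d *\<^sub>v x) = 0\<^sub>v r)"
    using W unfolding torus_weights_def by blast+
  note nz = torus_weights_nonzero[OF W]
  \<comment> \<open>The degrees that occur in the submodule; \<open>x0\<close> shows that there are
    some.\<close>
  define Q where "Q = {d. d \<le> D \<and> (\<exists>x\<in>carrier_vec ?n. A *\<^sub>v x = 0\<^sub>v r \<and> Ms d *\<^sub>v x \<noteq> 0\<^sub>v ?n)}"
  have Qf: "finite Q" "Q \<noteq> {}" using nz[OF x0(1,3)] x0 by (auto simp: Q_def)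
  define d0 where "d0 = Max Q"
  have "d0 \<in> Q" unfolding d0_def using Qf by (rule Max_in)
  then obtain x1 where x1: "x1 \<in> carrier_vec ?n" "A *\<^sub>v x1 = 0\<^sub>v r" "Ms d0 *\<^sub>v x1 \<noteq> 0\<^sub>v ?n" and d0: "d0 \<le> D" by (auto simp: Q_def)
  have above: "Ms e *\<^sub>v y = 0\<^sub>v ?n" if "e \<le> D" "d0 < e" "y \<in> carrier_vec ?n" "A *\<^sub>v y = 0\<^sub>v r" for e y
  proof (rule ccontr)
    assume "Ms e *\<^sub>v y \<noteq> 0\<^sub>v ?n"
    then have "e \<in> Q" using that by (auto simp: Q_def)
    then show False using Max_ge[OF Qf(1), of e] that(2) by (simp add: d0_def)
  qed
  define w where "w = Ms d0 *\<^sub>v x1"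
  have wc: "w \<in> carrier_vec ?n" unfolding w_def using Mc x1(1) by (intro mult_mat_vec_carrier) auto
  have Aw: "A *\<^sub>v w = 0\<^sub>v r" unfolding w_def using lin x1 A d0 st tG by blast
  have fixed: "snd M u *\<^sub>v w = w" if u: "u \<in> carrier (GL k)" "upper_triangular u" "\<forall>i<k. u $$ (i, i) = 1" for u
  proof -
    note uc = GL_carrier[OF u(1)]
    \<comment> \<open>The conjugate of \<open>u\<close> by \<open>tau s\<close>, written without
      inverses so that it makes sense at \<open>s = 0\<close> as well.\<close>
    define us where "us = (\<lambda>s. mat k k (\<lambda>(i, j). if i \<le> j then u $$ (i, j) * s ^ (j - i) else 0))"
    have usG: "us s \<in> carrier (GL k)" for s
      by (rule GL_upper) (use u in \<open>auto simp: us_def upper_triangular_def\<close>)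
    have us0: "us 0 = 1\<^sub>m k" by (rule eq_matI) (use u in \<open>auto simp: us_def power_0_left\<close>)
    have com: "tau s * u = us s * tau s" for s
    proof (rule eq_matI)
      fix i j assume "i < dim_row (us s * tau s)" "j < dim_col (us s * tau s)"
      then have ij: "i < k" "j < k" by (auto simp: us_def tau_def)
      have "(tau s * u) $$ (i, j) = (\<Sum>l<k. tau s $$ (i, l) * u $$ (l, j))" by (rule mm_index) (use ij uc in \<open>auto simp: tau_def\<close>)
      also have "\<dots> = (\<Sum>l<k. (if i = l then 1 else 0) * (s ^ (k - 1 - i) * u $$ (l, j)))"
        using ij by (intro sum.cong) (auto simp: tau_def)
      also have "\<dots> = s ^ (k - 1 - i) * u $$ (i, j)" using ij by (subst sum_pick) auto
      finally have 1: "(tau s * u) $$ (i, j) = s ^ (k - 1 - i) * u $$ (i, j)" .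
      have "(us s * tau s) $$ (i, j) = (\<Sum>l<k. us s $$ (i, l) * tau s $$ (l, j))" by (rule mm_index) (use ij in \<open>auto simp: tau_def us_def\<close>)
      also have "\<dots> = (\<Sum>l<k. (if l = j then 1 else 0) * (us s $$ (i, l) * s ^ (k - 1 - j)))"
        using ij by (intro sum.cong) (auto simp: tau_def)
      also have "\<dots> = us s $$ (i, j) * s ^ (k - 1 - j)" using ij by (subst sum_pick) auto
      finally have 2: "(us s * tau s) $$ (i, j) = us s $$ (i, j) * s ^ (k - 1 - j)" .
      show "(tau s * u) $$ (i, j) = (us s * tau s) $$ (i, j)"
      proof (cases "i \<le> j")
        case True
        then have "k - 1 - i = (j - i) + (k - 1 - j)" using ij by simp
        then have s: "s ^ (k - 1 - i) = s ^ (j - i) * s ^ (k - 1 - j)" by (simp only: power_add)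
        show ?thesis using True ij unfolding 1 2 s by (simp add: us_def)
      next
        case False
        then show ?thesis using ij u(2) uc unfolding 1 2 by (auto simp: us_def upper_triangular_def)
      qed
    qed (use uc in \<open>auto simp: us_def tau_def\<close>)
    define y where "y = snd M u *\<^sub>v w"
    have yc: "y \<in> carrier_vec ?n" unfolding y_def using pm_vec[OF M u(1) wc] .
    have Ay: "A *\<^sub>v y = 0\<^sub>v r" unfolding y_def using st wc Aw u(1) by blast
    have ty: "snd M (tau s) *\<^sub>v y = s ^ d0 \<cdot>\<^sub>v (snd M (us s) *\<^sub>v w)" if s: "s \<noteq> 0" for s
    proof -
      have "snd M (tau s) *\<^sub>v y = snd M (tau s * u) *\<^sub>v w" unfolding y_def using pm_mult_vec[OF M tG[OF s] u(1) wc] by simp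
      also have "\<dots> = snd M (us s) *\<^sub>v (snd M (tau s) *\<^sub>v w)" unfolding com using pm_mult_vec[OF M usG tG[OF s] wc] by simp
      also have "snd M (tau s) *\<^sub>v w = s ^ d0 \<cdot>\<^sub>v w" unfolding w_def using eig x1(1) d0 s by blast
      also have "snd M (us s) *\<^sub>v (s ^ d0 \<cdot>\<^sub>v w) = s ^ d0 \<cdot>\<^sub>v (snd M (us s) *\<^sub>v w)" using pm_carrier[OF M usG] wc by (rule mult_mat_vec)
      finally show ?thesis .
    qed
    have "\<exists>D' Ns. (\<forall>d. Ns d \<in> carrier_mat ?n ?n) \<and>
      (\<forall>x\<in>carrier_vec ?n. \<forall>s\<in>UNIV. \<forall>i<?n. (snd M (us s) *\<^sub>v x) $ i = (\<Sum>d\<le>D'. s ^ d * (Ns d *\<^sub>v x) $ i))"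
    proof (rule curve_expand[OF M usG])
      show "\<exists>q. \<forall>s. us s $$ (i, j) = poly q s" if "i < k" "j < k" for i j
        using that by (intro exI[of _ "if i \<le> j then monom (u $$ (i, j)) (j - i) else 0"]) (auto simp: us_def poly_monom)
    qed
    then obtain D' Ns where N: "\<forall>x\<in>carrier_vec ?n. \<forall>s\<in>UNIV. \<forall>i<?n. (snd M (us s) *\<^sub>v x) $ i = (\<Sum>d\<le>D'. s ^ d * (Ns d *\<^sub>v x) $ i)"
      by (elim exE conjE)
    have "y $ i = w $ i" if i: "i < ?n" for i
    proof -
      \<comment> \<open>Comparing powers of \<open>s\<close>: below degree \<open>d0\<close> the
        components of \<open>y\<close> vanish, and in degree \<open>d0\<close> the component is the
        value of the right side at \<open>s = 0\<close>, namely \<open>w\<close>. Above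
        \<open>d0\<close> the maximality of \<open>d0\<close> excludes components.\<close>
      have rel: "(\<Sum>e\<le>D. s ^ e * (Ms e *\<^sub>v y) $ i) = s ^ d0 * (\<Sum>e\<le>D'. s ^ e * (Ns e *\<^sub>v w) $ i)" if "s \<notin> {0}" for s
      proof -
        have s: "s \<noteq> 0" using that by simp
        have "(\<Sum>e\<le>D. s ^ e * (Ms e *\<^sub>v y) $ i) = (snd M (tau s) *\<^sub>v y) $ i" using ex yc s i by simp
        also have "\<dots> = s ^ d0 * (snd M (us s) *\<^sub>v w) $ i"
          unfolding ty[OF s] using pm_carrier[OF M usG, of s] i by (intro index_smult_vec) auto
        finally show ?thesis using N wc i by simp
      qed
      have sc1: "(Ms e *\<^sub>v y) $ i = 0" if "e \<le> D" "e < d0" for e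
        by (rule shift_coeffs(1)[where F = "{0}", OF _ rel that]) auto
      have sc2: "(Ms d0 *\<^sub>v y) $ i = (Ns 0 *\<^sub>v w) $ i"
        by (rule shift_coeffs(2)[where F = "{0}", OF _ rel d0]) auto
      have "(Ns 0 *\<^sub>v w) $ i = (\<Sum>d\<le>D'. 0 ^ d * (Ns d *\<^sub>v w) $ i)"
        by (simp add: power_0_left if_distrib[of "\<lambda>x. x * _"] cong: if_cong)
      also have "\<dots> = (snd M (us 0) *\<^sub>v w) $ i" using N[rule_format, OF wc UNIV_I i] by (rule sym)
      also have "\<dots> = w $ i" unfolding us0 pm_one[OF M] using wc by simp
      finally have n0: "(Ns 0 *\<^sub>v w) $ i = w $ i" .
      have "y $ i = (\<Sum>e\<le>D. (Ms e *\<^sub>v y) $ i)" using one yc i by simp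
      also have "\<dots> = (\<Sum>e\<le>D. if e = d0 then (Ms d0 *\<^sub>v y) $ i else 0)"
      proof (intro sum.cong refl)
        fix e assume "e \<in> {..D}"
        then show "(Ms e *\<^sub>v y) $ i = (if e = d0 then (Ms d0 *\<^sub>v y) $ i else 0)"
          using sc1[of e] above[of e y, OF _ _ yc Ay] i by (cases e d0 rule: linorder_cases) simp_all
      qed
      also have "\<dots> = w $ i" using d0 sc2 n0 by simp
      finally show ?thesis .
    qed
    then show ?thesis using yc wc unfolding y_def[symmetric] by (auto simp: vec_eq_iff)
  qed
  \<comment> \<open>The torus coordinates, treated one after the other; invariance under
    unitriangular matrices and the weights found so far are carried along.\<close>
  define ti where "ti = (\<lambda>i s. dmat k (\<lambda>j. if j = i then s else 1))"
  have tiG: "ti i s \<in> carrier (GL k)" if "s \<noteq> 0" for i s unfolding ti_def using that by (intro dmat_GL) simp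
  have "\<exists>x a. x \<in> carrier_vec ?n \<and> x \<noteq> 0\<^sub>v ?n \<and> A *\<^sub>v x = 0\<^sub>v r \<and>
     (\<forall>u\<in>carrier (GL k). upper_triangular u \<and> (\<forall>i<k. u $$ (i, i) = 1) \<longrightarrow> snd M u *\<^sub>v x = x) \<and>
     (\<forall>i<p. \<forall>s. s \<noteq> 0 \<longrightarrow> snd M (ti i s) *\<^sub>v x = s ^ a i \<cdot>\<^sub>v x)" if "p \<le> k" for p
    using that
  proof (induction p)
    case 0
    have "w \<noteq> 0\<^sub>v ?n" using x1(3) by (simp add: w_def)
    then show ?case using wc Aw fixed by auto
  next
    case (Suc p)
    then obtain x a where x: "x \<in> carrier_vec ?n" "x \<noteq> 0\<^sub>v ?n" "A *\<^sub>v x = 0\<^sub>v r"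
      and xu: "\<And>u. u \<in> carrier (GL k) \<Longrightarrow> upper_triangular u \<Longrightarrow> (\<forall>i<k. u $$ (i, i) = 1) \<Longrightarrow> snd M u *\<^sub>v x = x"
      and xt: "\<And>i s. i < p \<Longrightarrow> s \<noteq> 0 \<Longrightarrow> snd M (ti i s) *\<^sub>v x = s ^ a i \<cdot>\<^sub>v x" by (auto simp: Suc_le_eq)
    have "\<exists>D Ms. torus_weights M (ti p) D Ms"
    proof (rule torus_expand[OF M tiG])
      show "\<exists>q. \<forall>s. ti p s $$ (i, j) = poly q s" if "i < k" "j < k" for i j
        using that by (intro exI[of _ "if i = j then (if i = p then [:0, 1:] else 1) else 0"]) (auto simp: ti_def)
      show "ti p s * ti p s' = ti p (s * s')" for s s' unfolding ti_def diag_mat_mult by (intro eq_matI) auto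
      show "ti p 1 = 1\<^sub>m k" unfolding ti_def by (intro eq_matI) auto
    qed auto
    then obtain D Ms where W: "torus_weights M (ti p) D Ms" by blast
    have Mc: "\<forall>d. Ms d \<in> carrier_mat ?n ?n"
      and eig: "\<forall>x\<in>carrier_vec ?n. \<forall>d\<le>D. \<forall>s. s \<noteq> 0 \<longrightarrow> snd M (ti p s) *\<^sub>v (Ms d *\<^sub>v x) = s ^ d \<cdot>\<^sub>v (Ms d *\<^sub>v x)"
      and lin: "\<forall>x\<in>carrier_vec ?n. \<forall>r. \<forall>C\<in>carrier_mat r ?n. (\<forall>s. s \<noteq> 0 \<longrightarrow> C *\<^sub>v (snd M (ti p s) *\<^sub>v x) = 0\<^sub>v r) \<longrightarrow>
        (\<forall>d\<le>D. C *\<^sub>v (Ms d *\<^sub>v x) = 0\<^sub>v r)"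
      using W unfolding torus_weights_def by blast+
    from torus_weights_nonzero[OF W x(1,2)] obtain d where d: "d \<le> D" "Ms d *\<^sub>v x \<noteq> 0\<^sub>v ?n" by blast
    let ?x = "Ms d *\<^sub>v x"
    have xc: "?x \<in> carrier_vec ?n" using Mc x(1) by (intro mult_mat_vec_carrier) auto
    \<comment> \<open>An eigenvector equation along the torus orbit of \<open>x\<close> is a linear
      condition, hence passes to the weight component \<open>?x\<close>.\<close>
    have tr: "B *\<^sub>v ?x = b \<cdot>\<^sub>v ?x" if B: "B \<in> carrier_mat ?n ?n"
      and e: "\<And>s. s \<noteq> 0 \<Longrightarrow> B *\<^sub>v (snd M (ti p s) *\<^sub>v x) = b \<cdot>\<^sub>v (snd M (ti p s) *\<^sub>v x)" for B b
    proof -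
      have "(B - b \<cdot>\<^sub>m 1\<^sub>m ?n) *\<^sub>v (snd M (ti p s) *\<^sub>v x) = 0\<^sub>v ?n" if "s \<noteq> 0" for s
        using minus_scalar_apply[OF B pm_vec[OF M tiG[OF that] x(1)]] e[OF that] by blast
      moreover have "B - b \<cdot>\<^sub>m 1\<^sub>m ?n \<in> carrier_mat ?n ?n" by (intro minus_carrier_mat) auto
      ultimately have "(B - b \<cdot>\<^sub>m 1\<^sub>m ?n) *\<^sub>v ?x = 0\<^sub>v ?n"
        using lin x(1) d(1) by blast
      then show ?thesis using minus_scalar_apply[OF B xc] by blast
    qed
    have "A *\<^sub>v ?x = 0\<^sub>v r" using lin x A d(1) st tiG by blast
    moreover have "snd M u *\<^sub>v ?x = ?x" if u: "u \<in> carrier (GL k)" "upper_triangular u" "\<forall>i<k. u $$ (i, i) = 1" for u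
    proof -
      have "snd M u *\<^sub>v ?x = 1 \<cdot>\<^sub>v ?x"
      proof (rule tr[OF pm_carrier[OF M u(1)]])
        fix s :: complex assume s: "s \<noteq> 0"
        note uc = GL_carrier[OF u(1)]
        let ?b = "\<lambda>j. if j = p then s else 1"
        \<comment> \<open>Conjugation by the torus element stays within the upper unitriangular
          matrices.\<close>
        define u' where "u' = mat k k (\<lambda>(i, j). u $$ (i, j) * ?b j / ?b i)"
        have u'c: "u' \<in> carrier_mat k k" by (simp add: u'_def)
        have ut: "upper_triangular u'" using u(2) uc by (auto simp: u'_def upper_triangular_def)
        have ud: "\<forall>i<k. u' $$ (i, i) = 1" using u(3) s by (auto simp: u'_def)
        have u'G: "u' \<in> carrier (GL k)" using u'c ut ud by (intro GL_upper) auto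
        have com: "u * ti p s = ti p s * u'"
        proof (rule eq_matI)
          fix i j assume "i < dim_row (ti p s * u')" "j < dim_col (ti p s * u')"
          then have ij: "i < k" "j < k" using u'c by (auto simp: ti_def)
          have "(u * ti p s) $$ (i, j) = (\<Sum>l<k. u $$ (i, l) * ti p s $$ (l, j))" by (rule mm_index) (use ij uc in \<open>auto simp: ti_def\<close>)
          also have "\<dots> = (\<Sum>l<k. (if l = j then 1 else 0) * (u $$ (i, l) * ?b j))" using ij by (intro sum.cong) (auto simp: ti_def)
          also have "\<dots> = u $$ (i, j) * ?b j" using ij by (subst sum_pick) auto
          finally have 1: "(u * ti p s) $$ (i, j) = u $$ (i, j) * ?b j" .
          have "(ti p s * u') $$ (i, j) = (\<Sum>l<k. ti p s $$ (i, l) * u' $$ (l, j))" by (rule mm_index) (use ij u'c in \<open>auto simp: ti_def\<close>)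
          also have "\<dots> = (\<Sum>l<k. (if i = l then 1 else 0) * (?b i * u' $$ (l, j)))" using ij by (intro sum.cong) (auto simp: ti_def)
          also have "\<dots> = ?b i * u' $$ (i, j)" using ij by (subst sum_pick) auto
          finally show "(u * ti p s) $$ (i, j) = (ti p s * u') $$ (i, j)" using 1 ij s by (simp add: u'_def)
        qed (use uc u'c in \<open>auto simp: ti_def\<close>)
        have "snd M u *\<^sub>v (snd M (ti p s) *\<^sub>v x) = snd M (ti p s) *\<^sub>v (snd M u' *\<^sub>v x)"
          using pm_mult_vec[OF M u(1) tiG[OF s, of p] x(1)] pm_mult_vec[OF M tiG[OF s, of p] u'G x(1)] com by simp
        then show "snd M u *\<^sub>v (snd M (ti p s) *\<^sub>v x) = 1 \<cdot>\<^sub>v (snd M (ti p s) *\<^sub>v x)"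
          using xu[OF u'G ut ud] by simp
      qed
      then show ?thesis by simp
    qed
    moreover have "snd M (ti i s) *\<^sub>v ?x = s ^ (a(p := d)) i \<cdot>\<^sub>v ?x" if i: "i < Suc p" and s: "s \<noteq> 0" for i s
    proof (cases "i = p")
      case True
      then show ?thesis using eig x(1) d(1) s by simp
    next
      case False
      then have ip: "i < p" using i by simp
      have "snd M (ti i s) *\<^sub>v ?x = s ^ a i \<cdot>\<^sub>v ?x"
      proof (rule tr[OF pm_carrier[OF M tiG[OF s]]])
        fix s' :: complex assume s': "s' \<noteq> 0"
        have com: "ti i s * ti p s' = ti p s' * ti i s" unfolding ti_def diag_mat_mult by (intro eq_matI) auto
        have "snd M (ti i s) *\<^sub>v (snd M (ti p s') *\<^sub>v x) = snd M (ti p s') *\<^sub>v (snd M (ti i s) *\<^sub>v x)"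
          using pm_mult_vec[OF M tiG[OF s, of i] tiG[OF s', of p] x(1)] pm_mult_vec[OF M tiG[OF s', of p] tiG[OF s, of i] x(1)] com by simp
        then show "snd M (ti i s) *\<^sub>v (snd M (ti p s') *\<^sub>v x) = s ^ a i \<cdot>\<^sub>v (snd M (ti p s') *\<^sub>v x)"
          using xt[OF ip s] mult_mat_vec[OF pm_carrier[OF M tiG[OF s']] x(1)] by simp
      qed
      then show ?thesis using False by simp
    qed
    ultimately show ?case using xc d(2) by blast
  qed
  from this[of k] obtain x a where x: "x \<in> carrier_vec ?n" "x \<noteq> 0\<^sub>v ?n" "A *\<^sub>v x = 0\<^sub>v r"
    and xu: "\<forall>u\<in>carrier (GL k). upper_triangular u \<and> (\<forall>i<k. u $$ (i, i) = 1) \<longrightarrow> snd M u *\<^sub>v x = x"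
    and xt: "\<And>i s. i < k \<Longrightarrow> s \<noteq> 0 \<Longrightarrow> snd M (ti i s) *\<^sub>v x = s ^ a i \<cdot>\<^sub>v x" by auto
  define kap where "kap = map a [0..<k]"
  have "snd M t *\<^sub>v x = wt k kap t \<cdot>\<^sub>v x" if t: "t \<in> carrier (GL k)" "diagonal_mat t" for t
  proof -
    let ?b = "\<lambda>p i. if i < p then t $$ (i, i) else 1"
    have nzt: "t $$ (i, i) \<noteq> 0" if "i < k" for i using GL_diag_nz[OF t that] .
    have G: "dmat k (?b p) \<in> carrier (GL k)" for p by (intro dmat_GL) (use nzt in auto)
    have "snd M (dmat k (?b p)) *\<^sub>v x = (\<Prod>i<p. t $$ (i, i) ^ a i) \<cdot>\<^sub>v x" if "p \<le> k" for p
      using that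
    proof (induction p)
      case 0
      have "dmat k (?b 0) = 1\<^sub>m k" by (intro eq_matI) auto
      then show ?case using pm_one[OF M] x(1) by simp
    next
      case (Suc p)
      have s: "t $$ (p, p) \<noteq> 0" using nzt Suc.prems by simp
      have "dmat k (?b (Suc p)) = dmat k (?b p) * ti p (t $$ (p, p))"
        unfolding ti_def diag_mat_mult by (intro eq_matI) auto
      then have "snd M (dmat k (?b (Suc p))) *\<^sub>v x = snd M (dmat k (?b p)) *\<^sub>v (snd M (ti p (t $$ (p, p))) *\<^sub>v x)"
        using pm_mult_vec[OF M G tiG[OF s] x(1)] by simp
      also have "\<dots> = t $$ (p, p) ^ a p \<cdot>\<^sub>v (snd M (dmat k (?b p)) *\<^sub>v x)"
        using xt[of p] s Suc.prems mult_mat_vec[OF pm_carrier[OF M G] x(1)] by simp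
      finally show ?case using Suc by (simp add: smult_smult_assoc mult.commute)
    qed
    from this[of k] have "snd M (dmat k (?b k)) *\<^sub>v x = (\<Prod>i<k. t $$ (i, i) ^ a i) \<cdot>\<^sub>v x" by simp
    moreover have "dmat k (?b k) = t"
      using GL_carrier[OF t(1)] t(2) by (intro eq_matI) (auto simp: diagonal_mat_def)
    moreover have "wt k kap t = (\<Prod>i<k. t $$ (i, i) ^ a i)" unfolding wt_def kap_def by (intro prod.cong) auto
    ultimately show ?thesis by simp
  qed
  then have "hwv k M kap x" using x(1) xu by (simp add: hwv_def)
  moreover have "length kap = k" by (simp add: kap_def)
  ultimately show ?thesis using x by blast
qed

section \<open>Transposed duals, covectors and uniqueness of weights\<close>

lemma polyfun_transpose:
  assumes "p \<in> polynomial_functions k"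
  shows "\<exists>p'\<in>polynomial_functions k. \<forall>g\<in>carrier_mat k k. p (g\<^sup>T) = p' g"
  using assms
proof induction
  case (const c)
  show ?case by (rule bexI[of _ "\<lambda>_. c"]) (auto intro: polynomial_functions.const)
next
  case (entry i j)
  then show ?case by (intro bexI[of _ "\<lambda>g. g $$ (j, i)"]) (auto intro: polynomial_functions.entry)
next
  case (add p q)
  then obtain a b where "a \<in> polynomial_functions k" "\<forall>g\<in>carrier_mat k k. p (g\<^sup>T) = a g"
    "b \<in> polynomial_functions k" "\<forall>g\<in>carrier_mat k k. q (g\<^sup>T) = b g" by blast
  then show ?case by (intro bexI[of _ "\<lambda>g. a g + b g"]) (auto intro: polynomial_functions.add)
next
  case (mult p q)
  then obtain a b where "a \<in> polynomial_functions k" "\<forall>g\<in>carrier_mat k k. p (g\<^sup>T) = a g"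
    "b \<in> polynomial_functions k" "\<forall>g\<in>carrier_mat k k. q (g\<^sup>T) = b g" by blast
  then show ?case by (intro bexI[of _ "\<lambda>g. a g * b g"]) (auto intro: polynomial_functions.mult)
qed

text \<open>The contragredient action involves inverses and is in general not polynomial. Using the
  transpose instead keeps the order of products and the polynomial entries, and it exchanges upper
  with lower unitriangular matrices, so that highest weight vectors here are covectors of
  \<open>M\<close>.\<close>

definition dual_module :: "module_data \<Rightarrow> module_data" where
  "dual_module M = (fst M, \<lambda>g. (snd M (g\<^sup>T))\<^sup>T)"

text \<open>The matrices are invertible automatically, as inverses are mapped to inverses.\<close>

lemma polynomial_moduleI:
  assumes "\<And>g. g \<in> carrier (GL k) \<Longrightarrow> snd M g \<in> carrier_mat (fst M) (fst M)"
    "\<And>g h. g \<in> carrier (GL k) \<Longrightarrow> h \<in> carrier (GL k) \<Longrightarrow> snd M (g * h) = snd M g * snd M h"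
    "snd M (1\<^sub>m k) = 1\<^sub>m (fst M)"
    "\<And>i j. i < fst M \<Longrightarrow> j < fst M \<Longrightarrow> \<exists>p\<in>polynomial_functions k. \<forall>g\<in>carrier (GL k). snd M g $$ (i, j) = p g"
  shows "polynomial_module k M"
proof -
  have "snd M g \<in> carrier (GL (fst M))" if g: "g \<in> carrier (GL k)" for g
  proof -
    obtain h where h: "h \<in> carrier (GL k)" "h * g = 1\<^sub>m k" "g * h = 1\<^sub>m k"
      using g by (metis GL_iff)
    then have "snd M h * snd M g = 1\<^sub>m (fst M)" "snd M g * snd M h = 1\<^sub>m (fst M)"
      using assms(2)[OF g h(1)] assms(2)[OF h(1) g] assms(3) by simp_all
    then show ?thesis using assms(1)[OF g] assms(1)[OF h(1)] by (auto simp: GL_iff)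
  qed
  then show ?thesis using assms(2,4) unfolding polynomial_module_def by (cases M) (auto simp: hom_def)
qed

lemma dual_polynomial_module:
  assumes M: "polynomial_module k M"
  shows "polynomial_module k (dual_module M)"
proof (rule polynomial_moduleI)
  fix g h assume g: "g \<in> carrier (GL k)" and h: "h \<in> carrier (GL k)"
  note c = pm_carrier[OF M GL_transpose[OF g]] pm_carrier[OF M GL_transpose[OF h]]
  show "snd (dual_module M) g \<in> carrier_mat (fst (dual_module M)) (fst (dual_module M))"
    using c by (simp add: dual_module_def)
  have "(g * h)\<^sup>T = h\<^sup>T * g\<^sup>T" using GL_carrier[OF g] GL_carrier[OF h] by (rule transpose_mult)
  then have "snd M ((g * h)\<^sup>T) = snd M (h\<^sup>T) * snd M (g\<^sup>T)" using pm_mult[OF M GL_transpose[OF h] GL_transpose[OF g]] by simp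
  then show "snd (dual_module M) (g * h) = snd (dual_module M) g * snd (dual_module M) h"
    using transpose_mult[OF c(2,1)] by (simp add: dual_module_def)
next
  show "snd (dual_module M) (1\<^sub>m k) = 1\<^sub>m (fst (dual_module M))"
    using pm_one[OF M] by (simp add: dual_module_def)
next
  fix i j assume ij: "i < fst (dual_module M)" "j < fst (dual_module M)"
  then obtain p where p: "p \<in> polynomial_functions k" "\<forall>g\<in>carrier (GL k). snd M g $$ (j, i) = p g"
    using pm_entry[OF M, of j i] by (auto simp: dual_module_def)
  obtain p' where p': "p' \<in> polynomial_functions k" "\<forall>g\<in>carrier_mat k k. p (g\<^sup>T) = p' g" using polyfun_transpose[OF p(1)] by blast
  have "snd (dual_module M) g $$ (i, j) = p' g" if g: "g \<in> carrier (GL k)" for g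
    using p p' ij GL_transpose[OF g] GL_carrier[OF g] pm_carrier[OF M GL_transpose[OF g]] by (simp add: dual_module_def)
  then show "\<exists>p\<in>polynomial_functions k. \<forall>g\<in>carrier (GL k). snd (dual_module M) g $$ (i, j) = p g" using p'(1) by blast
qed

lemma dual_hwv_covv:
  assumes M: "polynomial_module k M" and y: "hwv k (dual_module M) kap y"
  shows "covv k M kap y"
proof -
  have yc: "y \<in> carrier_vec (fst M)" using y by (simp add: hwv_def dual_module_def)
  have mv: "y \<bullet> (snd M g *\<^sub>v x) = (snd (dual_module M) (g\<^sup>T) *\<^sub>v y) \<bullet> x" if "g \<in> carrier (GL k)" "x \<in> carrier_vec (fst M)" for g x
    using transpose_vec_mult_scalar[OF pm_carrier[OF M that(1)] that(2) yc] by (simp add: dual_module_def)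
  have "y \<bullet> (snd M t *\<^sub>v x) = wt k kap t * (y \<bullet> x)" if t: "t \<in> carrier (GL k)" "diagonal_mat t" and x: "x \<in> carrier_vec (fst M)" for t x
  proof -
    have "t\<^sup>T = t" using t(2) GL_carrier[OF t(1)] by (intro eq_matI) (auto simp: diagonal_mat_def, metis)
    then show ?thesis using mv[OF t(1) x] y t yc x by (simp add: hwv_def)
  qed
  moreover have "y \<bullet> (snd M l *\<^sub>v x) = y \<bullet> x" if l: "l \<in> carrier (GL k)" "upper_triangular (l\<^sup>T)" "\<forall>i<k. l $$ (i, i) = 1"
    and x: "x \<in> carrier_vec (fst M)" for l x
  proof -
    have "\<forall>i<k. l\<^sup>T $$ (i, i) = 1" using l GL_carrier[OF l(1)] by auto
    then have "snd (dual_module M) (l\<^sup>T) *\<^sub>v y = y" using y l(2) GL_transpose[OF l(1)] unfolding hwv_def by blast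
    then show ?thesis using mv[OF l(1) x] by simp
  qed
  ultimately show ?thesis using yc by (simp add: covv_def)
qed

lemma exists_covector:
  assumes M: "polynomial_module k M" and n: "0 < fst M"
  shows "\<exists>kap y. length kap = k \<and> y \<noteq> 0\<^sub>v (fst M) \<and> covv k M kap y"
proof -
  have D: "polynomial_module k (dual_module M)" by (rule dual_polynomial_module[OF M])
  have "unit_vec (fst M) 0 $ 0 \<noteq> (0\<^sub>v (fst M) :: complex vec) $ 0" using n by simp
  then have u: "unit_vec (fst M) 0 \<noteq> (0\<^sub>v (fst M) :: complex vec)" by metis
  have z: "0\<^sub>m 0 (fst M) *\<^sub>v x = 0\<^sub>v 0" for x :: "complex vec" by (intro eq_vecI) auto
  \<comment> \<open>A constraint matrix without rows imposes no condition.\<close>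
  have "\<exists>kap v. length kap = k \<and> v \<noteq> 0\<^sub>v (fst (dual_module M)) \<and> 0\<^sub>m 0 (fst M) *\<^sub>v v = 0\<^sub>v 0 \<and> hwv k (dual_module M) kap v"
    by (rule exists_highest_weight_vector[OF D, of _ 0 "unit_vec (fst M) 0"]) (use u z in \<open>auto simp: dual_module_def\<close>)
  then show ?thesis using dual_hwv_covv[OF M] by (auto simp: dual_module_def)
qed

text \<open>The vectors whose whole orbit is annihilated by \<open>y\<close> form a submodule. It is
  proper, because at the identity a nonzero \<open>y\<close> fails to annihilate some unit
  vector.\<close>

lemma simple_annihilator:
  assumes M: "polynomial_module k M" and S: "simple_module k M" and y: "y \<in> carrier_vec (fst M)" "y \<noteq> 0\<^sub>v (fst M)"
    and x: "x \<in> carrier_vec (fst M)" "\<And>g. g \<in> carrier (GL k) \<Longrightarrow> y \<bullet> (snd M g *\<^sub>v x) = 0"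
  shows "x = 0\<^sub>v (fst M)"
proof -
  let ?n = "fst M"
  let ?W = "{x \<in> carrier_vec ?n. \<forall>g\<in>carrier (GL k). y \<bullet> (snd M g *\<^sub>v x) = 0}"
  have "?W = {0\<^sub>v ?n} \<or> ?W = carrier_vec ?n"
  proof (rule simple_moduleD[OF S])
    have "snd M g *\<^sub>v 0\<^sub>v ?n = 0\<^sub>v ?n" if "g \<in> carrier (GL k)" for g
      using pm_carrier[OF M that] by (intro eq_vecI) (auto simp: scalar_prod_def)
    then show "0\<^sub>v ?n \<in> ?W" using y by simp
    show "v + w \<in> ?W" if "v \<in> ?W" "w \<in> ?W" for v w
      using that y pm_vec[OF M] by (auto simp: mult_add_distrib_mat_vec[OF pm_carrier[OF M]] scalar_prod_add_distrib[of y ?n])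
    show "c \<cdot>\<^sub>v v \<in> ?W" if "v \<in> ?W" for c v
      using that y pm_vec[OF M] by (auto simp: mult_mat_vec[OF pm_carrier[OF M]])
    show "snd M g *\<^sub>v v \<in> ?W" if "g \<in> carrier (GL k)" "v \<in> ?W" for g v
      using that pm_vec[OF M that(1)] by (auto simp: pm_mult_vec[OF M, symmetric] GL_mult_closed)
  qed auto
  moreover have "?W \<noteq> carrier_vec ?n"
  proof
    assume W: "?W = carrier_vec ?n"
    have "y $ i = 0" if i: "i < ?n" for i
    proof -
      have "unit_vec ?n i \<in> ?W" using W by simp
      then have "y \<bullet> (snd M (1\<^sub>m k) *\<^sub>v unit_vec ?n i) = 0" using GL_one_closed by blast
      then show ?thesis using y i by (simp add: pm_one[OF M] scalar_prod_right_unit)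
    qed
    then show False using y by (auto simp: vec_eq_iff)
  qed
  moreover have "x \<in> ?W" using x by simp
  ultimately show ?thesis by blast
qed

text \<open>Any nonzero covector will do: it cannot vanish at \<open>v\<close>, for then
  \<open>pairing_zero\<close> and simplicity would kill \<open>v\<close>. The nonzero pairing forces
  its weight to agree with that of \<open>v\<close> on the torus, and a scalar normalises
  it.\<close>

lemma simple_covector:
  assumes M: "polynomial_module k M" and S: "simple_module k M" and v: "hwv k M kap v" "v \<noteq> 0\<^sub>v (fst M)"
  shows "\<exists>xi. covv k M kap xi \<and> xi \<bullet> v = 1"
proof -
  have n: "0 < fst M" using S by (cases M) (simp add: simple_module_def)
  obtain kap' y where y: "y \<noteq> 0\<^sub>v (fst M)" "covv k M kap' y" using exists_covector[OF M n] by blast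
  have c: "v \<in> carrier_vec (fst M)" "y \<in> carrier_vec (fst M)" using v y by (auto simp: hwv_def covv_def)
  have nz: "y \<bullet> v \<noteq> 0"
    using simple_annihilator[OF M S c(2) y(1) c(1)] pairing_zero[OF M v(1) y(2)] v(2) by blast
  have w: "wt k kap' t = wt k kap t" if t: "t \<in> carrier (GL k)" "diagonal_mat t" for t
  proof -
    have "y \<bullet> (snd M t *\<^sub>v v) = wt k kap' t * (y \<bullet> v)" using y(2) t c by (simp add: covv_def)
    moreover have "y \<bullet> (snd M t *\<^sub>v v) = wt k kap t * (y \<bullet> v)" using v(1) t c by (simp add: hwv_def)
    ultimately show ?thesis using nz by simp
  qed
  let ?xi = "(1 / (y \<bullet> v)) \<cdot>\<^sub>v y"
  have "covv k M kap ?xi" using y(2) c pm_vec[OF M] by (auto simp: covv_def w)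
  moreover have "?xi \<bullet> v = 1" using c nz by simp
  ultimately show ?thesis by blast
qed

lemma weight_unique:
  assumes v: "hwv k M kap v" and y: "covv k M kap' y" and nz: "y \<bullet> v \<noteq> 0" and l: "length kap = k" "length kap' = k"
  shows "kap = kap'"
proof (rule nth_equalityI)
  fix i assume "i < length kap"
  then have i: "i < k" using l by simp
  \<comment> \<open>The torus element with entry 2 in place \<open>i\<close> detects the exponent
    there.\<close>
  let ?t = "dmat k (\<lambda>j. if j = i then 2 else 1)"
  have t: "?t \<in> carrier (GL k)" "diagonal_mat ?t" by (auto intro!: dmat_GL simp: diagonal_mat_def split: if_splits)
  have w: "wt k kap ?t = 2 ^ (kap ! i)" for kap
  proof -
    have "wt k kap ?t = (\<Prod>j<k. if j = i then 2 ^ (kap ! i) else 1)" unfolding wt_def by (intro prod.cong) auto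
    then show ?thesis using i by simp
  qed
  have c: "v \<in> carrier_vec (fst M)" "y \<in> carrier_vec (fst M)" using v y by (auto simp: hwv_def covv_def)
  have "y \<bullet> (snd M ?t *\<^sub>v v) = wt k kap' ?t * (y \<bullet> v)" using y t c by (simp add: covv_def)
  moreover have "y \<bullet> (snd M ?t *\<^sub>v v) = wt k kap ?t * (y \<bullet> v)" using v t c by (simp add: hwv_def)
  ultimately have "(2::complex) ^ (kap ! i) = 2 ^ (kap' ! i)" using nz by (simp add: w)
  then have "of_nat (2 ^ (kap ! i)) = (of_nat (2 ^ (kap' ! i)) :: complex)" by simp
  then show "kap ! i = kap' ! i" by (simp only: of_nat_eq_iff power_inject_exp one_less_numeral_iff semiring_norm(76))
qed (use l in simp)

section \<open>Adjoints and invariant sesquilinear forms\<close>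

definition adj :: "complex mat \<Rightarrow> complex mat" where
  "adj A = mat (dim_col A) (dim_row A) (\<lambda>(i, j). cnj (A $$ (j, i)))"

definition cv :: "complex vec \<Rightarrow> complex vec" where
  "cv x = vec (dim_vec x) (\<lambda>i. cnj (x $ i))"

lemma adj_carrier [simp]: "A \<in> carrier_mat r n \<Longrightarrow> adj A \<in> carrier_mat n r"
  by (auto simp: adj_def)

lemma adj_index: "A \<in> carrier_mat r n \<Longrightarrow> i < n \<Longrightarrow> j < r \<Longrightarrow> adj A $$ (i, j) = cnj (A $$ (j, i))"
  by (auto simp: adj_def)

lemma adj_adj [simp]: "adj (adj A) = A"
  by (rule eq_matI) (auto simp: adj_def)

lemma adj_one [simp]: "adj (1\<^sub>m n) = 1\<^sub>m n"
  by (rule eq_matI) (auto simp: adj_def)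

lemma adj_mult: "A \<in> carrier_mat r n \<Longrightarrow> B \<in> carrier_mat n q \<Longrightarrow> adj (A * B) = adj B * adj A"
proof (rule eq_matI)
  fix i j assume A: "A \<in> carrier_mat r n" and B: "B \<in> carrier_mat n q"
    and "i < dim_row (adj B * adj A)" "j < dim_col (adj B * adj A)"
  then have ij: "i < q" "j < r" by (auto simp: adj_def)
  have "adj (A * B) $$ (i, j) = cnj ((A * B) $$ (j, i))" using A B ij by (intro adj_index) auto
  also have "(A * B) $$ (j, i) = (\<Sum>l<n. A $$ (j, l) * B $$ (l, i))" by (rule mm_index[OF A B ij(2,1)])
  also have "cnj \<dots> = (\<Sum>l<n. adj B $$ (i, l) * adj A $$ (l, j))"
    using A B ij by (simp add: adj_index mult.commute)
  also have "\<dots> = (adj B * adj A) $$ (i, j)" using A B ij by (intro mm_index[symmetric]) auto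
  finally show "adj (A * B) $$ (i, j) = (adj B * adj A) $$ (i, j)" .
qed (auto simp: adj_def)

lemma adj_GL: "g \<in> carrier (GL k) \<Longrightarrow> adj g \<in> carrier (GL k)"
proof -
  assume "g \<in> carrier (GL k)"
  then obtain h where h: "g \<in> carrier_mat k k" "h \<in> carrier_mat k k" "h * g = 1\<^sub>m k" "g * h = 1\<^sub>m k" by (auto simp: GL_iff)
  have "adj g * adj h = 1\<^sub>m k" "adj h * adj g = 1\<^sub>m k"
    by (metis h adj_mult adj_one)+
  then show ?thesis using h by (auto simp: GL_iff intro!: bexI[of _ "adj h"])
qed

lemma cv_carrier [simp]: "x \<in> carrier_vec n \<Longrightarrow> cv x \<in> carrier_vec n"
  by (auto simp: cv_def)

lemma cv_index: "x \<in> carrier_vec n \<Longrightarrow> i < n \<Longrightarrow> cv x $ i = cnj (x $ i)"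
  by (auto simp: cv_def)

lemma cv_add: "x \<in> carrier_vec n \<Longrightarrow> y \<in> carrier_vec n \<Longrightarrow> cv (x + y) = cv x + cv y"
  and cv_smult: "cv (c \<cdot>\<^sub>v x) = cnj c \<cdot>\<^sub>v cv x"
  by (auto simp: cv_def)

lemma cv_mult:
  assumes A: "A \<in> carrier_mat r n" and x: "x \<in> carrier_vec n" and y: "y \<in> carrier_vec r"
  shows "cv (A *\<^sub>v x) \<bullet> y = cv x \<bullet> (adj A *\<^sub>v y)"
proof -
  have Ax: "A *\<^sub>v x \<in> carrier_vec r" using A x by (rule mult_mat_vec_carrier)
  have Ay: "adj A *\<^sub>v y \<in> carrier_vec n" using adj_carrier[OF A] y by (rule mult_mat_vec_carrier)
  have "cv (A *\<^sub>v x) \<bullet> y = (\<Sum>i<r. \<Sum>j<n. cnj (A $$ (i, j)) * cnj (x $ j) * y $ i)"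
    unfolding sp_sum[OF y]
    by (intro sum.cong refl) (simp add: cv_index[OF Ax] mv_index[OF A x] sum_distrib_right del: index_mult_mat_vec)
  also have "\<dots> = (\<Sum>j<n. \<Sum>i<r. cnj (A $$ (i, j)) * cnj (x $ j) * y $ i)" by (rule sum.swap)
  also have "\<dots> = cv x \<bullet> (adj A *\<^sub>v y)"
    unfolding sp_sum[OF Ay]
    by (intro sum.cong refl) (simp add: cv_index[OF x] mv_index[OF adj_carrier[OF A] y] adj_index[OF A] sum_distrib_left mult_ac del: index_mult_mat_vec)
  finally show ?thesis .
qed

text \<open>A substitute for an invariant inner product of the unitary group; \<open>H\<close> need not be positive,
  since only the absence of isotropic vectors matters.\<close>

definition hform :: "nat \<Rightarrow> module_data \<Rightarrow> complex mat \<Rightarrow> bool" where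
  "hform k M H \<longleftrightarrow> H \<in> carrier_mat (fst M) (fst M) \<and>
     (\<forall>x\<in>carrier_vec (fst M). cv x \<bullet> (H *\<^sub>v x) = 0 \<longrightarrow> x = 0\<^sub>v (fst M)) \<and>
     (\<forall>g\<in>carrier (GL k). adj (snd M g) * H = H * snd M (adj g))"

lemma hform_move:
  assumes M: "polynomial_module k M" and H: "hform k M H" and g: "g \<in> carrier (GL k)"
    and x: "x \<in> carrier_vec (fst M)" and y: "y \<in> carrier_vec (fst M)"
  shows "cv (snd M g *\<^sub>v x) \<bullet> (H *\<^sub>v y) = cv x \<bullet> (H *\<^sub>v (snd M (adj g) *\<^sub>v y))"
proof -
  have Hc: "H \<in> carrier_mat (fst M) (fst M)" and e: "adj (snd M g) * H = H * snd M (adj g)" using H g by (auto simp: hform_def)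
  note c = pm_carrier[OF M g] pm_carrier[OF M adj_GL[OF g]]
  have "cv (snd M g *\<^sub>v x) \<bullet> (H *\<^sub>v y) = cv x \<bullet> (adj (snd M g) *\<^sub>v (H *\<^sub>v y))"
    by (rule cv_mult[OF c(1) x]) (use Hc y in auto)
  also have "adj (snd M g) *\<^sub>v (H *\<^sub>v y) = (adj (snd M g) * H) *\<^sub>v y"
    using adj_carrier[OF c(1)] Hc y by simp
  also have "\<dots> = H *\<^sub>v (snd M (adj g) *\<^sub>v y)" unfolding e using Hc c(2) y by simp
  finally show ?thesis .
qed

text \<open>The adjoint of a lower unitriangular matrix is upper unitriangular and therefore fixes
  \<open>z\<close>. On the torus the weight is conjugated once by \<open>adj\<close> and once by
  \<open>cv\<close>.\<close>

lemma hform_covector: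
  assumes M: "polynomial_module k M" and H: "hform k M H" and z: "hwv k M kap z"
  shows "covv k M kap (H\<^sup>T *\<^sub>v cv z)" "x \<in> carrier_vec (fst M) \<Longrightarrow> (H\<^sup>T *\<^sub>v cv z) \<bullet> x = cv z \<bullet> (H *\<^sub>v x)"
proof -
  let ?y = "H\<^sup>T *\<^sub>v cv z"
  have Hc: "H \<in> carrier_mat (fst M) (fst M)" using H by (simp add: hform_def)
  have zc: "z \<in> carrier_vec (fst M)" using z by (simp add: hwv_def)
  have e: "?y \<bullet> x = cv z \<bullet> (H *\<^sub>v x)" if "x \<in> carrier_vec (fst M)" for x
    using transpose_vec_mult_scalar[OF Hc that cv_carrier[OF zc]] .
  then show "x \<in> carrier_vec (fst M) \<Longrightarrow> ?y \<bullet> x = cv z \<bullet> (H *\<^sub>v x)" .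
  have yc: "?y \<in> carrier_vec (fst M)" using Hc zc by (intro mult_mat_vec_carrier) auto
  have mv: "?y \<bullet> (snd M g *\<^sub>v x) = cv (snd M (adj g) *\<^sub>v z) \<bullet> (H *\<^sub>v x)" if "g \<in> carrier (GL k)" "x \<in> carrier_vec (fst M)" for g x
    using e[OF pm_vec[OF M that]] hform_move[OF M H adj_GL[OF that(1)] zc that(2)] by simp
  have "?y \<bullet> (snd M t *\<^sub>v x) = wt k kap t * (?y \<bullet> x)" if t: "t \<in> carrier (GL k)" "diagonal_mat t" and x: "x \<in> carrier_vec (fst M)" for t x
  proof -
    have d: "diagonal_mat (adj t)" using t(2) GL_carrier[OF t(1)] by (auto simp: diagonal_mat_def adj_def)
    have "wt k kap (adj t) = cnj (wt k kap t)" using GL_carrier[OF t(1)] by (simp add: wt_def adj_index)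
    then have "snd M (adj t) *\<^sub>v z = cnj (wt k kap t) \<cdot>\<^sub>v z" using z d adj_GL[OF t(1)] by (simp add: hwv_def)
    then show ?thesis using mv[OF t(1) x] e[OF x] zc Hc x by (simp add: cv_smult)
  qed
  moreover have "?y \<bullet> (snd M l *\<^sub>v x) = ?y \<bullet> x" if l: "l \<in> carrier (GL k)" "upper_triangular (l\<^sup>T)" "\<forall>i<k. l $$ (i, i) = 1"
    and x: "x \<in> carrier_vec (fst M)" for l x
  proof -
    have lc: "l \<in> carrier_mat k k" using GL_carrier[OF l(1)] .
    have "upper_triangular (adj l)" using l(2) lc by (auto simp: upper_triangular_def adj_def)
    moreover have "\<forall>i<k. adj l $$ (i, i) = 1" using l(3) lc by (simp add: adj_index)
    ultimately have "snd M (adj l) *\<^sub>v z = z" using z adj_GL[OF l(1)] by (simp add: hwv_def)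
    then show ?thesis using mv[OF l(1) x] e[OF x] by simp
  qed
  ultimately show "covv k M kap ?y" using yc by (simp add: covv_def)
qed

text \<open>By \<open>pairing_big_cell\<close> both coefficients are the same character of the
  diagonal factor times their values at the identity. The cross multiplied difference is a
  polynomial function that vanishes on the big cell.\<close>

lemma pairing_proportional:
  assumes M: "polynomial_module k M" and v: "hwv k M kap v" and y: "covv k M a y"
    and N: "polynomial_module k N" and z: "hwv k N kap z" and w: "covv k N b w" and g: "g \<in> carrier (GL k)"
  shows "(y \<bullet> v) * (w \<bullet> (snd N g *\<^sub>v z)) = (w \<bullet> z) * (y \<bullet> (snd M g *\<^sub>v v))"
proof -
  have c: "v \<in> carrier_vec (fst M)" "z \<in> carrier_vec (fst N)" using v z by (auto simp: hwv_def)
  obtain p where p: "p \<in> polynomial_functions k" "\<forall>g\<in>carrier (GL k). y \<bullet> (snd M g *\<^sub>v v) = p g" using pm_coeff[OF M c(1)] by blast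
  obtain q where q: "q \<in> polynomial_functions k" "\<forall>g\<in>carrier (GL k). w \<bullet> (snd N g *\<^sub>v z) = q g" using pm_coeff[OF N c(2)] by blast
  let ?f = "\<lambda>g. (y \<bullet> v) * q g + (- (w \<bullet> z)) * p g"
  have "?f g = 0"
  proof (rule big_cell_dense[OF _ _ GL_carrier[OF g], of ?f])
    show "?f \<in> polynomial_functions k" using p(1) q(1)
      by (intro polynomial_functions.add[OF polynomial_functions.mult[OF polynomial_functions.const] polynomial_functions.mult[OF polynomial_functions.const]])
    fix l d u :: "complex mat"
    assume a: "l \<in> carrier_mat k k" "upper_triangular (l\<^sup>T)" "\<forall>i<k. l $$ (i, i) = 1"
      "d \<in> carrier_mat k k" "diagonal_mat d" "\<forall>i<k. d $$ (i, i) \<noteq> 0"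
      "u \<in> carrier_mat k k" "upper_triangular u" "\<forall>i<k. u $$ (i, i) = 1"
    show "?f (l * d * u) = 0"
      using pairing_big_cell[OF M v y a] pairing_big_cell[OF N z w a] p(2) q(2) by simp
  qed
  then show ?thesis using p(2) q(2) g by simp
qed

section \<open>Intertwiners out of simple modules\<close>

lemma mat_vec_eqI:
  fixes A B :: "complex mat"
  assumes "A \<in> carrier_mat r n" "B \<in> carrier_mat r n" "\<And>x. x \<in> carrier_vec n \<Longrightarrow> A *\<^sub>v x = B *\<^sub>v x"
  shows "A = B"
proof (rule eq_matI)
  fix i j assume "i < dim_row B" "j < dim_col B"
  then have ij: "i < r" "j < n" using assms by auto
  have "(A *\<^sub>v unit_vec n j) $ i = (B *\<^sub>v unit_vec n j) $ i" using assms(3)[of "unit_vec n j"] by simp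
  then show "A $$ (i, j) = B $$ (i, j)" using assms(1,2) ij by (simp add: scalar_prod_right_unit)
qed (use assms in auto)

text \<open>The submodule of the direct sum of \<open>M\<close> and \<open>N\<close> generated by
  the pair of \<open>v\<close> and \<open>z\<close>. It is to become the graph of the intertwiner
  that sends \<open>v\<close> to \<open>z\<close>.\<close>

inductive orbit_graph :: "nat \<Rightarrow> module_data \<Rightarrow> complex vec \<Rightarrow> module_data \<Rightarrow> complex vec \<Rightarrow> complex vec \<Rightarrow> complex vec \<Rightarrow> bool"
  for k M v N z where
  zero: "orbit_graph k M v N z (0\<^sub>v (fst M)) (0\<^sub>v (fst N))"
| step: "orbit_graph k M v N z x y \<Longrightarrow> g \<in> carrier (GL k) \<Longrightarrow>
    orbit_graph k M v N z (x + c \<cdot>\<^sub>v (snd M g *\<^sub>v v)) (y + c \<cdot>\<^sub>v (snd N g *\<^sub>v z))"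

context
  fixes k :: nat and M N :: module_data and v z :: "complex vec"
  assumes M: "polynomial_module k M" and N: "polynomial_module k N"
    and v: "v \<in> carrier_vec (fst M)" and z: "z \<in> carrier_vec (fst N)"
begin

lemma orbit_graph_carrier: "orbit_graph k M v N z x y \<Longrightarrow> x \<in> carrier_vec (fst M) \<and> y \<in> carrier_vec (fst N)"
  by (induction rule: orbit_graph.induct) (auto simp: pm_vec[OF M _ v] pm_vec[OF N _ z])

lemma orbit_graph_add: "orbit_graph k M v N z x' y' \<Longrightarrow> orbit_graph k M v N z x y \<Longrightarrow> orbit_graph k M v N z (x + x') (y + y')"
proof (induction rule: orbit_graph.induct)
  case zero
  then show ?case using orbit_graph_carrier by simp
next
  case (step x' y' g c)
  have "x + (x' + c \<cdot>\<^sub>v (snd M g *\<^sub>v v)) = (x + x') + c \<cdot>\<^sub>v (snd M g *\<^sub>v v)"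
    "y + (y' + c \<cdot>\<^sub>v (snd N g *\<^sub>v z)) = (y + y') + c \<cdot>\<^sub>v (snd N g *\<^sub>v z)"
    using orbit_graph_carrier[OF step(1)] orbit_graph_carrier[OF step(4)] pm_vec[OF M step(2) v] pm_vec[OF N step(2) z] by auto
  then show ?case using orbit_graph.step[OF step(3)[OF step(4)] step(2)] by simp
qed

lemma orbit_graph_smult: "orbit_graph k M v N z x y \<Longrightarrow> orbit_graph k M v N z (b \<cdot>\<^sub>v x) (b \<cdot>\<^sub>v y)"
proof (induction rule: orbit_graph.induct)
  case zero
  have "b \<cdot>\<^sub>v 0\<^sub>v (fst M) = 0\<^sub>v (fst M)" "b \<cdot>\<^sub>v 0\<^sub>v (fst N) = 0\<^sub>v (fst N)" by auto
  then show ?case using orbit_graph.zero[of k M v N z] by simp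
next
  case (step x y g c)
  have "b \<cdot>\<^sub>v (x + c \<cdot>\<^sub>v (snd M g *\<^sub>v v)) = b \<cdot>\<^sub>v x + (b * c) \<cdot>\<^sub>v (snd M g *\<^sub>v v)"
    "b \<cdot>\<^sub>v (y + c \<cdot>\<^sub>v (snd N g *\<^sub>v z)) = b \<cdot>\<^sub>v y + (b * c) \<cdot>\<^sub>v (snd N g *\<^sub>v z)"
    using orbit_graph_carrier[OF step(1)] pm_vec[OF M step(2) v] pm_vec[OF N step(2) z]
    by (auto simp: smult_add_distrib_vec[of _ "fst M"] smult_add_distrib_vec[of _ "fst N"] smult_smult_assoc)
  then show ?case using orbit_graph.step[OF step(3,2)] by simp
qed

lemma orbit_graph_act: "orbit_graph k M v N z x y \<Longrightarrow> h \<in> carrier (GL k) \<Longrightarrow> orbit_graph k M v N z (snd M h *\<^sub>v x) (snd N h *\<^sub>v y)"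
proof (induction rule: orbit_graph.induct)
  case zero
  have "snd M h *\<^sub>v 0\<^sub>v (fst M) = 0\<^sub>v (fst M)" "snd N h *\<^sub>v 0\<^sub>v (fst N) = 0\<^sub>v (fst N)"
    using pm_carrier[OF M zero] pm_carrier[OF N zero] by (auto intro!: eq_vecI simp: scalar_prod_def)
  then show ?case using orbit_graph.zero[of k M v N z] by simp
next
  case (step x y g c)
  have "snd M h *\<^sub>v (x + c \<cdot>\<^sub>v (snd M g *\<^sub>v v)) = snd M h *\<^sub>v x + c \<cdot>\<^sub>v (snd M (h * g) *\<^sub>v v)"
    "snd N h *\<^sub>v (y + c \<cdot>\<^sub>v (snd N g *\<^sub>v z)) = snd N h *\<^sub>v y + c \<cdot>\<^sub>v (snd N (h * g) *\<^sub>v z)"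
    using orbit_graph_carrier[OF step(1)] pm_vec[OF M step(2) v] pm_vec[OF N step(2) z] pm_carrier[OF M step(4)] pm_carrier[OF N step(4)]
    by (simp_all add: mult_add_distrib_mat_vec mult_mat_vec pm_mult_vec[OF M step(4,2) v] pm_mult_vec[OF N step(4,2) z])
  then show ?case using orbit_graph.step[OF step(3)[OF step(4)] GL_mult_closed[OF step(4,2)]] by simp
qed

text \<open>The domain of the relation is a submodule that contains \<open>v\<close>.\<close>

lemma orbit_graph_total:
  assumes S: "simple_module k M" and nz: "v \<noteq> 0\<^sub>v (fst M)" and x: "x \<in> carrier_vec (fst M)"
  shows "\<exists>y. orbit_graph k M v N z x y"
proof -
  let ?W = "{x. \<exists>y. orbit_graph k M v N z x y}"
  have "?W = {0\<^sub>v (fst M)} \<or> ?W = carrier_vec (fst M)"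
    by (rule simple_moduleD[OF S])
      (use orbit_graph_carrier orbit_graph.zero orbit_graph_add orbit_graph_smult orbit_graph_act in blast)+
  moreover have "orbit_graph k M v N z (0\<^sub>v (fst M) + 1 \<cdot>\<^sub>v (snd M (1\<^sub>m k) *\<^sub>v v)) (0\<^sub>v (fst N) + 1 \<cdot>\<^sub>v (snd N (1\<^sub>m k) *\<^sub>v z))"
    by (rule orbit_graph.step[OF orbit_graph.zero GL_one_closed])
  then have "v \<in> ?W" using v by (auto simp: pm_one[OF M])
  ultimately show ?thesis using nz x by blast
qed

end

text \<open>The relation \<open>orbit_graph\<close> is total by simplicity of \<open>M\<close>. It
  is single valued, since a pair of zero and \<open>y\<close> makes \<open>y\<close> orthogonal for
  the form \<open>H\<close> to the orbit of \<open>z\<close>; as \<open>y\<close> lies in the span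
  of that orbit, it is isotropic and so zero.\<close>

theorem simple_intertwiner:
  assumes M: "polynomial_module k M" and S: "simple_module k M" and v: "hwv k M kap v" "v \<noteq> 0\<^sub>v (fst M)"
    and N: "polynomial_module k N" and H: "hform k N H" and z: "hwv k N kap z" "z \<noteq> 0\<^sub>v (fst N)"
  shows "\<exists>J\<in>carrier_mat (fst N) (fst M). (\<forall>g\<in>carrier (GL k). snd N g * J = J * snd M g) \<and> J *\<^sub>v v = z \<and>
    (\<forall>x\<in>carrier_vec (fst M). J *\<^sub>v x = 0\<^sub>v (fst N) \<longrightarrow> x = 0\<^sub>v (fst M))"
proof -
  let ?n = "fst M" and ?m = "fst N" and ?G = "orbit_graph k M v N z"
  have vc: "v \<in> carrier_vec ?n" and zc: "z \<in> carrier_vec ?m" using v z by (auto simp: hwv_def)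
  have Hc: "H \<in> carrier_mat ?m ?m" and Hd: "\<And>x. x \<in> carrier_vec ?m \<Longrightarrow> cv x \<bullet> (H *\<^sub>v x) = 0 \<Longrightarrow> x = 0\<^sub>v ?m"
    using H by (auto simp: hform_def)
  note car = orbit_graph_carrier[OF M N vc zc]
  obtain xi where xi: "covv k M kap xi" "xi \<bullet> v = 1" using simple_covector[OF M S v] by blast
  have xic: "xi \<in> carrier_vec ?n" using xi by (simp add: covv_def)
  let ?ze = "H\<^sup>T *\<^sub>v cv z"
  note ze = hform_covector[OF N H z(1)]
  have zec: "?ze \<in> carrier_vec ?m" using ze(1) by (simp add: covv_def)
  \<comment> \<open>The coefficients of the two modules stay proportional along the graph, by
    \<open>pairing_proportional\<close> on the generating pairs.\<close>
  have fn: "?ze \<bullet> (snd N h *\<^sub>v y) = (?ze \<bullet> z) * (xi \<bullet> (snd M h *\<^sub>v x))" if "?G x y" "h \<in> carrier (GL k)" for x y h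
    using that
  proof (induction rule: orbit_graph.induct)
    case zero
    have "snd M h *\<^sub>v 0\<^sub>v ?n = 0\<^sub>v ?n" "snd N h *\<^sub>v 0\<^sub>v ?m = 0\<^sub>v ?m"
      using pm_carrier[OF M zero] pm_carrier[OF N zero] by (auto intro!: eq_vecI simp: scalar_prod_def)
    then show ?case using xic zec by simp
  next
    case (step x y g c)
    note c = car[OF step(1)]
    have "?ze \<bullet> (snd N h *\<^sub>v (y + c \<cdot>\<^sub>v (snd N g *\<^sub>v z))) = ?ze \<bullet> (snd N h *\<^sub>v y) + c * (?ze \<bullet> (snd N (h * g) *\<^sub>v z))"
      using c pm_vec[OF N step(2) zc] pm_carrier[OF N step(4)] zec pm_vec[OF N step(4)] pm_vec[OF N GL_mult_closed[OF step(4,2)] zc]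
      by (simp add: mult_add_distrib_mat_vec mult_mat_vec pm_mult_vec[OF N step(4,2) zc, symmetric] scalar_prod_add_distrib[of _ ?m] )
    moreover have "xi \<bullet> (snd M h *\<^sub>v (x + c \<cdot>\<^sub>v (snd M g *\<^sub>v v))) = xi \<bullet> (snd M h *\<^sub>v x) + c * (xi \<bullet> (snd M (h * g) *\<^sub>v v))"
      using c pm_vec[OF M step(2) vc] pm_carrier[OF M step(4)] xic pm_vec[OF M step(4)] pm_vec[OF M GL_mult_closed[OF step(4,2)] vc]
      by (simp add: mult_add_distrib_mat_vec mult_mat_vec pm_mult_vec[OF M step(4,2) vc, symmetric] scalar_prod_add_distrib[of _ ?n] )
    moreover have "?ze \<bullet> (snd N (h * g) *\<^sub>v z) = (?ze \<bullet> z) * (xi \<bullet> (snd M (h * g) *\<^sub>v v))"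
      using pairing_proportional[OF M v(1) xi(1) N z(1) ze(1) GL_mult_closed[OF step(4,2)]] xi(2) by simp
    ultimately show ?case using step by (simp add: algebra_simps)
  qed
  have func0: "y = 0\<^sub>v ?m" if y: "?G (0\<^sub>v ?n) y" for y
  proof -
    have yc: "y \<in> carrier_vec ?m" using car[OF y] by simp
    have "cv (snd N g *\<^sub>v z) \<bullet> (H *\<^sub>v y) = 0" if g: "g \<in> carrier (GL k)" for g
    proof -
      have "snd M (adj g) *\<^sub>v 0\<^sub>v ?n = 0\<^sub>v ?n" using pm_carrier[OF M adj_GL[OF g]] by (auto intro!: eq_vecI simp: scalar_prod_def)
      then have "?ze \<bullet> (snd N (adj g) *\<^sub>v y) = 0" using fn[OF y adj_GL[OF g]] xic by simp
      then show ?thesis using ze(2)[OF pm_vec[OF N adj_GL[OF g] yc]] hform_move[OF N H g zc yc] by simp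
    qed
    note gen = this
    have "cv y' \<bullet> (H *\<^sub>v y) = 0" if "?G x' y'" for x' y'
      using that
    proof (induction rule: orbit_graph.induct)
      case zero
      have "cv (0\<^sub>v ?m) = 0\<^sub>v ?m" by (auto simp: cv_def)
      then show ?case using Hc yc by simp
    next
      case (step x' y' g c)
      have Hy: "H *\<^sub>v y \<in> carrier_vec ?m" using Hc yc by (rule mult_mat_vec_carrier)
      show ?case
        using step gen[OF step(2)] car[OF step(1)] pm_vec[OF N step(2) zc] Hy
        by (simp add: cv_add[of _ ?m] cv_smult add_scalar_prod_distrib[of _ ?m] smult_scalar_prod_distrib[of _ ?m])
    qed
    then show ?thesis using Hd[OF yc] y by blast
  qed
  have func: "y = y'" if "?G x y" "?G x y'" for x y y'
  proof -
    have c: "x \<in> carrier_vec ?n" "y \<in> carrier_vec ?m" "y' \<in> carrier_vec ?m" using that car by auto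
    have "?G (x + (-1) \<cdot>\<^sub>v x) (y + (-1) \<cdot>\<^sub>v y')"
      using orbit_graph_add[OF M N vc zc orbit_graph_smult[OF M N vc zc that(2)] that(1)] .
    moreover have "x + (-1) \<cdot>\<^sub>v x = 0\<^sub>v ?n" using c by (intro eq_vecI) auto
    ultimately have "y + (-1) \<cdot>\<^sub>v y' = 0\<^sub>v ?m" using func0 by simp
    then have "(y + (-1) \<cdot>\<^sub>v y') $ i = 0" if "i < ?m" for i using that by simp
    then show ?thesis using c by (intro eq_vecI) auto
  qed
  have "\<forall>i. \<exists>y. ?G (unit_vec ?n i) y" using orbit_graph_total[OF M N vc zc S v(2)] by simp
  then obtain f where f: "\<And>i. ?G (unit_vec ?n i) (f i)" by metis
  have fc: "f i \<in> carrier_vec ?m" for i using car[OF f] by simp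
  define J where "J = mat ?m ?n (\<lambda>(a, i). f i $ a)"
  have Jc: "J \<in> carrier_mat ?m ?n" by (simp add: J_def)
  have G: "?G x (J *\<^sub>v x)" if x: "x \<in> carrier_vec ?n" for x
  proof -
    \<comment> \<open>\<open>x\<close> is built up coordinate by coordinate from the pairs that
      define the columns of \<open>J\<close>.\<close>
    define xr where "xr = (\<lambda>r. vec ?n (\<lambda>i. if i < r then x $ i else 0))"
    have "?G (xr r) (J *\<^sub>v xr r)" if "r \<le> ?n" for r
      using that
    proof (induction r)
      case 0
      have "xr 0 = 0\<^sub>v ?n" by (auto simp: xr_def)
      moreover have "J *\<^sub>v 0\<^sub>v ?n = 0\<^sub>v ?m" using Jc by (auto intro!: eq_vecI simp: scalar_prod_def)
      ultimately show ?case using orbit_graph.zero[of k M v N z] by simp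
    next
      case (Suc r)
      then have r: "r < ?n" by simp
      have e: "xr (Suc r) = xr r + x $ r \<cdot>\<^sub>v unit_vec ?n r" by (rule eq_vecI) (auto simp: xr_def less_Suc_eq unit_vec_def)
      have xc: "xr r \<in> carrier_vec ?n" by (simp add: xr_def)
      have "J *\<^sub>v unit_vec ?n r = f r"
        using r fc[of r] by (intro eq_vecI) (auto simp: J_def scalar_prod_right_unit)
      then have "J *\<^sub>v xr (Suc r) = J *\<^sub>v xr r + x $ r \<cdot>\<^sub>v f r"
        unfolding e using Jc xc by (simp add: mult_add_distrib_mat_vec mult_mat_vec)
      then show ?case
        unfolding e using orbit_graph_add[OF M N vc zc orbit_graph_smult[OF M N vc zc f[of r], of "x $ r"] Suc.IH] r by simp
    qed
    moreover have "xr ?n = x" using x by (auto simp: xr_def)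
    ultimately show ?thesis by (metis order_refl)
  qed
  have int: "snd N g *\<^sub>v (J *\<^sub>v x) = J *\<^sub>v (snd M g *\<^sub>v x)" if "g \<in> carrier (GL k)" "x \<in> carrier_vec ?n" for g x
    using func[OF orbit_graph_act[OF M N vc zc G[OF that(2)] that(1)] G[OF pm_vec[OF M that]]] .
  have "snd N g * J = J * snd M g" if g: "g \<in> carrier (GL k)" for g
  proof (rule mat_vec_eqI)
    fix x :: "complex vec" assume x: "x \<in> carrier_vec ?n"
    show "(snd N g * J) *\<^sub>v x = (J * snd M g) *\<^sub>v x"
      using int[OF g x] pm_carrier[OF N g] pm_carrier[OF M g] Jc x by simp
  qed (use pm_carrier[OF N g] pm_carrier[OF M g] Jc in auto)
  moreover have Jv: "J *\<^sub>v v = z"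
  proof -
    have "?G (0\<^sub>v ?n + 1 \<cdot>\<^sub>v (snd M (1\<^sub>m k) *\<^sub>v v)) (0\<^sub>v ?m + 1 \<cdot>\<^sub>v (snd N (1\<^sub>m k) *\<^sub>v z))"
      by (rule orbit_graph.step[OF orbit_graph.zero GL_one_closed])
    then have "?G v z" using vc zc by (simp add: pm_one[OF M] pm_one[OF N])
    then show ?thesis using func[OF G[OF vc]] by simp
  qed
  moreover have "x = 0\<^sub>v ?n" if x: "x \<in> carrier_vec ?n" "J *\<^sub>v x = 0\<^sub>v ?m" for x
  proof -
    \<comment> \<open>The kernel is a submodule that misses \<open>v\<close>.\<close>
    let ?W = "{x \<in> carrier_vec ?n. J *\<^sub>v x = 0\<^sub>v ?m}"
    have "?W = {0\<^sub>v ?n} \<or> ?W = carrier_vec ?n"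
    proof (rule simple_moduleD[OF S])
      show "0\<^sub>v ?n \<in> ?W" using Jc by (auto intro!: eq_vecI simp: scalar_prod_def)
      show "a + b \<in> ?W" if "a \<in> ?W" "b \<in> ?W" for a b using that Jc by (auto simp: mult_add_distrib_mat_vec)
      show "c \<cdot>\<^sub>v a \<in> ?W" if "a \<in> ?W" for c a using that Jc by (auto simp: mult_mat_vec)
      show "snd M g *\<^sub>v a \<in> ?W" if "g \<in> carrier (GL k)" "a \<in> ?W" for g a
        using that pm_vec[OF M that(1)] int[OF that(1), of a, symmetric] pm_carrier[OF N that(1)]
        by (auto intro!: eq_vecI simp: scalar_prod_def)
    qed auto
    moreover have "v \<notin> ?W" using Jv z(2) by simp
    ultimately show ?thesis using x vc by blast
  qed
  ultimately show ?thesis using Jc by blast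
qed

text \<open>Dominance is read off the copy of SL_2 in rows \<open>i\<close> and
  \<open>Suc i\<close>. The curve \<open>c\<close> with block entries \<open>s, 1, - 1, 0\<close>
  has for \<open>s \<noteq> 0\<close> an LDU factorisation with torus part \<open>s, 1 / s\<close>,
  so the pairing is a nonzero constant times \<open>s\<close> to the integer power
  \<open>kap ! i - kap ! Suc i\<close>. Being polynomial in \<open>s\<close>, it cannot have a pole
  at \<open>0\<close>.\<close>

lemma weight_dominant:
  assumes N: "polynomial_module k N" and z: "hwv k N kap z" and y: "covv k N kap y" and nz: "y \<bullet> z \<noteq> 0"
    and len: "length kap = k"
  shows "kap \<in> partitions k"
proof -
  have "kap ! Suc i \<le> kap ! i" if i: "Suc i < k" for i
  proof (rule ccontr)
    assume "\<not> kap ! Suc i \<le> kap ! i"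
    then have lt: "kap ! i < kap ! Suc i" by simp
    define c where "c = (\<lambda>s::complex. mat k k (\<lambda>(a, b). if a = i \<and> b = i then s else if a = i \<and> b = Suc i then 1
       else if a = Suc i \<and> b = i then - 1 else if a = b \<and> a \<noteq> Suc i then 1 else 0))"
    obtain p where p: "p \<in> polynomial_functions k" "\<forall>g\<in>carrier (GL k). y \<bullet> (snd N g *\<^sub>v z) = p g"
      using pm_coeff[OF N] z unfolding hwv_def by blast
    have "\<exists>q. \<forall>s. p (c s) = poly q s"
    proof (rule polyfun_curve[OF p(1)])
      fix a b assume "a < k" "b < k"
      then show "\<exists>q. \<forall>s. c s $$ (a, b) = poly q s"
        by (intro exI[of _ "if a = i \<and> b = i then [:0, 1:] else [:c 0 $$ (a, b):]"]) (auto simp: c_def)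
    qed
    then obtain q where q: "\<And>s. p (c s) = poly q s" by blast
    have val: "poly q s = s ^ (kap ! i) * (1 / s) ^ (kap ! Suc i) * W" if s: "s \<noteq> 0"
      and W: "W = (y \<bullet> z)" for s W
    proof -
      define l where "l = mat k k (\<lambda>(a, b). if a = b then 1 else if a = Suc i \<and> b = i then - 1 / s else 0)"
      define d where "d = dmat k (\<lambda>a. if a = i then s else if a = Suc i then 1 / s else 1)"
      define u where "u = mat k k (\<lambda>(a, b). if a = b then 1 else if a = i \<and> b = Suc i then 1 / s else 0)"
      have cs: "l \<in> carrier_mat k k" "d \<in> carrier_mat k k" "u \<in> carrier_mat k k" by (auto simp: l_def d_def u_def)
      have "l * d * u = c s"
      proof (rule eq_matI)
        fix a b assume "a < dim_row (c s)" "b < dim_col (c s)"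
        then have ab: "a < k" "b < k" by (auto simp: c_def)
        have ld: "(l * d) $$ (a, e) = l $$ (a, e) * (if e = i then s else if e = Suc i then 1 / s else 1)" if "e < k" for e
        proof -
          have "(l * d) $$ (a, e) = (\<Sum>f<k. l $$ (a, f) * d $$ (f, e))" by (rule mm_index[OF cs(1,2) ab(1) that])
          also have "\<dots> = (\<Sum>f<k. (if f = e then 1 else 0) * (l $$ (a, f) * (if f = i then s else if f = Suc i then 1 / s else 1)))"
            using that by (intro sum.cong) (auto simp: d_def)
          finally show ?thesis using that by (simp add: sum_pick)
        qed
        have "(l * d * u) $$ (a, b) = (\<Sum>e<k. (l * d) $$ (a, e) * u $$ (e, b))"
          by (rule mm_index[OF _ cs(3) ab]) (use cs in auto)
        also have "\<dots> = (\<Sum>e<k. (if e = b then 1 else 0) * (l * d) $$ (a, e) + (if e = i then 1 else 0) * (if b = Suc i then (l * d) $$ (a, e) / s else 0))"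
          using ab by (intro sum.cong) (auto simp: u_def)
        also have "\<dots> = (l * d) $$ (a, b) + (if b = Suc i then (l * d) $$ (a, i) / s else 0)"
          using ab i by (simp only: sum.distrib sum_pick finite_lessThan) auto
        also have "\<dots> = c s $$ (a, b)"
          unfolding ld[OF ab(2)] ld[OF Suc_lessD[OF i]] using ab i s by (auto simp: l_def c_def)
        finally show "(l * d * u) $$ (a, b) = c s $$ (a, b)" .
      qed (auto simp: c_def l_def u_def)
      moreover have "y \<bullet> (snd N (l * d * u) *\<^sub>v z) = wt k kap d * (y \<bullet> z)" "l * d * u \<in> carrier (GL k)"
        by (intro pairing_big_cell[OF N z y]; use s in \<open>auto simp: l_def d_def u_def upper_triangular_def diagonal_mat_def split: if_splits\<close>)+
      moreover have "wt k kap d = s ^ (kap ! i) * (1 / s) ^ (kap ! Suc i)"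
      proof -
        have "wt k kap d = (\<Prod>a<k. (if a = i then s ^ (kap ! i) else 1) * (if a = Suc i then (1 / s) ^ (kap ! Suc i) else 1))"
          unfolding wt_def by (intro prod.cong) (auto simp: d_def)
        then show ?thesis using i by (simp add: prod.distrib)
      qed
      ultimately show ?thesis using p(2) q W by metis
    qed
    have "monom 1 (kap ! Suc i - kap ! i) * q = [:y \<bullet> z:]"
    proof (rule poly_cofinite_eq[of "{0}"])
      fix s :: complex assume "s \<notin> {0}"
      then have s: "s \<noteq> 0" by simp
      have "s ^ (kap ! Suc i - kap ! i) * (s ^ (kap ! i) * (1 / s) ^ (kap ! Suc i)) = 1"
        using s lt by (simp add: power_diff power_one_over)
      then show "poly (monom 1 (kap ! Suc i - kap ! i) * q) s = poly [:y \<bullet> z:] s"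
        using val[OF s refl] by (simp add: poly_monom)
    qed simp
    then have "poly (monom 1 (kap ! Suc i - kap ! i) * q) 0 = y \<bullet> z" by simp
    then show False using nz lt by (simp add: poly_monom zero_power)
  qed
  then have "kap ! j \<le> kap ! i" if "i < j" "j < k" for i j
    using that by (induction j) (auto simp: less_Suc_eq intro: order.trans)
  then show ?thesis using len by (auto simp: partitions_def sorted_wrt_iff_nth_less)
qed

subsection \<open>Complete reducibility\<close>

lemma wide_kernel:
  fixes A :: "complex mat"
  assumes A: "A \<in> carrier_mat r n" and rn: "r < n"
  shows "\<exists>x\<in>carrier_vec n. x \<noteq> 0\<^sub>v n \<and> A *\<^sub>v x = 0\<^sub>v r"
proof -
  \<comment> \<open>Padding with zero rows gives a singular square matrix.\<close>
  let ?B = "mat n n (\<lambda>(i, j). if i < r then A $$ (i, j) else 0)"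
  have B: "?B \<in> carrier_mat n n" by simp
  have "transpose_mat ?B *\<^sub>v unit_vec n r = 0\<^sub>v n"
    using rn by (intro eq_vecI) (auto simp: scalar_prod_right_unit)
  moreover have "unit_vec n r \<noteq> (0\<^sub>v n :: complex vec)"
  proof
    assume "unit_vec n r = (0\<^sub>v n :: complex vec)"
    then have "unit_vec n r $ r = (0\<^sub>v n :: complex vec) $ r" by simp
    then show False using rn by simp
  qed
  ultimately have "det (transpose_mat ?B) = 0"
    by (subst det_0_iff_vec_prod_zero_field[of _ n]) (auto intro!: exI[of _ "unit_vec n r"])
  then have "det ?B = 0" using det_transpose[OF B] by simp
  then obtain x where x: "x \<in> carrier_vec n" "x \<noteq> 0\<^sub>v n" "?B *\<^sub>v x = 0\<^sub>v n"
    using det_0_iff_vec_prod_zero_field[OF B] by blast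
  have "(A *\<^sub>v x) $ i = 0" if i: "i < r" for i
  proof -
    have "(A *\<^sub>v x) $ i = (\<Sum>j<n. A $$ (i, j) * x $ j)" by (rule mv_index[OF A x(1) i])
    also have "\<dots> = (\<Sum>j<n. ?B $$ (i, j) * x $ j)" using i rn by (intro sum.cong) auto
    also have "\<dots> = (?B *\<^sub>v x) $ i" using i rn by (intro mv_index[OF B x(1), symmetric]) simp
    finally show ?thesis using x(3) i rn by simp
  qed
  then have "A *\<^sub>v x = 0\<^sub>v r" using A by (intro eq_vecI) auto
  then show ?thesis using x by blast
qed

definition inj_mat :: "complex mat \<Rightarrow> nat \<Rightarrow> nat \<Rightarrow> bool" where
  "inj_mat A n r \<longleftrightarrow> A \<in> carrier_mat n r \<and> (\<forall>x\<in>carrier_vec r. A *\<^sub>v x = 0\<^sub>v n \<longrightarrow> x = 0\<^sub>v r)"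

lemma inj_mat_le: "inj_mat A n r \<Longrightarrow> r \<le> n"
  using wide_kernel[of A n r] by (auto simp: inj_mat_def not_le[symmetric])

lemma inj_square_inverse:
  assumes "inj_mat A n n"
  obtains B where "B \<in> carrier_mat n n" "A * B = 1\<^sub>m n" "B * A = 1\<^sub>m n"
proof -
  have A: "A \<in> carrier_mat n n" using assms by (simp add: inj_mat_def)
  have "det A \<noteq> 0" using det_0_iff_vec_prod_zero_field[OF A] assms by (auto simp: inj_mat_def)
  then have "A \<in> carrier (GL n)" by (rule GL_det[OF A])
  then show ?thesis using that by (auto simp: GL_iff)
qed

definition hcat :: "complex mat \<Rightarrow> complex mat \<Rightarrow> complex mat" where
  "hcat A B = mat (dim_row A) (dim_col A + dim_col B) (\<lambda>(i, j). if j < dim_col A then A $$ (i, j) else B $$ (i, j - dim_col A))"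

lemma hcat_carrier: "A \<in> carrier_mat n a \<Longrightarrow> B \<in> carrier_mat n b \<Longrightarrow> hcat A B \<in> carrier_mat n (a + b)"
  by (auto simp: hcat_def)

lemma hcat_mult:
  assumes A: "A \<in> carrier_mat n a" and B: "B \<in> carrier_mat n b" and x: "x \<in> carrier_vec a" and y: "y \<in> carrier_vec b"
  shows "hcat A B *\<^sub>v (x @\<^sub>v y) = A *\<^sub>v x + B *\<^sub>v y"
proof (rule eq_vecI)
  fix i assume "i < dim_vec (A *\<^sub>v x + B *\<^sub>v y)"
  then have i: "i < n" using B by simp
  have "row (hcat A B) i = row A i @\<^sub>v row B i"
    using A B i by (intro eq_vecI) (auto simp: hcat_def)
  then have "(hcat A B *\<^sub>v (x @\<^sub>v y)) $ i = (row A i @\<^sub>v row B i) \<bullet> (x @\<^sub>v y)"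
    using hcat_carrier[OF A B] i by simp
  also have "\<dots> = row A i \<bullet> x + row B i \<bullet> y" using A B i x y by (intro scalar_prod_append) auto
  finally show "(hcat A B *\<^sub>v (x @\<^sub>v y)) $ i = (A *\<^sub>v x + B *\<^sub>v y) $ i" using A B i by simp
qed (use hcat_carrier[OF A B] B in auto)

lemma append_split:
  assumes "z \<in> carrier_vec (a + b)"
  obtains x y where "x \<in> carrier_vec a" "y \<in> carrier_vec b" "z = x @\<^sub>v y"
  using that[of "vec_first z a" "vec_last z b"] vec_first_last_append[OF assms] by auto

text \<open>Condition \<open>d\<close> expresses that the images of \<open>A\<close> and
  \<open>B\<close> meet only in zero.\<close>

lemma hcat_inj:
  assumes A: "inj_mat A n a" and B: "inj_mat B n b"
    and d: "\<And>x y. x \<in> carrier_vec a \<Longrightarrow> y \<in> carrier_vec b \<Longrightarrow> A *\<^sub>v x + B *\<^sub>v y = 0\<^sub>v n \<Longrightarrow> B *\<^sub>v y = 0\<^sub>v n"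
  shows "inj_mat (hcat A B) n (a + b)"
proof -
  have c: "A \<in> carrier_mat n a" "B \<in> carrier_mat n b" using A B by (auto simp: inj_mat_def)
  have "z = 0\<^sub>v (a + b)" if z: "z \<in> carrier_vec (a + b)" "hcat A B *\<^sub>v z = 0\<^sub>v n" for z
  proof -
    obtain x y where xy: "x \<in> carrier_vec a" "y \<in> carrier_vec b" "z = x @\<^sub>v y" using append_split[OF z(1)] .
    have e: "A *\<^sub>v x + B *\<^sub>v y = 0\<^sub>v n" using z(2) xy by (simp add: hcat_mult[OF c])
    have By: "B *\<^sub>v y = 0\<^sub>v n" using d[OF xy(1,2) e] .
    then have "A *\<^sub>v x = 0\<^sub>v n" using e c xy by (metis mult_mat_vec_carrier right_zero_vec)
    then have "x = 0\<^sub>v a" "y = 0\<^sub>v b" using A B By xy by (auto simp: inj_mat_def)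
    then show ?thesis using xy(3) by auto
  qed
  then show ?thesis using hcat_carrier[OF c] by (simp add: inj_mat_def)
qed

text \<open>The columns of \<open>C\<close> are a basis: among the injective matrices with image in
  \<open>W\<close> one with the largest number of columns is taken, and a vector of \<open>W\<close>
  outside its image could be appended as one more column.\<close>

lemma subspace_image:
  assumes W: "W \<subseteq> carrier_vec n" "0\<^sub>v n \<in> W" "\<And>v w. v \<in> W \<Longrightarrow> w \<in> W \<Longrightarrow> v + w \<in> W"
    "\<And>c v. v \<in> W \<Longrightarrow> c \<cdot>\<^sub>v v \<in> W"
  obtains r C where "inj_mat C n r" "W = (\<lambda>x. C *\<^sub>v x) ` carrier_vec r"
proof -
  let ?P = "\<lambda>r. \<exists>C. inj_mat C n r \<and> (\<forall>x\<in>carrier_vec r. C *\<^sub>v x \<in> W)"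
  have "?P 0"
  proof (intro exI conjI ballI)
    show "inj_mat (0\<^sub>m n 0) n 0" by (auto simp: inj_mat_def)
    show "0\<^sub>m n 0 *\<^sub>v x \<in> W" if "x \<in> carrier_vec 0" for x
    proof -
      have "0\<^sub>m n 0 *\<^sub>v x = 0\<^sub>v n" using that by (intro eq_vecI) (auto simp: scalar_prod_def)
      then show ?thesis using W(2) by simp
    qed
  qed
  moreover have "\<forall>r. ?P r \<longrightarrow> r \<le> n" using inj_mat_le by blast
  ultimately have "?P (Greatest ?P)" "\<And>r'. ?P r' \<Longrightarrow> r' \<le> Greatest ?P"
    by (blast intro: GreatestI_nat[of ?P 0 n], blast intro: Greatest_le_nat[of ?P _ n])
  then obtain r where r: "?P r" "\<And>r'. ?P r' \<Longrightarrow> r' \<le> r" by blast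
  then obtain C where C: "inj_mat C n r" "\<And>x. x \<in> carrier_vec r \<Longrightarrow> C *\<^sub>v x \<in> W" by blast
  have Cc: "C \<in> carrier_mat n r" using C(1) by (simp add: inj_mat_def)
  have "w \<in> (\<lambda>x. C *\<^sub>v x) ` carrier_vec r" if w: "w \<in> W" for w
  proof (rule ccontr)
    assume nw: "w \<notin> (\<lambda>x. C *\<^sub>v x) ` carrier_vec r"
    have wc: "w \<in> carrier_vec n" using w W(1) by blast
    define D where "D = mat n 1 (\<lambda>(i, j). w $ i)"
    have Dc: "D \<in> carrier_mat n 1" by (simp add: D_def)
    have Dy: "D *\<^sub>v y = y $ 0 \<cdot>\<^sub>v w" if "y \<in> carrier_vec 1" for y
    proof (rule eq_vecI)
      fix i assume "i < dim_vec (y $ 0 \<cdot>\<^sub>v w)"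
      then have i: "i < n" using wc by simp
      show "(D *\<^sub>v y) $ i = (y $ 0 \<cdot>\<^sub>v w) $ i" unfolding mv_index[OF Dc that i] using i wc by (simp add: D_def)
    qed (use Dc wc in auto)
    have key: "y $ 0 = 0" if x: "x \<in> carrier_vec r" and y: "y \<in> carrier_vec 1" and e: "C *\<^sub>v x + D *\<^sub>v y = 0\<^sub>v n" for x y
    proof (rule ccontr)
      assume y0: "y $ 0 \<noteq> 0"
      have "w = C *\<^sub>v ((- 1 / y $ 0) \<cdot>\<^sub>v x)"
      proof (rule eq_vecI)
        fix i assume "i < dim_vec (C *\<^sub>v ((- 1 / y $ 0) \<cdot>\<^sub>v x))"
        then have i: "i < n" using Cc by simp
        have "(C *\<^sub>v x + D *\<^sub>v y) $ i = 0" using e i by simp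
        then have "(C *\<^sub>v x) $ i + y $ 0 * w $ i = 0" using i wc Cc unfolding Dy[OF y] by simp
        then have a: "(C *\<^sub>v x) $ i = - (y $ 0 * w $ i)" by (simp only: add_eq_0_iff2)
        moreover have "(C *\<^sub>v ((- 1 / y $ 0) \<cdot>\<^sub>v x)) $ i = (- 1 / y $ 0) * (C *\<^sub>v x) $ i"
          unfolding mult_mat_vec[OF Cc x] using i Cc by simp
        ultimately show "w $ i = (C *\<^sub>v ((- 1 / y $ 0) \<cdot>\<^sub>v x)) $ i"
          unfolding a using y0 by simp
      qed (use wc Cc in auto)
      moreover have "(- 1 / y $ 0) \<cdot>\<^sub>v x \<in> carrier_vec r" using x by simp
      ultimately show False using nw by blast
    qed
    have "inj_mat D n 1"
    proof -
      have "y = 0\<^sub>v 1" if "y \<in> carrier_vec 1" "D *\<^sub>v y = 0\<^sub>v n" for y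
      proof -
        have "C *\<^sub>v 0\<^sub>v r = 0\<^sub>v n" using Cc by (intro eq_vecI) (auto simp: scalar_prod_def)
        then have "y $ 0 = 0" using key[of "0\<^sub>v r" y] that by simp
        then show ?thesis using that(1) by (intro eq_vecI) auto
      qed
      then show ?thesis using Dc by (simp add: inj_mat_def)
    qed
    moreover have "D *\<^sub>v y = 0\<^sub>v n" if "x \<in> carrier_vec r" "y \<in> carrier_vec 1" "C *\<^sub>v x + D *\<^sub>v y = 0\<^sub>v n" for x y
      using key[OF that] wc unfolding Dy[OF that(2)] by auto
    ultimately have "inj_mat (hcat C D) n (r + 1)" using C(1) by (intro hcat_inj) auto
    moreover have "hcat C D *\<^sub>v z \<in> W" if z: "z \<in> carrier_vec (r + 1)" for z
    proof -
      obtain x y where "x \<in> carrier_vec r" "y \<in> carrier_vec 1" "z = x @\<^sub>v y" using append_split[OF z] .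
      then show ?thesis using W(3,4) C(2) w by (simp add: hcat_mult[OF Cc Dc] Dy)
    qed
    ultimately have "?P (r + 1)" by blast
    then show False using r(2)[of "r + 1"] by simp
  qed
  then have "W = (\<lambda>x. C *\<^sub>v x) ` carrier_vec r" using C(2) by blast
  then show ?thesis using that C(1) by blast
qed

section \<open>Invariant projections and simple modules of given highest weight\<close>

lemma polyfun_linear_combination:
  assumes N: "polynomial_module k N" and L: "L \<in> carrier_mat r (fst N)" and C: "C \<in> carrier_mat (fst N) q" and ij: "i < r" "j < q"
  shows "\<exists>p\<in>polynomial_functions k. \<forall>g\<in>carrier (GL k). (L * (snd N g * C)) $$ (i, j) = p g"
proof -
  have cc: "col C j \<in> carrier_vec (fst N)" using col_dim[of C j] C by (metis carrier_matD(1))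
  obtain p where p: "p \<in> polynomial_functions k" "\<forall>g\<in>carrier (GL k). row L i \<bullet> (snd N g *\<^sub>v col C j) = p g"
    using pm_coeff[OF N cc, of "row L i"] by blast
  have "(L * (snd N g * C)) $$ (i, j) = row L i \<bullet> (snd N g *\<^sub>v col C j)" if "g \<in> carrier (GL k)" for g
  proof -
    have "col (snd N g * C) j = snd N g *\<^sub>v col C j" by (rule col_mult2[OF pm_carrier[OF N that] C ij(2)])
    moreover have "(L * (snd N g * C)) $$ (i, j) = row L i \<bullet> col (snd N g * C) j"
      by (rule index_mult_mat(1)) (use L C ij in auto)
    ultimately show ?thesis by simp
  qed
  then show ?thesis using p by auto
qed

lemma hwv_intertwine:
  assumes N: "\<And>g. g \<in> carrier (GL k) \<Longrightarrow> snd N g \<in> carrier_mat (fst N) (fst N)" and L: "L \<in> carrier_mat (fst N') (fst N)"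
    and N': "\<And>g. g \<in> carrier (GL k) \<Longrightarrow> snd N' g \<in> carrier_mat (fst N') (fst N')"
    and int: "\<And>g. g \<in> carrier (GL k) \<Longrightarrow> L * snd N g = snd N' g * L" and z: "hwv k N kap z"
  shows "hwv k N' kap (L *\<^sub>v z)"
proof -
  have zc: "z \<in> carrier_vec (fst N)" using z by (simp add: hwv_def)
  have m: "snd N' g *\<^sub>v (L *\<^sub>v z) = L *\<^sub>v (snd N g *\<^sub>v z)" if "g \<in> carrier (GL k)" for g
  proof -
    have "snd N' g *\<^sub>v (L *\<^sub>v z) = (snd N' g * L) *\<^sub>v z" using N'[OF that] L zc by simp
    also have "\<dots> = L *\<^sub>v (snd N g *\<^sub>v z)" unfolding int[OF that, symmetric] using N[OF that] L zc by simp
    finally show ?thesis .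
  qed
  have "L *\<^sub>v z \<in> carrier_vec (fst N')" using L zc by (rule mult_mat_vec_carrier)
  then show ?thesis using z m mult_mat_vec[OF L zc] by (simp add: hwv_def)
qed

lemma inverse_intertwines:
  fixes T :: "complex mat"
  assumes T: "T \<in> carrier_mat n n" "B \<in> carrier_mat n n" "T * B = 1\<^sub>m n" "B * T = 1\<^sub>m n"
    and c: "a \<in> carrier_mat n n" "b \<in> carrier_mat n n" and int: "T * a = b * T"
  shows "B * b = a * B"
proof -
  have Bb: "B * b \<in> carrier_mat n n" using T(2) c(2) by (rule mult_carrier_mat)
  have "B * b = B * b * (T * B)" unfolding T(3) by (rule right_mult_one_mat[OF Bb, symmetric])
  also have "\<dots> = B * b * T * B" by (rule assoc_mult_mat[OF Bb T(1,2), symmetric])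
  also have "B * b * T = B * (b * T)" by (rule assoc_mult_mat[OF T(2) c(2) T(1)])
  also have "\<dots> = B * T * a" unfolding int[symmetric] by (rule assoc_mult_mat[OF T(2,1) c(1), symmetric])
  also have "\<dots> = a" unfolding T(4) by (rule left_mult_one_mat[OF c(1)])
  finally show ?thesis .
qed

text \<open>In the coordinates given by \<open>C\<close>, the submodule \<open>W\<close> is a
  smaller module \<open>N'\<close>, and \<open>L\<close> is the projection onto it along the
  complement orthogonal for \<open>H\<close>. The restricted form \<open>HW\<close> is invertible
  because \<open>H\<close> has no isotropic vectors.\<close>

lemma submodule_quotient:
  assumes N: "polynomial_module k N" and H: "hform k N H"
    and W: "W \<subseteq> carrier_vec (fst N)" "0\<^sub>v (fst N) \<in> W" "\<And>v w. v \<in> W \<Longrightarrow> w \<in> W \<Longrightarrow> v + w \<in> W"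
      "\<And>c v. v \<in> W \<Longrightarrow> c \<cdot>\<^sub>v v \<in> W" "\<And>g v. g \<in> carrier (GL k) \<Longrightarrow> v \<in> W \<Longrightarrow> snd N g *\<^sub>v v \<in> W"
    and proper: "W \<noteq> carrier_vec (fst N)"
  shows "\<exists>N' H' L. fst N' < fst N \<and> polynomial_module k N' \<and> hform k N' H' \<and> L \<in> carrier_mat (fst N') (fst N) \<and>
     (\<forall>g\<in>carrier (GL k). L * snd N g = snd N' g * L) \<and> (\<forall>x\<in>W. L *\<^sub>v x = 0\<^sub>v (fst N') \<longrightarrow> x = 0\<^sub>v (fst N))"
proof -
  let ?n = "fst N"
  obtain r C where C: "inj_mat C ?n r" "W = (\<lambda>x. C *\<^sub>v x) ` carrier_vec r" using subspace_image[OF W(1-4)] .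
  have Cc: "C \<in> carrier_mat ?n r" using C(1) by (simp add: inj_mat_def)
  have Hc: "H \<in> carrier_mat ?n ?n" and Hd: "\<And>x. x \<in> carrier_vec ?n \<Longrightarrow> cv x \<bullet> (H *\<^sub>v x) = 0 \<Longrightarrow> x = 0\<^sub>v ?n"
    and He: "\<And>g. g \<in> carrier (GL k) \<Longrightarrow> adj (snd N g) * H = H * snd N (adj g)" using H by (auto simp: hform_def)
  let ?A = "adj C * H"
  define HW where "HW = ?A * C"
  have Ac: "?A \<in> carrier_mat r ?n" using adj_carrier[OF Cc] Hc by simp
  have HWc: "HW \<in> carrier_mat r r" unfolding HW_def using Ac Cc by simp
  have HWd: "x = 0\<^sub>v r" if x: "x \<in> carrier_vec r" "cv x \<bullet> (HW *\<^sub>v x) = 0" for x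
  proof -
    have Cx: "C *\<^sub>v x \<in> carrier_vec ?n" using Cc x(1) by (rule mult_mat_vec_carrier)
    have "HW *\<^sub>v x = adj C *\<^sub>v (H *\<^sub>v (C *\<^sub>v x))"
      unfolding HW_def assoc_mult_mat_vec[OF Ac Cc x(1)] assoc_mult_mat_vec[OF adj_carrier[OF Cc] Hc Cx] ..
    then have "cv (C *\<^sub>v x) \<bullet> (H *\<^sub>v (C *\<^sub>v x)) = 0"
      using cv_mult[OF Cc x(1), of "H *\<^sub>v (C *\<^sub>v x)"] Hc Cx x(2) by simp
    then show ?thesis using Hd[OF Cx] C(1) x(1) by (simp add: inj_mat_def)
  qed
  have "inj_mat HW r r"
    using HWc HWd by (auto simp: inj_mat_def)
  then obtain K where K: "K \<in> carrier_mat r r" "HW * K = 1\<^sub>m r" "K * HW = 1\<^sub>m r" by (rule inj_square_inverse)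
  \<comment> \<open>The left inverse of \<open>C\<close> whose kernel is the orthogonal complement
    of \<open>W\<close>.\<close>
  define L where "L = K * ?A"
  have Lc: "L \<in> carrier_mat r ?n" unfolding L_def using K Ac by simp
  have LC: "L * C = 1\<^sub>m r"
    unfolding L_def using K Ac Cc by (simp add: HW_def[symmetric])
  have CL: "C *\<^sub>v (L *\<^sub>v x) = x" if xW: "x \<in> W" for x
  proof -
    obtain y where y: "y \<in> carrier_vec r" "x = C *\<^sub>v y" using xW unfolding C(2) by blast
    have "L *\<^sub>v (C *\<^sub>v y) = (L * C) *\<^sub>v y" using Lc Cc y(1) by simp
    then show ?thesis using y LC by simp
  qed
  define N' where "N' = (r, \<lambda>g. L * (snd N g * C))"
  have f: "fst N' = r" "\<And>g. snd N' g = L * (snd N g * C)" by (auto simp: N'_def)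
  have gC: "snd N g * C = C * snd N' g" if g: "g \<in> carrier (GL k)" for g
  proof (rule mat_vec_eqI)
    note gc = pm_carrier[OF N g]
    show "snd N g * C \<in> carrier_mat ?n r" "C * snd N' g \<in> carrier_mat ?n r" using gc Cc Lc by (auto simp: f)
    fix x :: "complex vec" assume x: "x \<in> carrier_vec r"
    have Cx: "C *\<^sub>v x \<in> carrier_vec ?n" using Cc x by (rule mult_mat_vec_carrier)
    have "snd N g *\<^sub>v (C *\<^sub>v x) \<in> W" using W(5)[OF g] C(2) x by blast
    from CL[OF this] show "(snd N g * C) *\<^sub>v x = (C * snd N' g) *\<^sub>v x"
      unfolding f using gc Cc Lc x by (simp add: assoc_mult_mat_vec[of C ?n r _ r] assoc_mult_mat_vec[of L r ?n _ r] assoc_mult_mat_vec[of "snd N g" ?n ?n C r])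
  qed
  have N'c: "snd N' g \<in> carrier_mat r r" if "g \<in> carrier (GL k)" for g
    unfolding f using pm_carrier[OF N that] Lc Cc by auto
  have pm: "polynomial_module k N'"
  proof (rule polynomial_moduleI)
    show "snd N' (g * h) = snd N' g * snd N' h" if g: "g \<in> carrier (GL k)" and h: "h \<in> carrier (GL k)" for g h
    proof -
      note c = pm_carrier[OF N g] pm_carrier[OF N h] N'c[OF g] N'c[OF h]
      have "snd N (g * h) * C = snd N g * (snd N h * C)" using pm_mult[OF N g h] c Cc by simp
      also have "\<dots> = snd N g * C * snd N' h" unfolding gC[OF h] using c Cc by simp
      also have "\<dots> = C * (snd N' g * snd N' h)" unfolding gC[OF g] using c Cc by simp
      finally have "snd N' (g * h) = L * (C * (snd N' g * snd N' h))" by (simp add: f(2)[of "g * h"])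
      also have "\<dots> = L * C * (snd N' g * snd N' h)" using Lc Cc c by (intro assoc_mult_mat[symmetric]) auto
      finally show ?thesis using LC c by simp
    qed
    show "snd N' (1\<^sub>m k) = 1\<^sub>m (fst N')" unfolding f pm_one[OF N] using Cc LC by simp
    show "\<exists>p\<in>polynomial_functions k. \<forall>g\<in>carrier (GL k). snd N' g $$ (i, j) = p g" if "i < fst N'" "j < fst N'" for i j
      unfolding f using polyfun_linear_combination[OF N Lc Cc that[unfolded f(1)]] .
  qed (use N'c f(1) in auto)
  have HW': "adj (snd N' g) * ?A = ?A * snd N (adj g)" if g: "g \<in> carrier (GL k)" for g
  proof -
    note c = pm_carrier[OF N g] pm_carrier[OF N adj_GL[OF g]] N'c[OF g]
    have "adj (snd N' g) * ?A = (adj (snd N' g) * adj C) * H"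
      by (rule assoc_mult_mat[OF adj_carrier[OF c(3)] adj_carrier[OF Cc] Hc, symmetric])
    also have "adj (snd N' g) * adj C = adj (C * snd N' g)" using adj_mult[OF Cc c(3)] by simp
    also have "\<dots> = adj C * adj (snd N g)" unfolding gC[OF g, symmetric] using adj_mult[OF c(1) Cc] .
    also have "adj C * adj (snd N g) * H = adj C * (adj (snd N g) * H)"
      by (rule assoc_mult_mat[OF adj_carrier[OF Cc] adj_carrier[OF c(1)] Hc])
    also have "\<dots> = ?A * snd N (adj g)" unfolding He[OF g]
      by (rule assoc_mult_mat[OF adj_carrier[OF Cc] Hc c(2), symmetric])
    finally show ?thesis .
  qed
  have HWe: "adj (snd N' g) * HW = HW * snd N' (adj g)" if g: "g \<in> carrier (GL k)" for g
  proof -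
    note c = pm_carrier[OF N adj_GL[OF g]] N'c[OF g] N'c[OF adj_GL[OF g]]
    have "adj (snd N' g) * HW = adj (snd N' g) * ?A * C" unfolding HW_def
      by (rule assoc_mult_mat[OF adj_carrier[OF c(2)] Ac Cc, symmetric])
    also have "\<dots> = ?A * (snd N (adj g) * C)" unfolding HW'[OF g]
      by (rule assoc_mult_mat[OF Ac c(1) Cc])
    also have "\<dots> = HW * snd N' (adj g)" unfolding gC[OF adj_GL[OF g]] HW_def
      by (rule assoc_mult_mat[OF Ac Cc c(3), symmetric])
    finally show ?thesis .
  qed
  have hf: "hform k N' HW" using HWc HWd HWe by (auto simp: hform_def f(1))
  have Lint: "L * snd N g = snd N' g * L" if g: "g \<in> carrier (GL k)" for g
  proof -
    note c = pm_carrier[OF N g] N'c[OF g] N'c[OF adj_GL[OF g]]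
    have "?A * snd N g = adj (snd N' (adj g)) * ?A" using HW'[OF adj_GL[OF g]] by simp
    moreover have "K * (adj (snd N' (adj g)) * ?A) = snd N' g * K * ?A"
    proof -
      let ?X = "adj (snd N' (adj g))"
      note X = adj_carrier[OF c(3)]
      have e: "?X * HW = HW * snd N' g" using HWe[OF adj_GL[OF g]] by simp
      have KX': "K * ?X = snd N' g * K" by (rule inverse_intertwines[OF HWc K c(2) X e[symmetric]])
      have "K * (?X * ?A) = K * ?X * ?A" by (rule assoc_mult_mat[OF K(1) X Ac, symmetric])
      then show ?thesis unfolding KX' .
    qed
    moreover have "L * snd N g = K * (?A * snd N g)" unfolding L_def using K(1) Ac c by (intro assoc_mult_mat) auto
    moreover have "snd N' g * K * ?A = snd N' g * L" unfolding L_def using K(1) Ac c by (intro assoc_mult_mat) auto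
    ultimately show ?thesis by simp
  qed
  \<comment> \<open>Equality would make \<open>C\<close> surjective and \<open>W\<close> the whole
    space.\<close>
  have "r \<noteq> ?n"
  proof
    assume rn: "r = ?n"
    obtain B where B: "B \<in> carrier_mat ?n ?n" "C * B = 1\<^sub>m ?n" using C(1) unfolding rn by (metis inj_square_inverse)
    have "x \<in> W" if x: "x \<in> carrier_vec ?n" for x
    proof -
      have "x = C *\<^sub>v (B *\<^sub>v x)" using B x Cc rn by (metis assoc_mult_mat_vec one_mult_mat_vec)
      then show ?thesis unfolding C(2) using B(1) x rn by (metis image_eqI mult_mat_vec_carrier)
    qed
    then show False using proper W(1) by blast
  qed
  then have rn: "r < ?n" using inj_mat_le[OF C(1)] by simp
  have "x = 0\<^sub>v ?n" if "x \<in> W" "L *\<^sub>v x = 0\<^sub>v r" for x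
  proof -
    have "C *\<^sub>v 0\<^sub>v r = 0\<^sub>v ?n" using Cc by (intro eq_vecI) (auto simp: scalar_prod_def)
    then show ?thesis using CL[OF that(1)] that(2) by simp
  qed
  then show ?thesis using rn pm hf Lc Lint by (intro exI[of _ N'] exI[of _ HW] exI[of _ L]) (auto simp: f(1))
qed

text \<open>Descent on the dimension by projecting onto a proper nonzero submodule \<open>W\<close>.
  If \<open>z\<close> survives, its image is a highest weight vector in a smaller module. Otherwise
  \<open>z\<close> lies in the kernel of the projection; this submodule is proper, as the projection
  is injective on \<open>W\<close>, and projecting onto it keeps \<open>z\<close> alive.\<close>

lemma simple_with_highest_weight:
  assumes "polynomial_module k N" "hform k N H" "hwv k N kap z" "z \<noteq> 0\<^sub>v (fst N)"
  shows "\<exists>S. polynomial_module k S \<and> simple_module k S \<and> has_highest_weight k kap S"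
  using assms
proof (induction "fst N" arbitrary: N H z rule: less_induct)
  case less
  let ?n = "fst N"
  show ?case
  proof (cases "simple_module k N")
    case True
    then show ?thesis using less.prems has_highest_weight_hwv by blast
  next
    case False
    have zc: "z \<in> carrier_vec ?n" using less.prems(3) by (simp add: hwv_def)
    have n0: "0 < ?n"
    proof (rule ccontr)
      assume "\<not> 0 < ?n"
      then have "z = 0\<^sub>v ?n" using zc by (intro eq_vecI) auto
      then show False using less.prems(4) by simp
    qed
    then obtain W where W: "VectorSpace.subspace class_ring W (module_vec TYPE(complex) ?n)"
      "\<forall>g\<in>carrier (GL k). \<forall>w\<in>W. snd N g *\<^sub>v w \<in> W" "W \<noteq> {0\<^sub>v ?n}" "W \<noteq> carrier_vec ?n"
      using False unfolding simple_module_def by (cases N) auto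
    have Ws: "W \<subseteq> carrier_vec ?n" "0\<^sub>v ?n \<in> W" "\<And>v w. v \<in> W \<Longrightarrow> w \<in> W \<Longrightarrow> v + w \<in> W" "\<And>c v. v \<in> W \<Longrightarrow> c \<cdot>\<^sub>v v \<in> W"
      using W(1) unfolding subspace_def submodule_def by (auto simp: module_vec_simps class_ring_simps)
    let ?Q = "\<exists>S. polynomial_module k S \<and> simple_module k S \<and> has_highest_weight k kap S"
    \<comment> \<open>\<open>L0\<close> is what remains to be shown when the projection kills
      \<open>z\<close>. The argument is run for \<open>W\<close> and, inside that case, for the
      kernel \<open>?K\<close>.\<close>
    have down: ?Q if W: "W \<subseteq> carrier_vec ?n" "0\<^sub>v ?n \<in> W" "\<And>v w. v \<in> W \<Longrightarrow> w \<in> W \<Longrightarrow> v + w \<in> W"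
      "\<And>c v. v \<in> W \<Longrightarrow> c \<cdot>\<^sub>v v \<in> W" "\<And>g v. g \<in> carrier (GL k) \<Longrightarrow> v \<in> W \<Longrightarrow> snd N g *\<^sub>v v \<in> W" "W \<noteq> carrier_vec ?n"
      and L0: "\<And>N' L. L \<in> carrier_mat (fst N') ?n \<Longrightarrow> polynomial_module k N' \<Longrightarrow> (\<forall>g\<in>carrier (GL k). L * snd N g = snd N' g * L) \<Longrightarrow>
        (\<forall>x\<in>W. L *\<^sub>v x = 0\<^sub>v (fst N') \<longrightarrow> x = 0\<^sub>v ?n) \<Longrightarrow> L *\<^sub>v z = 0\<^sub>v (fst N') \<Longrightarrow> ?Q" for W
    proof -
      have "\<exists>N' H' L. fst N' < ?n \<and> polynomial_module k N' \<and> hform k N' H' \<and> L \<in> carrier_mat (fst N') ?n \<and>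
        (\<forall>g\<in>carrier (GL k). L * snd N g = snd N' g * L) \<and> (\<forall>x\<in>W. L *\<^sub>v x = 0\<^sub>v (fst N') \<longrightarrow> x = 0\<^sub>v ?n)"
        by (rule submodule_quotient[OF less.prems(1,2)]) (fact W)+
      then obtain N' H' L where L: "fst N' < ?n" "polynomial_module k N'" "hform k N' H'"
        "L \<in> carrier_mat (fst N') ?n" "\<forall>g\<in>carrier (GL k). L * snd N g = snd N' g * L" "\<forall>x\<in>W. L *\<^sub>v x = 0\<^sub>v (fst N') \<longrightarrow> x = 0\<^sub>v ?n"
        by (elim exE conjE)
      show ?Q
      proof (cases "L *\<^sub>v z = 0\<^sub>v (fst N')")
        case True
        then show ?thesis using L0[OF L(4,2,5,6)] by blast
      next
        case False
        then show ?thesis using less.hyps[OF L(1,2,3) hwv_intertwine[OF pm_carrier[OF less.prems(1)] L(4) pm_carrier[OF L(2)] _ less.prems(3)]] L(5) by blast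
      qed
    qed
    show ?thesis
    proof (rule down[OF Ws _ W(4)])
      fix N' L
      assume L: "L \<in> carrier_mat (fst N') ?n" "polynomial_module k N'" "\<forall>g\<in>carrier (GL k). L * snd N g = snd N' g * L"
        "\<forall>x\<in>W. L *\<^sub>v x = 0\<^sub>v (fst N') \<longrightarrow> x = 0\<^sub>v ?n" "L *\<^sub>v z = 0\<^sub>v (fst N')"
      let ?K = "{x \<in> carrier_vec ?n. L *\<^sub>v x = 0\<^sub>v (fst N')}"
      show ?thesis
      proof (rule down[of ?K])
        show "0\<^sub>v ?n \<in> ?K" using L(1) by (auto intro!: eq_vecI simp: scalar_prod_def)
        show "v + w \<in> ?K" if "v \<in> ?K" "w \<in> ?K" for v w using that L(1) by (auto simp: mult_add_distrib_mat_vec)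
        show "c \<cdot>\<^sub>v v \<in> ?K" if "v \<in> ?K" for c v using that L(1) by (auto simp: mult_mat_vec)
        show "snd N g *\<^sub>v v \<in> ?K" if g: "g \<in> carrier (GL k)" and v: "v \<in> ?K" for g v
        proof -
          have vc: "v \<in> carrier_vec ?n" "L *\<^sub>v v = 0\<^sub>v (fst N')" using v by auto
          note gc = pm_carrier[OF less.prems(1) g] pm_carrier[OF L(2) g]
          have "L *\<^sub>v (snd N g *\<^sub>v v) = (L * snd N g) *\<^sub>v v" using L(1) gc vc by simp
          also have "\<dots> = snd N' g *\<^sub>v (L *\<^sub>v v)" using L(1,3) g gc vc by simp
          also have "\<dots> = 0\<^sub>v (fst N')" unfolding vc(2) using gc by (auto intro!: eq_vecI simp: scalar_prod_def)
          finally show ?thesis using pm_vec[OF less.prems(1) g vc(1)] by simp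
        qed
        show "?K \<noteq> carrier_vec ?n"
        proof
          assume "?K = carrier_vec ?n"
          then have "W \<subseteq> {0\<^sub>v ?n}" using L(4) Ws(1) by blast
          then show False using W(3) Ws(2) by blast
        qed
        fix N'' L'
        assume "\<forall>x\<in>?K. L' *\<^sub>v x = 0\<^sub>v (fst N'') \<longrightarrow> x = 0\<^sub>v ?n" "L' *\<^sub>v z = 0\<^sub>v (fst N'')"
        then show ?thesis using less.prems(4) zc L(5) by blast
      qed auto
    qed (use W(2) in auto)
  qed
qed

section \<open>Direct sums of Schur modules and their highest weight spaces\<close>

definition schur_ok :: "nat \<Rightarrow> nat list \<Rightarrow> bool" where
  "schur_ok k kap \<longleftrightarrow> polynomial_module k (schur_module k kap) \<and> simple_module k (schur_module k kap) \<and>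
     has_highest_weight k kap (schur_module k kap)"

abbreviation schur_dim :: "nat \<Rightarrow> nat list \<Rightarrow> nat" where
  "schur_dim k kap \<equiv> fst (schur_module k kap)"

abbreviation schur_rep :: "nat \<Rightarrow> nat list \<Rightarrow> complex mat \<Rightarrow> complex mat" where
  "schur_rep k kap \<equiv> snd (schur_module k kap)"

text \<open>Any module with an invariant form and a nonzero highest weight vector supplies a
  candidate for the choice in \<open>schur_module\<close>.\<close>

lemma schur_okI:
  assumes "polynomial_module k N" "hform k N H" "hwv k N kap z" "z \<noteq> 0\<^sub>v (fst N)"
  shows "schur_ok k kap"
  unfolding schur_ok_def schur_module_def
  using simple_with_highest_weight[OF assms] by (rule someI_ex)

definition schur_sum :: "nat \<Rightarrow> nat list list \<Rightarrow> module_data" where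
  "schur_sum k nus = module_sum (map (schur_module k) nus)"

lemma mult_mat_zero_vec: "A \<in> carrier_mat r n \<Longrightarrow> A *\<^sub>v 0\<^sub>v n = 0\<^sub>v r" for A :: "complex mat"
  by (rule eq_vecI) auto

lemma smult_zero_vec: "c \<cdot>\<^sub>v 0\<^sub>v n = 0\<^sub>v n" for c :: complex
  by (rule eq_vecI) auto

lemma schur_sum_Nil: "fst (schur_sum k []) = 0"
  by (simp add: schur_sum_def module_sum_def)

lemma schur_sum_dim: "fst (schur_sum k (kap # nus)) = schur_dim k kap + fst (schur_sum k nus)"
  by (simp add: schur_sum_def module_sum_def)

lemma schur_sum_carrier:
  assumes "\<forall>kap\<in>set nus. schur_ok k kap" "g \<in> carrier (GL k)"
  shows "snd (schur_sum k nus) g \<in> carrier_mat (fst (schur_sum k nus)) (fst (schur_sum k nus))"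
  using assms(1)
proof (induction nus)
  case (Cons kap nus)
  then show ?case
    using pm_carrier[of k "schur_module k kap" g] assms(2) by (auto simp: schur_sum_def module_sum_def schur_ok_def Let_def)
qed (simp add: schur_sum_def module_sum_def)

lemma schur_sum_apply:
  assumes ok: "schur_ok k kap" "\<forall>kap\<in>set nus. schur_ok k kap" and g: "g \<in> carrier (GL k)"
    and x: "x \<in> carrier_vec (schur_dim k kap)" and y: "y \<in> carrier_vec (fst (schur_sum k nus))"
  shows "snd (schur_sum k (kap # nus)) g *\<^sub>v (x @\<^sub>v y) = (schur_rep k kap g *\<^sub>v x) @\<^sub>v (snd (schur_sum k nus) g *\<^sub>v y)"
proof -
  have c: "schur_rep k kap g \<in> carrier_mat (schur_dim k kap) (schur_dim k kap)"
    by (rule pm_carrier) (use ok(1) g in \<open>auto simp: schur_ok_def\<close>)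
  note d = schur_sum_carrier[OF ok(2) g]
  have "snd (schur_sum k (kap # nus)) g = four_block_mat (schur_rep k kap g) (0\<^sub>m (schur_dim k kap) (fst (schur_sum k nus)))
    (0\<^sub>m (fst (schur_sum k nus)) (schur_dim k kap)) (snd (schur_sum k nus) g)"
    using c d by (simp add: schur_sum_def module_sum_def Let_def)
  then show ?thesis using mult_mat_vec_split[OF c d x y] by presburger
qed

lemma smult_append: "c \<cdot>\<^sub>v (x @\<^sub>v y) = (c \<cdot>\<^sub>v x) @\<^sub>v (c \<cdot>\<^sub>v y)" for x y :: "complex vec"
  by (rule eq_vecI) auto

lemma hwv_append:
  assumes ok: "schur_ok k kap" "\<forall>kap\<in>set nus. schur_ok k kap"
    and x: "x \<in> carrier_vec (schur_dim k kap)" and y: "y \<in> carrier_vec (fst (schur_sum k nus))"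
  shows "hwv k (schur_sum k (kap # nus)) nu (x @\<^sub>v y) \<longleftrightarrow> hwv k (schur_module k kap) nu x \<and> hwv k (schur_sum k nus) nu y"
proof -
  let ?S = "schur_module k kap" and ?R = "schur_sum k nus"
  have S: "polynomial_module k ?S" using ok by (simp add: schur_ok_def)
  have c: "snd ?S g *\<^sub>v x \<in> carrier_vec (fst ?S)" if "g \<in> carrier (GL k)" for g using pm_vec[OF S that x] .
  have e: "(snd (schur_sum k (kap # nus)) g *\<^sub>v (x @\<^sub>v y) = b \<cdot>\<^sub>v (x @\<^sub>v y)) \<longleftrightarrow>
    snd ?S g *\<^sub>v x = b \<cdot>\<^sub>v x \<and> snd ?R g *\<^sub>v y = b \<cdot>\<^sub>v y" if "g \<in> carrier (GL k)" for g b
    unfolding schur_sum_apply[OF ok that x y] smult_append using c[OF that] x by (intro append_vec_eq) auto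
  have e1: "(snd (schur_sum k (kap # nus)) g *\<^sub>v (x @\<^sub>v y) = x @\<^sub>v y) \<longleftrightarrow>
    snd ?S g *\<^sub>v x = x \<and> snd ?R g *\<^sub>v y = y" if "g \<in> carrier (GL k)" for g
    using e[OF that, of 1] by simp
  have "x @\<^sub>v y \<in> carrier_vec (fst (schur_sum k (kap # nus)))" unfolding schur_sum_dim using x y by simp
  then show ?thesis using x y by (auto simp: hwv_def e e1)
qed

lemma append_zero_iff: "x \<in> carrier_vec a \<Longrightarrow> y \<in> carrier_vec b \<Longrightarrow> x @\<^sub>v y = 0\<^sub>v (a + b) \<longleftrightarrow> x = 0\<^sub>v a \<and> y = 0\<^sub>v b" for x y :: "complex vec"
proof -
  assume c: "x \<in> carrier_vec a" "y \<in> carrier_vec b"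
  have "0\<^sub>v (a + b) = 0\<^sub>v a @\<^sub>v (0\<^sub>v b :: complex vec)" by (rule eq_vecI) auto
  then show ?thesis using append_vec_eq[OF c(1) zero_carrier_vec] by metis
qed

lemma schur_hw:
  assumes "schur_ok k kap"
  obtains v xi where "hwv k (schur_module k kap) kap v" "v \<noteq> 0\<^sub>v (schur_dim k kap)" "covv k (schur_module k kap) kap xi" "xi \<bullet> v = 1"
  using assms simple_covector[of k "schur_module k kap" kap] unfolding schur_ok_def has_highest_weight_hwv by blast

lemma schur_hwv_zero:
  assumes ok: "schur_ok k kap" and xi: "covv k (schur_module k kap) kap xi" "xi \<noteq> 0\<^sub>v (schur_dim k kap)"
    and x: "hwv k (schur_module k kap) nu x" "xi \<bullet> x = 0"
  shows "x = 0\<^sub>v (schur_dim k kap)"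
proof -
  have S: "polynomial_module k (schur_module k kap)" "simple_module k (schur_module k kap)" using ok by (auto simp: schur_ok_def)
  show ?thesis
    by (rule simple_annihilator[OF S _ xi(2)]) (use xi x pairing_zero[OF S(1) x(1) xi(1) x(2)] in \<open>auto simp: covv_def hwv_def\<close>)
qed

text \<open>Says that the highest weight vectors of weight \<open>nu\<close> form a space of
  dimension \<open>count_list nus nu\<close>: the \<open>V i\<close> are independent by means of the
  dual functionals \<open>Xi i\<close>, and these functionals separate such vectors. Dual families
  take the place of a notion of dimension.\<close>

lemma schur_sum_highest_weights:
  assumes ok: "\<forall>kap\<in>set nus. schur_ok k kap \<and> length kap = k" and nu: "length nu = k"
  shows "\<exists>V Xi. (\<forall>i<count_list nus nu. hwv k (schur_sum k nus) nu (V i) \<and> Xi i \<in> carrier_vec (fst (schur_sum k nus))) \<and>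
    (\<forall>i<count_list nus nu. \<forall>j<count_list nus nu. Xi i \<bullet> V j = (if i = j then 1 else 0)) \<and>
    (\<forall>z. hwv k (schur_sum k nus) nu z \<longrightarrow> (\<forall>i<count_list nus nu. Xi i \<bullet> z = 0) \<longrightarrow> z = 0\<^sub>v (fst (schur_sum k nus)))"
  using ok
proof (induction nus)
  case Nil
  then show ?case by (auto simp: hwv_def schur_sum_Nil)
next
  case (Cons kap nus)
  let ?S = "schur_module k kap" and ?R = "schur_sum k nus" and ?c = "count_list nus nu"
  have okk: "schur_ok k kap" "\<forall>kap\<in>set nus. schur_ok k kap" "length kap = k" using Cons.prems by auto
  have "\<forall>kap\<in>set nus. schur_ok k kap \<and> length kap = k" using Cons.prems by simp
  from Cons.IH[OF this] obtain V Xi where VX: "(\<forall>i<?c. hwv k ?R nu (V i) \<and> Xi i \<in> carrier_vec (fst ?R))"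
    "(\<forall>i<?c. \<forall>j<?c. Xi i \<bullet> V j = (if i = j then 1 else 0))"
    "(\<forall>z. hwv k ?R nu z \<longrightarrow> (\<forall>i<?c. Xi i \<bullet> z = 0) \<longrightarrow> z = 0\<^sub>v (fst ?R))" by (elim exE conjE)
  have V: "hwv k ?R nu (V i)" and Xi: "Xi i \<in> carrier_vec (fst ?R)" if "i < ?c" for i using VX(1) that by auto
  have XV: "Xi i \<bullet> V j = (if i = j then 1 else 0)" if "i < ?c" "j < ?c" for i j using VX(2) that by blast
  have Z: "z = 0\<^sub>v (fst ?R)" if "hwv k ?R nu z" "\<forall>i<?c. Xi i \<bullet> z = 0" for z using VX(3) that by blast
  have Vc: "V i \<in> carrier_vec (fst ?R)" if "i < ?c" for i using V[OF that] by (simp add: hwv_def)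
  obtain v xi where v: "hwv k ?S kap v" "v \<noteq> 0\<^sub>v (fst ?S)" and xi: "covv k ?S kap xi" "xi \<bullet> v = 1" using schur_hw[OF okk(1)] .
  have c: "v \<in> carrier_vec (fst ?S)" "xi \<in> carrier_vec (fst ?S)" using v xi by (auto simp: hwv_def covv_def)
  have xi0: "xi \<noteq> 0\<^sub>v (fst ?S)" using xi(2) c by auto
  let ?z1 = "0\<^sub>v (fst ?S) :: complex vec" and ?z2 = "0\<^sub>v (fst ?R) :: complex vec"
  have h0: "hwv k ?S nu ?z1"
    using pm_carrier[of k ?S] okk(1) by (auto simp: hwv_def schur_ok_def mult_mat_zero_vec smult_zero_vec)
  have h0': "hwv k ?R nu ?z2"
    using schur_sum_carrier[OF okk(2)] by (auto simp: hwv_def mult_mat_zero_vec smult_zero_vec)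
  have hV: "hwv k (schur_sum k (kap # nus)) nu (?z1 @\<^sub>v V i)" if "i < ?c" for i
    using hwv_append[OF okk(1,2) zero_carrier_vec Vc[OF that]] h0 V[OF that] by blast
  have hv: "hwv k (schur_sum k (kap # nus)) kap (v @\<^sub>v ?z2)" if "hwv k ?R kap ?z2"
    using hwv_append[OF okk(1,2) c(1) zero_carrier_vec] that v(1) by blast
  \<comment> \<open>A highest weight vector of the sum splits into highest weight vectors of the two
    parts, so it vanishes once its pairings do.\<close>
  have split: "z = 0\<^sub>v (fst (schur_sum k (kap # nus)))"
    if z: "hwv k (schur_sum k (kap # nus)) nu z" and a: "\<And>x y. x \<in> carrier_vec (fst ?S) \<Longrightarrow> y \<in> carrier_vec (fst ?R) \<Longrightarrow> z = x @\<^sub>v y \<Longrightarrow>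
       hwv k ?S nu x \<Longrightarrow> xi \<bullet> x = 0 \<and> (\<forall>i<?c. Xi i \<bullet> y = 0)" for z
  proof -
    have "z \<in> carrier_vec (fst ?S + fst ?R)" using z schur_sum_dim by (simp add: hwv_def)
    then obtain x y where xy: "x \<in> carrier_vec (fst ?S)" "y \<in> carrier_vec (fst ?R)" "z = x @\<^sub>v y" by (rule append_split)
    have h: "hwv k ?S nu x" "hwv k ?R nu y" using hwv_append[OF okk(1,2) xy(1,2)] z xy(3) by auto
    have "x = ?z1" using schur_hwv_zero[OF okk(1) xi(1) xi0 h(1)] a[OF xy h(1)] by blast
    moreover have "y = ?z2" using Z[OF h(2)] a[OF xy h(1)] by blast
    ultimately show ?thesis using xy append_zero_iff[of x "fst ?S" y "fst ?R"] schur_sum_dim by metis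
  qed
  show ?case
  proof (cases "kap = nu")
    case True
    define V' where "V' = (\<lambda>i. case i of 0 \<Rightarrow> v @\<^sub>v ?z2 | Suc i \<Rightarrow> ?z1 @\<^sub>v V i)"
    define Xi' where "Xi' = (\<lambda>i. case i of 0 \<Rightarrow> xi @\<^sub>v ?z2 | Suc i \<Rightarrow> ?z1 @\<^sub>v Xi i)"
    have cnt: "count_list (kap # nus) nu = Suc ?c" using True by simp
    have "hwv k (schur_sum k (kap # nus)) nu (V' i) \<and> Xi' i \<in> carrier_vec (fst (schur_sum k (kap # nus)))" if "i < Suc ?c" for i
      unfolding V'_def Xi'_def schur_sum_dim
      using that hV Xi hv h0' c True by (cases i) simp_all
    moreover have "Xi' i \<bullet> V' j = (if i = j then 1 else 0)" if "i < Suc ?c" "j < Suc ?c" for i j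
      unfolding V'_def Xi'_def using that Vc Xi XV c xi(2)
      by (cases i; cases j) (auto simp: scalar_prod_append[of _ "fst ?S" _ "fst ?R"])
    moreover have "z = 0\<^sub>v (fst (schur_sum k (kap # nus)))" if z: "hwv k (schur_sum k (kap # nus)) nu z" "\<forall>i<Suc ?c. Xi' i \<bullet> z = 0" for z
    proof (rule split[OF z(1)])
      fix x y assume xy: "x \<in> carrier_vec (fst ?S)" "y \<in> carrier_vec (fst ?R)" "z = x @\<^sub>v y"
      have "Xi' 0 \<bullet> z = xi \<bullet> x" unfolding Xi'_def xy(3) using xy c by (simp add: scalar_prod_append[of _ "fst ?S" _ "fst ?R"])
      moreover have "Xi' (Suc i) \<bullet> z = Xi i \<bullet> y" if "i < ?c" for i
        unfolding Xi'_def xy(3) using xy Xi[OF that] by (simp add: scalar_prod_append[of _ "fst ?S" _ "fst ?R"])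
      ultimately show "xi \<bullet> x = 0 \<and> (\<forall>i<?c. Xi i \<bullet> y = 0)" using z(2) by (metis Suc_less_eq zero_less_Suc)
    qed
    ultimately show ?thesis unfolding cnt by blast
  next
    case False
    define V' where "V' = (\<lambda>i. ?z1 @\<^sub>v V i)"
    define Xi' where "Xi' = (\<lambda>i. ?z1 @\<^sub>v Xi i)"
    have cnt: "count_list (kap # nus) nu = ?c" using False by simp
    have "hwv k (schur_sum k (kap # nus)) nu (V' i) \<and> Xi' i \<in> carrier_vec (fst (schur_sum k (kap # nus)))" if "i < ?c" for i
      unfolding V'_def Xi'_def schur_sum_dim
      using that hV Xi by simp
    moreover have "Xi' i \<bullet> V' j = (if i = j then 1 else 0)" if "i < ?c" "j < ?c" for i j
      unfolding V'_def Xi'_def using that Vc Xi XV by (auto simp: scalar_prod_append[of _ "fst ?S" _ "fst ?R"])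
    moreover have "z = 0\<^sub>v (fst (schur_sum k (kap # nus)))" if z: "hwv k (schur_sum k (kap # nus)) nu z" "\<forall>i<?c. Xi' i \<bullet> z = 0" for z
    proof (rule split[OF z(1)])
      fix x y assume xy: "x \<in> carrier_vec (fst ?S)" "y \<in> carrier_vec (fst ?R)" "z = x @\<^sub>v y" and hx: "hwv k ?S nu x"
      have "Xi' i \<bullet> z = Xi i \<bullet> y" if "i < ?c" for i
        unfolding Xi'_def xy(3) using xy Xi[OF that] by (simp add: scalar_prod_append[of _ "fst ?S" _ "fst ?R"])
      \<comment> \<open>A nonzero pairing with the covector of weight \<open>kap\<close> would force
        \<open>kap = nu\<close>.\<close>
      moreover have "xi \<bullet> x = 0" using weight_unique[OF hx xi(1)] False nu okk(3) by metis
      ultimately show "xi \<bullet> x = 0 \<and> (\<forall>i<?c. Xi i \<bullet> y = 0)" using z(2) by simp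
    qed
    ultimately show ?thesis unfolding cnt by blast
  qed
qed

text \<open>An injective intertwiner maps highest weight vectors to highest weight vectors of the
  same weight. If the source had more of them, their pairings with the functionals
  \<open>Xi'\<close> of the target would form a matrix with more columns than rows, and a kernel
  vector of it gives a nonzero combination whose image is killed by all these functionals.\<close>

lemma schur_sum_count_le:
  assumes ok: "\<forall>kap\<in>set nus. schur_ok k kap \<and> length kap = k" and ok': "\<forall>kap\<in>set nus'. schur_ok k kap \<and> length kap = k"
    and nu: "length nu = k"
    and T: "inj_mat T (fst (schur_sum k nus')) (fst (schur_sum k nus))"
    and int: "\<And>g. g \<in> carrier (GL k) \<Longrightarrow> T * snd (schur_sum k nus) g = snd (schur_sum k nus') g * T"
  shows "count_list nus nu \<le> count_list nus' nu"
proof (rule ccontr)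
  let ?M = "schur_sum k nus" and ?M' = "schur_sum k nus'" and ?a = "count_list nus nu" and ?b = "count_list nus' nu"
  assume "\<not> ?a \<le> ?b"
  then have lt: "?b < ?a" by simp
  have Tc: "T \<in> carrier_mat (fst ?M') (fst ?M)" using T by (simp add: inj_mat_def)
  from schur_sum_highest_weights[OF ok nu] obtain V Xi where V: "\<And>i. i < ?a \<Longrightarrow> hwv k ?M nu (V i)" and Xi: "\<And>i. i < ?a \<Longrightarrow> Xi i \<in> carrier_vec (fst ?M)"
    and XV: "\<And>i j. i < ?a \<Longrightarrow> j < ?a \<Longrightarrow> Xi i \<bullet> V j = (if i = j then 1 else 0)" by (elim exE conjE) metis
  from schur_sum_highest_weights[OF ok' nu] obtain Xi' where Xi': "\<And>i. i < ?b \<Longrightarrow> Xi' i \<in> carrier_vec (fst ?M')"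
    and Z: "\<And>z. hwv k ?M' nu z \<Longrightarrow> (\<forall>i<?b. Xi' i \<bullet> z = 0) \<Longrightarrow> z = 0\<^sub>v (fst ?M')" by (elim exE conjE) metis
  have Vc: "V i \<in> carrier_vec (fst ?M)" if "i < ?a" for i using V[OF that] by (simp add: hwv_def)
  define A where "A = mat ?b ?a (\<lambda>(i, j). Xi' i \<bullet> (T *\<^sub>v V j))"
  have Ac: "A \<in> carrier_mat ?b ?a" by (simp add: A_def)
  obtain x where x: "x \<in> carrier_vec ?a" "x \<noteq> 0\<^sub>v ?a" "A *\<^sub>v x = 0\<^sub>v ?b" using wide_kernel[OF Ac lt] by blast
  define B where "B = mat (fst ?M) ?a (\<lambda>(i, j). V j $ i)"
  have Bc: "B \<in> carrier_mat (fst ?M) ?a" by (simp add: B_def)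
  define z where "z = B *\<^sub>v x"
  have zc: "z \<in> carrier_vec (fst ?M)" unfolding z_def using Bc x(1) by (rule mult_mat_vec_carrier)
  have zi: "z $ i = (\<Sum>j<?a. x $ j * V j $ i)" if "i < fst ?M" for i
    unfolding z_def mv_index[OF Bc x(1) that] using that by (intro sum.cong) (auto simp: B_def)
  have lin: "(C *\<^sub>v z) $ i = (\<Sum>j<?a. x $ j * (C *\<^sub>v V j) $ i)" if C: "C \<in> carrier_mat r (fst ?M)" and i: "i < r" for C r i
  proof -
    have "(C *\<^sub>v z) $ i = (\<Sum>l<fst ?M. \<Sum>j<?a. x $ j * (C $$ (i, l) * V j $ l))"
      unfolding mv_index[OF C zc i] by (intro sum.cong refl) (simp add: zi sum_distrib_left mult.left_commute)
    also have "\<dots> = (\<Sum>j<?a. x $ j * (\<Sum>l<fst ?M. C $$ (i, l) * V j $ l))"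
      by (subst sum.swap) (simp add: sum_distrib_left)
    also have "\<dots> = (\<Sum>j<?a. x $ j * (C *\<^sub>v V j) $ i)"
      by (intro sum.cong refl arg_cong[of _ _ "(*) _"]) (simp add: mv_index[OF C Vc i] del: index_mult_mat_vec)
    finally show ?thesis .
  qed
  note mc = schur_sum_carrier[of nus k] schur_sum_carrier[of nus' k]
  have hz: "hwv k ?M nu z"
  proof -
    have "snd ?M g *\<^sub>v z = b \<cdot>\<^sub>v z" if g: "g \<in> carrier (GL k)" and e: "\<And>j. j < ?a \<Longrightarrow> snd ?M g *\<^sub>v V j = b \<cdot>\<^sub>v V j" for g b
    proof (rule eq_vecI)
      have c: "snd ?M g \<in> carrier_mat (fst ?M) (fst ?M)" using mc(1) ok g by blast
      fix i assume "i < dim_vec (b \<cdot>\<^sub>v z)"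
      then have i: "i < fst ?M" using zc by simp
      have "(snd ?M g *\<^sub>v z) $ i = (\<Sum>j<?a. b * (x $ j * V j $ i))"
        unfolding lin[OF c i]
      proof (intro sum.cong refl)
        fix j assume "j \<in> {..<?a}"
        then show "x $ j * (snd ?M g *\<^sub>v V j) $ i = b * (x $ j * V j $ i)" using e[of j] Vc[of j] i by simp
      qed
      then show "(snd ?M g *\<^sub>v z) $ i = (b \<cdot>\<^sub>v z) $ i" using i zc zi[OF i] by (simp add: sum_distrib_left)
    next
      show "dim_vec (snd ?M g *\<^sub>v z) = dim_vec (b \<cdot>\<^sub>v z)" using mc(1)[of g] ok g zc by auto
    qed
    from this[of _ "wt k nu _"] this[of _ 1] show ?thesis using zc V by (auto simp: hwv_def)
  qed
  have hTz: "hwv k ?M' nu (T *\<^sub>v z)"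
    by (rule hwv_intertwine[OF _ Tc _ int hz]) (use mc ok ok' in auto)
  have "T *\<^sub>v z = 0\<^sub>v (fst ?M')"
  proof (rule Z[OF hTz], intro allI impI)
    fix i assume i: "i < ?b"
    have Tz: "T *\<^sub>v z \<in> carrier_vec (fst ?M')" using Tc zc by (rule mult_mat_vec_carrier)
    have "Xi' i \<bullet> (T *\<^sub>v z) = (\<Sum>l<fst ?M'. \<Sum>j<?a. x $ j * (Xi' i $ l * (T *\<^sub>v V j) $ l))"
      unfolding sp_sum[OF Tz] by (intro sum.cong refl) (simp add: lin[OF Tc] sum_distrib_left mult.left_commute del: index_mult_mat_vec)
    also have "\<dots> = (\<Sum>j<?a. x $ j * (\<Sum>l<fst ?M'. Xi' i $ l * (T *\<^sub>v V j) $ l))"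
      by (subst sum.swap) (simp add: sum_distrib_left)
    also have "\<dots> = (\<Sum>j<?a. A $$ (i, j) * x $ j)"
    proof (intro sum.cong refl)
      fix j assume j: "j \<in> {..<?a}"
      have "T *\<^sub>v V j \<in> carrier_vec (fst ?M')" using Tc Vc[of j] j by (intro mult_mat_vec_carrier) auto
      from sp_sum[OF this] show "x $ j * (\<Sum>l<fst ?M'. Xi' i $ l * (T *\<^sub>v V j) $ l) = A $$ (i, j) * x $ j"
        using i j by (simp add: A_def)
    qed
    also have "\<dots> = (A *\<^sub>v x) $ i" by (rule mv_index[OF Ac x(1) i, symmetric])
    finally show "Xi' i \<bullet> (T *\<^sub>v z) = 0" using x(3) i by simp
  qed
  then have z0: "z = 0\<^sub>v (fst ?M)" using T zc by (simp add: inj_mat_def)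
  have "x $ i = 0" if i: "i < ?a" for i
  proof -
    have "0 = Xi i \<bullet> z" using z0 Xi[OF i] by simp
    also have "\<dots> = (\<Sum>l<fst ?M. \<Sum>j<?a. x $ j * (Xi i $ l * V j $ l))"
      unfolding sp_sum[OF zc] by (intro sum.cong refl) (simp add: zi sum_distrib_left mult.left_commute)
    also have "\<dots> = (\<Sum>j<?a. x $ j * (\<Sum>l<fst ?M. Xi i $ l * V j $ l))"
      by (subst sum.swap) (simp add: sum_distrib_left)
    also have "\<dots> = (\<Sum>j<?a. x $ j * (if i = j then 1 else 0))"
      using XV[OF i] Vc by (intro sum.cong refl arg_cong[of _ _ "(*) _"]) (simp add: sp_sum[symmetric])
    finally show ?thesis using i by (simp add: sum_pick)
  qed
  then show False using x(1,2) by (auto simp: vec_eq_iff)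
qed

text \<open>A nonzero covector restricts to a nonzero covector on some summand. There simplicity
  forces a nonzero pairing with the highest weight vector, and \<open>weight_unique\<close>
  identifies the summand.\<close>

lemma schur_sum_covector:
  assumes ok: "\<forall>kap\<in>set nus. schur_ok k kap \<and> length kap = k" and nu: "length nu = k"
    and y: "covv k (schur_sum k nus) nu y" "y \<noteq> 0\<^sub>v (fst (schur_sum k nus))"
  shows "nu \<in> set nus"
  using ok y
proof (induction nus arbitrary: y)
  case Nil
  then have "y = 0\<^sub>v (fst (schur_sum k []))" by (intro eq_vecI) (auto simp: covv_def schur_sum_Nil)
  then show ?case using Nil by simp
next
  case (Cons kap nus)
  let ?S = "schur_module k kap" and ?R = "schur_sum k nus"
  have okk: "schur_ok k kap" "\<forall>kap\<in>set nus. schur_ok k kap" "length kap = k" using Cons.prems by auto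
  have S: "polynomial_module k ?S" "simple_module k ?S" using okk by (auto simp: schur_ok_def)
  have "y \<in> carrier_vec (fst ?S + fst ?R)" using Cons.prems(2) schur_sum_dim by (simp add: covv_def)
  then obtain y1 y2 where yy: "y1 \<in> carrier_vec (fst ?S)" "y2 \<in> carrier_vec (fst ?R)" "y = y1 @\<^sub>v y2" by (rule append_split)
  have ap: "y \<bullet> (snd (schur_sum k (kap # nus)) g *\<^sub>v (x1 @\<^sub>v x2)) = y1 \<bullet> (snd ?S g *\<^sub>v x1) + y2 \<bullet> (snd ?R g *\<^sub>v x2)"
    "y \<bullet> (x1 @\<^sub>v x2) = y1 \<bullet> x1 + y2 \<bullet> x2"
    if "g \<in> carrier (GL k)" "x1 \<in> carrier_vec (fst ?S)" "x2 \<in> carrier_vec (fst ?R)" for g x1 x2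
    using that yy pm_vec[OF S(1) that(1,2)] mult_mat_vec_carrier[OF schur_sum_carrier[OF okk(2) that(1)] that(3)]
    by (auto simp: schur_sum_apply[OF okk(1,2)] scalar_prod_append[of _ "fst ?S" _ "fst ?R"])
  have c12: "x1 @\<^sub>v x2 \<in> carrier_vec (fst (schur_sum k (kap # nus)))" if "x1 \<in> carrier_vec (fst ?S)" "x2 \<in> carrier_vec (fst ?R)" for x1 x2
    using that unfolding schur_sum_dim by simp
  have z1: "snd ?S g *\<^sub>v 0\<^sub>v (fst ?S) = 0\<^sub>v (fst ?S)" "snd ?R g *\<^sub>v 0\<^sub>v (fst ?R) = 0\<^sub>v (fst ?R)" if "g \<in> carrier (GL k)" for g
    using pm_carrier[OF S(1) that] schur_sum_carrier[OF okk(2) that] by (auto simp: mult_mat_zero_vec smult_zero_vec)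
  have red1: "y1 \<bullet> (snd ?S g *\<^sub>v x) = b * (y1 \<bullet> x)" if "g \<in> carrier (GL k)" "x \<in> carrier_vec (fst ?S)"
    "\<And>x. x \<in> carrier_vec (fst (schur_sum k (kap # nus))) \<Longrightarrow> y \<bullet> (snd (schur_sum k (kap # nus)) g *\<^sub>v x) = b * (y \<bullet> x)" for g x b
    using that(3)[OF c12[OF that(2) zero_carrier_vec]] ap[OF that(1,2) zero_carrier_vec] z1[OF that(1)] yy by simp
  have red2: "y2 \<bullet> (snd ?R g *\<^sub>v x) = b * (y2 \<bullet> x)" if "g \<in> carrier (GL k)" "x \<in> carrier_vec (fst ?R)"
    "\<And>x. x \<in> carrier_vec (fst (schur_sum k (kap # nus))) \<Longrightarrow> y \<bullet> (snd (schur_sum k (kap # nus)) g *\<^sub>v x) = b * (y \<bullet> x)" for g x b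
    using that(3)[OF c12[OF zero_carrier_vec that(2)]] ap[OF that(1) zero_carrier_vec that(2)] z1[OF that(1)] yy by simp
  have "covv k ?S nu y1" unfolding covv_def
    using yy(1) Cons.prems(2) red1[of _ _ "wt k nu _"] red1[of _ _ 1] by (auto simp: covv_def)
  moreover have "covv k ?R nu y2" unfolding covv_def
    using yy(2) Cons.prems(2) red2[of _ _ "wt k nu _"] red2[of _ _ 1] by (auto simp: covv_def)
  ultimately have cov: "covv k ?S nu y1" "covv k ?R nu y2" .
  show ?case
  proof (cases "y1 = 0\<^sub>v (fst ?S)")
    case True
    then have "y2 \<noteq> 0\<^sub>v (fst ?R)" using Cons.prems(3) yy append_zero_iff[OF yy(1,2)] schur_sum_dim by metis
    then show ?thesis using Cons.IH[OF _ cov(2)] Cons.prems(1) by simp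
  next
    case False
    obtain v xi where v: "hwv k ?S kap v" "v \<noteq> 0\<^sub>v (fst ?S)" using schur_hw[OF okk(1)] by metis
    have vc: "v \<in> carrier_vec (fst ?S)" using v by (simp add: hwv_def)
    have "y1 \<bullet> v \<noteq> 0"
      using simple_annihilator[OF S yy(1) False vc] pairing_zero[OF S(1) v(1) cov(1)] v(2) by blast
    then have "kap = nu" using weight_unique[OF v(1) cov(1)] okk(3) nu by blast
    then show ?thesis by simp
  qed
qed

section \<open>Invariant complements and complete reducibility\<close>

lemma intertwine_kernel:
  assumes N: "polynomial_module k N" and H: "hform k N H" and J: "J \<in> carrier_mat (fst N) r"
    and s: "\<And>g. g \<in> carrier (GL k) \<Longrightarrow> s g \<in> carrier_mat r r"
    and int: "\<And>g. g \<in> carrier (GL k) \<Longrightarrow> snd N g * J = J * s g" and g: "g \<in> carrier (GL k)"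
  shows "adj J * H * snd N g = adj (s (adj g)) * (adj J * H)"
proof -
  have Hc: "H \<in> carrier_mat (fst N) (fst N)" and He: "adj (snd N (adj g)) * H = H * snd N g"
    using H adj_GL[OF g] by (auto simp: hform_def)
  note c = pm_carrier[OF N g] pm_carrier[OF N adj_GL[OF g]] s[OF adj_GL[OF g]]
  have "adj J * H * snd N g = adj J * (H * snd N g)"
    by (rule assoc_mult_mat[OF adj_carrier[OF J] Hc c(1)])
  also have "\<dots> = adj J * adj (snd N (adj g)) * H" unfolding He[symmetric]
    by (rule assoc_mult_mat[OF adj_carrier[OF J] adj_carrier[OF c(2)] Hc, symmetric])
  also have "adj J * adj (snd N (adj g)) = adj (J * s (adj g))"
    unfolding adj_mult[OF c(2) J, symmetric] int[OF adj_GL[OF g]] ..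
  also have "\<dots> = adj (s (adj g)) * adj J" by (rule adj_mult[OF J c(3)])
  also have "\<dots> * H = adj (s (adj g)) * (adj J * H)"
    by (rule assoc_mult_mat[OF adj_carrier[OF c(3)] adj_carrier[OF J] Hc])
  finally show ?thesis .
qed

text \<open>The span of all constituents found so far has an invariant complement, the kernel of
  \<open>J\<^sup>* H\<close>, which contains a highest weight vector as long as it is nonzero.\<close>

lemma schur_sum_extend:
  assumes N: "polynomial_module k N" and H: "hform k N H"
    and ok: "set nus \<subseteq> partitions k" "\<forall>kap\<in>set nus. schur_ok k kap"
    and J: "inj_mat J (fst N) (fst (schur_sum k nus))"
    and int: "\<And>g. g \<in> carrier (GL k) \<Longrightarrow> snd N g * J = J * snd (schur_sum k nus) g"
    and lt: "fst (schur_sum k nus) < fst N"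
  shows "\<exists>kap J'. kap \<in> partitions k \<and> schur_ok k kap \<and> 0 < schur_dim k kap \<and>
    inj_mat J' (fst N) (fst (schur_sum k (kap # nus))) \<and>
    (\<forall>g\<in>carrier (GL k). snd N g * J' = J' * snd (schur_sum k (kap # nus)) g)"
proof -
  let ?n = "fst N" and ?R = "schur_sum k nus" and ?A = "adj J * H"
  have Jc: "J \<in> carrier_mat ?n (fst ?R)" using J by (simp add: inj_mat_def)
  have Hc: "H \<in> carrier_mat ?n ?n" and Hd: "\<And>x. x \<in> carrier_vec ?n \<Longrightarrow> cv x \<bullet> (H *\<^sub>v x) = 0 \<Longrightarrow> x = 0\<^sub>v ?n"
    using H by (auto simp: hform_def)
  have Ac: "?A \<in> carrier_mat (fst ?R) ?n" by (rule mult_carrier_mat[OF adj_carrier[OF Jc] Hc])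
  \<comment> \<open>The adjoint of an intertwiner intertwines in the opposite direction, up to
    replacing \<open>g\<close> by \<open>adj g\<close>, so its kernel is stable.\<close>
  have st: "?A *\<^sub>v (snd N g *\<^sub>v x) = 0\<^sub>v (fst ?R)"
    if x: "x \<in> carrier_vec ?n" "?A *\<^sub>v x = 0\<^sub>v (fst ?R)" and g: "g \<in> carrier (GL k)" for x g
  proof -
    note c = adj_carrier[OF schur_sum_carrier[OF ok(2) adj_GL[OF g]]]
    have e: "?A * snd N g = adj (snd ?R (adj g)) * ?A"
      by (rule intertwine_kernel[where s = "snd (schur_sum k nus)", OF N H Jc schur_sum_carrier[OF ok(2)] int g])
    have "?A *\<^sub>v (snd N g *\<^sub>v x) = (?A * snd N g) *\<^sub>v x"
      by (rule assoc_mult_mat_vec[OF Ac pm_carrier[OF N g] x(1), symmetric])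
    also have "\<dots> = adj (snd ?R (adj g)) *\<^sub>v (?A *\<^sub>v x)"
      unfolding e
      by (rule assoc_mult_mat_vec[OF c Ac x(1)])
    finally show ?thesis unfolding x(2) using mult_mat_zero_vec[OF c] by simp
  qed
  obtain x0 where x0: "x0 \<in> carrier_vec ?n" "x0 \<noteq> 0\<^sub>v ?n" "?A *\<^sub>v x0 = 0\<^sub>v (fst ?R)" using wide_kernel[OF Ac lt] by blast
  have "\<exists>kap z. length kap = k \<and> z \<noteq> 0\<^sub>v ?n \<and> ?A *\<^sub>v z = 0\<^sub>v (fst ?R) \<and> hwv k N kap z"
    by (rule exists_highest_weight_vector[OF N Ac st x0(1,3,2)])
  then obtain kap z where z: "length kap = k" "z \<noteq> 0\<^sub>v ?n" "?A *\<^sub>v z = 0\<^sub>v (fst ?R)" "hwv k N kap z" by blast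
  have zc: "z \<in> carrier_vec ?n" using z(4) by (simp add: hwv_def)
  have "kap \<in> partitions k"
    using weight_dominant[OF N z(4) hform_covector(1)[OF N H z(4)] _ z(1)] hform_covector(2)[OF N H z(4) zc] Hd[OF zc] z(2) by metis
  moreover have okk: "schur_ok k kap" by (rule schur_okI[OF N H z(4,2)])
  moreover obtain v xi where v: "hwv k (schur_module k kap) kap v" "v \<noteq> 0\<^sub>v (schur_dim k kap)" using schur_hw[OF okk] by metis
  let ?S = "schur_module k kap"
  have S: "polynomial_module k ?S" "simple_module k ?S" using okk by (auto simp: schur_ok_def)
  have vc: "v \<in> carrier_vec (fst ?S)" using v by (simp add: hwv_def)
  obtain Jz where Jz: "Jz \<in> carrier_mat ?n (fst ?S)" "\<And>g. g \<in> carrier (GL k) \<Longrightarrow> snd N g * Jz = Jz * snd ?S g" "Jz *\<^sub>v v = z"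
    "\<And>x. x \<in> carrier_vec (fst ?S) \<Longrightarrow> Jz *\<^sub>v x = 0\<^sub>v ?n \<Longrightarrow> x = 0\<^sub>v (fst ?S)"
    using simple_intertwiner[OF S v N H z(4,2)] by blast
  \<comment> \<open>The whole new summand lands in the complement: the vectors that do so form a
    submodule, and it contains \<open>v\<close>.\<close>
  have AJz: "?A *\<^sub>v (Jz *\<^sub>v x) = 0\<^sub>v (fst ?R)" if x: "x \<in> carrier_vec (fst ?S)" for x
  proof -
    let ?W = "{x \<in> carrier_vec (fst ?S). ?A *\<^sub>v (Jz *\<^sub>v x) = 0\<^sub>v (fst ?R)}"
    have c: "Jz *\<^sub>v x \<in> carrier_vec ?n" if "x \<in> carrier_vec (fst ?S)" for x using Jz(1) that by (rule mult_mat_vec_carrier)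
    have "?W = {0\<^sub>v (fst ?S)} \<or> ?W = carrier_vec (fst ?S)"
    proof (rule simple_moduleD[OF S(2)])
      show "0\<^sub>v (fst ?S) \<in> ?W" using mult_mat_zero_vec[OF Jz(1)] mult_mat_zero_vec[OF Ac] by simp
      show "a + b \<in> ?W" if "a \<in> ?W" "b \<in> ?W" for a b
        using that mult_add_distrib_mat_vec[OF Jz(1), of a b] mult_add_distrib_mat_vec[OF Ac c c, of a b] by simp
      show "b \<cdot>\<^sub>v a \<in> ?W" if "a \<in> ?W" for b a
        using that mult_mat_vec[OF Jz(1), of a b] mult_mat_vec[OF Ac c, of a b] smult_zero_vec by simp
      show "snd ?S g *\<^sub>v a \<in> ?W" if g: "g \<in> carrier (GL k)" and a: "a \<in> ?W" for g a
      proof -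
        have ac: "a \<in> carrier_vec (fst ?S)" "?A *\<^sub>v (Jz *\<^sub>v a) = 0\<^sub>v (fst ?R)" using a by auto
        have "Jz *\<^sub>v (snd ?S g *\<^sub>v a) = snd N g *\<^sub>v (Jz *\<^sub>v a)"
          using assoc_mult_mat_vec[OF Jz(1) pm_carrier[OF S(1) g] ac(1)] assoc_mult_mat_vec[OF pm_carrier[OF N g] Jz(1) ac(1)] Jz(2)[OF g] by simp
        then show ?thesis using st[OF c[OF ac(1)] ac(2) g] pm_vec[OF S(1) g ac(1)] by simp
      qed
    qed auto
    moreover have "v \<in> ?W" using Jz(3) z(3) vc by simp
    ultimately show ?thesis using v(2) x by blast
  qed
  let ?T = "schur_sum k (kap # nus)" and ?J = "hcat Jz J"
  have "inj_mat ?J ?n (fst ?T)" unfolding schur_sum_dim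
  proof (rule hcat_inj[OF _ J])
    show "inj_mat Jz ?n (fst ?S)" using Jz(1,4) by (simp add: inj_mat_def)
    \<comment> \<open>Applying \<open>adj J * H\<close> to a relation removes the new summand, so
      \<open>J *\<^sub>v y\<close> is isotropic.\<close>
    fix x y assume x: "x \<in> carrier_vec (fst ?S)" and y: "y \<in> carrier_vec (fst ?R)" and e: "Jz *\<^sub>v x + J *\<^sub>v y = 0\<^sub>v ?n"
    have c: "Jz *\<^sub>v x \<in> carrier_vec ?n" "J *\<^sub>v y \<in> carrier_vec ?n"
      using mult_mat_vec_carrier[OF Jz(1) x] mult_mat_vec_carrier[OF Jc y] by auto
    have Ay: "?A *\<^sub>v (J *\<^sub>v y) \<in> carrier_vec (fst ?R)" using Ac c(2) by (rule mult_mat_vec_carrier)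
    have "0\<^sub>v (fst ?R) = ?A *\<^sub>v (Jz *\<^sub>v x + J *\<^sub>v y)" unfolding e using mult_mat_zero_vec[OF Ac] by simp
    also have "\<dots> = ?A *\<^sub>v (J *\<^sub>v y)" unfolding mult_add_distrib_mat_vec[OF Ac c] AJz[OF x] using Ay by (rule left_zero_vec)
    finally have "adj J *\<^sub>v (H *\<^sub>v (J *\<^sub>v y)) = 0\<^sub>v (fst ?R)"
      using assoc_mult_mat_vec[OF adj_carrier[OF Jc] Hc c(2)] by simp
    then have "cv (J *\<^sub>v y) \<bullet> (H *\<^sub>v (J *\<^sub>v y)) = 0"
      using cv_mult[OF Jc y, of "H *\<^sub>v (J *\<^sub>v y)"] mult_mat_vec_carrier[OF Hc c(2)] y by simp
    then show "J *\<^sub>v y = 0\<^sub>v ?n" by (rule Hd[OF c(2)])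
  qed
  moreover have "snd N g * ?J = ?J * snd ?T g" if g: "g \<in> carrier (GL k)" for g
  proof (rule mat_vec_eqI)
    have okc: "\<forall>kap\<in>set (kap # nus). schur_ok k kap" using okk ok(2) by simp
    note gc = pm_carrier[OF N g] pm_carrier[OF S(1) g] schur_sum_carrier[OF ok(2) g] schur_sum_carrier[OF okc g, unfolded schur_sum_dim]
    note hc = hcat_carrier[OF Jz(1) Jc]
    show "snd N g * ?J \<in> carrier_mat ?n (fst ?S + fst ?R)" "?J * snd ?T g \<in> carrier_mat ?n (fst ?S + fst ?R)"
      using mult_carrier_mat[OF gc(1) hc] mult_carrier_mat[OF hc gc(4)] by auto
    fix w :: "complex vec" assume w: "w \<in> carrier_vec (fst ?S + fst ?R)"
    obtain x y where xy: "x \<in> carrier_vec (fst ?S)" "y \<in> carrier_vec (fst ?R)" "w = x @\<^sub>v y" using append_split[OF w] .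
    have "(snd N g * ?J) *\<^sub>v w = snd N g *\<^sub>v (Jz *\<^sub>v x + J *\<^sub>v y)"
      unfolding assoc_mult_mat_vec[OF gc(1) hc w] unfolding xy(3) hcat_mult[OF Jz(1) Jc xy(1,2)] ..
    also have "\<dots> = (snd N g * Jz) *\<^sub>v x + (snd N g * J) *\<^sub>v y"
      unfolding mult_add_distrib_mat_vec[OF gc(1) mult_mat_vec_carrier[OF Jz(1) xy(1)] mult_mat_vec_carrier[OF Jc xy(2)]]
      using assoc_mult_mat_vec[OF gc(1) Jz(1) xy(1)] assoc_mult_mat_vec[OF gc(1) Jc xy(2)] by simp
    also have "\<dots> = Jz *\<^sub>v (snd ?S g *\<^sub>v x) + J *\<^sub>v (snd ?R g *\<^sub>v y)"
      unfolding Jz(2)[OF g] int[OF g]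
      using assoc_mult_mat_vec[OF Jz(1) gc(2) xy(1)] assoc_mult_mat_vec[OF Jc gc(3) xy(2)] by simp
    also have "\<dots> = ?J *\<^sub>v (snd ?T g *\<^sub>v w)"
      unfolding xy(3) schur_sum_apply[OF okk ok(2) g xy(1,2)]
      using hcat_mult[OF Jz(1) Jc mult_mat_vec_carrier[OF gc(2) xy(1)] mult_mat_vec_carrier[OF gc(3) xy(2)]] by simp
    finally show "(snd N g * ?J) *\<^sub>v w = (?J * snd ?T g) *\<^sub>v w"
      unfolding assoc_mult_mat_vec[OF hc gc(4) w] .
  qed
  moreover have "0 < fst ?S"
  proof (rule ccontr)
    assume "\<not> 0 < fst ?S"
    then have "v = 0\<^sub>v (fst ?S)" using vc by (intro eq_vecI) auto
    then show False using v(2) by simp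
  qed
  ultimately show ?thesis by blast
qed

text \<open>Among the sums of Schur modules that embed into \<open>N\<close> one of maximal
  dimension is taken; if it did not fill \<open>N\<close>, \<open>schur_sum_extend\<close> would
  enlarge it.\<close>

theorem decomposition:
  assumes N: "polynomial_module k N" and H: "hform k N H"
  shows "\<exists>nus. set nus \<subseteq> partitions k \<and> (\<forall>kap\<in>set nus. schur_ok k kap) \<and> module_iso k N (schur_sum k nus)"
proof -
  let ?n = "fst N"
  let ?P = "\<lambda>d. \<exists>nus J. fst (schur_sum k nus) = d \<and> set nus \<subseteq> partitions k \<and> (\<forall>kap\<in>set nus. schur_ok k kap) \<and>
    inj_mat J ?n (fst (schur_sum k nus)) \<and> (\<forall>g\<in>carrier (GL k). snd N g * J = J * snd (schur_sum k nus) g)"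
  have "?P 0"
  proof (intro exI[of _ "[]"] exI[of _ "0\<^sub>m ?n 0"] conjI ballI)
    show "inj_mat (0\<^sub>m ?n 0) ?n (fst (schur_sum k []))" by (auto simp: inj_mat_def schur_sum_Nil)
    show "snd N g * 0\<^sub>m ?n 0 = 0\<^sub>m ?n 0 * snd (schur_sum k []) g" if "g \<in> carrier (GL k)" for g
      using pm_carrier[OF N that] schur_sum_carrier[of "[]" k g] that by (intro eq_matI) (auto simp: schur_sum_Nil)
  qed (auto simp: schur_sum_Nil)
  moreover have "\<forall>r. ?P r \<longrightarrow> r \<le> ?n" using inj_mat_le by blast
  ultimately have "?P (Greatest ?P)" "\<And>r'. ?P r' \<Longrightarrow> r' \<le> Greatest ?P"
    by (blast intro: GreatestI_nat[of ?P 0 ?n], blast intro: Greatest_le_nat[of ?P _ ?n])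
  then obtain d where d: "?P d" "\<And>r'. ?P r' \<Longrightarrow> r' \<le> d" by blast
  from d(1) obtain nus J where nus: "fst (schur_sum k nus) = d" "set nus \<subseteq> partitions k" "\<forall>kap\<in>set nus. schur_ok k kap"
    "inj_mat J ?n (fst (schur_sum k nus))" "\<And>g. g \<in> carrier (GL k) \<Longrightarrow> snd N g * J = J * snd (schur_sum k nus) g" by blast
  let ?R = "schur_sum k nus"
  have full: "fst ?R = ?n"
  proof (rule ccontr)
    assume "fst ?R \<noteq> ?n"
    then have "fst ?R < ?n" using inj_mat_le[OF nus(4)] by simp
    from schur_sum_extend[OF N H nus(2-5) this] obtain kap J' where e: "kap \<in> partitions k" "schur_ok k kap" "0 < schur_dim k kap"
      "inj_mat J' ?n (fst (schur_sum k (kap # nus)))" "\<forall>g\<in>carrier (GL k). snd N g * J' = J' * snd (schur_sum k (kap # nus)) g" by blast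
    have "?P (fst (schur_sum k (kap # nus)))" using e nus(2,3) by (intro exI[of _ "kap # nus"] exI[of _ J']) auto
    then have "fst (schur_sum k (kap # nus)) \<le> d" by (rule d(2))
    then show False using e(3) nus(1) schur_sum_dim[of k kap nus] by simp
  qed
  have Jn: "inj_mat J ?n ?n" using nus(4) full by simp
  then have Jc: "J \<in> carrier_mat ?n ?n" by (simp add: inj_mat_def)
  obtain B where B: "B \<in> carrier_mat ?n ?n" "J * B = 1\<^sub>m ?n" "B * J = 1\<^sub>m ?n" using inj_square_inverse[OF Jn] .
  have "B * snd N g = snd ?R g * B" if g: "g \<in> carrier (GL k)" for g
    by (rule inverse_intertwines[OF Jc B schur_sum_carrier[OF nus(3) g, unfolded full] pm_carrier[OF N g] nus(5)[OF g, symmetric]])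
  moreover have "B \<in> carrier (GL ?n)" using B Jc by (auto simp: GL_iff)
  ultimately have "module_iso k N ?R" unfolding module_iso_def using full by auto
  then show ?thesis using nus(2,3) by blast
qed

subsection \<open>Schur modules inside the exterior algebra\<close>

definition fun_algebra :: "('x \<Rightarrow> 'a::field_char_0) set \<Rightarrow> bool" where
  "fun_algebra F \<longleftrightarrow> (\<forall>c. (\<lambda>_. c) \<in> F) \<and> (\<forall>f\<in>F. \<forall>g\<in>F. (\<lambda>x. f x + g x) \<in> F \<and> (\<lambda>x. f x * g x) \<in> F)"

lemma fun_algebra_const: "fun_algebra F \<Longrightarrow> (\<lambda>_. c) \<in> F"
  and fun_algebra_add: "fun_algebra F \<Longrightarrow> f \<in> F \<Longrightarrow> g \<in> F \<Longrightarrow> (\<lambda>x. f x + g x) \<in> F"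
  and fun_algebra_mult: "fun_algebra F \<Longrightarrow> f \<in> F \<Longrightarrow> g \<in> F \<Longrightarrow> (\<lambda>x. f x * g x) \<in> F"
  by (auto simp: fun_algebra_def)

lemma fun_algebra_sum:
  assumes F: "fun_algebra F" and f: "\<And>i. i \<in> I \<Longrightarrow> f i \<in> F"
  shows "(\<lambda>x. \<Sum>i\<in>I. f i x) \<in> F"
proof (cases "finite I")
  case True
  then show ?thesis using f
    by (induction I rule: finite_induct) (auto intro: fun_algebra_const[OF F] fun_algebra_add[OF F])
qed (simp add: fun_algebra_const[OF F])

text \<open>Minors are polynomial in the matrix entries. The abstract algebra \<open>F\<close>
  serves both for polynomial functions of a matrix and for polynomial functions of one complex
  parameter.\<close>

lemma fun_algebra_img:
  assumes F: "fun_algebra F" and "finite A" and G: "\<And>p q. p \<in> A \<Longrightarrow> (\<lambda>x. G x p q) \<in> F"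
  shows "(\<lambda>x. img (G x) A B) \<in> F"
  using assms(2) G
proof (induction A arbitrary: B rule: finite_min_induct)
  case (insert p A)
  have e: "img (G x) (insert p A) = lm (G x p) (img (G x) A)" for x using insert(1,2) by (rule img_min)
  show ?case unfolding e lm_def
    by (intro fun_algebra_sum[OF F] fun_algebra_mult[OF F] fun_algebra_const[OF F]) (use insert in auto)
qed (simp add: fun_algebra_const[OF F])

lemma fun_algebra_ac:
  assumes F: "fun_algebra F" and g: "\<And>i j. i < k \<Longrightarrow> j < k \<Longrightarrow> (\<lambda>x. g x i j) \<in> F" and h: "\<And>i j. i < m \<Longrightarrow> j < m \<Longrightarrow> (\<lambda>x. h x i j) \<in> F"
    and u: "\<And>A. (\<lambda>x. u x A) \<in> F"
  shows "(\<lambda>x. ac k m (g x) (h x) (u x) B) \<in> F"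
  unfolding ac_def act_def
proof (intro fun_algebra_sum[OF F] fun_algebra_mult[OF F] u fun_algebra_img[OF F])
  fix A p q assume A: "A \<in> Pow (bx k m)"
  then show "finite A" using finite_subset bx_fin by blast
  assume "p \<in> A"
  then have "p \<in> bx k m" using A by blast
  then show "(\<lambda>x. tens k m (g x) (h x) p q) \<in> F"
    unfolding tens_def by (cases "q \<in> bx k m"; cases p; cases q) (auto intro!: fun_algebra_mult[OF F] fun_algebra_const[OF F] g h)
qed

lemma fun_algebra_wed:
  assumes F: "fun_algebra F" and u: "\<And>A. (\<lambda>x. u x A) \<in> F" "\<And>A. (\<lambda>x. v x A) \<in> F"
  shows "(\<lambda>x. wed (u x) (v x) C) \<in> F"
  unfolding wed_def by (intro fun_algebra_sum[OF F] fun_algebra_mult[OF F] fun_algebra_const[OF F] u)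

lemma fun_algebra_polynomial_functions: "fun_algebra (polynomial_functions k)"
  by (simp add: fun_algebra_def polynomial_functions.intros)

text \<open>Minors are polynomials with integer coefficients, so ring homomorphisms pass through
  them. The cases of interest are complex conjugation and the inclusion of the reals.\<close>

lemma img_hom:
  fixes f :: "'a::field_char_0 \<Rightarrow> 'b::field_char_0" and A :: "'i::linorder set"
  assumes f: "f 0 = 0" "f 1 = 1" "\<And>a b. f (a + b) = f a + f b" "\<And>a b. f (a * b) = f a * f b" and "finite A"
  shows "f (img G A B) = img (\<lambda>p q. f (G p q)) A B"
  using assms(5)
proof (induction A arbitrary: B rule: finite_min_induct)
  case empty
  then show ?case using f by (simp add: bas_def)
next
  case (insert p A)
  have s: "f (\<Sum>i\<in>I. c i) = (\<Sum>i\<in>I. f (c i))" for I :: "'i set" and c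
    by (induction I rule: infinite_finite_induct) (auto simp: f)
  have "f (- 1) + f 1 = 0" unfolding f(3)[symmetric] using f(1) by simp
  then have "f (- 1) = - 1" using f(2) by (simp add: add_eq_0_iff2)
  moreover have "f (c ^ n) = f c ^ n" for c n by (induction n) (auto simp: f)
  ultimately have e: "f (eps q C) = eps q C" for q and C :: "'i set" by (simp add: eps_def)
  have m: "img H (insert p A) = lm (H p) (img H A)" for H :: "'i \<Rightarrow> 'i \<Rightarrow> 'c::field_char_0" using insert(1,2) by (rule img_min)
  show ?case unfolding m lm_def s f(4) e insert.IH ..
qed

lemma ac_hom:
  fixes f :: "'a::field_char_0 \<Rightarrow> 'b::field_char_0"
  assumes f: "f 0 = 0" "f 1 = 1" "\<And>a b. f (a + b) = f a + f b" "\<And>a b. f (a * b) = f a * f b" and A: "A \<subseteq> bx k m"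
  shows "f (ac k m g h (bas A) B) = ac k m (\<lambda>i j. f (g i j)) (\<lambda>i j. f (h i j)) (bas A) B"
proof -
  have "(\<lambda>p q. f (tens k m g h p q)) = tens k m (\<lambda>i j. f (g i j)) (\<lambda>i j. f (h i j))"
    by (auto simp: tens_def f fun_eq_iff)
  then show ?thesis
    using img_hom[of f A, OF f] finite_subset[OF A bx_fin] by (simp add: ac_def act_bas[OF bx_fin A])
qed

section \<open>Changing the number of columns\<close>

lemma ac_coeff:
  assumes "u \<in> forms (bx k m)" "m \<le> m'" "B \<subseteq> bx k m"
  shows "ac k m' g h u B = ac k m g h u B"
proof -
  have sub: "bx k m \<subseteq> bx k m'" using assms(2) by (auto simp: bx_def)
  have "ac k m' g h u B = (\<Sum>A\<in>Pow (bx k m). u A * img (tens k m' g h) A B)"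
    unfolding ac_def act_def by (rule sum.mono_neutral_right) (use sub formsD[OF assms(1)] in auto)
  also have "\<dots> = ac k m g h u B"
    unfolding ac_def act_def
  proof (intro sum.cong refl)
    fix A assume A: "A \<in> Pow (bx k m)"
    have "img (tens k m' g h) A B = img (tens k m g h) A B"
      using A sub assms(3) by (intro img_cong_on) (auto simp: tens_def intro: finite_subset[OF _ bx_fin])
    then show "u A * img (tens k m' g h) A B = u A * img (tens k m g h) A B" by simp
  qed
  finally show ?thesis .
qed

text \<open>Row operations preserve the column of each box, so additional columns never come into
  play.\<close>

lemma ac_enlarge:
  assumes "u \<in> forms (bx k m)" "m \<le> m'"
  shows "ac k m' g idm u = ac k m g idm u"
proof -
  have sub: "bx k m \<subseteq> bx k m'" using assms(2) by (auto simp: bx_def)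
  have "ac k m' g idm u \<in> forms (bx k m)" unfolding ac_def
  proof (rule formsI, rule ccontr)
    fix B assume nz: "act (bx k m') (tens k m' g idm) u B \<noteq> 0" and B: "\<not> B \<subseteq> bx k m"
    have "u A * img (tens k m' g idm) A B = 0" for A
    proof (cases "A \<subseteq> bx k m")
      case True
      have "img (tens k m' g idm) A \<in> forms (bx k m)"
      proof (rule img_forms)
        show "finite A" using True finite_subset bx_fin by blast
        show "q \<in> bx k m" if "p \<in> A" "tens k m' g idm p q \<noteq> 0" for p q
          using that True by (cases p; cases q) (auto simp: tens_def idm_def bx_def split: if_splits)
      qed
      then show ?thesis using formsD[of "img (tens k m' g idm) A" "bx k m" B] B by simp
    qed (use formsD[OF assms(1)] in simp)
    then show False using nz by (simp add: act_def)
  qed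
  then have "ac k m' g idm u B = ac k m g idm u B" for B
    using ac_coeff[OF assms] formsD[of "ac k m' g idm u" "bx k m" B] formsD[OF ac_forms[of k m g idm u], of B]
    by (cases "B \<subseteq> bx k m") auto
  then show ?thesis by blast
qed

section \<open>The exterior algebra as a module in coordinates\<close>

definition box_sets :: "nat \<Rightarrow> nat \<Rightarrow> (nat \<times> nat) set list" where
  "box_sets k m = (SOME xs. set xs = Pow (bx k m) \<and> distinct xs)"

lemma box_sets: "set (box_sets k m) = Pow (bx k m)" "distinct (box_sets k m)"
  using someI_ex[OF finite_distinct_list[of "Pow (bx k m)"]] by (auto simp: box_sets_def)

lemma sum_box_sets: "(\<Sum>i<length (box_sets k m). f (box_sets k m ! i)) = (\<Sum>A\<in>Pow (bx k m). f A)"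
  by (rule sum.reindex_bij_betw[OF bij_betw_nth]) (auto simp: box_sets)

lemma box_sets_nth: "i < length (box_sets k m) \<Longrightarrow> box_sets k m ! i \<subseteq> bx k m"
  using box_sets(1)[of k m] nth_mem by blast

definition form_of :: "nat \<Rightarrow> nat \<Rightarrow> complex vec \<Rightarrow> (nat \<times> nat) set \<Rightarrow> complex" where
  "form_of k m x = (\<lambda>A. \<Sum>i<length (box_sets k m). x $ i * bas (box_sets k m ! i) A)"

definition vec_of :: "nat \<Rightarrow> nat \<Rightarrow> ((nat \<times> nat) set \<Rightarrow> complex) \<Rightarrow> complex vec" where
  "vec_of k m u = vec (length (box_sets k m)) (\<lambda>i. u (box_sets k m ! i))"

lemma vec_of_carrier [simp]: "vec_of k m u \<in> carrier_vec (length (box_sets k m))"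
  by (simp add: vec_of_def)

lemma form_vec_of: "u \<in> forms (bx k m) \<Longrightarrow> form_of k m (vec_of k m u) = u"
proof -
  assume u: "u \<in> forms (bx k m)"
  have "form_of k m (vec_of k m u) = (\<lambda>B. \<Sum>A\<in>Pow (bx k m). u A * bas A B)"
    unfolding form_of_def sum_box_sets[symmetric] by (simp add: vec_of_def)
  then show ?thesis using forms_expand[OF bx_fin u] by simp
qed

lemma vec_form_of:
  assumes x: "x \<in> carrier_vec (length (box_sets k m))"
  shows "vec_of k m (form_of k m x) = x"
proof (rule eq_vecI)
  fix i assume "i < dim_vec x"
  then have i: "i < length (box_sets k m)" using x by simp
  have "form_of k m x (box_sets k m ! i) = (\<Sum>j<length (box_sets k m). x $ j * (if j = i then 1 else 0))"
    unfolding form_of_def using nth_eq_iff_index_eq[OF box_sets(2)] i by (intro sum.cong) (auto simp: bas_def)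
  then show "vec_of k m (form_of k m x) $ i = x $ i" using i by (simp add: vec_of_def sum_pick)
qed (use x in \<open>simp add: vec_of_def\<close>)

lemma form_of_forms [simp]: "form_of k m x \<in> forms (bx k m)"
proof (rule formsI)
  fix A assume "form_of k m x A \<noteq> 0"
  then obtain i where "i < length (box_sets k m)" "bas (box_sets k m ! i) A \<noteq> (0::complex)"
    unfolding form_of_def by (metis (no_types, lifting) lessThan_iff mult_zero_right sum.neutral)
  then show "A \<subseteq> bx k m" using box_sets_nth by (auto simp: bas_def split: if_splits)
qed

text \<open>Only row operations act here; the column operations are left over as endomorphisms
  commuting with the module structure.\<close>

definition ext_module :: "nat \<Rightarrow> nat \<Rightarrow> module_data" where
  "ext_module k m = (length (box_sets k m), \<lambda>g. mat (length (box_sets k m)) (length (box_sets k m))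
     (\<lambda>(i, j). ac k m (mf g) idm (bas (box_sets k m ! j)) (box_sets k m ! i)))"

lemma fst_ext_module [simp]: "fst (ext_module k m) = length (box_sets k m)"
  by (simp add: ext_module_def)

lemma ext_module_carrier: "snd (ext_module k m) g \<in> carrier_mat (length (box_sets k m)) (length (box_sets k m))"
  by (simp add: ext_module_def)

lemma ext_module_apply:
  assumes u: "u \<in> forms (bx k m)"
  shows "snd (ext_module k m) g *\<^sub>v vec_of k m u = vec_of k m (ac k m (mf g) idm u)"
proof (rule eq_vecI)
  let ?N = "length (box_sets k m)"
  fix i assume "i < dim_vec (vec_of k m (ac k m (mf g) idm u))"
  then have i: "i < ?N" by (simp add: vec_of_def)
  have "(snd (ext_module k m) g *\<^sub>v vec_of k m u) $ i =
    (\<Sum>j<?N. ac k m (mf g) idm (bas (box_sets k m ! j)) (box_sets k m ! i) * u (box_sets k m ! j))"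
    unfolding mv_index[OF ext_module_carrier vec_of_carrier i] using i
    by (intro sum.cong) (auto simp: ext_module_def vec_of_def)
  also have "\<dots> = (\<Sum>A\<in>Pow (bx k m). ac k m (mf g) idm (bas A) (box_sets k m ! i) * u A)"
    by (rule sum_box_sets)
  also have "\<dots> = (\<Sum>A\<in>Pow (bx k m). ac k m (mf g) idm (\<lambda>B. u A * bas A B) (box_sets k m ! i))"
    by (simp add: ac_scale mult.commute)
  also have "\<dots> = ac k m (mf g) idm u (box_sets k m ! i)"
    by (subst (2) forms_expand[OF bx_fin u]) (simp add: ac_sum)
  finally show "(snd (ext_module k m) g *\<^sub>v vec_of k m u) $ i = vec_of k m (ac k m (mf g) idm u) $ i"
    using i by (simp add: vec_of_def)
qed (simp add: ext_module_def vec_of_def)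

lemma form_of_ext_module:
  assumes "x \<in> carrier_vec (length (box_sets k m))"
  shows "form_of k m (snd (ext_module k m) g *\<^sub>v x) = ac k m (mf g) idm (form_of k m x)"
  using ext_module_apply[OF form_of_forms, of k m g x] vec_form_of[OF assms] form_vec_of[OF ac_forms] by metis

lemma ac_mf_mult:
  assumes "g \<in> carrier_mat k k" "h \<in> carrier_mat k k"
  shows "ac k m (mf (g * h)) idm u = ac k m (mf g) idm (ac k m (mf h) idm u)"
  unfolding ac_ac by (rule ac_cong) (simp_all add: mf_mult[OF assms] mm_idl)

lemma ac_mf_one: "u \<in> forms (bx k m) \<Longrightarrow> ac k m (mf (1\<^sub>m k)) idm u = u"
proof -
  assume u: "u \<in> forms (bx k m)"
  have "ac k m (mf (1\<^sub>m k)) idm u = ac k m idm idm u" by (rule ac_cong) (auto simp: mf_def idm_def)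
  then show ?thesis using ac_id[OF u] by simp
qed

lemma ext_module_polynomial: "polynomial_module k (ext_module k m)"
proof (rule polynomial_moduleI)
  let ?N = "length (box_sets k m)"
  note c = ext_module_carrier[of k m]
  show "snd (ext_module k m) (g * h) = snd (ext_module k m) g * snd (ext_module k m) h"
    if "g \<in> carrier (GL k)" "h \<in> carrier (GL k)" for g h
  proof (rule mat_vec_eqI)
    show "snd (ext_module k m) g * snd (ext_module k m) h \<in> carrier_mat ?N ?N" by (rule mult_carrier_mat[OF c c])
    fix x :: "complex vec" assume x: "x \<in> carrier_vec ?N"
    have "snd (ext_module k m) (g * h) *\<^sub>v vec_of k m (form_of k m x) =
      snd (ext_module k m) g *\<^sub>v (snd (ext_module k m) h *\<^sub>v vec_of k m (form_of k m x))"
      by (simp add: ext_module_apply ac_mf_mult GL_carrier that)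
    then show "snd (ext_module k m) (g * h) *\<^sub>v x = (snd (ext_module k m) g * snd (ext_module k m) h) *\<^sub>v x"
      unfolding vec_form_of[OF x] assoc_mult_mat_vec[OF c c x] .
  qed (rule c)
  show "snd (ext_module k m) (1\<^sub>m k) = 1\<^sub>m (fst (ext_module k m))"
  proof (rule mat_vec_eqI)
    show "snd (ext_module k m) (1\<^sub>m k) \<in> carrier_mat ?N ?N" by (rule c)
    show "1\<^sub>m (fst (ext_module k m)) \<in> carrier_mat ?N ?N" by simp
    fix x :: "complex vec" assume x: "x \<in> carrier_vec ?N"
    have "snd (ext_module k m) (1\<^sub>m k) *\<^sub>v vec_of k m (form_of k m x) = vec_of k m (form_of k m x)"
      by (simp add: ext_module_apply ac_mf_one)
    then show "snd (ext_module k m) (1\<^sub>m k) *\<^sub>v x = 1\<^sub>m (fst (ext_module k m)) *\<^sub>v x"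
      unfolding vec_form_of[OF x] using x by simp
  qed
  fix i j assume ij: "i < fst (ext_module k m)" "j < fst (ext_module k m)"
  show "\<exists>p\<in>polynomial_functions k. \<forall>g\<in>carrier (GL k). snd (ext_module k m) g $$ (i, j) = p g"
  proof (rule bexI, rule ballI)
    show "(\<lambda>g. ac k m (mf g) idm (bas (box_sets k m ! j)) (box_sets k m ! i)) \<in> polynomial_functions k"
      by (intro fun_algebra_ac fun_algebra_polynomial_functions)
        (auto simp: mf_def intro: polynomial_functions.intros)
    show "snd (ext_module k m) g $$ (i, j) = ac k m (mf g) idm (bas (box_sets k m ! j)) (box_sets k m ! i)" for g
      using ij by (simp add: ext_module_def)
  qed
qed (use ext_module_carrier in auto)

lemma cv_definite:
  assumes x: "x \<in> carrier_vec n" "cv x \<bullet> x = 0"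
  shows "x = 0\<^sub>v n"
proof (rule eq_vecI)
  have e: "cv x \<bullet> x = of_real (\<Sum>j<n. (cmod (x $ j))\<^sup>2)"
    unfolding sp_sum[OF x(1)] of_real_sum
  proof (intro sum.cong refl)
    fix j assume "j \<in> {..<n}"
    then show "cv x $ j * x $ j = complex_of_real ((cmod (x $ j))\<^sup>2)"
      using cv_index[OF x(1)] complex_norm_square[of "x $ j"] by (simp add: mult.commute del: of_real_power)
  qed
  have "(\<Sum>j<n. (cmod (x $ j))\<^sup>2) = 0" using x(2) unfolding e of_real_eq_0_iff .
  then show "x $ i = 0\<^sub>v n $ i" if "i < dim_vec (0\<^sub>v n)" for i
    using that by (simp add: sum_nonneg_eq_0_iff)
qed (use x in auto)

text \<open>The standard hermitian product. Conjugating and transposing the matrix of minors of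
  \<open>g\<close> gives the minors of \<open>adj g\<close>, by \<open>img_hom\<close> and
  \<open>img_transpose\<close>.\<close>

lemma ext_module_hform: "hform k (ext_module k m) (1\<^sub>m (length (box_sets k m)))"
proof -
  let ?N = "length (box_sets k m)" and ?S = "box_sets k m"
  have fin: "finite (?S ! i)" if "i < ?N" for i using box_sets_nth[OF that] finite_subset bx_fin by blast
  have "adj (snd (ext_module k m) g) = snd (ext_module k m) (adj g)" if g: "g \<in> carrier (GL k)" for g
  proof (rule eq_matI)
    fix i j assume "i < dim_row (snd (ext_module k m) (adj g))" "j < dim_col (snd (ext_module k m) (adj g))"
    then have ij: "i < ?N" "j < ?N" by (auto simp: ext_module_def)
    have "adj (snd (ext_module k m) g) $$ (i, j) = cnj (img (tens k m (mf g) idm) (?S ! i) (?S ! j))"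
      unfolding adj_index[OF ext_module_carrier ij]
      using ij box_sets_nth[OF ij(1)] by (simp add: ext_module_def ac_def act_bas)
    also have "\<dots> = img (\<lambda>p q. cnj (tens k m (mf g) idm p q)) (?S ! i) (?S ! j)"
      by (rule img_hom) (use fin[OF ij(1)] in auto)
    also have "\<dots> = img (\<lambda>p q. cnj (tens k m (mf g) idm q p)) (?S ! j) (?S ! i)"
      by (rule img_transpose) (use fin ij in auto)
    also have "\<dots> = img (tens k m (mf (adj g)) idm) (?S ! j) (?S ! i)"
    proof (rule img_cong_on[OF fin[OF ij(2)]])
      fix p q assume "p \<in> ?S ! j" "q \<in> ?S ! i"
      then have "p \<in> bx k m" "q \<in> bx k m" using box_sets_nth ij by blast+
      then show "cnj (tens k m (mf g) idm q p) = tens k m (mf (adj g)) idm p q"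
        using adj_index[OF GL_carrier[OF g]] by (cases p; cases q) (auto simp: tens_def mf_def idm_def)
    qed
    also have "\<dots> = snd (ext_module k m) (adj g) $$ (i, j)"
      using ij box_sets_nth[OF ij(2)] by (simp add: ext_module_def ac_def act_bas)
    finally show "adj (snd (ext_module k m) g) $$ (i, j) = snd (ext_module k m) (adj g) $$ (i, j)" .
  qed (auto simp: ext_module_def adj_def)
  then show ?thesis
    using cv_definite right_mult_one_mat[OF ext_module_carrier[of k m]] left_mult_one_mat[OF ext_module_carrier[of k m]]
    by (auto simp: hform_def)
qed

lemma prod_diagram: "length kap = k \<Longrightarrow> (\<Prod>p\<in>diagram kap. f (fst p)) = (\<Prod>i<k. f i ^ (kap ! i))"
proof -
  assume "length kap = k"
  then have "diagram kap = Sigma {..<k} (\<lambda>i. {..<kap ! i})" by (auto simp: diagram_def)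
  then have "(\<Prod>p\<in>diagram kap. f (fst p)) = (\<Prod>i<k. \<Prod>j<kap ! i. f i)"
    using prod.Sigma[of "{..<k}" "\<lambda>i. {..<kap ! i}" "\<lambda>i j. f i"] by (simp add: split_def)
  then show ?thesis by simp
qed

lemma ac_upper_weight:
  assumes kap: "kap \<in> box_partitions k m" and g: "g \<in> carrier_mat k k" "upper_triangular g"
  shows "ac k m (mf g) idm (bas (diagram kap)) = (\<lambda>B. wt k kap g * bas (diagram kap) B)"
proof -
  have l: "length kap = k" using kap by (simp add: box_partitions_def partitions_def)
  have "ac k m (mf g) idm (bas (diagram kap)) =
    (\<lambda>B. (\<Prod>p\<in>diagram kap. mf g (fst p) (fst p) * idm (snd p) (snd p)) * bas (diagram kap) B)"
    by (rule ac_upper_diagram[OF kap]) (use g in \<open>auto simp: mf_def idm_def upper_triangular_def\<close>)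
  also have "(\<Prod>p\<in>diagram kap. mf g (fst p) (fst p) * idm (snd p) (snd p)) = wt k kap g"
    using prod_diagram[OF l, of "\<lambda>i. g $$ (i, i)"] by (simp add: wt_def mf_def idm_def)
  finally show ?thesis .
qed

lemma wt_one: "(\<forall>i<k. g $$ (i, i) = 1) \<Longrightarrow> wt k kap g = 1"
  by (simp add: wt_def)

lemma ext_module_hwv:
  assumes kap: "kap \<in> box_partitions k m"
  shows "hwv k (ext_module k m) kap (vec_of k m (bas (diagram kap)))" "vec_of k m (bas (diagram kap)) \<noteq> 0\<^sub>v (length (box_sets k m))"
proof -
  have f: "bas (diagram kap) \<in> forms (bx k m)" using diagram_bx[OF kap] by (rule bas_forms)
  have w: "snd (ext_module k m) g *\<^sub>v vec_of k m (bas (diagram kap)) = wt k kap g \<cdot>\<^sub>v vec_of k m (bas (diagram kap))"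
    if "g \<in> carrier (GL k)" "upper_triangular g" for g
    unfolding ext_module_apply[OF f] ac_upper_weight[OF kap GL_carrier[OF that(1)] that(2)] by (auto simp: vec_of_def)
  have "upper_triangular t" if "t \<in> carrier (GL k)" "diagonal_mat t" for t
    using that GL_carrier[OF that(1)] by (auto simp: diagonal_mat_def upper_triangular_def)
  then show "hwv k (ext_module k m) kap (vec_of k m (bas (diagram kap)))"
    using w wt_one[of k _ kap] by (simp add: hwv_def)
  show "vec_of k m (bas (diagram kap)) \<noteq> 0\<^sub>v (length (box_sets k m))"
  proof
    assume "vec_of k m (bas (diagram kap)) = 0\<^sub>v (length (box_sets k m))"
    then have "bas (diagram kap) = form_of k m (0\<^sub>v (length (box_sets k m)))" using form_vec_of[OF f] by simp
    then have "bas (diagram kap) (diagram kap) = (0::complex)" by (simp add: form_of_def)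
    then show False by (simp add: bas_def)
  qed
qed

lemma schur_ok_partitions:
  assumes "kap \<in> partitions k"
  shows "schur_ok k kap"
proof -
  \<comment> \<open>The number of columns is free here, and \<open>sum_list kap\<close> bounds every
    row.\<close>
  have "kap \<in> box_partitions k (sum_list kap)" using assms by (auto simp: box_partitions_def intro: member_le_sum_list)
  then show ?thesis
    using schur_okI[OF ext_module_polynomial ext_module_hform] ext_module_hwv by fastforce
qed

text \<open>The forms \<open>f i\<close> span a copy of the Schur module inside the exterior algebra, and \<open>v\<close> holds the
  coordinates of its highest weight vector \<open>v\<^sub>\<lambda>\<close>.\<close>

definition realizes :: "nat \<Rightarrow> nat \<Rightarrow> nat list \<Rightarrow> (nat \<Rightarrow> (nat \<times> nat) set \<Rightarrow> complex) \<Rightarrow> complex vec \<Rightarrow> bool" where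
  "realizes k m kap f v \<longleftrightarrow> (\<forall>i. f i \<in> forms (bx k m)) \<and>
    (\<forall>g\<in>carrier (GL k). \<forall>i<schur_dim k kap.
       ac k m (mf g) idm (f i) = (\<lambda>C. \<Sum>l<schur_dim k kap. schur_rep k kap g $$ (l, i) * f l C)) \<and>
    v \<in> carrier_vec (schur_dim k kap) \<and> v \<noteq> 0\<^sub>v (schur_dim k kap) \<and>
    bas (diagram kap) = (\<lambda>C. \<Sum>l<schur_dim k kap. v $ l * f l C) \<and>
    (\<forall>c. (\<forall>C. (\<Sum>l<schur_dim k kap. c l * f l C) = 0) \<longrightarrow> (\<forall>l<schur_dim k kap. c l = 0))"

text \<open>\<open>simple_intertwiner\<close> embeds the Schur module into the exterior algebra by a
  matrix \<open>J\<close>, and \<open>f i\<close> is the form with column \<open>i\<close> of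
  \<open>J\<close> as its coordinates. Independence of the forms is injectivity of
  \<open>J\<close>.\<close>

lemma schur_realization:
  assumes kap: "kap \<in> box_partitions k m"
  shows "\<exists>f v. realizes k m kap f v"
proof -
  let ?S = "schur_module k kap" and ?N = "length (box_sets k m)" and ?E = "ext_module k m"
  have ok: "schur_ok k kap" using kap by (intro schur_ok_partitions) (simp add: box_partitions_def)
  then have S: "polynomial_module k ?S" "simple_module k ?S" by (auto simp: schur_ok_def)
  obtain v where v: "hwv k ?S kap v" "v \<noteq> 0\<^sub>v (fst ?S)" using schur_hw[OF ok] by metis
  have vc: "v \<in> carrier_vec (fst ?S)" using v by (simp add: hwv_def)
  obtain J where J: "J \<in> carrier_mat ?N (fst ?S)" "\<And>g. g \<in> carrier (GL k) \<Longrightarrow> snd ?E g * J = J * snd ?S g"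
    "J *\<^sub>v v = vec_of k m (bas (diagram kap))" "\<And>x. x \<in> carrier_vec (fst ?S) \<Longrightarrow> J *\<^sub>v x = 0\<^sub>v ?N \<Longrightarrow> x = 0\<^sub>v (fst ?S)"
    using simple_intertwiner[OF S v ext_module_polynomial ext_module_hform ext_module_hwv(1)[OF kap]]
    unfolding fst_ext_module using ext_module_hwv(2)[OF kap] by blast
  define f where "f = (\<lambda>i. form_of k m (vec ?N (\<lambda>a. J $$ (a, i))))"
  have lin: "form_of k m (J *\<^sub>v x) = (\<lambda>C. \<Sum>l<fst ?S. x $ l * f l C)" if x: "x \<in> carrier_vec (fst ?S)" for x
  proof
    fix C
    have "form_of k m (J *\<^sub>v x) C = (\<Sum>i<?N. \<Sum>l<fst ?S. x $ l * (J $$ (i, l) * bas (box_sets k m ! i) C))"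
      unfolding form_of_def
    proof (intro sum.cong refl)
      fix i assume "i \<in> {..<?N}"
      then have i: "i < ?N" by simp
      show "(J *\<^sub>v x) $ i * bas (box_sets k m ! i) C = (\<Sum>l<fst ?S. x $ l * (J $$ (i, l) * bas (box_sets k m ! i) C))"
        unfolding mv_index[OF J(1) x i] sum_distrib_right by (intro sum.cong refl) simp
    qed
    also have "\<dots> = (\<Sum>l<fst ?S. x $ l * f l C)"
      by (subst sum.swap) (simp add: f_def form_of_def sum_distrib_left)
    finally show "form_of k m (J *\<^sub>v x) C = (\<Sum>l<fst ?S. x $ l * f l C)" .
  qed
  have fi: "f i = form_of k m (J *\<^sub>v unit_vec (fst ?S) i)" if "i < fst ?S" for i
    unfolding lin[OF unit_vec_carrier] using that by (auto simp: fun_eq_iff unit_vec_def sum_pick)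
  have act: "ac k m (mf g) idm (f i) = (\<lambda>C. \<Sum>l<fst ?S. snd ?S g $$ (l, i) * f l C)" if g: "g \<in> carrier (GL k)" and i: "i < fst ?S" for g i
  proof -
    note c = pm_carrier[OF S(1) g] pm_carrier[OF ext_module_polynomial g, of m, unfolded fst_ext_module]
    have "ac k m (mf g) idm (f i) = form_of k m (snd ?E g *\<^sub>v (J *\<^sub>v unit_vec (fst ?S) i))"
      unfolding fi[OF i] using form_of_ext_module[OF mult_mat_vec_carrier[OF J(1) unit_vec_carrier]] by simp
    also have "snd ?E g *\<^sub>v (J *\<^sub>v unit_vec (fst ?S) i) = J *\<^sub>v (snd ?S g *\<^sub>v unit_vec (fst ?S) i)"
      using assoc_mult_mat_vec[OF c(2) J(1) unit_vec_carrier, of i] assoc_mult_mat_vec[OF J(1) c(1) unit_vec_carrier, of i] J(2)[OF g] by simp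
    also have "form_of k m \<dots> = (\<lambda>C. \<Sum>l<fst ?S. (snd ?S g *\<^sub>v unit_vec (fst ?S) i) $ l * f l C)"
      by (rule lin[OF mult_mat_vec_carrier[OF c(1) unit_vec_carrier]])
    also have "\<dots> = (\<lambda>C. \<Sum>l<fst ?S. snd ?S g $$ (l, i) * f l C)"
      using c(1) i by (intro ext sum.cong refl) (auto simp: scalar_prod_right_unit)
    finally show ?thesis .
  qed
  have top: "bas (diagram kap) = (\<lambda>C. \<Sum>l<fst ?S. v $ l * f l C)"
    using lin[OF vc] form_vec_of[OF bas_forms[OF diagram_bx[OF kap]]] unfolding J(3) by simp
  have indep: "c l = 0" if c: "\<And>C. (\<Sum>l<fst ?S. c l * f l C) = 0" and l: "l < fst ?S" for c l
  proof -
    let ?x = "vec (fst ?S) c"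
    have xc: "?x \<in> carrier_vec (fst ?S)" by simp
    have Jx: "J *\<^sub>v ?x \<in> carrier_vec ?N" using J(1) xc by (rule mult_mat_vec_carrier)
    have "form_of k m (J *\<^sub>v ?x) = (\<lambda>C. 0)" unfolding lin[OF xc] using c by simp
    then have "J *\<^sub>v ?x = vec_of k m (\<lambda>C. 0)" using vec_form_of[OF Jx] by metis
    then have "J *\<^sub>v ?x = 0\<^sub>v ?N" by (auto simp: vec_of_def)
    then have "?x $ l = 0" using J(4)[OF xc] l by simp
    then show ?thesis using l by simp
  qed
  have ff: "f i \<in> forms (bx k m)" for i by (simp add: f_def)
  have "realizes k m kap f v" unfolding realizes_def
    by (intro conjI allI ballI impI ff act vc v(2) top) (use indep in blast)+
  then show ?thesis by blast
qed

subsection \<open>Tensor products\<close>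

lemma sum_div_mod: "(\<Sum>n<a * b. f (n div b) (n mod b)) = (\<Sum>i<a. \<Sum>j<(b::nat). f i j)"
proof -
  have "(\<Sum>n<a * b. f (n div b) (n mod b)) = (\<Sum>i<a. sum (\<lambda>n. f (n div b) (n mod b)) {i * b..<i * b + b})"
    by (rule sum.nat_group[symmetric])
  also have "\<dots> = (\<Sum>i<a. \<Sum>j<b. f i j)"
  proof (rule sum.cong[OF refl])
    fix i
    have "sum (\<lambda>n. f (n div b) (n mod b)) {0 + i * b..<b + i * b} = (\<Sum>j\<in>{0..<b}. f ((j + i * b) div b) ((j + i * b) mod b))"
      by (rule sum.shift_bounds_nat_ivl)
    also have "\<dots> = (\<Sum>j<b. f i j)" by (intro sum.cong) (auto simp: lessThan_atLeast0)
    finally show "sum (\<lambda>n. f (n div b) (n mod b)) {i * b..<i * b + b} = (\<Sum>j<b. f i j)" by (simp add: add.commute)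
  qed
  finally show ?thesis .
qed

lemma div_mod_less: "n < a * b \<Longrightarrow> n div b < a \<and> n mod b < (b::nat)"
  by (cases "b = 0") (auto simp: less_mult_imp_div_less)

lemma kronecker_carrier: "A \<in> carrier_mat a a' \<Longrightarrow> B \<in> carrier_mat b b' \<Longrightarrow> kronecker A B \<in> carrier_mat (a * b) (a' * b')"
  by (auto simp: kronecker_def)

lemma kronecker_index: "A \<in> carrier_mat a a' \<Longrightarrow> B \<in> carrier_mat b b' \<Longrightarrow> n < a * b \<Longrightarrow> n' < a' * b' \<Longrightarrow>
    kronecker A B $$ (n, n') = A $$ (n div b, n' div b') * B $$ (n mod b, n' mod b')"
  by (auto simp: kronecker_def)

lemma kronecker_mult:
  assumes A: "A \<in> carrier_mat a a'" and B: "B \<in> carrier_mat b b'" and C: "C \<in> carrier_mat a' a''" and D: "D \<in> carrier_mat b' b''"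
  shows "kronecker A B * kronecker C D = kronecker (A * C) (B * D)"
proof (rule eq_matI)
  note c = kronecker_carrier[OF A B] kronecker_carrier[OF C D] mult_carrier_mat[OF A C] mult_carrier_mat[OF B D]
  note k = kronecker_carrier[OF c(3,4)]
  show "dim_row (kronecker A B * kronecker C D) = dim_row (kronecker (A * C) (B * D))"
    "dim_col (kronecker A B * kronecker C D) = dim_col (kronecker (A * C) (B * D))" using c(1,2) k by auto
  fix n n' assume "n < dim_row (kronecker (A * C) (B * D))" "n' < dim_col (kronecker (A * C) (B * D))"
  then have n: "n < a * b" "n' < a'' * b''" using k by auto
  note dm = div_mod_less[OF n(1)] div_mod_less[OF n(2)]
  have "(kronecker A B * kronecker C D) $$ (n, n') =
    (\<Sum>l<a' * b'. (A $$ (n div b, l div b') * C $$ (l div b', n' div b'')) * (B $$ (n mod b, l mod b') * D $$ (l mod b', n' mod b'')))"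
    unfolding mm_index[OF c(1,2) n] by (intro sum.cong refl) (simp add: kronecker_index[OF A B] kronecker_index[OF C D] n)
  also have "\<dots> = (\<Sum>i<a'. \<Sum>j<b'. (A $$ (n div b, i) * C $$ (i, n' div b'')) * (B $$ (n mod b, j) * D $$ (j, n' mod b'')))"
    by (rule sum_div_mod)
  also have "\<dots> = (A * C) $$ (n div b, n' div b'') * (B * D) $$ (n mod b, n' mod b'')"
    using dm by (simp add: mm_index[OF A C] mm_index[OF B D] sum_product del: index_mult_mat)
  also have "\<dots> = kronecker (A * C) (B * D) $$ (n, n')"
    by (rule kronecker_index[OF c(3,4) n, symmetric])
  finally show "(kronecker A B * kronecker C D) $$ (n, n') = kronecker (A * C) (B * D) $$ (n, n')" .
qed

lemma kronecker_one: "kronecker (1\<^sub>m a) (1\<^sub>m b) = 1\<^sub>m (a * b)"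
proof (rule eq_matI)
  fix n n' assume "n < dim_row (1\<^sub>m (a * b))" "n' < dim_col (1\<^sub>m (a * b))"
  then have n: "n < a * b" "n' < a * b" by auto
  have "n = n'" if "n div b = n' div b" "n mod b = n' mod b" using that by (metis div_mult_mod_eq)
  then show "kronecker (1\<^sub>m a) (1\<^sub>m b) $$ (n, n') = 1\<^sub>m (a * b) $$ (n, n')"
    unfolding kronecker_index[OF one_carrier_mat one_carrier_mat n] using div_mod_less[OF n(1)] div_mod_less[OF n(2)] n by auto
qed (auto simp: kronecker_def)

lemma adj_kronecker: "adj (kronecker A B) = kronecker (adj A) (adj B)"
proof (rule eq_matI)
  fix i j assume "i < dim_row (kronecker (adj A) (adj B))" "j < dim_col (kronecker (adj A) (adj B))"
  then have ij: "i < dim_col A * dim_col B" "j < dim_row A * dim_row B" by (auto simp: kronecker_def adj_def)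
  then show "adj (kronecker A B) $$ (i, j) = kronecker (adj A) (adj B) $$ (i, j)"
    using div_mod_less[OF ij(1)] div_mod_less[OF ij(2)] by (simp add: adj_def kronecker_def)
qed (auto simp: adj_def kronecker_def)

section \<open>Gram matrices and invariant forms on tensor products\<close>

lemma gram_definite:
  assumes J: "inj_mat J n r" and x: "x \<in> carrier_vec r" "cv x \<bullet> ((adj J * J) *\<^sub>v x) = 0"
  shows "x = 0\<^sub>v r"
proof -
  have Jc: "J \<in> carrier_mat n r" using J by (simp add: inj_mat_def)
  have Jx: "J *\<^sub>v x \<in> carrier_vec n" using Jc x(1) by (rule mult_mat_vec_carrier)
  have "cv (J *\<^sub>v x) \<bullet> (J *\<^sub>v x) = cv x \<bullet> (adj J *\<^sub>v (J *\<^sub>v x))" by (rule cv_mult[OF Jc x(1) Jx])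
  also have "\<dots> = 0" using x assoc_mult_mat_vec[OF adj_carrier[OF Jc] Jc x(1)] by simp
  finally show ?thesis using cv_definite[OF Jx] J x(1) by (simp add: inj_mat_def)
qed

text \<open>The Gram matrix \<open>adj J * J\<close> is invertible by \<open>gram_definite\<close>,
  and its inverse times \<open>adj J\<close> is a left inverse.\<close>

lemma inj_left_inverse:
  assumes J: "inj_mat J n r"
  obtains L where "L \<in> carrier_mat r n" "L * J = 1\<^sub>m r"
proof -
  have Jc: "J \<in> carrier_mat n r" using J by (simp add: inj_mat_def)
  note aJ = adj_carrier[OF Jc]
  have "x = 0\<^sub>v r" if x: "x \<in> carrier_vec r" "(adj J * J) *\<^sub>v x = 0\<^sub>v r" for x
    by (rule gram_definite[OF J x(1)]) (use x in simp)
  then have "inj_mat (adj J * J) r r" using mult_carrier_mat[OF aJ Jc] by (simp add: inj_mat_def)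
  then obtain K where K: "K \<in> carrier_mat r r" "K * (adj J * J) = 1\<^sub>m r" by (rule inj_square_inverse)
  show ?thesis
    by (rule that[OF mult_carrier_mat[OF K(1) aJ]]) (use K(2) assoc_mult_mat[OF K(1) aJ Jc] in simp)
qed

lemma left_inverse_inj:
  assumes "J \<in> carrier_mat n r" "L \<in> carrier_mat r n" "L * J = 1\<^sub>m r"
  shows "inj_mat J n r"
proof -
  have "x = 0\<^sub>v r" if x: "x \<in> carrier_vec r" "J *\<^sub>v x = 0\<^sub>v n" for x
  proof -
    have "x = L *\<^sub>v (J *\<^sub>v x)" using assoc_mult_mat_vec[OF assms(2,1) x(1)] assms(3) x(1) by simp
    then show ?thesis unfolding x(2) mult_mat_zero_vec[OF assms(2)] .
  qed
  then show ?thesis using assms(1) by (simp add: inj_mat_def)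
qed

text \<open>Left inverses of the factors combine to a left inverse of the Kronecker product.\<close>

lemma kronecker_inj:
  assumes A: "inj_mat A n a" and B: "inj_mat B m b"
  shows "inj_mat (kronecker A B) (n * m) (a * b)"
proof -
  have c: "A \<in> carrier_mat n a" "B \<in> carrier_mat m b" using A B by (auto simp: inj_mat_def)
  obtain L K where L: "L \<in> carrier_mat a n" "L * A = 1\<^sub>m a" and K: "K \<in> carrier_mat b m" "K * B = 1\<^sub>m b"
    using inj_left_inverse[OF A] inj_left_inverse[OF B] by metis
  have "kronecker L K * kronecker A B = 1\<^sub>m (a * b)"
    unfolding kronecker_mult[OF L(1) K(1) c] L(2) K(2) by (rule kronecker_one)
  then show ?thesis using left_inverse_inj kronecker_carrier[OF c] kronecker_carrier[OF L(1) K(1)] by blast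
qed

text \<open>\<open>adj J * J\<close> is the standard hermitian product of the ambient space
  restricted to the image of \<open>J\<close>.\<close>

lemma hform_pullback:
  assumes e: "\<And>g. g \<in> carrier (GL k) \<Longrightarrow> e g \<in> carrier_mat n n" "\<And>g. g \<in> carrier (GL k) \<Longrightarrow> adj (e g) = e (adj g)"
    and J: "inj_mat J n (fst M)" and M: "polynomial_module k M"
    and int: "\<And>g. g \<in> carrier (GL k) \<Longrightarrow> e g * J = J * snd M g"
  shows "hform k M (adj J * J)"
proof -
  have Jc: "J \<in> carrier_mat n (fst M)" using J by (simp add: inj_mat_def)
  note aJ = adj_carrier[OF Jc]
  note gram_definite[OF J]
  moreover have "adj (snd M g) * (adj J * J) = adj J * J * snd M (adj g)" if g: "g \<in> carrier (GL k)" for g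
  proof -
    note c = pm_carrier[OF M g] pm_carrier[OF M adj_GL[OF g]] e(1)[OF g] e(1)[OF adj_GL[OF g]]
    have "adj (snd M g) * (adj J * J) = adj (snd M g) * adj J * J"
      by (rule assoc_mult_mat[OF adj_carrier[OF c(1)] aJ Jc, symmetric])
    also have "adj (snd M g) * adj J = adj J * e (adj g)"
      unfolding adj_mult[OF Jc c(1), symmetric] int[OF g, symmetric] adj_mult[OF c(3) Jc] e(2)[OF g] ..
    also have "\<dots> * J = adj J * (e (adj g) * J)" by (rule assoc_mult_mat[OF aJ c(4) Jc])
    also have "\<dots> = adj J * J * snd M (adj g)"
      unfolding int[OF adj_GL[OF g]] by (rule assoc_mult_mat[OF aJ Jc c(2), symmetric])
    finally show ?thesis .
  qed
  ultimately show ?thesis using mult_carrier_mat[OF aJ Jc] by (auto simp: hform_def)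
qed

lemma tensor_simps [simp]: "fst (module_tensor M N) = fst M * fst N" "snd (module_tensor M N) g = kronecker (snd M g) (snd N g)"
  by (simp_all add: module_tensor_def)

lemma tensor_polynomial_module:
  assumes M: "polynomial_module k M" and N: "polynomial_module k N"
  shows "polynomial_module k (module_tensor M N)"
proof (rule polynomial_moduleI)
  fix i j assume ij: "i < fst (module_tensor M N)" "j < fst (module_tensor M N)"
  then have ij': "i < fst M * fst N" "j < fst M * fst N" by auto
  note d = div_mod_less[OF ij'(1)] div_mod_less[OF ij'(2)]
  obtain p where p: "p \<in> polynomial_functions k" "\<forall>g\<in>carrier (GL k). snd M g $$ (i div fst N, j div fst N) = p g"
    by (rule bexE[OF pm_entry[OF M conjunct1[OF d(1)] conjunct1[OF d(2)]]])
  obtain q where q: "q \<in> polynomial_functions k" "\<forall>g\<in>carrier (GL k). snd N g $$ (i mod fst N, j mod fst N) = q g"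
    by (rule bexE[OF pm_entry[OF N conjunct2[OF d(1)] conjunct2[OF d(2)]]])
  have "snd (module_tensor M N) g $$ (i, j) = p g * q g" if g: "g \<in> carrier (GL k)" for g
    using kronecker_index[OF pm_carrier[OF M g] pm_carrier[OF N g] ij'] p q g by simp
  then show "\<exists>p\<in>polynomial_functions k. \<forall>g\<in>carrier (GL k). snd (module_tensor M N) g $$ (i, j) = p g"
    by (intro bexI[OF _ polynomial_functions.mult[OF p(1) q(1)]] ballI)
next
  fix g h assume g: "g \<in> carrier (GL k)" and h: "h \<in> carrier (GL k)"
  note c = pm_carrier[OF M g] pm_carrier[OF N g] pm_carrier[OF M h] pm_carrier[OF N h]
  show "snd (module_tensor M N) (g * h) = snd (module_tensor M N) g * snd (module_tensor M N) h"
    unfolding tensor_simps pm_mult[OF M g h] pm_mult[OF N g h] by (rule kronecker_mult[OF c, symmetric])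
next
  show "snd (module_tensor M N) g \<in> carrier_mat (fst (module_tensor M N)) (fst (module_tensor M N))" if "g \<in> carrier (GL k)" for g
    unfolding tensor_simps by (rule kronecker_carrier[OF pm_carrier[OF M that] pm_carrier[OF N that]])
  show "snd (module_tensor M N) (1\<^sub>m k) = 1\<^sub>m (fst (module_tensor M N))"
    unfolding tensor_simps pm_one[OF M] pm_one[OF N] by (rule kronecker_one)
qed

lemma schur_embedding:
  assumes kap: "kap \<in> box_partitions k m"
  shows "\<exists>J. inj_mat J (length (box_sets k m)) (schur_dim k kap) \<and>
    (\<forall>g\<in>carrier (GL k). snd (ext_module k m) g * J = J * schur_rep k kap g)"
proof -
  let ?S = "schur_module k kap"
  have ok: "schur_ok k kap" using kap by (intro schur_ok_partitions) (simp add: box_partitions_def)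
  then have S: "polynomial_module k ?S" "simple_module k ?S" by (auto simp: schur_ok_def)
  obtain v where v: "hwv k ?S kap v" "v \<noteq> 0\<^sub>v (fst ?S)" using schur_hw[OF ok] by metis
  show ?thesis
    using simple_intertwiner[OF S v ext_module_polynomial ext_module_hform ext_module_hwv(1)[OF kap]]
    unfolding fst_ext_module inj_mat_def using ext_module_hwv(2)[OF kap] by blast
qed

text \<open>Multiplying arbitrary forms of the two factors could create isotropic vectors. Instead
  both factors are embedded into the exterior algebra, and the form is restricted from its tensor
  square, where the standard hermitian product is definite.\<close>

lemma schur_tensor_hform:
  assumes lam: "lam \<in> box_partitions k m" and mu: "mu \<in> box_partitions k m"
  shows "polynomial_module k (module_tensor (schur_module k lam) (schur_module k mu))"
    "\<exists>H. hform k (module_tensor (schur_module k lam) (schur_module k mu)) H"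
proof -
  let ?L = "schur_module k lam" and ?M = "schur_module k mu" and ?N = "length (box_sets k m)" and ?E = "ext_module k m"
  have "schur_ok k lam" "schur_ok k mu" using lam mu by (auto intro: schur_ok_partitions simp: box_partitions_def)
  then have LM: "polynomial_module k ?L" "polynomial_module k ?M" by (auto simp: schur_ok_def)
  show T: "polynomial_module k (module_tensor ?L ?M)" by (rule tensor_polynomial_module[OF LM])
  obtain J J' where J: "inj_mat J ?N (fst ?L)" "\<And>g. g \<in> carrier (GL k) \<Longrightarrow> snd ?E g * J = J * snd ?L g"
    and J': "inj_mat J' ?N (fst ?M)" "\<And>g. g \<in> carrier (GL k) \<Longrightarrow> snd ?E g * J' = J' * snd ?M g"
    using schur_embedding[OF lam] schur_embedding[OF mu] by metis
  have c: "J \<in> carrier_mat ?N (fst ?L)" "J' \<in> carrier_mat ?N (fst ?M)" using J(1) J'(1) by (auto simp: inj_mat_def)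
  have aE: "adj (snd ?E g) = snd ?E (adj g)" if "g \<in> carrier (GL k)" for g
    using ext_module_hform[of k m] that right_mult_one_mat[OF adj_carrier[OF ext_module_carrier[of k m g]]]
      left_mult_one_mat[OF ext_module_carrier[of k m "adj g"]] by (simp add: hform_def)
  have "hform k (module_tensor ?L ?M) (adj (kronecker J J') * kronecker J J')"
  proof (rule hform_pullback[where e = "\<lambda>g. kronecker (snd ?E g) (snd ?E g)" and n = "?N * ?N"])
    show "inj_mat (kronecker J J') (?N * ?N) (fst (module_tensor ?L ?M))"
      unfolding tensor_simps by (rule kronecker_inj[OF J(1) J'(1)])
    show "kronecker (snd ?E g) (snd ?E g) \<in> carrier_mat (?N * ?N) (?N * ?N)" for g
      by (rule kronecker_carrier[OF ext_module_carrier ext_module_carrier])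
    show "adj (kronecker (snd ?E g) (snd ?E g)) = kronecker (snd ?E (adj g)) (snd ?E (adj g))" if "g \<in> carrier (GL k)" for g
      unfolding adj_kronecker aE[OF that] ..
    show "kronecker (snd ?E g) (snd ?E g) * kronecker J J' = kronecker J J' * snd (module_tensor ?L ?M) g" if g: "g \<in> carrier (GL k)" for g
      unfolding tensor_simps kronecker_mult[OF ext_module_carrier ext_module_carrier c] J(2)[OF g] J'(2)[OF g]
      by (rule kronecker_mult[OF c pm_carrier[OF LM(1) g] pm_carrier[OF LM(2) g], symmetric])
  qed (rule T)
  then show "\<exists>H. hform k (module_tensor ?L ?M) H" by blast
qed

section \<open>Uniqueness of multiplicities\<close>

lemma module_iso_inverse:
  assumes iso: "module_iso k M N" and M: "\<And>g. g \<in> carrier (GL k) \<Longrightarrow> snd M g \<in> carrier_mat (fst M) (fst M)"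
    and N: "\<And>g. g \<in> carrier (GL k) \<Longrightarrow> snd N g \<in> carrier_mat (fst N) (fst N)"
  shows "fst N = fst M" "\<exists>T\<in>carrier_mat (fst M) (fst M). \<exists>B\<in>carrier_mat (fst M) (fst M). T * B = 1\<^sub>m (fst M) \<and> B * T = 1\<^sub>m (fst M) \<and>
    (\<forall>g\<in>carrier (GL k). T * snd M g = snd N g * T) \<and> (\<forall>g\<in>carrier (GL k). B * snd N g = snd M g * B)"
proof -
  let ?n = "fst M"
  show n: "fst N = ?n" using iso by (simp add: module_iso_def)
  obtain T where T: "T \<in> carrier (GL ?n)" "\<And>g. g \<in> carrier (GL k) \<Longrightarrow> T * snd M g = snd N g * T" using iso by (auto simp: module_iso_def)
  obtain B where B: "B \<in> carrier_mat ?n ?n" "B * T = 1\<^sub>m ?n" "T * B = 1\<^sub>m ?n" using T(1) by (auto simp: GL_iff)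
  note Tc = GL_carrier[OF T(1)]
  have "B * snd N g = snd M g * B" if g: "g \<in> carrier (GL k)" for g
    by (rule inverse_intertwines[OF Tc B(1,3,2) M[OF g] N[OF g, unfolded n] T(2)[OF g]])
  then show "\<exists>T\<in>carrier_mat ?n ?n. \<exists>B\<in>carrier_mat ?n ?n. T * B = 1\<^sub>m ?n \<and> B * T = 1\<^sub>m ?n \<and>
    (\<forall>g\<in>carrier (GL k). T * snd M g = snd N g * T) \<and> (\<forall>g\<in>carrier (GL k). B * snd N g = snd M g * B)"
    using Tc B T(2) by blast
qed

text \<open>Justifies the definite description: two decompositions are isomorphic to each other
  through the tensor product, and \<open>schur_sum_count_le\<close> in both directions shows that
  their multiplicities agree.\<close>

lemma littlewood_richardson_count:
  assumes lam: "lam \<in> box_partitions k m" and mu: "mu \<in> box_partitions k m" and nu: "nu \<in> partitions k"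
    and nus: "set nus \<subseteq> partitions k" and iso: "module_iso k (module_tensor (schur_module k lam) (schur_module k mu)) (schur_sum k nus)"
  shows "littlewood_richardson k lam mu nu = count_list nus nu"
proof -
  let ?T = "module_tensor (schur_module k lam) (schur_module k mu)"
  have T: "snd ?T g \<in> carrier_mat (fst ?T) (fst ?T)" if "g \<in> carrier (GL k)" for g
    using pm_carrier[OF schur_tensor_hform(1)[OF lam mu] that] .
  have l: "length nu = k" using nu by (simp add: partitions_def)
  have ok: "\<forall>kap\<in>set nus. schur_ok k kap \<and> length kap = k" if "set nus \<subseteq> partitions k" for nus
    using that schur_ok_partitions by (auto simp: partitions_def)
  have le: "count_list nus nu \<le> count_list nus' nu"
    if s: "set nus \<subseteq> partitions k" "set nus' \<subseteq> partitions k" and i: "module_iso k ?T (schur_sum k nus)" "module_iso k ?T (schur_sum k nus')" for nus nus'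
  proof -
    let ?n = "fst ?T" and ?R = "schur_sum k nus" and ?R' = "schur_sum k nus'"
    have okk: "\<forall>kap\<in>set nus. schur_ok k kap" "\<forall>kap\<in>set nus'. schur_ok k kap" using ok s by auto
    note c = schur_sum_carrier[OF okk(1)] schur_sum_carrier[OF okk(2)]
    have AB1: "fst ?R = ?n" by (rule module_iso_inverse(1)[OF i(1) T c(1)])
    have AB1': "fst ?R' = ?n" by (rule module_iso_inverse(1)[OF i(2) T c(2)])
    obtain A B where AB: "A \<in> carrier_mat ?n ?n" "B \<in> carrier_mat ?n ?n" "A * B = 1\<^sub>m ?n" "B * A = 1\<^sub>m ?n"
      "\<And>g. g \<in> carrier (GL k) \<Longrightarrow> B * snd ?R g = snd ?T g * B" using module_iso_inverse(2)[OF i(1) T c(1)] by blast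
    obtain A' B' where AB': "A' \<in> carrier_mat ?n ?n" "B' \<in> carrier_mat ?n ?n" "A' * B' = 1\<^sub>m ?n" "B' * A' = 1\<^sub>m ?n"
      "\<And>g. g \<in> carrier (GL k) \<Longrightarrow> A' * snd ?T g = snd ?R' g * A'" using module_iso_inverse(2)[OF i(2) T c(2)] by blast
    have A'B: "A' * B \<in> carrier_mat ?n ?n" "A * B' \<in> carrier_mat ?n ?n" using AB AB' by (auto intro: mult_carrier_mat)
    have "A * B' * (A' * B) = A * (B' * (A' * B))" by (rule assoc_mult_mat[OF AB(1) AB'(2) A'B(1)])
    also have "B' * (A' * B) = B' * A' * B" by (rule assoc_mult_mat[OF AB'(2,1) AB(2), symmetric])
    also have "\<dots> = B" unfolding AB'(4) by (rule left_mult_one_mat[OF AB(2)])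
    finally have "A * B' * (A' * B) = 1\<^sub>m ?n" unfolding AB(3) .
    then have inj: "inj_mat (A' * B) (fst ?R') (fst ?R)" unfolding AB1 AB1' using left_inverse_inj[OF A'B] by blast
    have "A' * B * snd ?R g = snd ?R' g * (A' * B)" if g: "g \<in> carrier (GL k)" for g
    proof -
      note d = T[OF g] c(1)[OF g, unfolded AB1] c(2)[OF g, unfolded AB1']
      have "A' * B * snd ?R g = A' * (snd ?T g * B)" unfolding AB(5)[OF g, symmetric] by (rule assoc_mult_mat[OF AB'(1) AB(2) d(2)])
      also have "\<dots> = A' * snd ?T g * B" by (rule assoc_mult_mat[OF AB'(1) d(1) AB(2), symmetric])
      also have "\<dots> = snd ?R' g * (A' * B)" unfolding AB'(5)[OF g] by (rule assoc_mult_mat[OF d(3) AB'(1) AB(2)])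
      finally show ?thesis .
    qed
    then show ?thesis by (rule schur_sum_count_le[OF ok[OF s(1)] ok[OF s(2)] l inj])
  qed
  show ?thesis unfolding littlewood_richardson_def schur_sum_def[symmetric]
  proof (rule the_equality)
    show "\<exists>nus'. set nus' \<subseteq> partitions k \<and> module_iso k ?T (schur_sum k nus') \<and> count_list nus nu = count_list nus' nu"
      using nus iso by blast
    show "c = count_list nus nu" if "\<exists>nus'. set nus' \<subseteq> partitions k \<and> module_iso k ?T (schur_sum k nus') \<and> c = count_list nus' nu" for c
      using that le nus iso by (meson le_antisym)
  qed
qed

lemma schur_tensor_decomposition:
  assumes lam: "lam \<in> box_partitions k m" and mu: "mu \<in> box_partitions k m"
  obtains nus where "set nus \<subseteq> partitions k" "module_iso k (module_tensor (schur_module k lam) (schur_module k mu)) (schur_sum k nus)"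
  using schur_tensor_hform[OF lam mu] decomposition by metis

section \<open>Wedge products as equivariant maps on the tensor product\<close>

definition bilinear_form :: "nat \<Rightarrow> nat \<Rightarrow> (nat \<Rightarrow> (nat \<times> nat) set \<Rightarrow> complex) \<Rightarrow> (nat \<Rightarrow> (nat \<times> nat) set \<Rightarrow> complex) \<Rightarrow>
    complex vec \<Rightarrow> (nat \<times> nat) set \<Rightarrow> complex" where
  "bilinear_form a b F F' z = (\<lambda>C. \<Sum>n<a * b. z $ n * wed (F (n div b)) (F' (n mod b)) C)"

text \<open>\<open>bilinear_form\<close> is the linear map that sends the tensor of basis vectors
  \<open>i\<close> and \<open>j\<close> to \<open>wed (F i) (F' j)\<close>, the pair being stored at
  \<open>i * b + j\<close> as in \<open>kronecker\<close>. It inherits equivariance from the wedge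
  product.\<close>

lemma bilinear_form_equivariant:
  assumes f: "\<And>i. F i \<in> forms (bx k m)" "\<And>i. F' i \<in> forms (bx k m)" and A: "A \<in> carrier_mat a a" and B: "B \<in> carrier_mat b b"
    and z: "z \<in> carrier_vec (a * b)"
    and gF: "\<And>i. i < a \<Longrightarrow> ac k m g idm (F i) = (\<lambda>C. \<Sum>l<a. A $$ (l, i) * F l C)"
    and gF': "\<And>i. i < b \<Longrightarrow> ac k m g idm (F' i) = (\<lambda>C. \<Sum>l<b. B $$ (l, i) * F' l C)"
  shows "ac k m g idm (bilinear_form a b F F' z) = bilinear_form a b F F' (kronecker A B *\<^sub>v z)"
proof
  fix C
  let ?w = "\<lambda>i j. wed (F i) (F' j) C"
  have "ac k m g idm (bilinear_form a b F F' z) C = (\<Sum>n<a * b. z $ n * ac k m g idm (wed (F (n div b)) (F' (n mod b))) C)"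
    by (simp add: bilinear_form_def ac_sum ac_scale)
  also have "\<dots> = (\<Sum>n<a * b. z $ n * (\<Sum>n'<a * b. A $$ (n' div b, n div b) * B $$ (n' mod b, n mod b) * ?w (n' div b) (n' mod b)))"
  proof (intro sum.cong refl arg_cong[of _ _ "(*) _"])
    fix n assume "n \<in> {..<a * b}"
    then have n: "n div b < a" "n mod b < b" using div_mod_less by auto
    have "ac k m g idm (wed (F (n div b)) (F' (n mod b))) C =
      (\<Sum>i<a. \<Sum>j<b. A $$ (i, n div b) * B $$ (j, n mod b) * ?w i j)"
      unfolding ac_wed[OF f] gF[OF n(1)] gF'[OF n(2)] wed_sum wed_scale wed_sumr wed_scaler
      by (simp add: sum_distrib_left mult.assoc)
    then show "ac k m g idm (wed (F (n div b)) (F' (n mod b))) C =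
      (\<Sum>n'<a * b. A $$ (n' div b, n div b) * B $$ (n' mod b, n mod b) * ?w (n' div b) (n' mod b))"
      unfolding sum_div_mod[of "\<lambda>i j. A $$ (i, n div b) * B $$ (j, n mod b) * ?w i j"] .
  qed
  also have "\<dots> = (\<Sum>n'<a * b. \<Sum>n<a * b. z $ n * (A $$ (n' div b, n div b) * B $$ (n' mod b, n mod b) * ?w (n' div b) (n' mod b)))"
    unfolding sum_distrib_left by (rule sum.swap)
  also have "\<dots> = bilinear_form a b F F' (kronecker A B *\<^sub>v z) C"
    unfolding bilinear_form_def
  proof (intro sum.cong refl)
    fix n' assume "n' \<in> {..<a * b}"
    then have n': "n' < a * b" by simp
    show "(\<Sum>n<a * b. z $ n * (A $$ (n' div b, n div b) * B $$ (n' mod b, n mod b) * ?w (n' div b) (n' mod b))) =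
      (kronecker A B *\<^sub>v z) $ n' * ?w (n' div b) (n' mod b)"
      unfolding mv_index[OF kronecker_carrier[OF A B] z n'] sum_distrib_right
      by (intro sum.cong refl) (simp add: kronecker_index[OF A B n'])
  qed
  finally show "ac k m g idm (bilinear_form a b F F' z) C = bilinear_form a b F F' (kronecker A B *\<^sub>v z) C" .
qed

lemma polyfun_GL_nonzero:
  assumes p: "p \<in> polynomial_functions k" and g: "g \<in> carrier_mat k k" "p g \<noteq> 0"
  shows "\<exists>l d u. l \<in> carrier (GL k) \<and> upper_triangular (l\<^sup>T) \<and> (\<forall>i<k. l $$ (i, i) = 1) \<and>
      d \<in> carrier (GL k) \<and> diagonal_mat d \<and> u \<in> carrier (GL k) \<and> upper_triangular u \<and> (\<forall>i<k. u $$ (i, i) = 1) \<and> p (l * d * u) \<noteq> 0"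
proof (rule ccontr)
  assume n: "\<not> ?thesis"
  have "p g = 0"
  proof (rule big_cell_dense[OF p _ g(1)])
    fix l d u :: "complex mat"
    assume l: "l \<in> carrier_mat k k" "upper_triangular (l\<^sup>T)" "\<forall>i<k. l $$ (i, i) = 1"
      and d: "d \<in> carrier_mat k k" "diagonal_mat d" "\<forall>i<k. d $$ (i, i) \<noteq> 0"
      and u: "u \<in> carrier_mat k k" "upper_triangular u" "\<forall>i<k. u $$ (i, i) = 1"
    have "l \<in> carrier (GL k)" by (rule GL_lower[OF l(1,2)]) (use l(3) in simp)
    moreover have "u \<in> carrier (GL k)" by (rule GL_upper[OF u(1,2)]) (use u(3) in simp)
    moreover have "d \<in> carrier (GL k)" by (rule GL_diagonal[OF d(2,1,3)])
    ultimately show "p (l * d * u) = 0" using n l d u by blast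
  qed
  then show False using g(2) by simp
qed

lemma wed_bilinear:
  "wed (\<lambda>C. \<Sum>i\<in>I. x i * F i C) (\<lambda>C. \<Sum>j\<in>J. y j * F' j C) D = (\<Sum>i\<in>I. \<Sum>j\<in>J. x i * y j * wed (F i) (F' j) D)"
  unfolding wed_sum wed_scale wed_sumr wed_scaler by (simp add: sum_distrib_left mult.assoc)

lemma realizesD:
  assumes "realizes k m kap f v"
  shows "f i \<in> forms (bx k m)"
    "g \<in> carrier (GL k) \<Longrightarrow> i < schur_dim k kap \<Longrightarrow>
       ac k m (mf g) idm (f i) = (\<lambda>C. \<Sum>l<schur_dim k kap. schur_rep k kap g $$ (l, i) * f l C)"
    "v \<in> carrier_vec (schur_dim k kap)" "v \<noteq> 0\<^sub>v (schur_dim k kap)"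
    "bas (diagram kap) = (\<lambda>C. \<Sum>l<schur_dim k kap. v $ l * f l C)"
    "(\<And>C. (\<Sum>l<schur_dim k kap. c l * f l C) = 0) \<Longrightarrow> l < schur_dim k kap \<Longrightarrow> c l = 0"
  using assms unfolding realizes_def by blast+

lemma realizes_orbit:
  assumes r: "realizes k m kap f v" and kap: "kap \<in> box_partitions k m" and g: "g \<in> carrier (GL k)"
  shows "ac k m (mf g) h (bas (diagram kap)) =
    (\<lambda>C. \<Sum>l<schur_dim k kap. (schur_rep k kap g *\<^sub>v v) $ l * ac k m idm h (f l) C)"
proof -
  let ?S = "schur_module k kap"
  have S: "polynomial_module k ?S" using schur_ok_partitions[of kap k] kap by (simp add: schur_ok_def box_partitions_def)
  have "ac k m (mf g) idm (bas (diagram kap)) = (\<lambda>C. \<Sum>i<fst ?S. \<Sum>l<fst ?S. snd ?S g $$ (l, i) * v $ i * f l C)"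
    unfolding realizesD(5)[OF r] ac_sum ac_scale by (simp add: realizesD(2)[OF r g] sum_distrib_left mult_ac)
  also have "\<dots> = (\<lambda>C. \<Sum>l<fst ?S. (snd ?S g *\<^sub>v v) $ l * f l C)"
  proof
    fix C
    have "(\<Sum>i<fst ?S. \<Sum>l<fst ?S. snd ?S g $$ (l, i) * v $ i * f l C) = (\<Sum>l<fst ?S. \<Sum>i<fst ?S. snd ?S g $$ (l, i) * v $ i * f l C)"
      by (rule sum.swap)
    also have "\<dots> = (\<Sum>l<fst ?S. (snd ?S g *\<^sub>v v) $ l * f l C)"
    proof (rule sum.cong[OF refl])
      fix l assume "l \<in> {..<fst ?S}"
      then have l: "l < fst ?S" by simp
      show "(\<Sum>i<fst ?S. snd ?S g $$ (l, i) * v $ i * f l C) = (snd ?S g *\<^sub>v v) $ l * f l C"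
        unfolding mv_index[OF pm_carrier[OF S g] realizesD(3)[OF r] l] sum_distrib_right ..
    qed
    finally show "(\<Sum>i<fst ?S. \<Sum>l<fst ?S. snd ?S g $$ (l, i) * v $ i * f l C) = (\<Sum>l<fst ?S. (snd ?S g *\<^sub>v v) $ l * f l C)" .
  qed
  finally show ?thesis by (subst ac_split(2)) (simp add: ac_sum ac_scale)
qed

lemma product_coeff_realization:
  assumes r: "realizes k m lam f v" "realizes k m mu f' v'" and lam: "lam \<in> box_partitions k m" and mu: "mu \<in> box_partitions k m"
    and g: "g \<in> carrier (GL k)" "g' \<in> carrier (GL k)"
  shows "product_coeff k m lam mu nu (mf g) h (mf g') h' =
    (\<Sum>i<schur_dim k lam. \<Sum>j<schur_dim k mu. (schur_rep k lam g *\<^sub>v v) $ i *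
      (schur_rep k mu g' *\<^sub>v v') $ j * wed (ac k m idm h (f i)) (ac k m idm h' (f' j)) (diagram nu))"
  unfolding product_coeff_def realizes_orbit[OF r(1) lam g(1)] realizes_orbit[OF r(2) mu g(2)] by (rule wed_bilinear)

lemma mf_mat: "i < k \<Longrightarrow> j < k \<Longrightarrow> mf (mat k k (\<lambda>(i, j). g i j)) i j = g i j"
  by (simp add: mf_def)

text \<open>The coefficient is polynomial in each of the two row matrices, so a nonzero value at
  arbitrary matrices can be moved into the group, one argument after the other.\<close>

lemma product_coeff_GL:
  assumes "product_coeff k m lam mu nu g h g' h' \<noteq> (0::complex)"
  shows "\<exists>x\<in>carrier (GL k). \<exists>x'\<in>carrier (GL k). product_coeff k m lam mu nu (mf x) h (mf x') h' \<noteq> 0"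
proof -
  let ?M = "\<lambda>g. mat k k (\<lambda>(i, j). g i j)"
  have e: "ac k m (mf (?M g)) h u = ac k m g h u" for g h and u :: "(nat \<times> nat) set \<Rightarrow> complex"
    by (rule ac_cong) (simp_all add: mf_mat)
  note fa = fun_algebra_polynomial_functions[of k]
  have p: "(\<lambda>x. product_coeff k m lam mu nu (mf x) h g' h') \<in> polynomial_functions k"
    "(\<lambda>x. product_coeff k m lam mu nu g h (mf x) h') \<in> polynomial_functions k" for g h g' h'
    unfolding product_coeff_def
    by (intro fun_algebra_wed[OF fa] fun_algebra_ac[OF fa] fun_algebra_const[OF fa]; simp add: mf_def polynomial_functions.intros)+
  have G: "\<exists>x\<in>carrier (GL k). q x \<noteq> 0" if "q \<in> polynomial_functions k" "q (?M y) \<noteq> 0" for q y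
  proof -
    have "?M y \<in> carrier_mat k k" by simp
    from polyfun_GL_nonzero[OF that(1) this that(2)] show ?thesis using GL_mult_closed by blast
  qed
  have "\<exists>x\<in>carrier (GL k). product_coeff k m lam mu nu (mf x) h g' h' \<noteq> 0"
    by (rule G[of "\<lambda>x. product_coeff k m lam mu nu (mf x) h g' h'" g])
      (use p assms in \<open>auto simp: product_coeff_def e\<close>)
  then obtain x where x: "x \<in> carrier (GL k)" "product_coeff k m lam mu nu (mf x) h g' h' \<noteq> 0" by blast
  have "\<exists>x'\<in>carrier (GL k). product_coeff k m lam mu nu (mf x) h (mf x') h' \<noteq> 0"
    by (rule G[of "\<lambda>x'. product_coeff k m lam mu nu (mf x) h (mf x') h'" g'])
      (use p x(2) in \<open>auto simp: product_coeff_def e\<close>)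
  then show ?thesis using x(1) by blast
qed

text \<open>In a simple module the orbit of a nonzero vector spans, so a functional with coordinates
  \<open>c\<close> that vanishes on the orbit is zero.\<close>

lemma sum_annihilator:
  assumes kap: "kap \<in> box_partitions k m" and v: "v \<in> carrier_vec (schur_dim k kap)" "v \<noteq> 0\<^sub>v (schur_dim k kap)"
    and z: "\<And>g. g \<in> carrier (GL k) \<Longrightarrow> (\<Sum>i<schur_dim k kap. c i * (schur_rep k kap g *\<^sub>v v) $ i) = 0"
    and i: "i < schur_dim k kap"
  shows "c i = 0"
proof (rule ccontr)
  let ?S = "schur_module k kap"
  assume nz: "c i \<noteq> 0"
  have S: "polynomial_module k ?S" "simple_module k ?S" using schur_ok_partitions[of kap k] kap by (auto simp: schur_ok_def box_partitions_def)
  let ?y = "vec (fst ?S) c"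
  have yc: "?y \<in> carrier_vec (fst ?S)" by simp
  have "?y $ i \<noteq> 0\<^sub>v (fst ?S) $ i" using nz i by simp
  then have y0: "?y \<noteq> 0\<^sub>v (fst ?S)" by metis
  have "?y \<bullet> (snd ?S g *\<^sub>v v) = 0" if g: "g \<in> carrier (GL k)" for g
  proof -
    have "?y \<bullet> (snd ?S g *\<^sub>v v) = (\<Sum>i<fst ?S. c i * (snd ?S g *\<^sub>v v) $ i)"
      unfolding sp_sum[OF pm_vec[OF S(1) g v(1)]] by (rule sum.cong) auto
    then show ?thesis using z[OF g] by simp
  qed
  from simple_annihilator[OF S yc y0 v(1) this] v(2) show False by blast
qed

text \<open>Eliminates the row matrices: the translates of a highest weight vector span the Schur
  module, so they may be replaced by the basis forms \<open>f i\<close> and \<open>f' j\<close>, and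
  only column operations remain.\<close>

lemma product_coeff_forms:
  assumes r: "realizes k m lam f v" "realizes k m mu f' v'" and lam: "lam \<in> box_partitions k m" and mu: "mu \<in> box_partitions k m"
  shows "(\<exists>g h g' h'. product_coeff k m lam mu nu g h g' h' \<noteq> (0::complex)) \<longleftrightarrow>
    (\<exists>h h'. \<exists>i<schur_dim k lam. \<exists>j<schur_dim k mu. wed (ac k m idm h (f i)) (ac k m idm h' (f' j)) (diagram nu) \<noteq> 0)"
proof
  assume "\<exists>g h g' h'. product_coeff k m lam mu nu g h g' h' \<noteq> (0::complex)"
  then obtain h h' x x' where x: "x \<in> carrier (GL k)" "x' \<in> carrier (GL k)" "product_coeff k m lam mu nu (mf x) h (mf x') h' \<noteq> 0"
    using product_coeff_GL by blast
  show "\<exists>h h'. \<exists>i<schur_dim k lam. \<exists>j<schur_dim k mu. wed (ac k m idm h (f i)) (ac k m idm h' (f' j)) (diagram nu) \<noteq> 0"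
  proof (rule ccontr)
    assume n: "\<not> ?thesis"
    have "wed (ac k m idm h (f i)) (ac k m idm h' (f' j)) (diagram nu) = 0"
      if "i < schur_dim k lam" "j < schur_dim k mu" for i j using n that by blast
    then have "product_coeff k m lam mu nu (mf x) h (mf x') h' = 0"
      unfolding product_coeff_realization[OF r lam mu x(1,2)] by (intro sum.neutral ballI) simp
    then show False using x(3) by simp
  qed
next
  assume "\<exists>h h'. \<exists>i<schur_dim k lam. \<exists>j<schur_dim k mu. wed (ac k m idm h (f i)) (ac k m idm h' (f' j)) (diagram nu) \<noteq> 0"
  then obtain h h' i j where ij: "i < schur_dim k lam" "j < schur_dim k mu"
    "wed (ac k m idm h (f i)) (ac k m idm h' (f' j)) (diagram nu) \<noteq> 0" by blast
  let ?w = "\<lambda>i j. wed (ac k m idm h (f i)) (ac k m idm h' (f' j)) (diagram nu)"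
  show "\<exists>g h g' h'. product_coeff k m lam mu nu g h g' h' \<noteq> (0::complex)"
  proof (rule ccontr)
    assume n: "\<not> ?thesis"
    have "(\<Sum>j<schur_dim k mu. ?w i j * (schur_rep k mu g' *\<^sub>v v') $ j) = 0" if g': "g' \<in> carrier (GL k)" for g'
    proof (rule sum_annihilator[OF lam realizesD(3,4)[OF r(1)] _ ij(1)])
      fix g assume g: "g \<in> carrier (GL k)"
      have "product_coeff k m lam mu nu (mf g) h (mf g') h' = 0" using n by blast
      then show "(\<Sum>i<schur_dim k lam. (\<Sum>j<schur_dim k mu. ?w i j * (schur_rep k mu g' *\<^sub>v v') $ j) *
        (schur_rep k lam g *\<^sub>v v) $ i) = 0"
        unfolding product_coeff_realization[OF r lam mu g g'] by (simp add: sum_distrib_left sum_distrib_right mult_ac del: index_mult_mat_vec)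
    qed
    then have "?w i j = 0" by (rule sum_annihilator[OF mu realizesD(3,4)[OF r(2)] _ ij(2)])
    then show False using ij(3) by simp
  qed
qed

text \<open>Transposed to the other side of \<open>ip\<close>, a lower triangular matrix becomes
  upper triangular and scales the diagram. Taking the coefficient at a diagram is therefore a
  covector.\<close>

lemma lower_coefficient:
  assumes nu: "nu \<in> box_partitions k m" and g: "g \<in> carrier_mat k k" "upper_triangular (g\<^sup>T)" and u: "u \<in> forms (bx k m)"
  shows "ac k m (mf g) idm u (diagram nu) = wt k nu g * u (diagram nu)"
proof -
  note D = diagram_bx[OF nu]
  have gT: "g\<^sup>T \<in> carrier_mat k k" using g(1) by simp
  have "ac k m (mf g) idm u (diagram nu) = ip (bx k m) (ac k m (mf g) idm u) (bas (diagram nu))"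
    by (rule ip_bas[OF bx_fin D, symmetric])
  also have "\<dots> = ip (bx k m) u (ac k m (\<lambda>i j. mf g j i) (\<lambda>i j. idm j i) (bas (diagram nu)))" by (rule ac_adj)
  also have "ac k m (\<lambda>i j. mf g j i) (\<lambda>i j. idm j i) (bas (diagram nu)) = ac k m (mf (g\<^sup>T)) idm (bas (diagram nu))"
    by (rule ac_cong) (use g(1) in \<open>auto simp: mf_def idm_def\<close>)
  also have "\<dots> = (\<lambda>B. wt k nu (g\<^sup>T) * bas (diagram nu) B)" by (rule ac_upper_weight[OF nu gT g(2)])
  also have "wt k nu (g\<^sup>T) = wt k nu g" unfolding wt_def using g(1) by (intro prod.cong) auto
  finally show ?thesis using ip_scale[of "bx k m" "wt k nu g" "bas (diagram nu)" u] ip_bas[OF bx_fin D, of u]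
    by (simp add: ip_sym[of "bx k m" u])
qed

lemma coefficient_constituent:
  assumes r: "realizes k m lam f v" "realizes k m mu f' v'" and lam: "lam \<in> box_partitions k m" and mu: "mu \<in> box_partitions k m"
    and nu: "nu \<in> box_partitions k m" and nus: "set nus \<subseteq> partitions k"
    and iso: "module_iso k (module_tensor (schur_module k lam) (schur_module k mu)) (schur_sum k nus)"
    and ij: "i0 < schur_dim k lam" "j0 < schur_dim k mu"
    and nz: "wed (ac k m idm h (f i0)) (ac k m idm h' (f' j0)) (diagram nu) \<noteq> 0"
  shows "nu \<in> set nus"
proof -
  let ?L = "schur_module k lam" and ?M = "schur_module k mu" and ?R = "schur_sum k nus"
  let ?T = "module_tensor ?L ?M" and ?a = "fst ?L" and ?b = "fst ?M"
  define F where "F = (\<lambda>i. ac k m idm h (f i))"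
  define F' where "F' = (\<lambda>i. ac k m idm h' (f' i))"
  have P: "polynomial_module k ?L" "polynomial_module k ?M"
    using schur_ok_partitions[of lam k] schur_ok_partitions[of mu k] lam mu by (auto simp: schur_ok_def box_partitions_def)
  have T: "polynomial_module k ?T" by (rule schur_tensor_hform(1)[OF lam mu])
  have ok: "\<forall>kap\<in>set nus. schur_ok k kap \<and> length kap = k" using nus schur_ok_partitions by (auto simp: partitions_def)
  then have okk: "\<forall>kap\<in>set nus. schur_ok k kap" by simp
  have comm: "ac k m (mf g) idm (ac k m idm h u) = ac k m idm h (ac k m (mf g) idm u)" for g h and u :: "(nat \<times> nat) set \<Rightarrow> complex"
    using ac_split by metis
  have FF: "ac k m (mf g) idm (F i) = (\<lambda>C. \<Sum>l<?a. snd ?L g $$ (l, i) * F l C)" if "g \<in> carrier (GL k)" "i < ?a" for g i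
    unfolding F_def comm realizesD(2)[OF r(1) that] ac_sum ac_scale ..
  have FF': "ac k m (mf g) idm (F' i) = (\<lambda>C. \<Sum>l<?b. snd ?M g $$ (l, i) * F' l C)" if "g \<in> carrier (GL k)" "i < ?b" for g i
    unfolding F'_def comm realizesD(2)[OF r(2) that] ac_sum ac_scale ..
  have Ff: "F i \<in> forms (bx k m)" "F' i \<in> forms (bx k m)" for i by (auto simp: F_def F'_def)
  have bil: "bilinear_form ?a ?b F F' z \<in> forms (bx k m)" for z
    unfolding bilinear_form_def by (intro linc_sum[OF linc_forms] linc_scale[OF linc_forms] wed_forms Ff)
  \<comment> \<open>Row operations commute with the column operations \<open>h\<close> and
    \<open>h'\<close>, so by \<open>lower_coefficient\<close> this is a covector of weight
    \<open>nu\<close> on the tensor product.\<close>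
  define y where "y = vec (?a * ?b) (\<lambda>n. wed (F (n div ?b)) (F' (n mod ?b)) (diagram nu))"
  have yc: "y \<in> carrier_vec (?a * ?b)" by (simp add: y_def)
  have yz: "y \<bullet> z = bilinear_form ?a ?b F F' z (diagram nu)" if z: "z \<in> carrier_vec (?a * ?b)" for z
    unfolding sp_sum[OF z] bilinear_form_def by (rule sum.cong) (auto simp: y_def)
  have low: "y \<bullet> (snd ?T g *\<^sub>v z) = wt k nu g * (y \<bullet> z)"
    if g: "g \<in> carrier (GL k)" "upper_triangular (g\<^sup>T)" and z: "z \<in> carrier_vec (?a * ?b)" for g z
  proof -
    have Tz: "snd ?T g *\<^sub>v z \<in> carrier_vec (?a * ?b)" using pm_vec[OF T g(1)] z by simp
    have "ac k m (mf g) idm (bilinear_form ?a ?b F F' z) = bilinear_form ?a ?b F F' (kronecker (snd ?L g) (snd ?M g) *\<^sub>v z)"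
      by (rule bilinear_form_equivariant[OF Ff pm_carrier[OF P(1) g(1)] pm_carrier[OF P(2) g(1)] z FF[OF g(1)] FF'[OF g(1)]])
    then have "y \<bullet> (snd ?T g *\<^sub>v z) = ac k m (mf g) idm (bilinear_form ?a ?b F F' z) (diagram nu)"
      unfolding yz[OF Tz] by simp
    then show ?thesis using lower_coefficient[OF nu GL_carrier[OF g(1)] g(2) bil] yz[OF z] by simp
  qed
  have dlow: "upper_triangular (t\<^sup>T)" if "t \<in> carrier (GL k)" "diagonal_mat t" for t :: "complex mat"
    using that GL_carrier[OF that(1)] by (auto simp: diagonal_mat_def upper_triangular_def)
  have cov: "covv k ?T nu y" unfolding covv_def tensor_simps(1)
    using yc low dlow wt_one[of k _ nu] by simp
  have c: "snd ?T g \<in> carrier_mat (fst ?T) (fst ?T)" "snd ?R g \<in> carrier_mat (fst ?R) (fst ?R)" if "g \<in> carrier (GL k)" for g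
    using pm_carrier[OF T that] schur_sum_carrier[OF okk that] by blast+
  let ?n = "fst ?T"
  have Rn: "fst ?R = ?n" by (rule module_iso_inverse(1)[OF iso c])
  obtain A B where AB: "A \<in> carrier_mat ?n ?n" "B \<in> carrier_mat ?n ?n" "B * A = 1\<^sub>m ?n"
    "\<And>g. g \<in> carrier (GL k) \<Longrightarrow> B * snd ?R g = snd ?T g * B"
    using module_iso_inverse(2)[OF iso c] by blast
  \<comment> \<open>The covector pulled back to the direct sum along the intertwiner
    \<open>B\<close>.\<close>
  let ?y = "B\<^sup>T *\<^sub>v y"
  have yn: "y \<in> carrier_vec ?n" using yc by simp
  have By: "?y \<bullet> x = y \<bullet> (B *\<^sub>v x)" if "x \<in> carrier_vec ?n" for x by (rule transpose_vec_mult_scalar[OF AB(2) that yn])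
  have Byc: "?y \<in> carrier_vec (fst ?R)" unfolding Rn using AB(2) yn by (metis mult_mat_vec_carrier transpose_carrier_mat)
  have Bg: "?y \<bullet> (snd ?R g *\<^sub>v x) = y \<bullet> (snd ?T g *\<^sub>v (B *\<^sub>v x))" if g: "g \<in> carrier (GL k)" and x: "x \<in> carrier_vec ?n" for g x
  proof -
    note d = c(1)[OF g] c(2)[OF g, unfolded Rn]
    have "?y \<bullet> (snd ?R g *\<^sub>v x) = y \<bullet> (B *\<^sub>v (snd ?R g *\<^sub>v x))" by (rule By[OF mult_mat_vec_carrier[OF d(2) x]])
    also have "B *\<^sub>v (snd ?R g *\<^sub>v x) = snd ?T g *\<^sub>v (B *\<^sub>v x)"
      using assoc_mult_mat_vec[OF AB(2) d(2) x] assoc_mult_mat_vec[OF d(1) AB(2) x] AB(4)[OF g] by simp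
    finally show ?thesis .
  qed
  have Bx: "B *\<^sub>v x \<in> carrier_vec ?n" if "x \<in> carrier_vec ?n" for x using AB(2) that by (rule mult_mat_vec_carrier)
  have covR: "covv k ?R nu ?y" unfolding covv_def
  proof (intro conjI ballI impI Byc)
    fix t and x :: "complex vec" assume t: "t \<in> carrier (GL k)" "diagonal_mat t" and x: "x \<in> carrier_vec (fst ?R)"
    then have x': "x \<in> carrier_vec ?n" using Rn by simp
    show "?y \<bullet> (snd ?R t *\<^sub>v x) = wt k nu t * (?y \<bullet> x)"
      unfolding Bg[OF t(1) x'] By[OF x'] using cov t Bx[OF x'] unfolding covv_def by blast
  next
    fix t and x :: "complex vec" assume t: "t \<in> carrier (GL k)" "upper_triangular (t\<^sup>T) \<and> (\<forall>i<k. t $$ (i, i) = 1)" and x: "x \<in> carrier_vec (fst ?R)"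
    then have x': "x \<in> carrier_vec ?n" using Rn by simp
    show "?y \<bullet> (snd ?R t *\<^sub>v x) = ?y \<bullet> x"
      unfolding Bg[OF t(1) x'] By[OF x'] using cov t Bx[OF x'] unfolding covv_def by blast
  qed
  have "?y \<noteq> 0\<^sub>v (fst ?R)"
  proof
    assume y0: "?y = 0\<^sub>v (fst ?R)"
    \<comment> \<open>The place of the pair of \<open>i0\<close> and \<open>j0\<close> in the
      Kronecker ordering, where \<open>y\<close> is nonzero by assumption.\<close>
    let ?ij = "i0 * ?b + j0"
    have n0: "?ij < ?a * ?b"
    proof -
      have "?ij < Suc i0 * ?b" using ij(2) by simp
      also have "\<dots> \<le> ?a * ?b" using ij(1) by (intro mult_le_mono1) simp
      finally show ?thesis .
    qed
    have e: "unit_vec ?n ?ij \<in> (carrier_vec ?n :: complex vec set)" by simp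
    have Ae: "A *\<^sub>v unit_vec ?n ?ij \<in> carrier_vec ?n" using AB(1) e by (rule mult_mat_vec_carrier)
    have "0 = ?y \<bullet> (A *\<^sub>v unit_vec ?n ?ij)" unfolding y0 Rn using Ae by simp
    also have "\<dots> = y \<bullet> unit_vec ?n ?ij"
      unfolding By[OF Ae] using assoc_mult_mat_vec[OF AB(2,1) e] AB(3) by simp
    also have "\<dots> = y $ ?ij" using n0 by (simp add: scalar_prod_right_unit)
    also have "\<dots> = wed (F i0) (F' j0) (diagram nu)" using n0 ij(2) by (simp add: y_def)
    finally show False using nz by (simp add: F_def F'_def)
  qed
  moreover have "length nu = k" using nu by (simp add: box_partitions_def partitions_def)
  ultimately show ?thesis using schur_sum_covector[OF ok _ covR] by blast
qed

subsection \<open>Littlewood--Richardson coefficients\<close>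

lemma img_monotone:
  fixes A :: "'i::linorder set" and G :: "'i \<Rightarrow> 'i \<Rightarrow> 'a::field_char_0"
  assumes "finite A" "\<And>p q. p \<in> A \<Longrightarrow> q \<in> A \<Longrightarrow> p < q \<Longrightarrow> s p < s q" "\<And>p. p \<in> A \<Longrightarrow> G p = dl (s p)"
  shows "img G A = bas (s ` A)"
  using assms
proof (induction A rule: finite_min_induct)
  case (insert p A)
  have m: "img G (insert p A) = lm (G p) (img G A)" using insert(1,2) by (rule img_min)
  have IH: "img G A = bas (s ` A)" using insert by (intro insert.IH) auto
  have lt: "s p < q" if "q \<in> s ` A" for q using that insert(2) insert.prems(1)[of p] by auto
  then have n: "s p \<notin> s ` A" by blast
  have "eps (s p) (s ` A) = (1::'a)" by (rule eps_min) (use lt in force)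
  then show ?case unfolding m IH using insert.prems(2)[of p] lm_dl_bas[of "s ` A" "s p", where 'b='a] insert(1) n by simp
qed simp

definition col_shift :: "nat \<Rightarrow> nat \<times> nat \<Rightarrow> nat \<times> nat" where
  "col_shift m p = (fst p, m + snd p)"

definition shift_mat :: "nat \<Rightarrow> nat \<Rightarrow> nat \<Rightarrow> 'a::field_char_0" where
  "shift_mat m = (\<lambda>i j. if i = m + j then 1 else 0)"

lemma ac_shift:
  assumes u: "u \<in> forms (bx k m)"
  shows "ac k (2 * m) idm (shift_mat m) u = (\<lambda>C. \<Sum>A\<in>Pow (bx k m). u A * bas (col_shift m ` A) C)"
proof
  fix C
  have sub: "bx k m \<subseteq> bx k (2 * m)" by (auto simp: bx_def)
  have "ac k (2 * m) idm (shift_mat m) u C = (\<Sum>A\<in>Pow (bx k m). u A * img (tens k (2 * m) idm (shift_mat m)) A C)"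
    unfolding ac_def act_def by (rule sum.mono_neutral_right) (use sub formsD[OF u] in auto)
  also have "\<dots> = (\<Sum>A\<in>Pow (bx k m). u A * bas (col_shift m ` A) C)"
  proof (rule sum.cong[OF refl])
    fix A assume "A \<in> Pow (bx k m)"
    then have A: "A \<subseteq> bx k m" by simp
    have "img (tens k (2 * m) idm (shift_mat m)) A = (bas (col_shift m ` A) :: (nat \<times> nat) set \<Rightarrow> 'a)"
    proof (rule img_monotone)
      show "finite A" using A finite_subset bx_fin by blast
      show "col_shift m p < col_shift m q" if "p < q" for p q using that by (auto simp: col_shift_def less_prod_def)
      show "tens k (2 * m) idm (shift_mat m) p = dl (col_shift m p)" if "p \<in> A" for p
        using that A by (cases p) (auto simp: tens_def idm_def shift_mat_def dl_def col_shift_def fun_eq_iff bx_def)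
    qed
    then show "u A * img (tens k (2 * m) idm (shift_mat m)) A C = u A * bas (col_shift m ` A) C" by simp
  qed
  finally show "ac k (2 * m) idm (shift_mat m) u C = (\<Sum>A\<in>Pow (bx k m). u A * bas (col_shift m ` A) C)" .
qed

lemma ac_shift_value:
  assumes u: "u \<in> forms (bx k m)" and B: "B \<subseteq> bx k m"
  shows "ac k (2 * m) idm (shift_mat m) u (col_shift m ` B) = u B"
proof -
  have "inj (col_shift m)" by (auto simp: inj_def col_shift_def prod_eq_iff)
  then have "(\<Sum>A\<in>Pow (bx k m). u A * bas (col_shift m ` A) (col_shift m ` B)) = (\<Sum>A\<in>Pow (bx k m). u A * (if A = B then 1 else 0))"
    by (intro sum.cong refl) (auto simp: bas_def inj_image_eq_iff)
  then show ?thesis unfolding ac_shift[OF u] using B by (simp add: sum_pick)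
qed

lemma ac_shift_forms:
  assumes u: "u \<in> forms (bx k m)"
  shows "ac k (2 * m) idm (shift_mat m) u \<in> forms ({..<k} \<times> {m..<2 * m})"
proof (rule formsI)
  fix C assume "ac k (2 * m) idm (shift_mat m) u C \<noteq> 0"
  then obtain A where "A \<in> Pow (bx k m)" "bas (col_shift m ` A) C \<noteq> (0::'a)"
    unfolding ac_shift[OF u] by (metis (no_types, lifting) mult_zero_right sum.neutral)
  then show "C \<subseteq> {..<k} \<times> {m..<2 * m}" by (auto simp: bas_def bx_def col_shift_def split: if_splits)
qed

text \<open>Only the splitting of \<open>A \<union> B\<close> along \<open>X\<close> and
  \<open>Y\<close> contributes, so the product of the two coefficients is recovered up to
  sign.\<close>

lemma wed_disjoint:
  assumes u: "u \<in> forms X" and w: "w \<in> forms Y" and XY: "X \<inter> Y = {}" and A: "A \<subseteq> X" "finite A" and B: "B \<subseteq> Y" "finite B"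
  shows "wed u w (A \<union> B) = wsgn A B * u A * w B"
proof -
  have "wed u w (A \<union> B) = (\<Sum>C\<in>{A}. wsgn C (A \<union> B - C) * u C * w (A \<union> B - C))"
    unfolding wed_def
  proof (rule sum.mono_neutral_right)
    show "\<forall>C\<in>Pow (A \<union> B) - {A}. wsgn C (A \<union> B - C) * u C * w (A \<union> B - C) = 0"
    proof
      fix C assume C: "C \<in> Pow (A \<union> B) - {A}"
      then have "\<not> C \<subseteq> X \<or> \<not> A \<union> B - C \<subseteq> Y" using XY A(1) B(1) by blast
      then show "wsgn C (A \<union> B - C) * u C * w (A \<union> B - C) = 0" by (elim disjE) (simp_all add: formsD[OF u] formsD[OF w])
    qed
  qed (use A(2) B(2) in auto)
  moreover have "A \<union> B - A = B" using XY A(1) B(1) by blast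
  ultimately show ?thesis by simp
qed

text \<open>A highest weight vector of weight \<open>\<nu>\<close> in the tensor product becomes a form on a box with
  \<open>2 m\<close> columns, the second factor being moved to the last \<open>m\<close> columns so that nothing is lost in
  the wedge product. Column operations then carry it to a form with a nonzero coefficient at
  \<open>\<nu>\<close>.\<close>

lemma constituent_coefficient:
  assumes r: "realizes k m lam f v" "realizes k m mu f' v'" and lam: "lam \<in> box_partitions k m" and mu: "mu \<in> box_partitions k m"
    and nu: "nu \<in> box_partitions k m" and nus: "set nus \<subseteq> partitions k"
    and iso: "module_iso k (module_tensor (schur_module k lam) (schur_module k mu)) (schur_sum k nus)"
    and mem: "nu \<in> set nus"
  shows "\<exists>h h'. \<exists>i<schur_dim k lam. \<exists>j<schur_dim k mu. wed (ac k m idm h (f i)) (ac k m idm h' (f' j)) (diagram nu) \<noteq> 0"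
proof -
  let ?L = "schur_module k lam" and ?M = "schur_module k mu" and ?R = "schur_sum k nus"
  let ?T = "module_tensor ?L ?M" and ?a = "fst ?L" and ?b = "fst ?M"
  let ?n = "fst ?T" and ?X = "bx k (2 * m)"
  have P: "polynomial_module k ?L" "polynomial_module k ?M"
    using schur_ok_partitions[of lam k] schur_ok_partitions[of mu k] lam mu by (auto simp: schur_ok_def box_partitions_def)
  have T: "polynomial_module k ?T" by (rule schur_tensor_hform(1)[OF lam mu])
  have ok: "\<forall>kap\<in>set nus. schur_ok k kap \<and> length kap = k" using nus schur_ok_partitions by (auto simp: partitions_def)
  then have okk: "\<forall>kap\<in>set nus. schur_ok k kap" by simp
  have lnu: "length nu = k" using nu by (simp add: box_partitions_def partitions_def)
  have c: "snd ?T g \<in> carrier_mat (fst ?T) (fst ?T)" "snd ?R g \<in> carrier_mat (fst ?R) (fst ?R)" if "g \<in> carrier (GL k)" for g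
    using pm_carrier[OF T that] schur_sum_carrier[OF okk that] by blast+
  have Rn: "fst ?R = ?n" by (rule module_iso_inverse(1)[OF iso c])
  obtain A B where AB: "A \<in> carrier_mat ?n ?n" "B \<in> carrier_mat ?n ?n" "A * B = 1\<^sub>m ?n"
    "\<And>g. g \<in> carrier (GL k) \<Longrightarrow> B * snd ?R g = snd ?T g * B"
    using module_iso_inverse(2)[OF iso c] by blast
  have cnt: "0 < count_list nus nu" using mem count_list_0_iff[of nus nu] by simp
  from schur_sum_highest_weights[OF ok lnu] obtain V Xi where VX:
    "\<forall>i<count_list nus nu. hwv k ?R nu (V i) \<and> Xi i \<in> carrier_vec (fst ?R)"
    "\<forall>i<count_list nus nu. \<forall>j<count_list nus nu. Xi i \<bullet> V j = (if i = j then 1 else 0)" by (elim exE conjE)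
  have V: "hwv k ?R nu (V 0)" "Xi 0 \<in> carrier_vec (fst ?R)" "Xi 0 \<bullet> V 0 = 1" using VX cnt by auto
  have V0: "V 0 \<in> carrier_vec ?n" using V(1) Rn by (simp add: hwv_def)
  define z where "z = B *\<^sub>v V 0"
  have BR: "B \<in> carrier_mat ?n (fst ?R)" using AB(2) Rn by simp
  have hz: "hwv k ?T nu z" unfolding z_def by (rule hwv_intertwine[OF c(2) BR c(1) AB(4) V(1)])
  have zc: "z \<in> carrier_vec (?a * ?b)" using hz by (simp add: hwv_def)
  have z0: "z \<noteq> 0\<^sub>v (?a * ?b)"
  proof
    assume "z = 0\<^sub>v (?a * ?b)"
    then have "A *\<^sub>v z = 0\<^sub>v ?n" using mult_mat_zero_vec[OF AB(1)] by simp
    moreover have "A *\<^sub>v z = V 0" unfolding z_def using assoc_mult_mat_vec[OF AB(1,2) V0] AB(3) V0 by simp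
    ultimately show False using V(2,3) Rn by simp
  qed
  define F where "F = f"
  define F' where "F' = (\<lambda>j. ac k (2 * m) idm (shift_mat m) (f' j))"
  note ff = realizesD(1)[OF r(1)] and ff' = realizesD(1)[OF r(2)]
  have sub: "bx k m \<subseteq> ?X" by (auto simp: bx_def)
  have Ff: "F i \<in> forms ?X" "F' i \<in> forms ?X" for i
    using ff[of i] sub unfolding F_def F'_def forms_def[of "bx k m"] by (auto intro!: formsI)
  have comm: "ac k (2 * m) g idm (ac k (2 * m) idm h u) = ac k (2 * m) idm h (ac k (2 * m) g idm u)"
    for g h and u :: "(nat \<times> nat) set \<Rightarrow> complex" using ac_split by metis
  have FF: "ac k (2 * m) (mf g) idm (F i) = (\<lambda>C. \<Sum>l<?a. snd ?L g $$ (l, i) * F l C)" if "g \<in> carrier (GL k)" "i < ?a" for g i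
    unfolding F_def ac_enlarge[OF ff le_add1[of m m, folded mult_2]] by (rule realizesD(2)[OF r(1) that])
  have FF': "ac k (2 * m) (mf g) idm (F' i) = (\<lambda>C. \<Sum>l<?b. snd ?M g $$ (l, i) * F' l C)" if "g \<in> carrier (GL k)" "i < ?b" for g i
    unfolding F'_def comm ac_enlarge[OF ff' le_add1[of m m, folded mult_2]] realizesD(2)[OF r(2) that] ac_sum ac_scale ..
  define Z where "Z = bilinear_form ?a ?b F F' z"
  have Zf: "Z \<in> forms ?X"
    unfolding Z_def bilinear_form_def by (intro linc_sum[OF linc_forms] linc_scale[OF linc_forms] wed_forms Ff)
  have gZ: "ac k (2 * m) (mf g) idm Z = bilinear_form ?a ?b F F' (snd ?T g *\<^sub>v z)" if g: "g \<in> carrier (GL k)" for g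
    unfolding Z_def tensor_simps
    by (rule bilinear_form_equivariant[OF Ff pm_carrier[OF P(1) g] pm_carrier[OF P(2) g] zc FF[OF g] FF'[OF g]])
  have uZ: "ac k (2 * m) (mf u) idm Z = Z" if "u \<in> carrier (GL k)" "upper_triangular u" "\<forall>i<k. u $$ (i, i) = 1" for u
    unfolding gZ[OF that(1)] using hz that by (simp add: hwv_def Z_def)
  have tZ: "ac k (2 * m) (mf t) idm Z = (\<lambda>C. wt k nu t * Z C)" if "t \<in> carrier (GL k)" "diagonal_mat t" for t
  proof -
    have "snd ?T t *\<^sub>v z = wt k nu t \<cdot>\<^sub>v z" using hz that by (simp add: hwv_def)
    then have "ac k (2 * m) (mf t) idm Z = bilinear_form ?a ?b F F' (wt k nu t \<cdot>\<^sub>v z)" using gZ[OF that(1)] by simp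
    then show ?thesis unfolding Z_def bilinear_form_def using zc by (simp add: sum_distrib_left mult.assoc)
  qed
  \<comment> \<open>Up to sign, the coefficient of a wedge at \<open>A\<close> joined with a shifted
    \<open>B\<close> is a single product, so independence of \<open>f'\<close> and then of
    \<open>f\<close> recovers every coordinate of \<open>z\<close>.\<close>
  have "Z \<noteq> (\<lambda>_. 0)"
  proof
    assume Z0: "Z = (\<lambda>_. 0)"
    have part: "(\<Sum>j<?b. (\<Sum>i<?a. z $ (i * ?b + j) * f i A) * f' j B) = 0" for A B
    proof (cases "A \<subseteq> bx k m \<and> B \<subseteq> bx k m")
      case True
      let ?B = "col_shift m ` B"
      have fin: "finite A" "finite B" using True finite_subset bx_fin by blast+
      have B: "?B \<subseteq> {..<k} \<times> {m..<2 * m}" using True by (auto simp: col_shift_def bx_def)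
      have X: "bx k m \<inter> {..<k} \<times> {m..<2 * m} = {}" by (auto simp: bx_def)
      have w: "wed (F i) (F' j) (A \<union> ?B) = wsgn A ?B * (f i A * f' j B)" for i j
        unfolding F_def F'_def
          wed_disjoint[OF ff ac_shift_forms[OF ff'] X conjunct1[OF True] fin(1) B finite_imageI[OF fin(2)]]
          ac_shift_value[OF ff' conjunct2[OF True]] by simp
      have "0 = (\<Sum>n<?a * ?b. z $ (n div ?b * ?b + n mod ?b) * wed (F (n div ?b)) (F' (n mod ?b)) (A \<union> ?B))"
        using fun_cong[OF Z0, of "A \<union> ?B"] by (simp add: Z_def bilinear_form_def)
      also have "\<dots> = (\<Sum>i<?a. \<Sum>j<?b. z $ (i * ?b + j) * wed (F i) (F' j) (A \<union> ?B))"
        by (rule sum_div_mod)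
      also have "\<dots> = (\<Sum>j<?b. \<Sum>i<?a. z $ (i * ?b + j) * wed (F i) (F' j) (A \<union> ?B))"
        by (rule sum.swap)
      also have "\<dots> = wsgn A ?B * (\<Sum>j<?b. (\<Sum>i<?a. z $ (i * ?b + j) * f i A) * f' j B)"
        unfolding w by (simp add: sum_distrib_left sum_distrib_right mult_ac)
      finally show ?thesis by (simp add: wsgn_def)
    next
      case False
      then have "(\<forall>i. f i A = 0) \<or> (\<forall>j. f' j B = 0)" using formsD[OF ff] formsD[OF ff'] by blast
      then show ?thesis by auto
    qed
    have "(\<Sum>i<?a. z $ (i * ?b + j) * f i A) = 0" if "j < ?b" for j A
      by (rule realizesD(6)[OF r(2) part that])
    then have zij: "z $ (i * ?b + j) = 0" if "i < ?a" "j < ?b" for i j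
      using realizesD(6)[OF r(1), of "\<lambda>i. z $ (i * ?b + j)"] that by blast
    have "z $ n = 0" if "n < ?a * ?b" for n
      using zij[of "n div ?b" "n mod ?b"] div_mod_less[OF that] by simp
    then have "z = 0\<^sub>v (?a * ?b)" using zc by (intro eq_vecI) auto
    then show False using z0 by simp
  qed
  \<comment> \<open>Some diagram of the wide box detects \<open>Z\<close>; that it is the diagram of
    \<open>nu\<close> is shown below by comparing weights.\<close>
  then obtain g0 h0 kap where kap: "kap \<in> box_partitions k (2 * m)"
    and g0: "ip ?X (ac k (2 * m) g0 h0 (bas (diagram kap))) Z \<noteq> 0" using nondegenerate[OF Zf] by metis
  let ?D = "diagram kap"
  define ht where "ht = (\<lambda>i j. h0 j i)"
  define Z' where "Z' = ac k (2 * m) idm ht Z"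
  have Zf': "Z' \<in> forms ?X" by (simp add: Z'_def)
  define p where "p = (\<lambda>x. ac k (2 * m) (mf x) ht Z ?D)"
  have pp: "p \<in> polynomial_functions k" unfolding p_def
    by (intro fun_algebra_ac fun_algebra_polynomial_functions) (auto simp: mf_def intro: polynomial_functions.intros)
  \<comment> \<open>Transposing the pair onto \<open>Z\<close> turns the value of \<open>ip\<close>
    into the coefficient at \<open>?D\<close>.\<close>
  let ?G = "mat k k (\<lambda>(i, j). g0 j i)"
  have "p ?G = ac k (2 * m) (\<lambda>i j. g0 j i) ht Z ?D"
    unfolding p_def by (rule fun_cong[OF ac_cong]) (simp_all add: mf_def)
  also have "\<dots> = ip ?X (ac k (2 * m) (\<lambda>i j. g0 j i) ht Z) (bas ?D)"
    by (rule ip_bas[OF bx_fin diagram_bx[OF kap], symmetric])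
  also have "\<dots> = ip ?X Z (ac k (2 * m) g0 h0 (bas ?D))" unfolding ac_adj by (simp add: ht_def)
  finally have pG: "p ?G \<noteq> 0" using g0 by (simp add: ip_sym)
  have ctr: "ac k (2 * m) (mf x) ht Z = ac k (2 * m) idm ht (ac k (2 * m) (mf x) idm Z)" for x by (rule ac_split(2))
  have Gc: "?G \<in> carrier_mat k k" by simp
  \<comment> \<open>On the big cell the upper factor fixes \<open>Z\<close>, the diagonal one scales
    it, and the lower one does not change the coefficient at a diagram. Hence the column operation
    \<open>ht\<close> alone already produces a nonzero coefficient.\<close>
  from polyfun_GL_nonzero[OF pp Gc pG] obtain l d u where l: "l \<in> carrier (GL k)" "upper_triangular (l\<^sup>T)" "\<forall>i<k. l $$ (i, i) = 1"
    and d: "d \<in> carrier (GL k)" "diagonal_mat d" and u: "u \<in> carrier (GL k)" "upper_triangular u" "\<forall>i<k. u $$ (i, i) = 1"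
    and nz: "p (l * d * u) \<noteq> 0" by blast
  note cl = GL_carrier[OF l(1)] GL_carrier[OF d(1)] GL_carrier[OF u(1)]
  have "ac k (2 * m) (mf (l * d * u)) idm Z = (\<lambda>C. wt k nu d * ac k (2 * m) (mf l) idm Z C)"
    unfolding ac_mf_mult[OF mult_carrier_mat[OF cl(1,2)] cl(3)] ac_mf_mult[OF cl(1,2)] uZ[OF u] tZ[OF d] ac_scale ..
  then have "p (l * d * u) = wt k nu d * ac k (2 * m) (mf l) idm Z' ?D"
    unfolding p_def ctr Z'_def comm by (simp add: ac_scale)
  also have "ac k (2 * m) (mf l) idm Z' ?D = Z' ?D"
    using lower_coefficient[OF kap cl(1) l(2) Zf'] wt_one[OF l(3)] by simp
  finally have ZD: "Z' ?D \<noteq> 0" using nz by auto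
  \<comment> \<open>The coefficient at \<open>?D\<close> has weight \<open>kap\<close> as a
    functional, while \<open>Z'\<close> has weight \<open>nu\<close> as a vector.\<close>
  have "kap = nu"
  proof (rule nth_equalityI)
    have lk: "length kap = k" using kap by (simp add: box_partitions_def partitions_def)
    then show "length kap = length nu" using lnu by simp
    fix i assume "i < length kap"
    then have i: "i < k" using lk by simp
    define t where "t = dmat k (\<lambda>a. if a = i then 2 else 1)"
    have t: "t \<in> carrier (GL k)" "diagonal_mat t" "t \<in> carrier_mat k k"
      unfolding t_def by (rule dmat_GL) (auto simp: diagonal_mat_def)
    have w: "wt k al t = 2 ^ (al ! i)" for al
    proof -
      have "wt k al t = (\<Prod>a<k. if a = i then 2 ^ (al ! i) else 1)"
        unfolding wt_def by (intro prod.cong) (auto simp: t_def)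
      then show ?thesis using i by simp
    qed
    have "upper_triangular (t\<^sup>T)" by (auto simp: t_def upper_triangular_def)
    then have "wt k kap t * Z' ?D = ac k (2 * m) (mf t) idm Z' ?D"
      using lower_coefficient[OF kap t(3) _ Zf'] by simp
    also have "\<dots> = wt k nu t * Z' ?D" unfolding Z'_def comm tZ[OF t(1,2)] ac_scale ..
    finally have "(2::complex) ^ (kap ! i) = 2 ^ (nu ! i)" using ZD w by simp
    then have "cmod (2 ^ (kap ! i)) = cmod (2 ^ (nu ! i))" by simp
    then show "kap ! i = nu ! i" by (simp add: norm_power)
  qed
  then have "Z' (diagram nu) \<noteq> 0" using ZD by simp
  moreover have "Z' = (\<lambda>C. \<Sum>n<?a * ?b. z $ n * wed (ac k (2 * m) idm ht (F (n div ?b))) (ac k (2 * m) idm ht (F' (n mod ?b))) C)"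
    unfolding Z'_def Z_def bilinear_form_def ac_sum ac_scale ac_wed[OF Ff] ..
  ultimately have "(\<Sum>n<?a * ?b. z $ n * wed (ac k (2 * m) idm ht (F (n div ?b))) (ac k (2 * m) idm ht (F' (n mod ?b))) (diagram nu)) \<noteq> 0"
    by simp
  then obtain n where n: "n < ?a * ?b" "wed (ac k (2 * m) idm ht (F (n div ?b))) (ac k (2 * m) idm ht (F' (n mod ?b))) (diagram nu) \<noteq> 0"
    by (metis (no_types, lifting) lessThan_iff mult_zero_right sum.neutral)
  \<comment> \<open>The diagram of \<open>nu\<close> uses only the first \<open>m\<close> columns,
    so both factors may be computed in the narrow box; the shift is absorbed into
    \<open>?h'\<close>.\<close>
  let ?i = "n div ?b" and ?j = "n mod ?b" and ?h' = "mm (2 * m) ht (shift_mat m)"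
  have e1: "ac k (2 * m) idm ht (F ?i) C = ac k m idm ht (f ?i) C" if "C \<subseteq> bx k m" for C
    unfolding F_def by (rule ac_coeff[OF ff _ that]) simp
  have e2: "ac k (2 * m) idm ht (F' ?j) C = ac k m idm ?h' (f' ?j) C" if "C \<subseteq> bx k m" for C
  proof -
    have "ac k (2 * m) idm ht (F' ?j) = ac k (2 * m) idm ?h' (f' ?j)"
      unfolding F'_def ac_ac by (rule ac_cong) (simp_all add: mm_idl)
    then show ?thesis using ac_coeff[OF ff' _ that, of "2 * m" idm ?h' ?j] by simp
  qed
  have "wed (ac k (2 * m) idm ht (F ?i)) (ac k (2 * m) idm ht (F' ?j)) (diagram nu) =
    wed (ac k m idm ht (f ?i)) (ac k m idm ?h' (f' ?j)) (diagram nu)"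
    unfolding wed_def
  proof (rule sum.cong[OF refl])
    fix C assume "C \<in> Pow (diagram nu)"
    then have "C \<subseteq> bx k m" "diagram nu - C \<subseteq> bx k m" using diagram_bx[OF nu] by auto
    then show "wsgn C (diagram nu - C) * ac k (2 * m) idm ht (F ?i) C * ac k (2 * m) idm ht (F' ?j) (diagram nu - C) =
      wsgn C (diagram nu - C) * ac k m idm ht (f ?i) C * ac k m idm ?h' (f' ?j) (diagram nu - C)"
      by (simp add: e1 e2)
  qed
  then have "wed (ac k m idm ht (f ?i)) (ac k m idm ?h' (f' ?j)) (diagram nu) \<noteq> 0" using n(2) by simp
  then show ?thesis using div_mod_less[OF n(1)] by blast
qed

theorem littlewood_richardson_positive:
  assumes lam: "lam \<in> box_partitions k m" and mu: "mu \<in> box_partitions k m" and nu: "nu \<in> box_partitions k m"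
  shows "0 < littlewood_richardson k lam mu nu \<longleftrightarrow> (\<exists>g h g' h'. product_coeff k m lam mu nu g h g' h' \<noteq> (0::complex))"
proof -
  obtain nus where nus: "set nus \<subseteq> partitions k" "module_iso k (module_tensor (schur_module k lam) (schur_module k mu)) (schur_sum k nus)"
    using schur_tensor_decomposition[OF lam mu] .
  obtain f v f' v' where r: "realizes k m lam f v" "realizes k m mu f' v'" using schur_realization lam mu by blast
  have nu': "nu \<in> partitions k" using nu by (simp add: box_partitions_def)
  have "0 < littlewood_richardson k lam mu nu \<longleftrightarrow> nu \<in> set nus"
    unfolding littlewood_richardson_count[OF lam mu nu' nus] using count_list_0_iff[of nus nu] by (metis neq0_conv)
  also have "\<dots> \<longleftrightarrow> (\<exists>g h g' h'. product_coeff k m lam mu nu g h g' h' \<noteq> (0::complex))"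
    unfolding product_coeff_forms[OF r lam mu]
    using constituent_coefficient[OF r lam mu nu nus] coefficient_constituent[OF r lam mu nu nus] by blast
  finally show ?thesis .
qed

section \<open>Comparison of real and complex coefficients\<close>

lemma real_point:
  fixes Q :: "('e \<Rightarrow> complex) \<Rightarrow> complex"
  assumes "finite E" and cong: "\<And>x y. (\<And>e. e \<in> E \<Longrightarrow> x e = y e) \<Longrightarrow> Q x = Q y"
    and poly: "\<And>c. (\<And>e. \<exists>p. \<forall>s. c s e = poly p s) \<Longrightarrow> \<exists>p. \<forall>s. Q (c s) = poly p s" and nz: "Q x \<noteq> 0"
  shows "\<exists>y. Q (\<lambda>e. complex_of_real (y e)) \<noteq> 0"
proof -
  \<comment> \<open>Coordinates are made real one at a time: in one variable a nonzero polynomial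
    has only finitely many roots, whereas there are infinitely many real values.\<close>
  have "\<exists>x. Q x \<noteq> 0 \<and> (\<forall>e\<in>E. x e \<in> \<real>)"
    using assms(1)
  proof (induction E rule: finite_induct)
    case empty
    then show ?case using nz by auto
  next
    case (insert e E)
    then obtain x where x: "Q x \<noteq> 0" "\<forall>e\<in>E. x e \<in> \<real>" by blast
    have "\<exists>p. \<forall>s. Q (x(e := s)) = poly p s"
    proof (rule poly)
      fix d
      show "\<exists>p. \<forall>s. (x(e := s)) d = poly p s"
        by (cases "d = e") (auto intro: exI[of _ "[:0, 1:]"] exI[of _ "[:x d:]"])
    qed
    then obtain p where p: "\<And>s. Q (x(e := s)) = poly p s" by blast
    have "poly p (x e) \<noteq> 0" using p[of "x e"] x(1) by simp
    then have "p \<noteq> 0" by auto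
    then have "finite {s. poly p s = 0}" by (rule poly_roots_finite)
    moreover have "infinite (range complex_of_real)"
      using finite_imageD[of complex_of_real UNIV] infinite_UNIV_char_0[where 'a = real] by (auto simp: inj_on_def)
    ultimately obtain s where s: "s \<in> range complex_of_real" "poly p s \<noteq> 0"
      by (metis (mono_tags, lifting) finite_subset mem_Collect_eq subsetI)
    then have "s \<in> \<real>" by (simp add: Reals_def)
    then have "\<forall>d\<in>insert e E. (x(e := s)) d \<in> \<real>" using x(2) by simp
    moreover have "Q (x(e := s)) \<noteq> 0" using s(2) p by metis
    ultimately show ?case by blast
  qed
  then obtain x where x: "Q x \<noteq> 0" "\<forall>e\<in>E. x e \<in> \<real>" by blast
  have "Q (\<lambda>e. of_real (Re (x e))) = Q x" by (rule cong) (use x(2) in simp)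
  then show ?thesis using x(1) by (intro exI[of _ "\<lambda>e. Re (x e)"]) simp
qed

lemma fun_algebra_product_coeff:
  assumes F: "fun_algebra F" and "\<And>i j. i < k \<Longrightarrow> j < k \<Longrightarrow> (\<lambda>x. g x i j) \<in> F" "\<And>i j. i < m \<Longrightarrow> j < m \<Longrightarrow> (\<lambda>x. h x i j) \<in> F"
    "\<And>i j. i < k \<Longrightarrow> j < k \<Longrightarrow> (\<lambda>x. g' x i j) \<in> F" "\<And>i j. i < m \<Longrightarrow> j < m \<Longrightarrow> (\<lambda>x. h' x i j) \<in> F"
  shows "(\<lambda>x. product_coeff k m lam mu nu (g x) (h x) (g' x) (h' x)) \<in> F"
  unfolding product_coeff_def
  by (intro fun_algebra_wed[OF F] fun_algebra_ac[OF F] fun_algebra_const[OF F] assms)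

lemma product_coeff_cong:
  assumes "\<And>i j. i < k \<Longrightarrow> j < k \<Longrightarrow> g i j = x i j" "\<And>i j. i < m \<Longrightarrow> j < m \<Longrightarrow> h i j = y i j"
    "\<And>i j. i < k \<Longrightarrow> j < k \<Longrightarrow> g' i j = x' i j" "\<And>i j. i < m \<Longrightarrow> j < m \<Longrightarrow> h' i j = y' i j"
  shows "product_coeff k m lam mu nu g h g' h' = product_coeff k m lam mu nu x y x' y'"
  using ac_cong[of k g x m h y] ac_cong[of k g' x' m h' y'] assms by (simp add: product_coeff_def)

lemma product_coeff_complex_real:
  assumes lam: "lam \<in> box_partitions k m" and mu: "mu \<in> box_partitions k m"
  shows "(\<exists>g h g' h'. product_coeff k m lam mu nu g h g' h' \<noteq> (0::complex)) \<longleftrightarrow> (\<exists>g h g' h'. product_coeff k m lam mu nu g h g' h' \<noteq> (0::real))"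
proof
  let ?r = "\<lambda>(x :: nat \<Rightarrow> nat \<Rightarrow> real) i j. complex_of_real (x i j)" and ?P = "product_coeff k m lam mu nu"
  have "complex_of_real (wed u v C) = wed (\<lambda>A. of_real (u A)) (\<lambda>A. of_real (v A)) C" for u v and C :: "(nat \<times> nat) set"
    by (simp add: wed_def wsgn_def)
  then have real: "complex_of_real (?P g h g' h') = ?P (?r g) (?r h) (?r g') (?r h')" for g h g' h'
    using ac_hom[of complex_of_real "diagram lam" k m] ac_hom[of complex_of_real "diagram mu" k m] diagram_bx[OF lam] diagram_bx[OF mu]
    by (simp add: product_coeff_def)
  show "\<exists>g h g' h'. ?P g h g' h' \<noteq> (0::complex)" if "\<exists>g h g' h'. ?P g h g' h' \<noteq> (0::real)"
    using that real by (metis of_real_eq_0_iff)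
  let ?F = "{f. \<exists>p. \<forall>s::complex. f s = poly p s}"
  have F: "fun_algebra ?F" unfolding fun_algebra_def
  proof (intro conjI allI ballI)
    fix c show "(\<lambda>_. c) \<in> ?F" by (auto intro: exI[of _ "[:c:]"])
    fix f g assume "f \<in> ?F" "g \<in> ?F"
    then obtain p q where "\<forall>s. f s = poly p s" "\<forall>s. g s = poly q s" by blast
    then show "(\<lambda>x. f x + g x) \<in> ?F" "(\<lambda>x. f x * g x) \<in> ?F"
      by (auto intro: exI[of _ "p + q"] exI[of _ "p * q"])
  qed
  show "\<exists>g h g' h'. ?P g h g' h' \<noteq> (0::real)" if star: "\<exists>g h g' h'. ?P g h g' h' \<noteq> (0::complex)"
  proof -
    obtain g h g' h' where nz: "?P g h g' h' \<noteq> (0::complex)" using star by blast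
    \<comment> \<open>The four matrices are packed into one function with a tag in the first place;
      \<open>k + m\<close> bounds the indices of all of them.\<close>
    let ?Q = "\<lambda>x :: nat \<times> nat \<times> nat \<Rightarrow> complex. ?P (\<lambda>i j. x (0, i, j)) (\<lambda>i j. x (1, i, j)) (\<lambda>i j. x (2, i, j)) (\<lambda>i j. x (3, i, j))"
    let ?x = "\<lambda>(a, i, j). ([g, h, g', h'] ! a) i j"
    have "\<exists>y. ?Q (\<lambda>e. complex_of_real (y e)) \<noteq> 0"
    proof (rule real_point[of "{..<4} \<times> {..<k + m} \<times> {..<k + m}" ?Q ?x])
      show "?Q x = ?Q y" if "\<And>e. e \<in> {..<4} \<times> {..<k + m} \<times> {..<k + m} \<Longrightarrow> x e = y e" for x y
        by (rule product_coeff_cong) (use that in auto)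
      show "\<exists>p. \<forall>s. ?Q (c s) = poly p s" if c: "\<And>e. \<exists>p. \<forall>s. c s e = poly p s" for c
      proof -
        have "(\<lambda>s. ?Q (c s)) \<in> ?F" by (rule fun_algebra_product_coeff[OF F]) (use c in auto)
        then show ?thesis by simp
      qed
    qed (use nz in \<open>simp_all add: numeral_2_eq_2 numeral_3_eq_3\<close>)
    then obtain y where "?Q (\<lambda>e. complex_of_real (y e)) \<noteq> 0" by blast
    then have "?P (\<lambda>i j. y (0, i, j)) (\<lambda>i j. y (1, i, j)) (\<lambda>i j. y (2, i, j)) (\<lambda>i j. y (3, i, j)) \<noteq> 0"
      unfolding real[of "\<lambda>i j. y (0, i, j)", symmetric] by simp
    then show ?thesis by blast
  qed
qed

theorem theorem8p23:
  fixes k m :: nat and lam mu :: "nat list"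
  assumes "1 \<le> k" and "1 \<le> m"
    and "lam \<in> box_partitions k m" and "mu \<in> box_partitions k m"
  shows "internal_direct_sum (LR k m lam mu) (schubert_span k m)
    (wedge_space (schubert_span k m lam) (schubert_span k m mu))"
proof -
  have "0 < littlewood_richardson k lam mu nu \<longleftrightarrow> (\<exists>g h g' h'. product_coeff k m lam mu nu g h g' h' \<noteq> (0::real))"
    if "nu \<in> box_partitions k m" for nu
    unfolding littlewood_richardson_positive[OF assms(3,4) that] by (rule product_coeff_complex_real[OF assms(3,4)])
  then have "LR k m lam mu = {nu \<in> box_partitions k m. \<exists>g h g' h'. product_coeff k m lam mu nu g h g' h' \<noteq> (0::real)}"
    unfolding LR_def by (intro Collect_cong conj_cong refl)
  then show ?thesis using schubert_wedge_decomposition[OF assms(3,4)] by simp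
qed

end
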